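(* Let $k\ge 2$ and $m\ge 2$ be integers and let $a_1,a_2\in\mathbb{R}$ with $a_1<1$. In the hierarchical normal model described in the context, take the prior $\pi(\boldsymbol\beta)=1$ for $\boldsymbol\beta\in\mathbb{R}^k$, and suppose that there are constants $C_1,C_2>0$ such that for all $k\times k$ orthonormal $\mathbf{H}$ and all $\mathbf{D}=\mathrm{diag}(d_1,\dots,d_k)$ with $d_1>\cdots>d_k>0$, $$\frac{C_1}{|\mathbf{I}+\mathbf{D}|^{a_2-a_1}|\mathbf{D}|^{a_1}}\le \pi(\mathbf{H},\mathbf{D})\le \frac{C_2}{|\mathbf{I}+\mathbf{D}|^{a_2-a_1}|\mathbf{D}|^{a_1}}.$$ (1) If $k=2$ and $a_2>1$, then the posterior mean of $\boldsymbol\theta$ is admissible under quadratic loss. (2) If $\frac{3-m}{2}<a_2<\frac32-\frac1k$, then the posterior mean of $\boldsymbol\theta$ is inadmissible under quadratic loss.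
   Context: Model: $p=mk$, and $\mathbf{X}=(\mathbf{X}_1,\dots,\mathbf{X}_m)\in\mathbb{R}^p$ with $\mathbf{X}_i\in\mathbb{R}^k$. Independently for $i=1,\dots,m$, $\mathbf{X}_i\mid\boldsymbol\theta_i\sim N_k(\boldsymbol\theta_i,\mathbf{I})$ and $\boldsymbol\theta_i\mid\boldsymbol\beta,\mathbf{V}\sim N_k(\boldsymbol\beta,\mathbf{V})$, where $\boldsymbol\beta\in\mathbb{R}^k$ and $\mathbf{V}$ is a $k\times k$ positive-definite matrix; $\boldsymbol\theta=(\boldsymbol\theta_1,\dots,\boldsymbol\theta_m)\in\mathbb{R}^p$. The hyperprior is a (possibly improper) density $\pi(\boldsymbol\beta)\pi(\mathbf{V})$. Change of variables: write $\mathbf{V}=\mathbf{H}^t\mathbf{D}\mathbf{H}$ with $\mathbf{H}$ orthonormal and $\mathbf{D}=\mathrm{diag}(d_1,\dots,d_k)$, $d_1>\cdots>d_k>0$ the eigenvalues of $\mathbf{V}$. The prior on $\mathbf{V}$ is rewritten as $\pi(\mathbf{V})\,d\mathbf{V}=\pi(\mathbf{H},\mathbf{D})I_{[d_1>\cdots>d_k]}\,d\mathbf{D}\,d\mathbf{H}$, where $d\mathbf{V}=\prod_{i\le j}dV_{ij}$, $d\mathbf{D}=\prod_i dd_i$, $d\mathbf{H}$ is the invariant Haar measure on orthonormal matrices, and $\pi(\mathbf{H},\mathbf{D})=\pi(\mathbf{H}^t\mathbf{D}\mathbf{H})\prod_{i<j}(d_i-d_j)$. $|\cdot|$ of a matrix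 is its determinant. The posterior mean is $\boldsymbol\delta^\pi(\mathbf{x})=E[\boldsymbol\theta\mid\mathbf{X}=\mathbf{x}]$ under the posterior distribution. Quadratic loss: $L(\boldsymbol\theta,\boldsymbol\delta)=(\boldsymbol\theta-\boldsymbol\delta)^t\mathbf{Q}(\boldsymbol\theta-\boldsymbol\delta)$ with $\mathbf{Q}$ a known positive-definite $p\times p$ matrix. Frequentist risk of an estimator $\boldsymbol\delta$ of $\boldsymbol\theta$: $R(\boldsymbol\theta,\boldsymbol\delta)=E[L(\boldsymbol\theta,\boldsymbol\delta(\mathbf{X}))]$ with $\mathbf{X}\sim N_p(\boldsymbol\theta,\mathbf{I})$. An estimator $\boldsymbol\delta$ is inadmissible if there is another estimator whose risk is nowhere larger and somewhere smaller (as a function of $\boldsymbol\theta\in\mathbb{R}^p$); otherwise it is admissible. *)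

theory Defs
  imports "HOL-Probability.Probability"
begin

type_synonym 'n vector = "(real, 'n) vec"
type_synonym 'n matrix = "((real, 'n) vec, 'n) vec"

definition positive_definite :: "real^'n^'n \<Rightarrow> bool" where
  "positive_definite A \<longleftrightarrow> transpose A = A \<and> (\<forall>x. x \<noteq> 0 \<longrightarrow> x \<bullet> (A *v x) > 0)"

definition diag :: "real^'n \<Rightarrow> real^'n^'n" where
  "diag d = (\<chi> i j. if i = j then d $ i else 0)"

definition mvn_density :: "real^'n \<Rightarrow> real^'n^'n \<Rightarrow> real^'n \<Rightarrow> real" where
  "mvn_density \<mu> S x =
     exp (- ((x - \<mu>) \<bullet> (matrix_inv S *v (x - \<mu>))) / 2) / sqrt ((2 * pi) ^ CARD('n) * det S)"

definition mvn :: "real^'n \<Rightarrow> real^'n^'n \<Rightarrow> (real^'n) measure" where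
  "mvn \<mu> S = density lborel (\<lambda>x. ennreal (mvn_density \<mu> S x))"

text \<open>The measure $dV = \prod_{i \le j} dV_{ij}$: Lebesgue measure in the entries on and above the
  diagonal, carried to a measure on all matrices that is concentrated on the symmetric ones.\<close>

definition sym_matrix :: "('k::{finite,linorder} \<times> 'k \<Rightarrow> real) \<Rightarrow> 'k matrix" where
  "sym_matrix v = (\<chi> i j. v (min i j, max i j))"

definition sym_lborel :: "('k::{finite,linorder} matrix) measure" where
  "sym_lborel = distr (Pi\<^sub>M {(i, j). i \<le> j} (\<lambda>_. lborel)) borel sym_matrix"

text \<open>The density of $(H, D)$, $D = \mathrm{diag}(d)$, induced by a density on $V = H^t D H$: the
  product is the Jacobian, up to a constant factor that cancels in the posterior.\<close>

definition prior_HD ::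
    "('k::{finite,linorder} matrix \<Rightarrow> real) \<Rightarrow> 'k matrix \<Rightarrow> 'k vector \<Rightarrow> real" where
  "prior_HD prior_V H d =
     prior_V (transpose H ** diag d ** H) * (\<Prod>(i, j) | i < j. d $ i - d $ j)"

text \<open>$\mathbb{R}^p$ with $p = mk$ is indexed by pairs of a group and a coordinate within the group.\<close>

definition block :: "('m::finite \<times> 'k::finite) vector \<Rightarrow> 'm \<Rightarrow> 'k vector" where
  "block x i = (\<chi> j. x $ (i, j))"

text \<open>Data are \<open>x\<close>; the parameters are $(\theta, \beta, V)$. The prior on \<open>V\<close> lives on positive
  definite matrices only, so values of \<open>prior_V\<close> elsewhere are ignored.\<close>

definition joint_density ::
    "('k::finite vector \<Rightarrow> real) \<Rightarrow> ('k matrix \<Rightarrow> real) \<Rightarrow> ('m::finite \<times> 'k) vector \<Rightarrow>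
     ('m \<times> 'k) vector \<times> 'k vector \<times> 'k matrix \<Rightarrow> real" where
  "joint_density prior_b prior_V x = (\<lambda>(\<theta>, \<beta>, V).
     if positive_definite V
     then (\<Prod>i\<in>UNIV. mvn_density (block \<theta> i) (mat 1) (block x i) * mvn_density \<beta> V (block \<theta> i))
          * prior_b \<beta> * prior_V V
     else 0)"

definition param_measure ::
    "(('m::finite \<times> 'k::{finite,linorder}) vector \<times> 'k vector \<times> 'k matrix) measure" where
  "param_measure = lborel \<Otimes>\<^sub>M lborel \<Otimes>\<^sub>M sym_lborel"

definition marginal_density ::
    "('k::{finite,linorder} vector \<Rightarrow> real) \<Rightarrow> ('k matrix \<Rightarrow> real) \<Rightarrow>
     ('m::finite \<times> 'k) vector \<Rightarrow> ennreal" where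
  "marginal_density prior_b prior_V x =
     (\<integral>\<^sup>+ z. ennreal (joint_density prior_b prior_V x z) \<partial>param_measure)"

text \<open>Proper (a probability measure) when the marginal density at \<open>x\<close> is positive and finite; with improper
  priors this has to be verified.\<close>

definition posterior ::
    "('k::{finite,linorder} vector \<Rightarrow> real) \<Rightarrow> ('k matrix \<Rightarrow> real) \<Rightarrow>
     ('m::finite \<times> 'k) vector \<Rightarrow> (('m \<times> 'k) vector \<times> 'k vector \<times> 'k matrix) measure" where
  "posterior prior_b prior_V x = density param_measure
     (\<lambda>z. ennreal (joint_density prior_b prior_V x z) / marginal_density prior_b prior_V x)"

definition posterior_mean ::
    "('k::{finite,linorder} vector \<Rightarrow> real) \<Rightarrow> ('k matrix \<Rightarrow> real) \<Rightarrow>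
     ('m::finite \<times> 'k) vector \<Rightarrow> ('m \<times> 'k) vector" where
  "posterior_mean prior_b prior_V x = (\<integral>z. fst z \<partial>posterior prior_b prior_V x)"

definition quadratic_loss :: "real^'p^'p \<Rightarrow> real^'p \<Rightarrow> real^'p \<Rightarrow> real" where
  "quadratic_loss Q \<theta> d = (\<theta> - d) \<bullet> (Q *v (\<theta> - d))"

text \<open>The risk may be infinite.\<close>

definition risk :: "real^'p^'p \<Rightarrow> real^'p \<Rightarrow> (real^'p \<Rightarrow> real^'p) \<Rightarrow> ennreal" where
  "risk Q \<theta> \<delta> = (\<integral>\<^sup>+ x. ennreal (quadratic_loss Q \<theta> (\<delta> x)) \<partial>mvn \<theta> (mat 1))"

definition estimator :: "(real^'p \<Rightarrow> real^'p) \<Rightarrow> bool" where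
  "estimator \<delta> \<longleftrightarrow> \<delta> \<in> borel_measurable borel"

definition dominates :: "real^'p^'p \<Rightarrow> (real^'p \<Rightarrow> real^'p) \<Rightarrow> (real^'p \<Rightarrow> real^'p) \<Rightarrow> bool" where
  "dominates Q \<delta>' \<delta> \<longleftrightarrow>
     (\<forall>\<theta>. risk Q \<theta> \<delta>' \<le> risk Q \<theta> \<delta>) \<and> (\<exists>\<theta>. risk Q \<theta> \<delta>' < risk Q \<theta> \<delta>)"

definition inadmissible :: "real^'p^'p \<Rightarrow> (real^'p \<Rightarrow> real^'p) \<Rightarrow> bool" where
  "inadmissible Q \<delta> \<longleftrightarrow> estimator \<delta> \<and> (\<exists>\<delta>'. estimator \<delta>' \<and> dominates Q \<delta>' \<delta>)"

definition admissible :: "real^'p^'p \<Rightarrow> (real^'p \<Rightarrow> real^'p) \<Rightarrow> bool" where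
  "admissible Q \<delta> \<longleftrightarrow> estimator \<delta> \<and> \<not> (\<exists>\<delta>'. estimator \<delta>' \<and> dominates Q \<delta>' \<delta>)"

end

theory Submission
  imports Defs
begin

text \<open>
  Integrating out \<open>\<beta>\<close> and \<open>V\<close> turns the hierarchical prior into a single improper prior \<open>G\<close> of \<open>\<theta>\<close>, and by
  Tweedie's formula the posterior mean is governed by the marginal density
  \<open>m(x) = \<integral> exp (- |x - \<theta>|\<^sup>2 / 2) dG\<close>. Bounding the Jacobian of \<open>(H, d) \<mapsto> H\<^sup>T diag d H\<close> in Cayley charts shows
  that \<open>m\<close> is bounded; restricting \<open>V\<close> to matrices close to \<open>3/2 (1 + |x|\<^sup>2) I\<close> shows that
  \<open>m(x) \<ge> c (1 + |x|\<^sup>2)\<^sup>-\<^sup>\<kappa>\<close> with \<open>\<kappa> = k (m - 3 + 2 a\<^sub>2) / 2\<close>.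

  Inadmissibility: if \<open>2 \<kappa> + 2 < p\<close>, then \<open>\<delta> + Q\<^sup>-\<^sup>1 F / m\<close> with \<open>F(x) = - \<epsilon> x (1 + |x|\<^sup>2)\<^sup>-\<^sup>\<kappa>\<^sup>-\<^sup>1\<close> improves on \<open>\<delta>\<close>.
  By Stein's identity the change of risk is the expectation of
  \<open>(F \<bullet> Q\<^sup>-\<^sup>1 F / m + 2 div F) / m\<close>, which the lower bound on \<open>m\<close> makes negative for small \<open>\<epsilon>\<close>.

  Admissibility for \<open>k = 2\<close>: \<open>G\<close> is invariant under the diagonal translations \<open>\<theta>\<^sub>i \<mapsto> \<theta>\<^sub>i + b\<close> and, as \<open>a\<^sub>2 > 1\<close>
  makes the prior of \<open>V\<close> finite, it has finite mass on \<open>|avg \<theta>| < 1\<close>. Blyth's method applies with the priors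
  \<open>h\<^sub>n(avg \<theta>)\<^sup>2 G\<close>, because the plane carries compactly supported cutoffs \<open>h\<^sub>n\<close> of arbitrarily small energy.
\<close>

text \<open>The prior of V is known only up to two constants, so it may oscillate and no estimate of
  the gradient of m is available; each argument is shaped to use bounds on m alone. Dividing F by m
  has this effect in Stein's identity: the derivative of 1/m is exactly what turns x into the
  posterior mean, so the score disappears from the risk difference. In Blyth's method the remainder
  is a double integral over two copies of \<theta>, where differences of the cutoffs stand in for
  gradients. The hypothesis bounds the density in (H, d), gap product included, and the Jacobian
  supplies the same product: the two meet in the upper bounds on integrals over V. The lower bound
  makes no change of variables; a box of matrix entries is integrated directly, and every gap there
  is at most 1 + |x|^2. The three thresholds have separate sources: a2 > (3 - m)/2 makes m finite,
  a2 > 1 makes the prior of V finite, and a2 < 3/2 - 1/k is 2\<kappa> + 2 < mk rewritten.\<close>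

section \<open>Lebesgue measure on vectors\<close>

text \<open>The change-of-variables theorems of the library ask for a well-ordered index type; this copy of an arbitrary
  finite type carries an arbitrary enumeration as its order.\<close>

typedef (overloaded) ('a::finite) enum_ix = "UNIV :: 'a set"
  morphisms of_enum_ix to_enum_ix by blast

lemma bij_of_enum_ix: "bij of_enum_ix"
  by (metis bij_iff to_enum_ix_inverse of_enum_ix_inverse UNIV_I)

instance enum_ix :: (finite) finite
proof
  show "finite (UNIV :: 'a enum_ix set)"
    using bij_betw_finite[OF bij_of_enum_ix] by simp
qed

definition enum_code :: "'a::finite \<Rightarrow> nat" where
  "enum_code = (SOME f. inj f)"

lemma inj_enum_code: "inj (enum_code :: 'a::finite \<Rightarrow> nat)"
  unfolding enum_code_def
  by (rule someI_ex[of inj]) (meson finite_imp_inj_to_nat_seg finite_class.finite_UNIV)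

instantiation enum_ix :: (finite) wellorder
begin

definition "x \<le> y \<longleftrightarrow> enum_code (of_enum_ix x) \<le> enum_code (of_enum_ix y)"
definition "x < y \<longleftrightarrow> enum_code (of_enum_ix x) < enum_code (of_enum_ix y)"

instance
proof
  fix x y z :: "'a enum_ix"
  have inj: "inj (\<lambda>x :: 'a enum_ix. enum_code (of_enum_ix x))"
    using inj_compose[OF inj_enum_code bij_is_inj[OF bij_of_enum_ix]] by (simp add: o_def)
  show "(x < y) = (x \<le> y \<and> \<not> y \<le> x)" "x \<le> x" "x \<le> y \<or> y \<le> x"
    by (auto simp: less_enum_ix_def less_eq_enum_ix_def)
  show "x \<le> y \<Longrightarrow> y \<le> z \<Longrightarrow> x \<le> z" by (auto simp: less_eq_enum_ix_def)
  show "x \<le> y \<Longrightarrow> y \<le> x \<Longrightarrow> x = y" using inj by (auto simp: less_eq_enum_ix_def inj_def)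
next
  fix P and a :: "'a enum_ix"
  assume "\<And>x :: 'a enum_ix. (\<And>y. y < x \<Longrightarrow> P y) \<Longrightarrow> P x"
  note step = this
  show "P a"
  proof (induction "enum_code (of_enum_ix a)" arbitrary: a rule: less_induct)
    case less
    show ?case
      by (rule step, rule less) (simp only: less_enum_ix_def)
  qed
qed

end

interpretation lborel_prod: product_sigma_finite "\<lambda>_ :: 'i. lborel :: 'a::euclidean_space measure"
  by standard

section \<open>Product structure of Lebesgue measure in coordinates and in blocks\<close>

lemma measurable_vec_lambda:
  assumes "\<And>i. (\<lambda>x. f x i) \<in> borel_measurable M"
  shows "(\<lambda>x. (\<chi> i. f x i) :: real^'n) \<in> borel_measurable M"
  by (subst borel_measurable_euclidean_space)
    (use assms in \<open>auto simp: Basis_vec_def inner_axis\<close>)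

lemma vec_nth_measurable [measurable]: "(\<lambda>x :: real^'n. x $ i) \<in> borel_measurable borel"
  by (intro borel_measurable_continuous_onI continuous_intros)

lemma prod_Basis_vec: "(\<Prod>b\<in>(Basis :: (real^'n) set). g (v \<bullet> b)) = (\<Prod>i\<in>UNIV. g (v $ i))"
proof -
  have B: "(Basis :: (real^'n) set) = range (\<lambda>i. axis i 1)"
    by (auto simp: Basis_vec_def)
  have "inj (\<lambda>i :: 'n. axis i (1::real))"
    by (auto simp: inj_def axis_eq_axis)
  then show ?thesis
    by (simp add: B prod.reindex inner_axis)
qed

lemma prod_inner_Basis_vec: "(\<Prod>b\<in>Basis. (v :: real^'n) \<bullet> b) = (\<Prod>i\<in>UNIV. v $ i)"
  using prod_Basis_vec[of "\<lambda>x. x" v] by simp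

lemma mem_box_vec: "x \<in> box l u \<longleftrightarrow> (\<forall>i. l $ i < x $ i \<and> x $ i < (u :: real^'n) $ i)"
  by (simp add: mem_box_cart)

lemma Basis_vec_le: "(\<And>b. b \<in> Basis \<Longrightarrow> l \<bullet> b \<le> u \<bullet> b) \<Longrightarrow> l $ i \<le> (u :: real^'n) $ i"
  using axis_in_Basis_iff[of i "1::real"] by (metis Basis_real_def cart_eq_inner_axis insertI1)

text \<open>Both sides give a box the product of its side lengths, which determines Lebesgue
  measure. The index set is a parameter so that the product over entries i <= j in
  \<open>sym_lborel\<close> is covered as well as plain coordinates.\<close>

lemma lborel_vec_reindex:
  assumes r: "bij_betw r (UNIV :: 'n::finite set) I" and I: "finite I"
  shows "(lborel :: (real^'n) measure) = distr (PiM I (\<lambda>_. lborel)) borel (\<lambda>v. \<chi> n. v (r n))"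
proof (rule lborel_eqI)
  fix l u :: "real^'n"
  assume "\<And>b. b \<in> Basis \<Longrightarrow> l \<bullet> b \<le> u \<bullet> b"
  then have lu: "l $ i \<le> u $ i" for i by (rule Basis_vec_le)
  let ?s = "the_inv_into UNIV r"
  have inj: "inj r" and im: "r ` UNIV = I" using r by (auto simp: bij_betw_def)
  have sr: "?s (r n) = n" for n using inj by (simp add: the_inv_into_f_f)
  have meas: "(\<lambda>v. \<chi> n. v (r n)) \<in> PiM I (\<lambda>_. lborel) \<rightarrow>\<^sub>M (borel :: (real^'n) measure)"
    using im by (intro measurable_vec_lambda) auto
  have "(\<lambda>v. \<chi> n. v (r n)) -` box l u \<inter> space (PiM I (\<lambda>_. lborel))
      = PiE I (\<lambda>j. {l $ ?s j <..< u $ ?s j})"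
    using sr by (auto simp: space_PiM PiE_iff mem_box_vec im[symmetric])
  then have "emeasure (distr (PiM I (\<lambda>_. lborel)) borel (\<lambda>v. \<chi> n. v (r n))) (box l u)
      = (\<Prod>j\<in>I. emeasure lborel {l $ ?s j <..< u $ ?s j})"
    by (simp add: emeasure_distr[OF meas] lborel_prod.emeasure_PiM I)
  also have "\<dots> = (\<Prod>j\<in>I. ennreal (u $ ?s j - l $ ?s j))"
    using lu by simp
  also have "\<dots> = (\<Prod>n\<in>UNIV. ennreal (u $ n - l $ n))"
    by (subst prod.reindex_bij_betw[OF r, symmetric]) (simp add: sr)
  also have "\<dots> = ennreal (\<Prod>b\<in>Basis. (u - l) \<bullet> b)"
    using lu by (simp add: prod_inner_Basis_vec prod_ennreal)
  finally show "emeasure (distr (PiM I (\<lambda>_. lborel)) borel (\<lambda>v. \<chi> n. v (r n))) (box l u)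
      = ennreal (\<Prod>b\<in>Basis. (u - l) \<bullet> b)" .
qed simp

lemma lborel_vec: "(lborel :: (real^'n::finite) measure) = distr (PiM UNIV (\<lambda>_. lborel)) borel (\<lambda>v. \<chi> n. v n)"
  using lborel_vec_reindex[of "\<lambda>x. x"] by (simp add: bij_betw_def)

lemma nn_integral_lborel_vec_prod:
  assumes [measurable]: "\<And>i. f i \<in> borel_measurable borel"
  shows "(\<integral>\<^sup>+x. (\<Prod>i\<in>UNIV. f i (x $ i)) \<partial>(lborel :: (real^'n::finite) measure)) = (\<Prod>i\<in>UNIV. \<integral>\<^sup>+t. f i t \<partial>lborel)"
proof -
  have "(\<lambda>v. \<chi> n. v n) \<in> PiM UNIV (\<lambda>_. lborel) \<rightarrow>\<^sub>M (borel :: (real^'n) measure)"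
    by (intro measurable_vec_lambda) auto
  then show ?thesis
    by (subst lborel_vec) (simp add: nn_integral_distr lborel_prod.product_nn_integral_prod)
qed

lemma lborel_vec_enum_ix:
  "(lborel :: (real^('n::finite) enum_ix) measure) = distr (lborel :: (real^'n) measure) borel (\<lambda>x. \<chi> n. x $ of_enum_ix n)"
proof -
  have *: "(\<lambda>v. \<chi> n. v n) \<in> PiM UNIV (\<lambda>_. lborel) \<rightarrow>\<^sub>M (borel :: (real^'n) measure)"
    "(\<lambda>x. \<chi> n. x $ of_enum_ix n) \<in> (borel :: (real^'n) measure) \<rightarrow>\<^sub>M (borel :: (real^'n enum_ix) measure)"
    by (intro measurable_vec_lambda; simp)+
  show ?thesis
    using bij_of_enum_ix by (subst (2) lborel_vec, subst lborel_vec_reindex[of of_enum_ix UNIV])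
       (auto simp: distr_distr * o_def)
qed

lemma block_measurable [measurable]: "(\<lambda>x. block x i) \<in> borel_measurable borel"
  unfolding block_def by (intro measurable_vec_lambda) simp

lemma measurable_PiM_vec_component:
  "(\<lambda>v. v i $ j) \<in> borel_measurable (PiM UNIV (\<lambda>_ :: 'i. lborel :: (real^'k) measure))"
proof -
  have "(\<lambda>v. v i) \<in> PiM UNIV (\<lambda>_ :: 'i. lborel :: (real^'k) measure) \<rightarrow>\<^sub>M lborel"
    by (rule measurable_component_singleton) simp
  then show ?thesis
    by (rule measurable_compose) simp
qed

text \<open>Lets integrals of products over the m groups factor; the proof compares boxes, which
  split into one box per block.\<close>

lemma lborel_block:
  "(lborel :: (real^('m::finite \<times> 'k::finite)) measure)
    = distr (PiM UNIV (\<lambda>_. lborel :: (real^'k) measure)) borel (\<lambda>v. \<chi> p. v (fst p) $ snd p)"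
  (is "_ = distr ?P borel ?g")
proof (rule lborel_eqI)
  fix l u :: "real^('m \<times> 'k)"
  assume "\<And>b. b \<in> Basis \<Longrightarrow> l \<bullet> b \<le> u \<bullet> b"
  then have lu: "l $ i \<le> u $ i" for i by (rule Basis_vec_le)
  have meas: "?g \<in> ?P \<rightarrow>\<^sub>M borel"
    by (intro measurable_vec_lambda measurable_PiM_vec_component)
  have "?g -` box l u \<inter> space ?P = PiE UNIV (\<lambda>i. box (block l i) (block u i))"
    by (auto simp: space_PiM PiE_iff mem_box_vec block_def)
  then have "emeasure (distr ?P borel ?g) (box l u) = (\<Prod>i\<in>UNIV. emeasure lborel (box (block l i) (block u i)))"
    by (simp add: emeasure_distr[OF meas] lborel_prod.emeasure_PiM)
  also have "\<dots> = (\<Prod>i\<in>UNIV. ennreal (\<Prod>j\<in>UNIV. u $ (i, j) - l $ (i, j)))"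
  proof (rule prod.cong)
    fix i :: 'm
    have "block l i \<bullet> b \<le> block u i \<bullet> b" if "b \<in> Basis" for b
      using that lu by (auto simp: Basis_vec_def inner_axis block_def)
    then have "emeasure lborel (box (block l i) (block u i)) = ennreal (\<Prod>b\<in>Basis. (block u i - block l i) \<bullet> b)"
      by (rule emeasure_lborel_box)
    then show "emeasure lborel (box (block l i) (block u i)) = ennreal (\<Prod>j\<in>UNIV. u $ (i, j) - l $ (i, j))"
      by (simp add: prod_inner_Basis_vec block_def)
  qed simp
  also have "\<dots> = ennreal (\<Prod>i\<in>UNIV. \<Prod>j\<in>UNIV. u $ (i, j) - l $ (i, j))"
    using lu by (intro prod_ennreal prod_nonneg) auto
  also have "(\<Prod>i\<in>UNIV. \<Prod>j\<in>UNIV. u $ (i, j) - l $ (i, j)) = (\<Prod>b\<in>Basis. (u - l) \<bullet> b)"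
    by (simp add: prod_inner_Basis_vec prod.cartesian_product flip: UNIV_Times_UNIV)
  finally show "emeasure (distr ?P borel ?g) (box l u) = ennreal (\<Prod>b\<in>Basis. (u - l) \<bullet> b)" .
qed simp

lemma nn_integral_lborel_block_prod:
  assumes [measurable]: "\<And>i. f i \<in> borel_measurable borel"
  shows "(\<integral>\<^sup>+x. (\<Prod>i\<in>UNIV. f i (block x i)) \<partial>(lborel :: (real^('m::finite \<times> 'k::finite)) measure))
    = (\<Prod>i\<in>UNIV. \<integral>\<^sup>+t. f i t \<partial>lborel)"
proof -
  have "(\<lambda>v. \<chi> p. v (fst p) $ snd p) \<in> PiM UNIV (\<lambda>_. lborel) \<rightarrow>\<^sub>M (borel :: (real^('m \<times> 'k)) measure)"
    by (intro measurable_vec_lambda measurable_PiM_vec_component)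
  moreover have "block (\<chi> p. v (fst p) $ snd p) i = v i" for v :: "'m \<Rightarrow> real^'k" and i
    by (simp add: block_def vec_eq_iff)
  ultimately show ?thesis
    by (subst lborel_block) (simp add: nn_integral_distr lborel_prod.product_nn_integral_prod)
qed

section \<open>Invariance of Lebesgue measure under translations, reflections and isometries\<close>

lemma nn_integral_lborel_translate:
  fixes f :: "'a::euclidean_space \<Rightarrow> ennreal"
  assumes [measurable]: "f \<in> borel_measurable borel"
  shows "(\<integral>\<^sup>+x. f (a + x) \<partial>lborel) = (\<integral>\<^sup>+x. f x \<partial>lborel)"
  by (subst (2) lborel_distr_plus[symmetric, of a]) (simp add: nn_integral_distr)

lemma nn_integral_lborel_reflect:
  fixes f :: "'a::euclidean_space \<Rightarrow> ennreal"
  assumes [measurable]: "f \<in> borel_measurable borel"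
  shows "(\<integral>\<^sup>+x. f (a - x) \<partial>lborel) = (\<integral>\<^sup>+x. f x \<partial>lborel)"
proof -
  have "(lborel :: 'a measure) = distr lborel borel (\<lambda>x. a + (-1) *\<^sub>R x)"
    using lborel_affine[of "-1" a] by (simp add: density_1)
  then have "(\<integral>\<^sup>+x. f x \<partial>lborel) = (\<integral>\<^sup>+x. f x \<partial>distr lborel borel (\<lambda>x. a + (-1) *\<^sub>R x))" by simp
  then show ?thesis by (simp add: nn_integral_distr)
qed

lemma vec_enum_ix_norm: "norm ((\<chi> n. x $ of_enum_ix n) :: real^('n::finite) enum_ix) = norm (x :: real^'n)"
proof -
  have "(\<Sum>i\<in>UNIV. (x $ of_enum_ix i)\<^sup>2) = (\<Sum>i\<in>UNIV. (x $ i)\<^sup>2)"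
    by (rule sum.reindex_bij_betw[OF bij_of_enum_ix])
  then show ?thesis by (simp add: norm_vec_def L2_set_def)
qed

text \<open>The relabelling \<open>e\<close>, \<open>d\<close> conjugates T to an isometry S on a
  well-ordered index type. There the preimage of a box is its image under the inverse isometry, and
  orthogonal images preserve measure.\<close>

lemma nn_integral_lborel_isometry:
  fixes f :: "real^('n::finite) \<Rightarrow> ennreal" and T :: "real^'n \<Rightarrow> real^'n"
  assumes T: "orthogonal_transformation T" and f[measurable]: "f \<in> borel_measurable borel"
  shows "(\<integral>\<^sup>+x. f (T x) \<partial>lborel) = (\<integral>\<^sup>+x. f x \<partial>lborel)"
proof -
  define e :: "real^'n \<Rightarrow> real^'n enum_ix" where "e x = (\<chi> n. x $ of_enum_ix n)" for x
  define d :: "real^'n enum_ix \<Rightarrow> real^'n" where "d y = (\<chi> i. y $ to_enum_ix i)" for y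
  have de: "d (e x) = x" for x by (simp add: d_def e_def vec_eq_iff to_enum_ix_inverse)
  have ed: "e (d y) = y" for y by (simp add: d_def e_def vec_eq_iff of_enum_ix_inverse)
  have [measurable]: "e \<in> borel_measurable borel" "d \<in> borel_measurable borel"
    unfolding e_def d_def by (intro measurable_vec_lambda; simp)+
  have lT: "linear T" using T by (rule orthogonal_transformation_linear)
  have linT: "(\<lambda>x. T x) \<in> borel_measurable borel"
    by (intro borel_measurable_continuous_onI linear_continuous_on) (simp add: lT linear_linear)
  note [measurable] = linT
  define S where "S = (\<lambda>y. e (T (d y)))"
  have le: "linear e" "linear d"
    by (auto intro!: linearI simp: e_def d_def vec_eq_iff)
  have lS: "linear S"
    using linear_compose[OF linear_compose[OF le(2) lT] le(1)] by (simp add: S_def o_def)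
  have nS: "norm (S y) = norm y" for y
    using T vec_enum_ix_norm[of "T (d y)"] vec_enum_ix_norm[of "d y"] ed[of y]
    by (simp add: S_def e_def[symmetric] orthogonal_transformation)
  have S: "orthogonal_transformation S" using lS nS by (simp add: orthogonal_transformation)
  have lb: "distr lborel borel e = (lborel :: (real^'n enum_ix) measure)"
    unfolding e_def[abs_def] by (rule lborel_vec_enum_ix[symmetric])
  have distS: "distr lborel borel S = (lborel :: (real^'n enum_ix) measure)"
  proof (rule lborel_eqI[symmetric])
    fix l u :: "real^'n enum_ix" 
    assume lu: "\<And>b. b \<in> Basis \<Longrightarrow> l \<bullet> b \<le> u \<bullet> b"
    obtain S' where S': "orthogonal_transformation S'" "\<And>x. S' (S x) = x" "\<And>x. S (S' x) = x"
      using orthogonal_transformation_inv[OF S] orthogonal_transformation_bij[OF S]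
      by (metis bij_inv_eq_iff)
    have m: "S \<in> borel_measurable borel"
      by (intro borel_measurable_continuous_onI linear_continuous_on) (simp add: lS linear_linear)
    have pre: "S -` box l u = S' ` box l u" 
    proof (intro set_eqI iffI)
      show "x \<in> S' ` box l u" if "x \<in> S -` box l u" for x
        using that S'(2)[of x] by (metis imageI vimage_eq)
      show "x \<in> S -` box l u" if "x \<in> S' ` box l u" for x
        using that S'(3) by auto
    qed
    have box: "box l u \<in> lmeasurable" by (simp add: lmeasurable_box)
    have meas: "S -` box l u \<in> sets borel" using measurable_sets[OF m, of "box l u"] by simp
    have "emeasure lborel (S -` box l u) = emeasure lebesgue (S' ` box l u)"
      using meas pre by (simp add: emeasure_lborel_box)
    also have "\<dots> = ennreal (measure lebesgue (S' ` box l u))"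
      by (rule emeasure_eq_measure2[OF measurable_orthogonal_image[OF S'(1) box]])
    also have "\<dots> = ennreal (measure lebesgue (box l u))"
      using measure_orthogonal_image[OF S'(1) box] by simp
    also have "\<dots> = (\<Prod>b\<in>Basis. (u - l) \<bullet> b)"
      using lu by (simp add: measure_lborel_box)
    finally show "emeasure (distr lborel borel S) (box l u) = (\<Prod>b\<in>Basis. (u - l) \<bullet> b)"
      using m by (simp add: emeasure_distr)
  qed simp
  have mS[measurable]: "S \<in> borel_measurable borel" unfolding S_def by measurable
  have "(\<integral>\<^sup>+x. f (T x) \<partial>lborel) = (\<integral>\<^sup>+x. f (d (S (e x))) \<partial>lborel)"
    by (simp add: S_def de)
  also have "\<dots> = (\<integral>\<^sup>+y. f (d (S y)) \<partial>distr lborel borel e)"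
    by (simp add: nn_integral_distr)
  also have "\<dots> = (\<integral>\<^sup>+y. f (d y) \<partial>distr lborel borel S)"
    by (simp add: nn_integral_distr lb)
  also have "\<dots> = (\<integral>\<^sup>+y. f (d y) \<partial>distr lborel borel e)"
    by (simp add: distS lb)
  also have "\<dots> = (\<integral>\<^sup>+x. f x \<partial>lborel)"
    by (simp add: nn_integral_distr de)
  finally show ?thesis .
qed

section \<open>Orthogonal and positive definite matrices\<close>

lemma matrix_add_rdistrib: "(A + B) ** C = A ** C + B ** (C :: real^'p^'n)"
  by (simp add: matrix_matrix_mult_def vec_eq_iff distrib_right sum.distrib)

lemma bounded_bilinear_matrix_mult:
  "bounded_bilinear ((**) :: real^'n^'m \<Rightarrow> real^'p^'n \<Rightarrow> real^'p^'m)"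
  unfolding bilinear_conv_bounded_bilinear[symmetric] bilinear_def
  by (auto intro!: linearI simp: matrix_add_ldistrib matrix_add_rdistrib)
    (simp_all add: matrix_matrix_mult_def vec_eq_iff sum_distrib_left mult_ac)

interpretation matrix_mult: bounded_bilinear "(**) :: real^'n^'m \<Rightarrow> real^'p^'n \<Rightarrow> real^'p^'m"
  by (rule bounded_bilinear_matrix_mult)

lemma bounded_linear_transpose: "bounded_linear (transpose :: real^'n^'m \<Rightarrow> real^'m^'n)"
  by (simp add: linear_conv_bounded_linear[symmetric] linearI transpose_def vec_eq_iff)

lemma continuous_on_matrix_mult [continuous_intros]:
  fixes f :: "'a::topological_space \<Rightarrow> real^'n^'m" and g :: "'a \<Rightarrow> real^'p^'n"
  shows "continuous_on S f \<Longrightarrow> continuous_on S g \<Longrightarrow> continuous_on S (\<lambda>x. f x ** g x)"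
  by (rule matrix_mult.continuous_on)

lemma continuous_on_transpose [continuous_intros]:
  fixes f :: "'a::topological_space \<Rightarrow> real^'n^'m"
  shows "continuous_on S f \<Longrightarrow> continuous_on S (\<lambda>x. transpose (f x))"
  by (rule bounded_linear.continuous_on[OF bounded_linear_transpose])

lemma orthogonal_matrix_norm_row: "orthogonal_matrix (H :: real^'n^'n) \<Longrightarrow> norm (H $ i) = 1"
  by (auto simp: orthogonal_matrix_orthonormal_rows row_def vec_lambda_eta)

lemma orthogonal_matrix_inner_row: "orthogonal_matrix (H :: real^'n^'n) \<Longrightarrow> i \<noteq> j \<Longrightarrow> H $ i \<bullet> H $ j = 0"
  by (auto simp: orthogonal_matrix_orthonormal_rows row_def vec_lambda_eta orthogonal_def)

lemma orthogonal_matrix_entry_le: "orthogonal_matrix (H :: real^'n^'n) \<Longrightarrow> \<bar>H $ i $ j\<bar> \<le> 1"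
  using component_le_norm_cart[of "H $ i" j] by (simp add: orthogonal_matrix_norm_row)

lemma orthogonal_matrixI_rows:
  assumes "\<And>i. norm (H $ i) = 1" "\<And>i j. i \<noteq> j \<Longrightarrow> H $ i \<bullet> H $ j = 0"
  shows "orthogonal_matrix (H :: real^'n^'n)"
  using assms by (auto simp: orthogonal_matrix_orthonormal_rows row_def vec_lambda_eta orthogonal_def)

text \<open>Serves twice: a maximiser exists in the diagonalisation, and finitely many unit balls
  cover the group.\<close>

lemma compact_orthogonal_matrices: "compact {H :: real^'n^'n. orthogonal_matrix H}"
proof (subst compact_eq_bounded_closed, intro conjI)
  have "norm H \<le> real CARD('n)" if "orthogonal_matrix H" for H :: "real^'n^'n"
    using norm_le_l1_cart[of "vec_lambda (\<lambda>i. norm (H $ i))"]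
      L2_set_le_sum_abs[of "\<lambda>i. norm (H $ i)" UNIV] orthogonal_matrix_norm_row[OF that]
    by (simp add: norm_vec_def)
  then show "bounded {H :: real^'n^'n. orthogonal_matrix H}"
    by (auto simp: bounded_iff)
  have "{H :: real^'n^'n. orthogonal_matrix H} = {H. transpose H ** H = mat 1}"
    by (simp add: orthogonal_matrix)
  moreover have "closed {H :: real^'n^'n. transpose H ** H = mat 1}"
    by (intro closed_Collect_eq continuous_intros)
  ultimately show "closed {H :: real^'n^'n. orthogonal_matrix H}" by simp
qed

section \<open>Spectral decomposition of symmetric matrices\<close>

lemma conj_entry: "(H ** V ** transpose H) $ i $ j = H $ i \<bullet> (V *v (H $ j))"
  for H V :: "real^'n^'n"
proof -
  have "(H ** V ** transpose H) $ i $ j = (\<Sum>b\<in>UNIV. \<Sum>a\<in>UNIV. H $ i $ a * V $ a $ b * H $ j $ b)"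
    by (simp add: matrix_matrix_mult_def transpose_def sum_distrib_right)
  also have "\<dots> = H $ i \<bullet> (V *v (H $ j))"
    by (subst sum.swap) (simp add: matrix_vector_mult_def inner_vec_def sum_distrib_left mult.assoc)
  finally show ?thesis .
qed

lemma symmetric_inner: "transpose V = V \<Longrightarrow> x \<bullet> (V *v y) = y \<bullet> (V *v x)" for V :: "real^'n^'n"
  by (metis dot_lmul_matrix inner_commute transpose_matrix_vector)

text \<open>First-order stationarity without derivatives: the choice c = (1 - a)/r, s = b/r turns
  the left side into (b/r)^2, which is nonpositive only if b = 0.\<close>

lemma quadratic_rotation_zero:
  fixes a b :: real
  assumes "\<And>c s. c\<^sup>2 + s\<^sup>2 = 1 \<Longrightarrow> s\<^sup>2 * a + c * s * b \<le> 0"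
  shows "b = 0"
proof (rule ccontr)
  assume b: "b \<noteq> 0"
  define r where "r = sqrt (b\<^sup>2 + (1 - a)\<^sup>2)"
  have r: "r > 0" "r\<^sup>2 = b\<^sup>2 + (1 - a)\<^sup>2"
    using b by (auto simp: r_def add_pos_nonneg)
  have "((1 - a) / r)\<^sup>2 + (b / r)\<^sup>2 = 1"
  proof -
    have "((1 - a) / r)\<^sup>2 + (b / r)\<^sup>2 = (b\<^sup>2 + (1 - a)\<^sup>2) / r\<^sup>2"
      by (simp only: power_divide add_divide_distrib add.commute)
    also have "\<dots> = 1" unfolding r(2)[symmetric] using r(1) by simp
    finally show ?thesis .
  qed
  then have "(b / r)\<^sup>2 * a + (1 - a) / r * (b / r) * b \<le> 0" by (rule assms)
  also have "(b / r)\<^sup>2 * a + (1 - a) / r * (b / r) * b = (b / r)\<^sup>2"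
    using r(1) by (simp add: field_simps power2_eq_square)
  finally show False using b r(1) by simp
qed

text \<open>The maximiser of \<open>\<Sum>i. c i * (H V H\<^sup>T)\<^sub>i\<^sub>i\<close> over the orthogonal group, with \<open>c\<close> strictly decreasing,
  is stationary under rotations in each coordinate plane; hence it diagonalises \<open>V\<close> and sorts the eigenvalues.\<close>

lemma symmetric_diagonalise:
  fixes V :: "'k::{finite,linorder} matrix"
  assumes V: "transpose V = V"
  obtains H d where "orthogonal_matrix H" "\<And>i j. i < j \<Longrightarrow> d $ j \<le> d $ i" "V = transpose H ** diag d ** H"
proof -
  \<comment> \<open>Counting the larger indices gives strictly decreasing weights on any finite
    linear order.\<close>
  define c :: "'k \<Rightarrow> real" where "c i = real (card {l. i < l})" for i
  have c: "c j < c i" if "i < j" for i j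
    unfolding c_def using that by (simp, intro psubset_card_mono) auto
  define f where "f H = (\<Sum>i\<in>UNIV. c i * (H ** V ** transpose H) $ i $ i)" for H
  have "continuous_on {H. orthogonal_matrix H} f"
    unfolding f_def by (intro continuous_intros)
  moreover have "{H :: 'k matrix. orthogonal_matrix H} \<noteq> {}" using orthogonal_matrix_id by blast
  ultimately obtain H where H: "orthogonal_matrix H" and max: "\<And>G. orthogonal_matrix G \<Longrightarrow> f G \<le> f H"
    using continuous_attains_sup[OF compact_orthogonal_matrices] by (metis mem_Collect_eq)
  define w where "w i j = H $ i \<bullet> (V *v (H $ j))" for i j
  have wsym: "w i j = w j i" for i j unfolding w_def by (rule symmetric_inner[OF V])
  have key: "s\<^sup>2 * (w j j - w i i) + u * s * (2 * w i j) \<le> 0" if ij: "i < j" and us: "u\<^sup>2 + s\<^sup>2 = 1" for i j u s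
  proof -
    \<comment> \<open>\<open>H\<close> with its rows i and j turned by the plane rotation (u,
      s).\<close>
    define G :: "'k matrix" where "G = (\<chi> l. if l = i then u *\<^sub>R H $ i + s *\<^sub>R H $ j
        else if l = j then u *\<^sub>R H $ j - s *\<^sub>R H $ i else H $ l)"
    note row = orthogonal_matrix_norm_row[OF H] orthogonal_matrix_inner_row[OF H]
    have row1: "H $ l \<bullet> H $ l = 1" for l using row(1)[of l] by (simp add: norm_eq_1)
    have "orthogonal_matrix G"
    proof (rule orthogonal_matrixI_rows)
      show "norm (G $ l) = 1" for l
        using us ij row row1 by (auto simp: G_def norm_eq_1 inner_simps power2_eq_square algebra_simps)
      show "G $ l \<bullet> G $ m = 0" if "l \<noteq> m" for l m
        using that us ij row(2) row1 by (auto simp: G_def inner_simps)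
    qed
    then have "f G \<le> f H" by (rule max)
    have split: "(\<Sum>l\<in>UNIV. g l) = g i + g j + (\<Sum>l\<in>UNIV - {i, j}. g l)" for g :: "'k \<Rightarrow> real"
      using ij by (subst sum.subset_diff[of "{i, j}"]) auto
    have "f G = c i * (G $ i \<bullet> (V *v G $ i)) + c j * (G $ j \<bullet> (V *v G $ j)) + (\<Sum>l\<in>UNIV - {i, j}. c l * w l l)"
      unfolding f_def conj_entry by (subst split) (simp add: G_def w_def)
    moreover have "f H = c i * w i i + c j * w j j + (\<Sum>l\<in>UNIV - {i, j}. c l * w l l)"
      unfolding f_def conj_entry by (subst split) (simp add: w_def)
    moreover have "G $ i \<bullet> (V *v G $ i) = u\<^sup>2 * w i i + s\<^sup>2 * w j j + 2 * u * s * w i j"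
      using ij wsym[of i j]
      by (simp add: G_def w_def inner_simps matrix_vector_right_distrib matrix_vector_mult_scaleR power2_eq_square algebra_simps)
    moreover have "G $ j \<bullet> (V *v G $ j) = u\<^sup>2 * w j j + s\<^sup>2 * w i i - 2 * u * s * w i j"
      using ij wsym[of i j]
      by (simp add: G_def w_def inner_simps matrix_vector_mult_diff_distrib matrix_vector_mult_scaleR power2_eq_square algebra_simps)
    ultimately have "c i * (u\<^sup>2 * w i i + s\<^sup>2 * w j j + 2 * u * s * w i j - w i i)
        + c j * (u\<^sup>2 * w j j + s\<^sup>2 * w i i - 2 * u * s * w i j - w j j) \<le> 0"
      using \<open>f G \<le> f H\<close> by (simp add: algebra_simps)
    moreover have "u\<^sup>2 = 1 - s\<^sup>2" using us by simp
    \<comment> \<open>Because u^2 = 1 - s^2, the two brackets are opposite numbers, so only the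
      difference of the weights remains in front.\<close>
    ultimately have "(c i - c j) * (s\<^sup>2 * (w j j - w i i) + u * s * (2 * w i j)) \<le> 0"
      by (simp add: algebra_simps)
    then show ?thesis using c[OF ij] by (simp add: mult_le_0_iff)
  qed
  \<comment> \<open>The quarter turn u = 0, s = 1 exchanges the two rows.\<close>
  have sorted: "w j j \<le> w i i" if "i < j" for i j
    using key[OF that, of 0 1] by simp
  have off: "w i j = 0" if "i < j" for i j
    using quadratic_rotation_zero[OF key[OF that]] by simp
  have off': "w i j = 0" if "i \<noteq> j" for i j
    using that off[of i j] off[of j i] wsym[of i j] by (cases "i < j") auto
  let ?d = "\<chi> i. w i i"
  have "H ** V ** transpose H = diag ?d"
    using off' by (simp add: vec_eq_iff conj_entry w_def diag_def)
  then have "transpose H ** diag ?d ** H = transpose H ** (H ** V ** transpose H) ** H"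
    by simp
  also have "\<dots> = (transpose H ** H) ** V ** (transpose H ** H)"
    by (simp only: matrix_mul_assoc)
  finally have "transpose H ** diag ?d ** H = (transpose H ** H) ** V ** (transpose H ** H)" .
  then have "V = transpose H ** diag ?d ** H"
    using H by (simp add: orthogonal_matrix)
  then show ?thesis using that[OF H, of ?d] sorted by simp
qed

lemma det_conj:
  assumes "orthogonal_matrix (H :: real^'n^'n)"
  shows "det (transpose H ** A ** H) = det A"
proof -
  have "det H * det H = 1" using det_orthogonal_matrix[OF assms] by auto
  then show ?thesis by (simp add: det_mul det_transpose mult_ac)
qed

lemma det_diag: "det (diag d) = (\<Prod>i\<in>UNIV. d $ i)"
  by (subst det_diagonal) (auto simp: diag_def)

lemma mat_plus_conj:
  assumes "orthogonal_matrix (H :: real^'n^'n)"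
  shows "mat 1 + transpose H ** A ** H = transpose H ** (mat 1 + A) ** H"
  using assms by (simp add: matrix_add_ldistrib matrix_add_rdistrib orthogonal_matrix)

lemma mat_plus_diag: "mat 1 + diag d = diag (\<chi> i. 1 + d $ i)"
  by (simp add: vec_eq_iff diag_def mat_def)

lemma diag_mult_diag: "diag a ** diag b = diag (\<chi> i. a $ i * b $ i)"
  by (simp add: vec_eq_iff diag_def matrix_matrix_mult_def if_distrib[of "\<lambda>x. x * _"] cong: if_cong)

lemma diag_mult_vec: "diag a *v x = (\<chi> i. a $ i * x $ i)"
  by (simp add: vec_eq_iff diag_def matrix_vector_mult_def if_distrib[of "\<lambda>x. x * _"] cong: if_cong)

lemma transpose_diag: "transpose (diag d) = diag d"
  by (auto simp: vec_eq_iff diag_def transpose_def)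

lemma transpose_conj_diag: "transpose (transpose H ** diag d ** H) = transpose H ** diag d ** H"
  by (simp add: matrix_transpose_mul transpose_diag matrix_mul_assoc)

lemma conj_quadratic: "x \<bullet> ((transpose H ** diag d ** H) *v x) = (\<Sum>i\<in>UNIV. d $ i * ((H *v x) $ i)\<^sup>2)"
  for H :: "real^'n^'n"
proof -
  have "x \<bullet> ((transpose H ** diag d ** H) *v x) = (H *v x) \<bullet> (diag d *v (H *v x))"
    using dot_lmul_matrix[of x "transpose H" "diag d *v (H *v x)"]
    by (simp add: matrix_vector_mul_assoc matrix_mul_assoc del: transpose_matrix_vector)
  then show ?thesis
    by (simp add: diag_mult_vec inner_vec_def power2_eq_square mult_ac)
qed

lemma positive_definite_conj_iff:
  assumes H: "orthogonal_matrix (H :: real^'n^'n)"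
  shows "positive_definite (transpose H ** diag d ** H) \<longleftrightarrow> (\<forall>i. d $ i > 0)"
proof
  assume pd: "positive_definite (transpose H ** diag d ** H)"
  show "\<forall>i. d $ i > 0"
  proof
    fix i
    let ?x = "transpose H *v axis i 1"
    have Hx: "H *v ?x = axis i 1"
      using H by (simp add: matrix_vector_mul_assoc orthogonal_matrix_def del: transpose_matrix_vector)
    then have "?x \<noteq> 0" by (metis axis_eq_0_iff matrix_vector_mult_0_right zero_neq_one)
    then have "?x \<bullet> ((transpose H ** diag d ** H) *v ?x) > 0"
      using pd by (simp add: positive_definite_def)
    also have "?x \<bullet> ((transpose H ** diag d ** H) *v ?x) = d $ i"
      unfolding conj_quadratic Hx by (simp add: axis_def if_distrib[of "\<lambda>x. x\<^sup>2"] if_distrib[of "\<lambda>x. _ * x"] cong: if_cong)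
    finally show "d $ i > 0" .
  qed
next
  assume d: "\<forall>i. d $ i > 0"
  show "positive_definite (transpose H ** diag d ** H)"
    unfolding positive_definite_def
  proof (intro conjI allI impI)
    show "transpose (transpose H ** diag d ** H) = transpose H ** diag d ** H" by (rule transpose_conj_diag)
    fix x :: "real^'n" assume x: "x \<noteq> 0"
    have "H *v x \<noteq> 0"
      using H x by (metis matrix_vector_mul_assoc matrix_vector_mul_lid matrix_vector_mult_0_right orthogonal_matrix)
    then obtain i where "(H *v x) $ i \<noteq> 0" by (auto simp: vec_eq_iff)
    then have "(\<Sum>i\<in>UNIV. d $ i * ((H *v x) $ i)\<^sup>2) > 0"
      using d by (intro sum_pos2[of _ i]) (auto simp: less_imp_le)
    then show "x \<bullet> ((transpose H ** diag d ** H) *v x) > 0" by (simp add: conj_quadratic)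
  qed
qed

lemma positive_definite_diagonalise:
  fixes V :: "'k::{finite,linorder} matrix"
  assumes "positive_definite V"
  obtains H d where "orthogonal_matrix H" "\<And>i j. i < j \<Longrightarrow> d $ j \<le> d $ i" "\<And>i. d $ i > 0"
    "V = transpose H ** diag d ** H"
proof -
  have "transpose V = V" using assms by (simp add: positive_definite_def)
  then obtain H d where *: "orthogonal_matrix H" "\<And>i j. i < j \<Longrightarrow> d $ j \<le> d $ i" "V = transpose H ** diag d ** H"
    by (rule symmetric_diagonalise) blast
  moreover have "\<And>i. d $ i > 0" using assms * positive_definite_conj_iff by metis
  ultimately show ?thesis using that by blast
qed

text \<open>\<open>matrix_inv\<close> is defined by choice among two-sided inverses, so uniqueness
  of the inverse has to pin it down before it can be computed.\<close>

lemma matrix_inv_eqI: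
  assumes "A ** B = mat 1"
  shows "matrix_inv (A :: real^'n^'n) = B"
proof -
  have BA: "B ** A = mat 1" using assms matrix_left_right_inverse by blast
  have "A ** matrix_inv A = mat 1 \<and> matrix_inv A ** A = mat 1"
    unfolding matrix_inv_def by (rule someI[of _ B]) (simp add: assms BA)
  then show ?thesis by (metis BA matrix_mul_assoc matrix_mul_lid matrix_mul_rid)
qed

lemma conj_mult_conj:
  assumes "orthogonal_matrix (H :: real^'n^'n)"
  shows "(transpose H ** A ** H) ** (transpose H ** B ** H) = transpose H ** (A ** B) ** H"
proof -
  have "(transpose H ** A ** H) ** (transpose H ** B ** H) = transpose H ** A ** (H ** transpose H) ** B ** H"
    by (simp only: matrix_mul_assoc)
  also have "H ** transpose H = mat 1" using assms by (simp add: orthogonal_matrix_def)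
  finally show ?thesis by (simp add: matrix_mul_assoc)
qed

lemma matrix_inv_conj:
  assumes H: "orthogonal_matrix (H :: real^'n^'n)" and d: "\<And>i. d $ i \<noteq> 0"
  shows "matrix_inv (transpose H ** diag d ** H) = transpose H ** diag (\<chi> i. 1 / d $ i) ** H"
proof (rule matrix_inv_eqI)
  have "diag (\<chi> i. 1) = (mat 1 :: real^'n^'n)" by (simp add: vec_eq_iff diag_def mat_def)
  then show "(transpose H ** diag d ** H) ** (transpose H ** diag (\<chi> i. 1 / d $ i) ** H) = mat 1"
    using H d by (simp add: conj_mult_conj diag_mult_diag orthogonal_matrix)
qed

lemma matrix_inv_mat_1: "matrix_inv (mat 1 :: real^'n^'n) = mat 1"
  by (rule matrix_inv_eqI) simp

section \<open>Eigenvalues under Lebesgue measure on symmetric matrices\<close>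

text \<open>Making the pairs i <= j a type lets symmetric matrices be coordinatised by a Euclidean
  vector. The k eigenvalues and the k(k - 1)/2 parameters of a rotation fill a vector of the same
  type, so the spectral parametrisation has a square Jacobian matrix.\<close>

typedef (overloaded) ('k::"{finite,linorder}") tri_ix = "{(i :: 'k, j). i \<le> j}"
  morphisms tri_pair tri by auto

instance tri_ix :: ("{finite,linorder}") finite
proof
  have "inj (tri_pair :: 'a tri_ix \<Rightarrow> 'a \<times> 'a)"
    by (simp add: inj_def tri_pair_inject)
  then show "finite (UNIV :: 'a tri_ix set)"
    by (rule finite_imageD[rotated]) simp
qed

type_synonym 'k sym_coords = "(real, 'k tri_ix enum_ix) vec"

definition tri_entry :: "'k::{finite,linorder} tri_ix enum_ix \<Rightarrow> 'k \<times> 'k" where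
  "tri_entry n = tri_pair (of_enum_ix n)"

definition tri_index :: "'k::{finite,linorder} \<Rightarrow> 'k \<Rightarrow> 'k tri_ix enum_ix" where
  "tri_index i j = to_enum_ix (tri (i, j))"

lemma tri_entry_tri_index: "i \<le> j \<Longrightarrow> tri_entry (tri_index i j) = (i, j)"
  by (simp add: tri_entry_def tri_index_def to_enum_ix_inverse tri_inverse)

lemma tri_index_tri_entry: "tri_index (fst (tri_entry n)) (snd (tri_entry n)) = n"
  by (simp add: tri_entry_def tri_index_def of_enum_ix_inverse tri_pair_inverse)

lemma tri_entry_le: "fst (tri_entry n) \<le> snd (tri_entry n)"
  using tri_pair[of "of_enum_ix n"] by (auto simp: tri_entry_def)

lemma bij_tri_entry: "bij_betw tri_entry UNIV {(i :: 'k::{finite,linorder}, j). i \<le> j}"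
  by (rule bij_betwI[of _ _ _ "\<lambda>(i, j). tri_index i j"])
    (use tri_entry_le tri_index_tri_entry tri_entry_tri_index in \<open>auto simp: case_prod_unfold\<close>)

definition sym_of :: "'k::{finite,linorder} sym_coords \<Rightarrow> 'k matrix" where
  "sym_of X = (\<chi> i j. X $ tri_index (min i j) (max i j))"

definition coords :: "'k::{finite,linorder} matrix \<Rightarrow> 'k sym_coords" where
  "coords V = (\<chi> n. V $ fst (tri_entry n) $ snd (tri_entry n))"

text \<open>One coordinate vector is read in two ways: \<open>sym_of\<close> makes it a symmetric
  matrix, while \<open>skew_of\<close> and \<open>diag_of\<close> split it into the generator of a
  rotation and a list of eigenvalues.\<close>

definition skew_of :: "'k::{finite,linorder} sym_coords \<Rightarrow> 'k matrix" where
  "skew_of X = (\<chi> i j. if i < j then X $ tri_index i j else if j < i then - X $ tri_index j i else 0)"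

definition diag_of :: "'k::{finite,linorder} sym_coords \<Rightarrow> 'k vector" where
  "diag_of X = (\<chi> i. X $ tri_index i i)"

lemma sym_of_coords: "transpose V = V \<Longrightarrow> sym_of (coords V) = V"
  by (auto simp: sym_of_def coords_def vec_eq_iff tri_entry_tri_index min_def max_def transpose_def)

lemma coords_sym_of: "coords (sym_of X) = X"
  by (simp add: sym_of_def coords_def vec_eq_iff tri_index_tri_entry min_absorb1[OF tri_entry_le] max_absorb2[OF tri_entry_le])

lemma transpose_sym_of: "transpose (sym_of X) = sym_of X"
  by (simp add: sym_of_def transpose_def min.commute max.commute)

lemma transpose_skew_of: "transpose (skew_of X) = - skew_of X"
  by (auto simp: skew_of_def transpose_def vec_eq_iff)

lemma linear_sym_of: "linear sym_of"
  by (rule linearI) (simp_all add: sym_of_def vec_eq_iff)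

lemma linear_coords: "linear coords"
  by (rule linearI) (simp_all add: coords_def vec_eq_iff)

lemma linear_skew_of: "linear skew_of"
  by (rule linearI) (simp_all add: skew_of_def vec_eq_iff)

lemma linear_diag_of: "linear diag_of"
  by (rule linearI) (simp_all add: diag_of_def vec_eq_iff)

lemma linear_diag: "linear diag"
  by (auto intro!: linearI simp: diag_def vec_eq_iff)

text \<open>Separates the eigenvalue coordinates from the rotation coordinates.\<close>

lemma prod_sym_coords:
  fixes h :: "'k::{finite,linorder} \<times> 'k \<Rightarrow> 'a::comm_monoid_mult"
  shows "(\<Prod>n\<in>UNIV. h (tri_entry n)) = (\<Prod>i\<in>UNIV. h (i, i)) * (\<Prod>(i, j) | i < j. h (i, j))"
proof -
  have "(\<Prod>n\<in>UNIV. h (tri_entry n)) = (\<Prod>p\<in>{(i, j). i \<le> j}. h p)"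
    by (rule prod.reindex_bij_betw[OF bij_tri_entry])
  also have "{(i :: 'k, j). i \<le> j} = (\<lambda>i. (i, i)) ` UNIV \<union> {(i, j). i < j}"
    by auto
  also have "(\<Prod>p\<in>\<dots>. h p) = (\<Prod>p\<in>(\<lambda>i. (i, i)) ` UNIV. h p) * (\<Prod>p\<in>{(i, j). i < j}. h p)"
    by (rule prod.union_disjoint) auto
  also have "(\<Prod>p\<in>(\<lambda>i. (i, i)) ` UNIV. h p) = (\<Prod>i\<in>UNIV. h (i, i))"
    by (subst prod.reindex) (auto simp: inj_on_def)
  finally show ?thesis by (simp add: case_prod_unfold)
qed

lemma sym_of_measurable [measurable]: "sym_of \<in> borel_measurable borel"
  by (intro borel_measurable_continuous_onI linear_continuous_on)
    (simp add: linear_sym_of linear_linear)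

lemma sym_lborel_eq: "(sym_lborel :: 'k::{finite,linorder} matrix measure) = distr lborel borel sym_of"
proof -
  let ?I = "{(i :: 'k, j). i \<le> j}"
  have m: "(\<lambda>v. \<chi> n. v (tri_entry n)) \<in> PiM ?I (\<lambda>_. lborel) \<rightarrow>\<^sub>M (borel :: 'k sym_coords measure)"
  proof (rule measurable_vec_lambda)
    fix n :: "'k tri_ix enum_ix"
    have "tri_entry n \<in> ?I" using tri_entry_le[of n] by (simp add: case_prod_unfold)
    then have "(\<lambda>v. v (tri_entry n)) \<in> PiM ?I (\<lambda>_. lborel) \<rightarrow>\<^sub>M (lborel :: real measure)"
      by (rule measurable_component_singleton)
    then show "(\<lambda>v. v (tri_entry n)) \<in> borel_measurable (PiM ?I (\<lambda>_. lborel :: real measure))" by simp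
  qed
  have "distr lborel borel sym_of = distr (PiM ?I (\<lambda>_. lborel)) borel (sym_of \<circ> (\<lambda>v. \<chi> n. v (tri_entry n)))"
    by (subst lborel_vec_reindex[OF bij_tri_entry]) (simp_all add: distr_distr m)
  also have "sym_of \<circ> (\<lambda>v. \<chi> n. v (tri_entry n)) = sym_matrix"
    by (auto simp: fun_eq_iff sym_of_def sym_matrix_def vec_eq_iff tri_entry_tri_index min_def max_def)
  finally show ?thesis by (simp add: sym_lborel_def)
qed

lemma nn_integral_sym_lborel:
  "f \<in> borel_measurable borel \<Longrightarrow> (\<integral>\<^sup>+V. f V \<partial>sym_lborel) = (\<integral>\<^sup>+X. f (sym_of X) \<partial>lborel)"
  by (simp add: sym_lborel_eq nn_integral_distr)

section \<open>The Cayley transform of skew-symmetric matrices\<close>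

lemma norm_matrix_vector_mult_le: "norm (A *v w) \<le> norm (A :: real^'n^'m) * norm w"
proof -
  have "norm (A *v w) = L2_set (\<lambda>i. A $ i \<bullet> w) UNIV"
    by (simp add: norm_vec_def L2_set_def matrix_vector_mult_def inner_vec_def)
  also have "\<dots> \<le> L2_set (\<lambda>i. norm (A $ i) * norm w) UNIV"
    unfolding L2_set_def
    by (intro real_sqrt_le_mono sum_mono) (metis Cauchy_Schwarz_ineq2 abs_ge_zero power2_abs power_mono)
  also have "\<dots> = norm A * norm w"
    by (simp add: L2_set_right_distrib[symmetric] norm_vec_def L2_set_left_distrib[symmetric])
  finally show ?thesis .
qed

lemma norm_le_card_of_entries:
  assumes "\<And>i j. \<bar>A $ i $ j\<bar> \<le> 1"
  shows "norm (A :: real^'n^'m) \<le> real CARD('m) * real CARD('n)"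
proof -
  have "norm (A $ i) \<le> real CARD('n)" for i
    using norm_le_l1_cart[of "A $ i"] sum_mono[of UNIV "\<lambda>j. \<bar>A $ i $ j\<bar>" "\<lambda>_. 1"] assms by force
  then have "(\<Sum>i\<in>UNIV. \<bar>norm (A $ i)\<bar>) \<le> (\<Sum>i\<in>(UNIV :: 'm set). real CARD('n))"
    by (intro sum_mono) simp
  then show ?thesis
    using L2_set_le_sum_abs[of "\<lambda>i. norm (A $ i)" UNIV] by (simp add: norm_vec_def)
qed

text \<open>A matrix that never shrinks a vector is injective, hence invertible, and its inverse
  never expands one; basis vectors then bound the entries of the inverse. The bound is the same for
  all such matrices, which later makes the Jacobian factors uniformly bounded.\<close>

lemma invertible_of_norm_ge:
  fixes B :: "real^'n^'n"
  assumes "\<And>v. norm v \<le> norm (B *v v)"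
  shows "B ** matrix_inv B = mat 1" "matrix_inv B ** B = mat 1"
    "\<bar>matrix_inv B $ i $ j\<bar> \<le> 1"
proof -
  have "v = 0" if "B *v v = 0" for v using assms[of v] that by simp
  then obtain C where C: "C ** B = mat 1"
    by (metis matrix_left_invertible_ker)
  then have BC: "B ** C = mat 1" by (simp add: matrix_left_right_inverse)
  have inv: "matrix_inv B = C" by (rule matrix_inv_eqI[OF BC])
  show "B ** matrix_inv B = mat 1" "matrix_inv B ** B = mat 1" by (simp_all add: inv C BC)
  have "\<bar>C $ i $ j\<bar> = \<bar>(C *v axis j 1) $ i\<bar>"
    by (simp add: matrix_vector_mult_basis column_def)
  also have "\<dots> \<le> norm (C *v axis j 1)" by (rule component_le_norm_cart)
  also have "\<dots> \<le> norm (B *v (C *v axis j 1))" by (rule assms)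
  also have "\<dots> = 1" by (simp add: matrix_vector_mul_assoc BC)
  finally show "\<bar>matrix_inv B $ i $ j\<bar> \<le> 1" by (simp add: inv)
qed

text \<open>A skew matrix has v \<bullet> Av = 0, so Pythagoras applies to v + Av.\<close>

lemma skew_norm_ge:
  fixes A :: "real^'n^'n"
  assumes A: "transpose A = - A"
  shows "norm v \<le> norm ((mat 1 + A) *v v)"
proof -
  have "v \<bullet> (A *v v) = (transpose A *v v) \<bullet> v" by (simp add: dot_lmul_matrix)
  also have "transpose A *v v = - (A *v v)"
    unfolding A by (simp add: matrix_vector_mult_def vec_eq_iff sum_negf)
  also have "- (A *v v) \<bullet> v = - (v \<bullet> (A *v v))" by (simp add: inner_commute)
  finally have "v \<bullet> (A *v v) = 0" by simp
  then have "(norm ((mat 1 + A) *v v))\<^sup>2 = (norm v)\<^sup>2 + (norm (A *v v))\<^sup>2"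
    by (simp add: power2_norm_eq_inner matrix_vector_mult_add_rdistrib inner_simps inner_commute)
  then have "(norm v)\<^sup>2 \<le> (norm ((mat 1 + A) *v v))\<^sup>2" by simp
  then show ?thesis by (rule power2_le_imp_le) simp
qed

definition cayley_inv :: "'k::{finite,linorder} sym_coords \<Rightarrow> 'k matrix" where
  "cayley_inv X = matrix_inv (mat 1 + skew_of X)"

lemmas cayley_inv = invertible_of_norm_ge[OF skew_norm_ge[OF transpose_skew_of], folded cayley_inv_def]

lemma transpose_inverse_unique:
  assumes "A ** B = mat 1" "transpose A ** C = mat 1"
  shows "transpose B = (C :: real^'n^'n)"
proof -
  have "transpose B ** transpose A = mat 1" using assms(1) by (metis matrix_transpose_mul transpose_mat)
  then have "transpose B = transpose B ** (transpose A ** C)" by (simp add: assms(2))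
  also have "\<dots> = C" using \<open>transpose B ** transpose A = mat 1\<close> by (simp add: matrix_mul_assoc)
  finally show ?thesis .
qed

text \<open>With M = (I + A)^(-1) and A skew, transposing gives M^T = (I - A)^(-1), hence 2 M^T - I
  = (I + A) M^T. Both the orthogonality of the Cayley transform and the form of its derivative come
  from this identity.\<close>

lemma cayley_inv_transpose:
  "cayley_inv X ** (2 *\<^sub>R transpose (cayley_inv X) - mat 1) = transpose (cayley_inv X)"
proof -
  let ?M = "cayley_inv X" and ?A = "skew_of X"
  have "transpose (mat 1 + ?A) = transpose (mat 1) + transpose ?A" by (simp add: vec_eq_iff transpose_def)
  also have "\<dots> = mat 1 - ?A" by (simp add: transpose_skew_of transpose_mat)
  finally have "(mat 1 - ?A) ** transpose ?M = mat 1"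
    using arg_cong[OF cayley_inv(2)[of X], of transpose] by (simp add: matrix_transpose_mul transpose_mat)
  then have "transpose ?M - ?A ** transpose ?M = mat 1"
    by (simp add: matrix_mult.diff_left)
  then have "2 *\<^sub>R transpose ?M - mat 1 = (mat 1 + ?A) ** transpose ?M"
    by (simp add: matrix_add_rdistrib scaleR_2 algebra_simps)
  then show ?thesis by (simp add: matrix_mul_assoc cayley_inv)
qed

text \<open>2 (I + A)^(-1) - I equals (I - A)(I + A)^(-1), the Cayley transform; the right factor
  \<open>P\<close> moves the chart to a neighbourhood of \<open>P\<close>.\<close>

definition cayley :: "'k::{finite,linorder} matrix \<Rightarrow> 'k sym_coords \<Rightarrow> 'k matrix" where
  "cayley P X = (2 *\<^sub>R cayley_inv X - mat 1) ** P"

lemma bounded_linear_diff_transpose: "transpose (A - B) = transpose A - transpose (B :: real^'n^'m)"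
  by (simp add: vec_eq_iff transpose_def)

lemma transpose_scaleR: "transpose (c *\<^sub>R A) = c *\<^sub>R transpose (A :: real^'n^'m)"
  by (simp add: vec_eq_iff transpose_def)

lemma orthogonal_cayley:
  assumes "orthogonal_matrix P"
  shows "orthogonal_matrix (cayley P X)"
proof -
  let ?K = "2 *\<^sub>R cayley_inv X - mat 1"
  have "?K ** transpose ?K = 2 *\<^sub>R (cayley_inv X ** transpose ?K) - transpose ?K"
    by (simp add: matrix_mult.diff_left matrix_mult.scaleR_left)
  also have "transpose ?K = 2 *\<^sub>R transpose (cayley_inv X) - mat 1"
    by (simp add: bounded_linear_diff_transpose transpose_scaleR transpose_mat)
  finally have "?K ** transpose ?K = mat 1"
    by (simp add: cayley_inv_transpose bounded_linear_diff_transpose transpose_scaleR transpose_mat)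
  then have "orthogonal_matrix ?K"
    using matrix_left_right_inverse[of ?K "transpose ?K"] by (simp add: orthogonal_matrix)
  then show ?thesis unfolding cayley_def by (rule orthogonal_matrix_mul) (rule assms)
qed

text \<open>The resolvent identity M(Y) - M(X) = - M(Y) S M(X), with S =
  \<open>skew_of (Y - X)\<close>, is used twice: once for the linear part, and once more to exhibit
  a remainder that contains S twice. Since the entries of M are bounded uniformly, the remainder is
  quadratic.\<close>

lemma has_derivative_cayley_inv:
  "(cayley_inv has_derivative (\<lambda>h. - (cayley_inv X ** skew_of h ** cayley_inv X))) (at X)"
  (is "(_ has_derivative ?D) _") for X :: "'k::{finite,linorder} sym_coords"
proof -
  let ?M = "cayley_inv :: 'k sym_coords \<Rightarrow> 'k matrix"
  obtain K where K: "K > 0" "\<And>(a :: 'k matrix) (b :: 'k matrix). norm (a ** b) \<le> norm a * norm b * K"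
    using bounded_bilinear.pos_bounded[OF bounded_bilinear_matrix_mult] by blast
  have bls: "bounded_linear (skew_of :: 'k sym_coords \<Rightarrow> _)"
    by (simp add: linear_skew_of linear_linear)
  obtain L where L: "L > 0" "\<And>h. norm (skew_of h :: 'k matrix) \<le> norm h * L"
    using bounded_linear.pos_bounded[OF bls] by blast
  let ?c = "real CARD('k) * real CARD('k)"
  have M: "norm (?M Y) \<le> ?c" for Y
    by (rule norm_le_card_of_entries) (rule cayley_inv)
  have diff: "?M Y - ?M X = - (?M Y ** skew_of (Y - X) ** ?M X)" for Y
  proof -
    have "skew_of (Y - X) = (mat 1 + skew_of Y) - (mat 1 + skew_of X)"
      by (simp add: linear_diff[OF linear_skew_of])
    then have "?M Y ** skew_of (Y - X) ** ?M X
        = (?M Y ** (mat 1 + skew_of Y)) ** ?M X - ?M Y ** ((mat 1 + skew_of X) ** ?M X)"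
      by (simp only: matrix_mult.diff_left matrix_mult.diff_right matrix_mul_assoc)
    then show ?thesis by (simp add: cayley_inv)
  qed
  have rem: "?M Y - ?M X - ?D (Y - X) = ?M Y ** skew_of (Y - X) ** ?M X ** skew_of (Y - X) ** ?M X" for Y
  proof -
    have "?M Y - ?M X - ?D (Y - X) = - ((?M Y - ?M X) ** skew_of (Y - X) ** ?M X)"
      by (subst diff) (simp add: matrix_mult.diff_left)
    also have "\<dots> = ?M Y ** skew_of (Y - X) ** ?M X ** skew_of (Y - X) ** ?M X"
      by (subst diff) (simp add: matrix_mult.minus_left)
    finally show ?thesis .
  qed
  let ?C = "?c * (L * (?c * (L * (?c * K) * K) * K) * K)"
  have bound: "norm (?M Y - ?M X - ?D (Y - X)) \<le> ?C * norm (Y - X) * norm (Y - X)" for Y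
  proof -
    let ?S = "skew_of (Y - X) :: 'k matrix" and ?n = "norm (Y - X)"
    have mul: "norm (a ** b) \<le> x * y * K" if "norm a \<le> x" "norm b \<le> y" for a b :: "'k matrix" and x y
    proof -
      have "norm a * norm b \<le> x * y"
        using that by (intro mult_mono) (auto intro: order_trans[OF norm_ge_zero])
      then show ?thesis using K(2)[of a b] K(1) by (meson mult_right_mono less_imp_le order_trans)
    qed
    have "norm (?M Y ** ?S ** ?M X ** ?S ** ?M X) \<le> (((?c * (?n * L) * K) * ?c * K) * (?n * L) * K) * ?c * K"
      by (intro mul M L)
    then show ?thesis unfolding rem by (simp add: algebra_simps)
  qed
  show ?thesis
  proof (rule has_derivativeI_sandwich[where e = 1 and H = "\<lambda>Y. ?C * norm (Y - X)"])
    show "bounded_linear ?D"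
      by (intro bounded_linear_minus bounded_linear_compose[OF matrix_mult.bounded_linear_left]
          bounded_linear_compose[OF matrix_mult.bounded_linear_right] bls)
    show "norm (?M Y - ?M X - ?D (Y - X)) / norm (Y - X) \<le> ?C * norm (Y - X)" if "Y \<noteq> X" for Y
      using bound[of Y] that by (simp add: divide_le_eq)
    have "((\<lambda>Y. ?C * norm (Y - X)) \<longlongrightarrow> ?C * norm (X - X)) (at X)"
      by (intro tendsto_intros)
    then show "((\<lambda>Y. ?C * norm (Y - X)) \<longlongrightarrow> 0) (at X)" by simp
  qed simp
qed

section \<open>Derivative of the spectral parametrisation\<close>

definition spectral_param :: "'k::{finite,linorder} matrix \<Rightarrow> 'k sym_coords \<Rightarrow> 'k sym_coords" where
  "spectral_param P X = coords (transpose (cayley P X) ** diag (diag_of X) ** cayley P X)"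

text \<open>The angular velocity of the rotation \<open>cayley P X\<close> when X moves in direction
  h; it acts from the left and is independent of P.\<close>

definition rot_rate :: "'k::{finite,linorder} sym_coords \<Rightarrow> 'k sym_coords \<Rightarrow> 'k matrix" where
  "rot_rate X h = - 2 *\<^sub>R (cayley_inv X ** skew_of h ** transpose (cayley_inv X))"

text \<open>Eigenvalue increments on the diagonal and angular velocity above it, packed into one
  vector so that the derivative becomes \<open>jac_in\<close>, a diagonal matrix of gaps and
  \<open>jac_out\<close> in succession.\<close>

definition jac_in :: "'k::{finite,linorder} sym_coords \<Rightarrow> 'k sym_coords \<Rightarrow> 'k sym_coords" where
  "jac_in X h = (\<chi> n. case tri_entry n of (i, j) \<Rightarrow> if i = j then h $ n else rot_rate X h $ i $ j)"

definition gap :: "'k::{finite,linorder} sym_coords \<Rightarrow> 'k \<times> 'k \<Rightarrow> real" where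
  "gap X = (\<lambda>(i, j). if i = j then 1 else diag_of X $ i - diag_of X $ j)"

definition jac_out :: "'k::{finite,linorder} matrix \<Rightarrow> 'k sym_coords \<Rightarrow> 'k sym_coords \<Rightarrow> 'k sym_coords" where
  "jac_out P X z = coords (transpose (cayley P X) ** sym_of z ** cayley P X)"

lemma sym_of_spectral_param: "sym_of (spectral_param P X) = transpose (cayley P X) ** diag (diag_of X) ** cayley P X"
  unfolding spectral_param_def by (rule sym_of_coords) (rule transpose_conj_diag)

lemma transpose_rot_rate: "transpose (rot_rate X h) = - rot_rate X h"
  unfolding rot_rate_def transpose_scaleR
  by (simp add: matrix_transpose_mul transpose_skew_of matrix_mul_assoc
      matrix_mult.minus_left matrix_mult.minus_right)

text \<open>Differentiating the inverse gives - 2 M S M P. Since M^T (2M - I) = M, this is the skew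
  matrix - 2 M S M^T times the Cayley transform.\<close>

lemma has_derivative_cayley:
  assumes P: "orthogonal_matrix P"
  shows "(cayley P has_derivative (\<lambda>h. rot_rate X h ** cayley P X)) (at X)"
proof -
  let ?M = "cayley_inv X" and ?K = "2 *\<^sub>R cayley_inv X - mat 1"
  have "(cayley P has_derivative (\<lambda>h. (2 *\<^sub>R (- (?M ** skew_of h ** ?M)) - 0) ** P)) (at X)"
    unfolding cayley_def[abs_def]
    by (intro bounded_linear.has_derivative[OF matrix_mult.bounded_linear_left] has_derivative_diff
        has_derivative_scaleR_right has_derivative_cayley_inv has_derivative_const)
  moreover have "(2 *\<^sub>R (- (?M ** skew_of h ** ?M)) - 0) ** P = rot_rate X h ** cayley P X" for h
  proof -
    have K: "transpose ?K = 2 *\<^sub>R transpose ?M - mat 1"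
      by (simp add: bounded_linear_diff_transpose transpose_scaleR transpose_mat)
    have "orthogonal_matrix ?K"
      using orthogonal_cayley[of "mat 1" X] by (simp add: cayley_def orthogonal_matrix_id)
    then have "transpose ?M ** ?K = ?M ** (transpose ?K ** ?K)"
      using cayley_inv_transpose[of X] by (simp add: K matrix_mul_assoc)
    also have "\<dots> = ?M" using \<open>orthogonal_matrix ?K\<close> by (simp add: orthogonal_matrix)
    finally have "rot_rate X h ** ?K = - 2 *\<^sub>R (?M ** skew_of h ** ?M)"
      by (simp add: rot_rate_def matrix_mult.scaleR_left matrix_mult.minus_left matrix_mul_assoc[symmetric])
    then show ?thesis by (simp add: cayley_def matrix_mul_assoc)
  qed
  ultimately show ?thesis by simp
qed

text \<open>The derivative of K^T D K is K^T (dD + DO - OD) K with O the skew angular velocity. The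
  commutator has entries (d_i - d_j) O_ij and vanishes on the diagonal, so the gaps multiply the
  rotation coordinates and leave the eigenvalue coordinates alone.\<close>

lemma has_derivative_spectral_param:
  assumes P: "orthogonal_matrix (P :: 'k::{finite,linorder} matrix)"
  shows "(spectral_param P has_derivative jac_out P X \<circ> (\<lambda>y. \<chi> n. gap X (tri_entry n) * y $ n) \<circ> jac_in X) (at X)"
proof -
  let ?K = "cayley P X" and ?O = "rot_rate X" and ?D = "diag (diag_of X)"
  have bl: "bounded_linear (\<lambda>X :: 'k sym_coords. diag (diag_of X))"
    using linear_compose[OF linear_diag_of linear_diag] by (simp add: linear_linear o_def)
  have dD: "((\<lambda>X :: 'k sym_coords. diag (diag_of X)) has_derivative (\<lambda>h. diag (diag_of h))) (at X)"
    using bl by (rule bounded_linear_imp_has_derivative)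
  note dK = has_derivative_cayley[OF P, of X]
  have "((\<lambda>X. transpose (cayley P X) ** diag (diag_of X) ** cayley P X) has_derivative
     (\<lambda>h. (transpose ?K ** ?D) ** (?O h ** ?K) + (transpose ?K ** diag (diag_of h) + transpose (?O h ** ?K) ** ?D) ** ?K)) (at X)"
    by (intro matrix_mult.FDERIV bounded_linear.has_derivative[OF bounded_linear_transpose] dK dD)
  moreover have "(transpose ?K ** ?D) ** (?O h ** ?K) + (transpose ?K ** diag (diag_of h) + transpose (?O h ** ?K) ** ?D) ** ?K
      = transpose ?K ** sym_of ((\<chi> n. gap X (tri_entry n) * jac_in X h $ n)) ** ?K" for h
  proof -
    have "(transpose ?K ** ?D) ** (?O h ** ?K) + (transpose ?K ** diag (diag_of h) + transpose (?O h ** ?K) ** ?D) ** ?K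
      = transpose ?K ** (diag (diag_of h) + (?D ** ?O h - ?O h ** ?D)) ** ?K"
      by (simp add: matrix_transpose_mul transpose_rot_rate matrix_mult.minus_left matrix_mult.minus_right
          matrix_add_ldistrib matrix_add_rdistrib matrix_mult.diff_left matrix_mult.diff_right matrix_mul_assoc)
    also have "diag (diag_of h) + (?D ** ?O h - ?O h ** ?D) = sym_of ((\<chi> n. gap X (tri_entry n) * jac_in X h $ n))"
    proof -
      have skew: "?O h $ j $ i = - ?O h $ i $ j" for i j
        using arg_cong[OF transpose_rot_rate[of X h], of "\<lambda>A. A $ i $ j"] by (simp add: transpose_def)
      have c: "(?D ** ?O h - ?O h ** ?D) $ i $ j = (diag_of X $ i - diag_of X $ j) * ?O h $ i $ j" for i j
        by (simp add: diag_def matrix_matrix_mult_def if_distrib[of "\<lambda>x. x * _"] if_distrib[of "\<lambda>x. _ * x"]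
            algebra_simps cong: if_cong)
      have "(diag (diag_of h) + (?D ** ?O h - ?O h ** ?D)) $ i $ j
          = sym_of ((\<chi> n. gap X (tri_entry n) * jac_in X h $ n)) $ i $ j" for i j
      proof (cases i j rule: linorder_cases)
        case less
        then show ?thesis
          unfolding vector_add_component c by (simp add: less_imp_neq diag_def sym_of_def tri_entry_tri_index gap_def jac_in_def)
      next
        case equal
        then show ?thesis
          unfolding vector_add_component c by (simp add: diag_def sym_of_def tri_entry_tri_index gap_def jac_in_def diag_of_def)
      next
        case greater
        then show ?thesis
          unfolding vector_add_component c using skew[of j i]
          by (simp add: less_imp_neq less_imp_neq[THEN not_sym] diag_def sym_of_def tri_entry_tri_index gap_def jac_in_def min_def max_def algebra_simps)
      qed
      then show ?thesis by (simp only: vec_eq_iff) blast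
    qed
    finally show ?thesis .
  qed
  ultimately have "((\<lambda>X. transpose (cayley P X) ** diag (diag_of X) ** cayley P X) has_derivative
     (\<lambda>h. transpose ?K ** sym_of ((\<chi> n. gap X (tri_entry n) * jac_in X h $ n)) ** ?K)) (at X)"
    by simp
  then show ?thesis
    unfolding spectral_param_def[abs_def] jac_out_def[abs_def] o_def
    by (intro bounded_linear.has_derivative[of coords]) (simp add: linear_coords linear_linear)
qed

lemma linear_rot_rate: "linear (rot_rate X)"
  unfolding rot_rate_def
  by (intro linearI) (simp_all add: linear_add[OF linear_skew_of] linear_cmul[OF linear_skew_of]
      matrix_add_ldistrib matrix_add_rdistrib matrix_mult.scaleR_left matrix_mult.scaleR_right scaleR_add_right)

lemma linear_jac_in: "linear (jac_in X)"
  by (intro linearI) (auto simp: jac_in_def vec_eq_iff linear_add[OF linear_rot_rate] linear_cmul[OF linear_rot_rate]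
      split: prod.split)

lemma linear_jac_out: "linear (jac_out P X)"
  by (intro linearI) (simp_all add: jac_out_def linear_add[OF linear_sym_of] linear_cmul[OF linear_sym_of]
     linear_add[OF linear_coords] linear_cmul[OF linear_coords]
     matrix_add_ldistrib matrix_add_rdistrib matrix_mult.scaleR_left matrix_mult.scaleR_right)

section \<open>Uniform bounds on the Jacobian factors\<close>

text \<open>The Leibniz expansion, estimated term by term; boundedness is all that the outer
  Jacobian factors have to provide.\<close>

lemma abs_det_le:
  fixes A :: "real^'n^'n"
  assumes "\<And>i j. \<bar>A $ i $ j\<bar> \<le> B"
  shows "\<bar>det A\<bar> \<le> fact CARD('n) * B ^ CARD('n)"
proof -
  have "\<bar>det A\<bar> \<le> (\<Sum>p | p permutes (UNIV :: 'n set). \<bar>of_int (sign p) * (\<Prod>i\<in>UNIV. A $ i $ p i)\<bar>)"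
    unfolding det_def by (rule sum_abs)
  also have "\<dots> \<le> (\<Sum>p | p permutes (UNIV :: 'n set). B ^ CARD('n))"
  proof (rule sum_mono)
    fix p assume "p \<in> {p. p permutes (UNIV :: 'n set)}"
    have "\<bar>of_int (sign p) * (\<Prod>i\<in>UNIV. A $ i $ p i)\<bar> = (\<Prod>i\<in>UNIV. \<bar>A $ i $ p i\<bar>)"
      by (simp add: abs_mult abs_prod sign_def)
    also have "\<dots> \<le> (\<Prod>i\<in>(UNIV :: 'n set). B)" by (rule prod_mono) (simp add: assms)
    finally show "\<bar>of_int (sign p) * (\<Prod>i\<in>UNIV. A $ i $ p i)\<bar> \<le> B ^ CARD('n)" by simp
  qed
  also have "\<dots> = fact CARD('n) * B ^ CARD('n)"
    by (simp add: card_permutations)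
  finally show ?thesis .
qed

lemma abs_sandwich_entry_le:
  fixes A B C :: "real^'n^'n"
  assumes "\<And>i j. \<bar>A $ i $ j\<bar> \<le> 1" "\<And>i j. \<bar>B $ i $ j\<bar> \<le> 1" "\<And>i j. \<bar>C $ i $ j\<bar> \<le> 1"
  shows "\<bar>(A ** B ** C) $ i $ j\<bar> \<le> real CARD('n) * real CARD('n)"
proof -
  have "(A ** B ** C) $ i $ j = (\<Sum>b\<in>UNIV. \<Sum>a\<in>UNIV. A $ i $ a * B $ a $ b * C $ b $ j)"
    by (simp add: matrix_matrix_mult_def sum_distrib_right)
  also have "\<bar>\<dots>\<bar> \<le> (\<Sum>b\<in>UNIV. \<Sum>a\<in>UNIV. \<bar>A $ i $ a * B $ a $ b * C $ b $ j\<bar>)"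
    by (intro order_trans[OF sum_abs] sum_mono sum_abs)
  also have "\<dots> \<le> (\<Sum>b\<in>(UNIV :: 'n set). \<Sum>a\<in>(UNIV :: 'n set). 1)"
  proof (intro sum_mono)
    fix a b
    have "\<bar>A $ i $ a\<bar> * \<bar>B $ a $ b\<bar> * \<bar>C $ b $ j\<bar> \<le> 1 * 1 * 1"
      by (intro mult_mono assms) auto
    then show "\<bar>A $ i $ a * B $ a $ b * C $ b $ j\<bar> \<le> 1" by (simp add: abs_mult)
  qed
  finally show ?thesis by simp
qed

lemma axis_entry_le: "\<bar>(axis m 1 :: real^'n) $ n\<bar> \<le> 1"
  by (simp add: axis_def)

text \<open>The entries of \<open>cayley_inv X\<close> lie in [-1, 1] for every X, so the angular
  velocity of a unit direction has one bound for the whole chart.\<close>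

lemma det_jac_in_le:
  "\<exists>C\<ge>0. \<forall>X :: 'k::{finite,linorder} sym_coords. \<bar>det (matrix (jac_in X))\<bar> \<le> C"
proof -
  let ?c = "2 * (real CARD('k) * real CARD('k))"
  have "\<bar>matrix (jac_in X) $ n $ m\<bar> \<le> ?c" for X :: "'k sym_coords" and n m
  proof -
    have sk: "\<bar>skew_of (axis m 1 :: 'k sym_coords) $ i $ j\<bar> \<le> 1" for i j
      using axis_entry_le[of m "tri_index i j"] axis_entry_le[of m "tri_index j i"]
      by (simp only: skew_of_def vec_lambda_beta) (auto simp del: vec_component)
    have "\<bar>rot_rate X (axis m 1) $ i $ j\<bar> \<le> ?c" for i j
      using abs_sandwich_entry_le[of "cayley_inv X" "skew_of (axis m 1)" "transpose (cayley_inv X)" i j] cayley_inv(3)[of X] sk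
      by (simp add: rot_rate_def abs_mult transpose_def)
    moreover have "1 \<le> ?c"
    proof -
      have "1 \<le> real CARD('k)" by (simp add: Suc_leI)
      then have "1 * 1 \<le> real CARD('k) * real CARD('k)" by (intro mult_mono) auto
      then show ?thesis by simp
    qed
    ultimately show ?thesis
      using axis_entry_le[of m n] by (auto simp: matrix_def jac_in_def split: prod.split)
  qed
  then have "\<bar>det (matrix (jac_in X))\<bar> \<le> fact CARD('k tri_ix enum_ix) * ?c ^ CARD('k tri_ix enum_ix)" for X :: "'k sym_coords"
    by (rule abs_det_le)
  then show ?thesis by (metis abs_ge_zero order_trans)
qed

lemma det_jac_out_le:
  "\<exists>C\<ge>0. \<forall>(X :: 'k::{finite,linorder} sym_coords) P. orthogonal_matrix P \<longrightarrow> \<bar>det (matrix (jac_out P X))\<bar> \<le> C"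
proof -
  let ?c = "real CARD('k) * real CARD('k)"
  have "\<bar>matrix (jac_out P X) $ n $ m\<bar> \<le> ?c" if P: "orthogonal_matrix P" for X :: "'k sym_coords" and P n m
  proof -
    have sy: "\<bar>sym_of (axis m 1 :: 'k sym_coords) $ i $ j\<bar> \<le> 1" for i j
      using axis_entry_le by (simp add: sym_of_def)
    have "\<bar>(transpose (cayley P X) ** sym_of (axis m 1) ** cayley P X) $ i $ j\<bar> \<le> ?c" for i j
      using orthogonal_matrix_entry_le[OF orthogonal_cayley[OF P]] sy
      by (intro abs_sandwich_entry_le) (auto simp: transpose_def)
    then show ?thesis by (simp add: matrix_def jac_out_def coords_def)
  qed
  then have "\<bar>det (matrix (jac_out P X))\<bar> \<le> fact CARD('k tri_ix enum_ix) * ?c ^ CARD('k tri_ix enum_ix)"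
    if "orthogonal_matrix P" for X :: "'k sym_coords" and P
    using that by (intro abs_det_le) blast
  then show ?thesis by (metis (no_types, lifting) abs_ge_zero order_trans orthogonal_matrix_id)
qed

text \<open>The middle factor is diagonal with the gaps as entries: its determinant is the
  Vandermonde product that also appears in \<open>prior_HD\<close>.\<close>

lemma abs_det_spectral_param:
  fixes X :: "'k::{finite,linorder} sym_coords"
  shows "\<bar>det (matrix (jac_out P X \<circ> (\<lambda>y. \<chi> n. gap X (tri_entry n) * y $ n) \<circ> jac_in X))\<bar>
    = \<bar>det (matrix (jac_out P X))\<bar> * \<bar>\<Prod>(i, j) | i < j. diag_of X $ i - diag_of X $ j\<bar> * \<bar>det (matrix (jac_in X))\<bar>"
proof -
  let ?G = "\<lambda>y :: 'k sym_coords. (\<chi> n. gap X (tri_entry n) * y $ n) :: 'k sym_coords"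
  have lG: "linear ?G" by (intro linearI) (auto simp: vec_eq_iff algebra_simps)
  have "det (matrix ?G) = (\<Prod>n\<in>UNIV. gap X (tri_entry n))"
    by (subst det_diagonal) (auto simp: matrix_def axis_def)
  also have "\<dots> = (\<Prod>(i, j) | i < j. diag_of X $ i - diag_of X $ j)"
    unfolding prod_sym_coords by (auto simp: gap_def intro!: prod.cong)
  finally have dG: "det (matrix ?G) = (\<Prod>(i, j) | i < j. diag_of X $ i - diag_of X $ j)" .
  have "matrix (jac_out P X \<circ> ?G \<circ> jac_in X) = matrix (jac_out P X) ** matrix ?G ** matrix (jac_in X)"
    by (simp add: matrix_compose linear_jac_in linear_jac_out lG linear_compose)
  then show ?thesis by (simp add: det_mul dG abs_mult)
qed

section \<open>Covering the positive definite matrices by finitely many charts\<close>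

text \<open>The bound 3 fits the entries of A = 2M - I when those of M lie in [-1, 1]; the
  eigenvalue coordinates stay unbounded.\<close>

definition param_box :: "'k::{finite,linorder} sym_coords set" where
  "param_box = {X. (\<forall>i j. i < j \<longrightarrow> \<bar>X $ tri_index i j\<bar> \<le> 3) \<and> (\<forall>i. diag_of X $ i > 0)}"

text \<open>The Cayley transform is its own inverse: for G = H P^T the generator is A = 2 (I +
  G)^(-1) - I. The inverse exists because |Gv - v| <= |v|, so that I + G = 2I + (G - I) does not
  shrink vectors.\<close>

lemma orthogonal_matrix_near_cayley:
  fixes H P :: "'k::{finite,linorder} matrix"
  assumes H: "orthogonal_matrix H" and P: "orthogonal_matrix P" and near: "norm (H - P) \<le> 1"
  obtains X where "diag_of X = d" "cayley P X = H" "\<And>i j. i < j \<Longrightarrow> \<bar>X $ tri_index i j\<bar> \<le> 3"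
proof -
  let ?G = "H ** transpose P"
  let ?M = "matrix_inv (mat 1 + ?G)"
  have GP: "?G ** P = H" using P by (simp add: matrix_mul_assoc[symmetric] orthogonal_matrix)
  have PT: "norm (transpose P *v v) = norm v" for v
    using P orthogonal_transformation_norm[of "(*v) (transpose P)" v]
    by (simp add: orthogonal_transformation_matrix del: transpose_matrix_vector)
  have G: "orthogonal_matrix ?G" using H P by (simp add: orthogonal_matrix_mul)
  have ge: "norm v \<le> norm ((mat 1 + ?G) *v v)" for v
  proof -
    have "(H - P) ** transpose P = ?G - mat 1"
      using P by (simp add: matrix_mult.diff_left orthogonal_matrix_def)
    then have "(H - P) *v (transpose P *v v) = ?G *v v - v"
      by (simp add: matrix_vector_mult_diff_rdistrib matrix_vector_mul_assoc del: transpose_matrix_vector)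
    then have "norm (?G *v v - v) \<le> norm (H - P) * norm (transpose P *v v)"
      by (metis norm_matrix_vector_mult_le)
    also have "\<dots> \<le> 1 * norm v" unfolding PT by (rule mult_right_mono[OF near]) simp
    finally have "norm (?G *v v - v) \<le> norm v" by simp
    moreover have "(mat 1 + ?G) *v v = 2 *\<^sub>R v + (?G *v v - v)"
      by (simp add: matrix_vector_mult_add_rdistrib scaleR_2)
    moreover have "norm (2 *\<^sub>R v) \<le> norm (2 *\<^sub>R v + (?G *v v - v)) + norm (?G *v v - v)"
      using norm_triangle_ineq4[of "2 *\<^sub>R v + (?G *v v - v)" "?G *v v - v"] by simp
    ultimately show ?thesis by simp
  qed
  note M = invertible_of_norm_ge[OF ge]
  define A where "A = 2 *\<^sub>R ?M - mat 1"
  \<comment> \<open>Orthogonality of G gives (I + G)^T = G^T (I + G); this leads to M + M^T = I,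
    which is the skewness of A.\<close>
  have "transpose ?M = ?G ** ?M"
  proof (rule transpose_inverse_unique[OF M(1)])
    have "transpose (mat 1 + ?G) = mat 1 + transpose ?G"
      by (simp add: vec_eq_iff transpose_def mat_def)
    then have "transpose (mat 1 + ?G) ** ?G = ?G + mat 1"
      using G by (simp add: matrix_add_rdistrib orthogonal_matrix)
    then have "transpose (mat 1 + ?G) ** (?G ** ?M) = (mat 1 + ?G) ** ?M"
      by (simp add: matrix_mul_assoc add.commute)
    then show "transpose (mat 1 + ?G) ** (?G ** ?M) = mat 1" by (simp add: M)
  qed
  then have MT: "?M + transpose ?M = mat 1"
    using M(1) by (simp add: matrix_add_rdistrib)
  have "transpose A = - A"
  proof -
    have "transpose ?M = mat 1 - ?M" using MT by (simp add: eq_diff_eq add.commute)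
    then have "transpose A = 2 *\<^sub>R (mat 1 - ?M) - mat 1"
      by (simp only: A_def bounded_linear_diff_transpose transpose_scaleR transpose_mat)
    then show ?thesis by (simp add: A_def vec_eq_iff)
  qed
  then have skew: "A $ j $ i = - A $ i $ j" for i j
    by (metis (mono_tags) transpose_def vec_lambda_beta vector_uminus_component)
  define X where "X = (\<chi> n. case tri_entry n of (i, j) \<Rightarrow> if i = j then d $ i else A $ i $ j)"
  have "skew_of X = A"
  proof -
    have "skew_of X $ i $ j = A $ i $ j" for i j
      using skew[of i i] skew[of i j]
      by (cases i j rule: linorder_cases) (auto simp: skew_of_def X_def tri_entry_tri_index)
    then show ?thesis by (simp only: vec_eq_iff) blast
  qed
  moreover have "diag_of X = d"
    by (simp add: diag_of_def X_def vec_eq_iff tri_entry_tri_index)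
  moreover have "\<bar>X $ tri_index i j\<bar> \<le> 3" if "i < j" for i j
  proof -
    have "\<bar>A $ i $ j\<bar> \<le> 3"
      using M(3)[of i j] by (auto simp: A_def mat_def)
    then show ?thesis using that by (simp add: X_def tri_entry_tri_index less_imp_neq)
  qed
  moreover have "cayley P X = H"
  proof -
    have "mat 1 + A = 2 *\<^sub>R ?M" by (simp add: A_def)
    then have "(mat 1 + A) ** ((1/2) *\<^sub>R (mat 1 + ?G)) = mat 1"
      by (simp add: matrix_mult.scaleR_left matrix_mult.scaleR_right M)
    then have "cayley_inv X = (1/2) *\<^sub>R (mat 1 + ?G)"
      unfolding cayley_inv_def \<open>skew_of X = A\<close> by (rule matrix_inv_eqI)
    then show ?thesis by (simp add: cayley_def GP)
  qed
  ultimately show ?thesis using that by blast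
qed

lemma finite_net_orthogonal:
  obtains N :: "(real^'k^'k) set" where "finite N" "\<And>P. P \<in> N \<Longrightarrow> orthogonal_matrix P"
    "\<And>H. orthogonal_matrix H \<Longrightarrow> \<exists>P\<in>N. norm (H - P) \<le> 1"
proof -
  obtain N where N: "N \<subseteq> {H :: real^'k^'k. orthogonal_matrix H}" "finite N"
      "{H. orthogonal_matrix H} \<subseteq> (\<Union>P\<in>N. ball P 1)"
  proof (rule compactE_image[OF compact_orthogonal_matrices])
    show "{H :: real^'k^'k. orthogonal_matrix H} \<subseteq> (\<Union>P\<in>{H. orthogonal_matrix H}. ball P 1)" by force
  qed auto
  show ?thesis
  proof (rule that[OF N(2)])
    show "\<exists>P\<in>N. norm (H - P) \<le> 1" if "orthogonal_matrix H" for H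
      using N(3) that by (force simp: dist_norm norm_minus_commute)
  qed (use N(1) in auto)
qed

lemma spectral_param_covers:
  assumes net: "\<And>H. orthogonal_matrix H \<Longrightarrow> \<exists>P\<in>N. norm (H - P) \<le> 1"
    "\<And>P. P \<in> N \<Longrightarrow> orthogonal_matrix P"
    and pd: "positive_definite (sym_of (Y :: 'k::{finite,linorder} sym_coords))"
  shows "\<exists>P\<in>N. \<exists>X\<in>param_box. Y = spectral_param P X \<and> (\<forall>i j. i < j \<longrightarrow> diag_of X $ j \<le> diag_of X $ i)"
proof -
  obtain H d where H: "orthogonal_matrix H" "\<And>i j. i < j \<Longrightarrow> d $ j \<le> d $ i" "\<And>i. d $ i > 0"
      and V: "sym_of Y = transpose H ** diag d ** H"
    using positive_definite_diagonalise[OF pd] by blast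
  obtain P where P: "P \<in> N" "norm (H - P) \<le> 1" using net(1)[OF H(1)] by blast
  obtain X where X: "diag_of X = d" "cayley P X = H" "\<And>i j. i < j \<Longrightarrow> \<bar>X $ tri_index i j\<bar> \<le> 3"
    using orthogonal_matrix_near_cayley[OF H(1) net(2)[OF P(1)] P(2)] by blast
  have "Y = coords (sym_of Y)" by (simp add: coords_sym_of)
  then have "Y = spectral_param P X" by (simp add: V spectral_param_def X)
  moreover have "X \<in> param_box" using X H(3) by (simp add: param_box_def)
  ultimately show ?thesis using P(1) H(2) X(1) by blast
qed

text \<open>A repeated eigenvalue makes the gap product vanish, so the derivative is singular there
  and Sard's theorem applies.\<close>

lemma negligible_repeated_eigenvalues:
  assumes P: "orthogonal_matrix (P :: 'k::{finite,linorder} matrix)"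
  shows "negligible (spectral_param P ` {X. \<exists>i j. i < j \<and> diag_of X $ i = diag_of X $ j})"
proof (rule baby_Sard)
  fix X :: "'k sym_coords"
  assume "X \<in> {X. \<exists>i j. i < j \<and> diag_of X $ i = diag_of X $ j}"
  then have "(\<Prod>(i, j) | i < j. diag_of X $ i - diag_of X $ j) = 0"
    by (auto intro!: prod_zero)
  let ?D = "jac_out P X \<circ> (\<lambda>y. \<chi> n. gap X (tri_entry n) * y $ n) \<circ> jac_in X"
  show "(spectral_param P has_derivative ?D) (at X within {X. \<exists>i j. i < j \<and> diag_of X $ i = diag_of X $ j})"
    by (rule has_derivative_at_withinI[OF has_derivative_spectral_param[OF P]])
  have "det (matrix ?D) = 0"
    using abs_det_spectral_param[of P X] \<open>_ = 0\<close> by simp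
  then show "rank (matrix ?D) < CARD('k tri_ix enum_ix)"
    by (simp only: det_eq_0_rank)
qed simp

text \<open>The bounds on the prior speak of strictly ordered eigenvalues; matrices with ties are
  discarded here as a null set of coordinates.\<close>

lemma AE_sym_lborel_distinct:
  "\<exists>N :: 'k::{finite,linorder} sym_coords set. negligible N \<and>
     (\<forall>Y. positive_definite (sym_of Y) \<longrightarrow> Y \<notin> N \<longrightarrow>
        (\<exists>H d. orthogonal_matrix H \<and> (\<forall>i j. i < j \<longrightarrow> d $ j < d $ i) \<and> (\<forall>i. d $ i > 0) \<and>
           sym_of Y = transpose H ** diag d ** H))"
proof -
  obtain N :: "'k matrix set" where N: "finite N" "\<And>P. P \<in> N \<Longrightarrow> orthogonal_matrix P"
    "\<And>H. orthogonal_matrix H \<Longrightarrow> \<exists>P\<in>N. norm (H - P) \<le> 1"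
    by (rule finite_net_orthogonal) blast
  let ?T = "{X :: 'k sym_coords. \<exists>i j. i < j \<and> diag_of X $ i = diag_of X $ j}"
  let ?Z = "\<Union>P\<in>N. spectral_param P ` ?T"
  have "negligible ?Z"
    using N(1,2) by (intro negligible_Union) (auto intro: negligible_repeated_eigenvalues)
  moreover have "\<exists>H d. orthogonal_matrix H \<and> (\<forall>i j. i < j \<longrightarrow> d $ j < d $ i) \<and> (\<forall>i. d $ i > 0) \<and>
           sym_of Y = transpose H ** diag d ** H"
    if pd: "positive_definite (sym_of Y)" and Y: "Y \<notin> ?Z" for Y :: "'k sym_coords"
  proof -
    obtain P X where X: "P \<in> N" "X \<in> param_box" "Y = spectral_param P X" "\<forall>i j. i < j \<longrightarrow> diag_of X $ j \<le> diag_of X $ i"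
      using spectral_param_covers[OF N(3,2) pd] by blast
    then have "X \<notin> ?T" using Y by blast
    then have "\<forall>i j. i < j \<longrightarrow> diag_of X $ j < diag_of X $ i" using X(4) by (force simp: le_less)
    then show ?thesis
      using X orthogonal_cayley[OF N(2)[OF X(1)], of X]
      by (intro exI[of _ "cayley P X"] exI[of _ "diag_of X"]) (auto simp: sym_of_spectral_param param_box_def)
  qed
  ultimately show ?thesis by blast
qed

section \<open>Finiteness of integrals over positive definite matrices\<close>

text \<open>Passes from gauge integrability, the language of the change-of-variables bound and of
  the power integrals, to finiteness of a nonnegative integral.\<close>

lemma nn_integral_lebesgue_restrict:
  assumes f: "f \<in> borel_measurable borel" and nonneg: "\<And>x. 0 \<le> f x"
    and int: "(f :: 'a::euclidean_space \<Rightarrow> real) integrable_on S"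
  shows "(\<integral>\<^sup>+x. ennreal (f x) * indicator S x \<partial>lebesgue) < \<infinity>"
proof -
  have "f absolutely_integrable_on S"
    by (rule nonnegative_absolutely_integrable_1[OF int]) (rule nonneg)
  then have "integrable lebesgue (\<lambda>x. indicat_real S x *\<^sub>R f x)"
    by (simp add: set_integrable_def)
  then have "(\<integral>\<^sup>+x. ennreal (norm (indicat_real S x *\<^sub>R f x)) \<partial>lebesgue) < \<infinity>"
    by (simp add: integrable_iff_bounded)
  also have "(\<lambda>x. ennreal (norm (indicat_real S x *\<^sub>R f x))) = (\<lambda>x. ennreal (f x) * indicator S x)"
    using nonneg by (auto simp: fun_eq_iff indicator_def)
  finally show ?thesis .
qed

lemma continuous_spectral_param:
  assumes P: "orthogonal_matrix (P :: 'k::{finite,linorder} matrix)"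
  shows "spectral_param P \<in> borel_measurable borel"
  using has_derivative_continuous[OF has_derivative_spectral_param[OF P]]
  by (intro borel_measurable_continuous_onI) (simp add: continuous_at_imp_continuous_on)

text \<open>A majorant factors over the coordinates: a rotation coordinate contributes the length 6
  of [-3, 3], an eigenvalue the integral of g over the positive axis.\<close>

lemma nn_integral_spectral_box_finite:
  fixes g :: "real \<Rightarrow> real"
  assumes g[measurable]: "g \<in> borel_measurable borel" and g_int: "(\<integral>\<^sup>+t. ennreal (g t) * indicator {0<..} t \<partial>lborel) < \<infinity>"
  shows "(\<integral>\<^sup>+X. (\<Prod>i\<in>UNIV. ennreal (g (diag_of X $ i))) * indicator param_box (X :: 'k::{finite,linorder} sym_coords) \<partial>lborel) < \<infinity>"
proof -
  define w :: "'k \<times> 'k \<Rightarrow> real \<Rightarrow> ennreal" where "w = (\<lambda>(i, j) t. if i = j then ennreal (g t) * indicator {0<..} t else indicator {-3..3} t)"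
  have [measurable]: "w p \<in> borel_measurable borel" for p
    unfolding w_def by (cases p) auto
  have "(\<Prod>i\<in>UNIV. ennreal (g (diag_of X $ i))) * indicator param_box X \<le> (\<Prod>n\<in>UNIV. w (tri_entry n) (X $ n))" for X :: "'k sym_coords"
  proof (cases "X \<in> param_box")
    case True
    have "(\<Prod>n\<in>UNIV. w (tri_entry n) (X $ n)) = (\<Prod>n\<in>UNIV. (\<lambda>(i, j). w (i, j) (X $ tri_index i j)) (tri_entry n))"
      by (simp add: case_prod_unfold tri_index_tri_entry)
    also have "\<dots> = (\<Prod>i\<in>UNIV. w (i, i) (X $ tri_index i i)) * (\<Prod>(i, j) | i < j. w (i, j) (X $ tri_index i j))"
      by (subst prod_sym_coords) (simp add: case_prod_unfold)
    also have "(\<Prod>i\<in>UNIV. w (i, i) (X $ tri_index i i)) = (\<Prod>i\<in>UNIV. ennreal (g (diag_of X $ i)))"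
      using True by (intro prod.cong) (auto simp: w_def param_box_def diag_of_def)
    also have "(\<Prod>(i, j) | i < j. w (i, j) (X $ tri_index i j)) = 1"
      using True by (intro prod.neutral) (auto simp: w_def param_box_def abs_le_iff minus_le_iff)
    finally show ?thesis using True by simp
  qed simp
  then have "(\<integral>\<^sup>+X. (\<Prod>i\<in>UNIV. ennreal (g (diag_of X $ i))) * indicator param_box (X :: 'k sym_coords) \<partial>lborel)
      \<le> (\<integral>\<^sup>+X. (\<Prod>n\<in>UNIV. w (tri_entry n) (X $ n)) \<partial>lborel)"
    by (intro nn_integral_mono) auto
  also have "\<dots> = (\<Prod>n\<in>UNIV. \<integral>\<^sup>+t. w (tri_entry n) t \<partial>lborel)"
    by (rule nn_integral_lborel_vec_prod) simp
  also have "\<dots> < \<infinity>"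
  proof -
    have "(\<integral>\<^sup>+t. w p t \<partial>lborel) \<noteq> top" for p
      using g_int by (cases "fst p = snd p") (auto simp: w_def case_prod_unfold)
    then have "(\<Prod>n\<in>UNIV. \<integral>\<^sup>+t. w (tri_entry n) t \<partial>lborel) \<noteq> top" by (simp add: ennreal_prod_eq_top)
    then show ?thesis by (simp add: less_top)
  qed
  finally show ?thesis .
qed

lemma gap_measurable [measurable]:
  "(\<lambda>X :: 'k::{finite,linorder} sym_coords. diag_of X $ i) \<in> borel_measurable borel"
  by (simp add: diag_of_def)

lemma param_box_measurable [measurable]: "param_box \<in> sets (borel :: 'k::{finite,linorder} sym_coords measure)"
  unfolding param_box_def by measurable

text \<open>Half of Weyl's integration formula: the eigenvalue gaps are the Jacobian of \<open>(H, d) \<mapsto> H\<^sup>T diag d H\<close>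
  up to a bounded factor, with finitely many Cayley charts for \<open>H\<close>.\<close>

lemma nn_integral_sym_lborel_finite:
  fixes f :: "'k::{finite,linorder} matrix \<Rightarrow> real" and g :: "real \<Rightarrow> real"
  assumes f[measurable]: "f \<in> borel_measurable borel" and f0: "\<And>V. 0 \<le> f V"
    and fpd: "\<And>V. \<not> positive_definite V \<Longrightarrow> f V = 0"
    and g[measurable]: "g \<in> borel_measurable borel" and g0: "\<And>t. t > 0 \<Longrightarrow> 0 \<le> g t"
    and g_int: "(\<integral>\<^sup>+t. ennreal (g t) * indicator {0<..} t \<partial>lborel) < \<infinity>"
    and bound: "\<And>H d. orthogonal_matrix H \<Longrightarrow> (\<forall>i j. i < j \<longrightarrow> d $ j < d $ i) \<Longrightarrow> (\<forall>i. d $ i > 0) \<Longrightarrow>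
      f (transpose H ** diag d ** H) * (\<Prod>(i, j) | i < j. d $ i - d $ j) \<le> (\<Prod>i\<in>UNIV. g (d $ i))"
  shows "(\<integral>\<^sup>+V. ennreal (f V) \<partial>sym_lborel) < \<infinity>"
proof -
  obtain N :: "'k matrix set" where N: "finite N" "\<And>P. P \<in> N \<Longrightarrow> orthogonal_matrix P"
    "\<And>H. orthogonal_matrix H \<Longrightarrow> \<exists>P\<in>N. norm (H - P) \<le> 1"
    by (rule finite_net_orthogonal) blast
  obtain C1 where C1: "C1 \<ge> 0" "\<And>X :: 'k sym_coords. \<bar>det (matrix (jac_in X))\<bar> \<le> C1"
    using det_jac_in_le by blast
  obtain C2 where C2: "C2 \<ge> 0" "\<And>(X :: 'k sym_coords) P. orthogonal_matrix P \<Longrightarrow> \<bar>det (matrix (jac_out P X))\<bar> \<le> C2"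
    using det_jac_out_le by blast
  \<comment> \<open>The chamber of strictly ordered eigenvalues, where \<open>bound\<close> applies
    and the gap product is positive.\<close>
  define S where "S = {X :: 'k sym_coords. X \<in> param_box \<and> (\<forall>i j. i < j \<longrightarrow> diag_of X $ j < diag_of X $ i)}"
  let ?T = "{X :: 'k sym_coords. \<exists>i j. i < j \<and> diag_of X $ i = diag_of X $ j}"
  let ?F = "\<lambda>Y. f (sym_of Y)"
  define D where "D P X = jac_out P X \<circ> (\<lambda>y. \<chi> n. gap X (tri_entry n) * y $ n) \<circ> jac_in X" for P and X :: "'k sym_coords"
  have Sm: "S \<in> sets borel" unfolding S_def by measurable
  have fin: "(\<integral>\<^sup>+Y. ennreal (?F Y) * indicator (spectral_param P ` S) Y \<partial>lebesgue) < \<infinity>" if "P \<in> N" for P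
  proof (rule nn_integral_lebesgue_restrict)
    note P = N(2)[OF that]
    note [measurable] = continuous_spectral_param[OF P]
    have der: "(spectral_param P has_derivative D P X) (at X within A)" for X A
      unfolding D_def by (rule has_derivative_at_withinI[OF has_derivative_spectral_param[OF P]])
    let ?I = "\<lambda>X. \<bar>det (matrix (D P X))\<bar> * ?F (spectral_param P X)"
    have I0: "0 \<le> ?I X" for X using f0 by simp
    \<comment> \<open>The gap product supplied by the Jacobian is absorbed by \<open>bound\<close>;
      the two outer determinants cost C1 and C2.\<close>
    have Ile: "?I X \<le> C1 * C2 * (\<Prod>i\<in>UNIV. g (diag_of X $ i))" if X: "X \<in> S" for X
    proof -
      let ?p = "\<Prod>(i, j) | i < j. diag_of X $ i - diag_of X $ j"
      have p: "?p \<ge> 0" using X by (intro prod_nonneg) (auto simp: S_def less_imp_le)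
      have "?F (spectral_param P X) * ?p \<le> (\<Prod>i\<in>UNIV. g (diag_of X $ i))"
        unfolding sym_of_spectral_param
        using X by (intro bound orthogonal_cayley P) (auto simp: S_def param_box_def)
      moreover have "?I X = (\<bar>det (matrix (jac_in X))\<bar> * \<bar>det (matrix (jac_out P X))\<bar>) * (?F (spectral_param P X) * ?p)"
        unfolding D_def abs_det_spectral_param using p by simp
      moreover have "\<bar>det (matrix (jac_in X))\<bar> * \<bar>det (matrix (jac_out P X))\<bar> \<le> C1 * C2"
        using C1 C2 P by (intro mult_mono) auto
      moreover have "0 \<le> C1 * C2" "0 \<le> ?F (spectral_param P X) * ?p"
        using C1(1) C2(1) f0 p by simp_all
      ultimately show ?thesis
        by (simp only:) (rule mult_mono)
    qed
    have "set_integrable lebesgue S ?I"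
      unfolding set_integrable_def integrable_iff_bounded
    proof
      have "(\<lambda>X. det (matrix (D P X))) \<in> borel_measurable (lebesgue_on UNIV)"
        by (rule borel_measurable_det_Jacobian) (auto intro: der)
      then have "(\<lambda>X. det (matrix (D P X))) \<in> borel_measurable lebesgue" by simp
      moreover have "(\<lambda>X. ?F (spectral_param P X)) \<in> borel_measurable lebesgue"
        by (rule measurable_completion) simp
      moreover have "indicat_real S \<in> borel_measurable lebesgue"
        using Sm by (intro measurable_completion) simp
      ultimately show "(\<lambda>X. indicat_real S X *\<^sub>R ?I X) \<in> borel_measurable lebesgue"
        by measurable
      have le: "ennreal (norm (indicat_real S X *\<^sub>R ?I X))
          \<le> ennreal (C1 * C2) * ((\<Prod>i\<in>UNIV. ennreal (g (diag_of X $ i))) * indicator param_box X)" for X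
      proof (cases "X \<in> S")
        case True
        then have d: "diag_of X $ i > 0" for i by (auto simp: S_def param_box_def)
        have "(\<Prod>i\<in>UNIV. ennreal (g (diag_of X $ i))) = ennreal (\<Prod>i\<in>UNIV. g (diag_of X $ i))"
          using g0[OF d] by (intro prod_ennreal) auto
        moreover have "(\<Prod>i\<in>UNIV. g (diag_of X $ i)) \<ge> 0" using g0[OF d] by (intro prod_nonneg) auto
        ultimately show ?thesis
          using True Ile[OF True] I0[of X] C1(1) C2(1)
          by (simp add: S_def ennreal_mult[symmetric] abs_mult)
      qed simp
      have "(\<integral>\<^sup>+X. ennreal (norm (indicat_real S X *\<^sub>R ?I X)) \<partial>lebesgue)
          \<le> (\<integral>\<^sup>+X. ennreal (C1 * C2) * ((\<Prod>i\<in>UNIV. ennreal (g (diag_of X $ i))) * indicator param_box (X :: 'k sym_coords)) \<partial>lebesgue)"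
        by (rule nn_integral_mono) (rule le)
      also have "\<dots> = (\<integral>\<^sup>+X. ennreal (C1 * C2) * ((\<Prod>i\<in>UNIV. ennreal (g (diag_of X $ i))) * indicator param_box (X :: 'k sym_coords)) \<partial>lborel)"
        by (rule nn_integral_completion)
      also have "\<dots> < \<infinity>"
        using nn_integral_spectral_box_finite[OF g g_int, where 'k='k]
        by (subst nn_integral_cmult) (auto simp: ennreal_mult_less_top)
      finally show "(\<integral>\<^sup>+X. ennreal (norm (indicat_real S X *\<^sub>R ?I X)) \<partial>lebesgue) < \<infinity>" .
    qed
    then have "?I integrable_on S" by (rule set_lebesgue_integral_eq_integral(1))
    \<comment> \<open>An integral over an image is at most the integral of the pulled-back function
      times the Jacobian; points hit repeatedly only enlarge the right side.\<close>
    then show "?F integrable_on spectral_param P ` S"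
      using integral_on_image_ubound_nonneg[of S ?F "spectral_param P" "D P"] f0 der by blast
  qed (use f0 in auto)
  have Z: "negligible (\<Union>P\<in>N. spectral_param P ` ?T)"
    using N(1,2) by (intro negligible_Union) (auto intro: negligible_repeated_eigenvalues)
  \<comment> \<open>Away from ties every positive definite point lies in the image of some chart, so
    the sum over charts dominates.\<close>
  have le: "ennreal (?F Y) \<le> (\<Sum>P\<in>N. ennreal (?F Y) * indicator (spectral_param P ` S) Y)"
    if Y: "Y \<notin> (\<Union>P\<in>N. spectral_param P ` ?T)" for Y
  proof (cases "positive_definite (sym_of Y)")
    case True
    obtain P X where X: "P \<in> N" "X \<in> param_box" "Y = spectral_param P X" "\<forall>i j. i < j \<longrightarrow> diag_of X $ j \<le> diag_of X $ i"
      using spectral_param_covers[OF N(3,2) True] by blast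
    have "X \<notin> ?T" using X(1,3) Y by blast
    then have "X \<in> S" using X(2,4) by (force simp: S_def le_less)
    then have "ennreal (?F Y) = ennreal (?F Y) * indicator (spectral_param P ` S) Y"
      using X(3) by simp
    also have "\<dots> \<le> (\<Sum>P\<in>N. ennreal (?F Y) * indicator (spectral_param P ` S) Y)"
      using X(1) N(1) by (intro member_le_sum) auto
    finally show ?thesis .
  qed (simp add: fpd)
  have imm: "(\<lambda>Y. ennreal (?F Y) * indicator (spectral_param P ` S) Y) \<in> borel_measurable lebesgue" if "P \<in> N" for P
  proof -
    have "spectral_param P ` S \<in> sets lebesgue"
      using Sm continuous_spectral_param N(2)[OF that] has_derivative_spectral_param[OF N(2)[OF that]]
      by (intro differentiable_image_in_sets_lebesgue) (auto simp: differentiable_on_def differentiable_def intro: has_derivative_at_withinI)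
    moreover have "(\<lambda>Y. ennreal (?F Y)) \<in> borel_measurable lebesgue" by (rule measurable_completion) simp
    ultimately show ?thesis by measurable
  qed
  have "(\<integral>\<^sup>+V. ennreal (f V) \<partial>sym_lborel) = (\<integral>\<^sup>+Y. ennreal (?F Y) \<partial>lebesgue)"
    by (simp add: nn_integral_sym_lborel nn_integral_completion)
  also have "\<dots> \<le> (\<integral>\<^sup>+Y. (\<Sum>P\<in>N. ennreal (?F Y) * indicator (spectral_param P ` S) Y) \<partial>lebesgue)"
    using le Z by (intro nn_integral_mono_AE)
      (auto simp: negligible_iff_null_sets dest!: AE_not_in)
  also have "\<dots> = (\<Sum>P\<in>N. \<integral>\<^sup>+Y. ennreal (?F Y) * indicator (spectral_param P ` S) Y \<partial>lebesgue)"
    by (rule nn_integral_sum) (rule imm)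
  also have "\<dots> < \<infinity>"
    using fin N(1) by simp
  finally show ?thesis .
qed

section \<open>Posterior means of mixtures of normal distributions\<close>

text \<open>Left unnormalised because the constant cancels from posterior means and from comparisons
  of risks.\<close>

definition gauss :: "real^'p \<Rightarrow> real" where
  "gauss z = exp (- ((norm z)\<^sup>2 / 2))"

lemma gauss_pos: "gauss z > 0" and gauss_nonneg: "0 \<le> gauss z"
  by (simp_all add: gauss_def)

lemma continuous_on_gauss [continuous_intros]: "continuous_on S f \<Longrightarrow> continuous_on S (\<lambda>x. gauss (f x))"
  unfolding gauss_def by (intro continuous_intros) auto

lemma gauss_measurable [measurable]: "gauss \<in> borel_measurable borel"
  by (intro borel_measurable_continuous_onI continuous_intros)

text \<open>Half of the exponent pays for a polynomial of degree four. With u the squared norm, the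
  quadratic Taylor bound of exp at u/4 gives u^2 <= 32 exp(u/4); the summand 1 makes it 33.\<close>

lemma gauss_poly_le: "gauss z * (1 + norm z ^ 4) \<le> 33 * exp (- ((norm z)\<^sup>2 / 4))"
proof -
  let ?u = "(norm z)\<^sup>2"
  have "1 + ?u / 4 + (?u / 4)\<^sup>2 / 2 \<le> exp (?u / 4)" by (rule exp_lower_Taylor_quadratic) simp
  moreover have "?u \<ge> 0" by simp
  ultimately have "(?u / 4)\<^sup>2 / 2 \<le> exp (?u / 4)" by linarith
  then have "?u\<^sup>2 \<le> 32 * exp (?u / 4)" by (simp add: power_divide)
  moreover have "norm z ^ 4 = ?u\<^sup>2" by simp
  moreover have "1 \<le> exp (?u / 4)" by simp
  ultimately have "1 + norm z ^ 4 \<le> 33 * exp (?u / 4)" by linarith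
  then have "gauss z * (1 + norm z ^ 4) \<le> gauss z * (33 * exp (?u / 4))"
    by (rule mult_left_mono) (rule gauss_nonneg)
  also have "\<dots> = 33 * exp (- (?u / 4))" by (simp add: gauss_def exp_add[symmetric])
  finally show ?thesis .
qed

section \<open>Gaussian integrals and polynomial weights\<close>

lemma nn_integral_exp_square:
  fixes a :: real
  assumes a: "a > 0"
  shows "(\<integral>\<^sup>+t. ennreal (exp (- (a * t\<^sup>2 / 2))) \<partial>lborel) = ennreal (sqrt (2 * pi / a))"
proof -
  let ?s = "1 / sqrt a"
  have s: "?s > 0" using a by simp
  have "(\<integral>\<^sup>+t. ennreal (normal_density 0 ?s t) \<partial>lborel) = 1"
    using prob_space.emeasure_space_1[OF prob_space_normal_density[OF s, of 0]]
    by (simp add: emeasure_density)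
  moreover have "exp (- (a * t\<^sup>2 / 2)) = sqrt (2 * pi / a) * normal_density 0 ?s t" for t
    using a by (simp add: normal_density_def power_divide real_sqrt_divide real_sqrt_mult field_simps)
  ultimately show ?thesis
    using a by (simp add: ennreal_mult' nn_integral_cmult)
qed

lemma power2_norm_vec: "(norm (x :: real^'n))\<^sup>2 = (\<Sum>i\<in>UNIV. (x $ i)\<^sup>2)"
  by (simp add: norm_vec_def L2_set_def sum_nonneg)

lemma prod_sqrt: "(\<Prod>i\<in>A. sqrt (f i)) = sqrt (\<Prod>i\<in>A. f i)"
  by (induction A rule: infinite_finite_induct) (simp_all add: real_sqrt_mult)

lemma nn_integral_gauss_diag:
  fixes d :: "real^'n"
  assumes d: "\<And>i. d $ i > 0"
  shows "(\<integral>\<^sup>+x. ennreal (exp (- ((\<Sum>i\<in>UNIV. d $ i * (x $ i)\<^sup>2) / 2))) \<partial>lborel) = ennreal (sqrt ((2 * pi) ^ CARD('n) / (\<Prod>i\<in>UNIV. d $ i)))"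
proof -
  have "ennreal (exp (- ((\<Sum>i\<in>UNIV. d $ i * (x $ i)\<^sup>2) / 2))) = (\<Prod>i\<in>UNIV. ennreal (exp (- (d $ i * (x $ i)\<^sup>2 / 2))))" for x :: "real^'n"
    by (simp add: prod_ennreal exp_sum[symmetric] sum_negf sum_divide_distrib)
  then have "(\<integral>\<^sup>+x. ennreal (exp (- ((\<Sum>i\<in>UNIV. d $ i * (x $ i)\<^sup>2) / 2))) \<partial>lborel)
      = (\<Prod>i\<in>UNIV. ennreal (sqrt (2 * pi / d $ i)))"
    using nn_integral_lborel_vec_prod[of "\<lambda>i t. ennreal (exp (- (d $ i * t\<^sup>2 / 2)))"]
    by (simp add: nn_integral_exp_square d)
  also have "\<dots> = ennreal (\<Prod>i\<in>UNIV. sqrt (2 * pi / d $ i))"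
    using d by (intro prod_ennreal) (simp add: less_imp_le)
  also have "(\<Prod>i\<in>UNIV. sqrt (2 * pi / d $ i)) = sqrt (\<Prod>i\<in>UNIV. 2 * pi / d $ i)"
    by (rule prod_sqrt)
  also have "\<dots> = sqrt ((2 * pi) ^ CARD('n) / (\<Prod>i\<in>UNIV. d $ i))"
    by (simp add: prod_dividef)
  finally show ?thesis .
qed

lemma nn_integral_gauss_scale:
  assumes a: "a > 0"
  shows "(\<integral>\<^sup>+x. ennreal (exp (- (a * (norm (x :: real^'n))\<^sup>2 / 2))) \<partial>lborel) = ennreal (sqrt ((2 * pi / a) ^ CARD('n)))"
  using nn_integral_gauss_diag[of "\<chi> i :: 'n. a"] a
  by (simp add: power2_norm_vec sum_distrib_left power_divide)

text \<open>Peetre's inequality: polynomial weights centred at 0 and at another point differ by a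
  factor polynomial in the displacement.\<close>

lemma one_plus_norm_shift: "1 + (norm x)\<^sup>2 \<le> 2 * (1 + (norm y)\<^sup>2) * (1 + (norm (x - y))\<^sup>2)"
  for x y :: "'a::real_normed_vector"
proof -
  let ?a = "norm y" and ?b = "norm (x - y)"
  have "norm x \<le> ?a + ?b" using norm_triangle_ineq[of y "x - y"] by simp
  then have "(norm x)\<^sup>2 \<le> (?a + ?b)\<^sup>2" by (intro power_mono) auto
  also have "\<dots> \<le> 2 * ?a\<^sup>2 + 2 * ?b\<^sup>2"
    using sum_squares_bound[of ?a ?b] by (simp add: power2_sum)
  finally have "1 + (norm x)\<^sup>2 \<le> 2 * (1 + ?a\<^sup>2 + ?b\<^sup>2)" by simp
  also have "\<dots> \<le> 2 * ((1 + ?a\<^sup>2) * (1 + ?b\<^sup>2))"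
    by (simp add: algebra_simps)
  finally show ?thesis by (simp only: mult.assoc)
qed

text \<open>A single term of the exponential series, of an order n above a, is enough; writing (1 +
  u)/4 for its argument costs the factor exp(1/4).\<close>

lemma powr_le_exp_quarter: "\<exists>C. \<forall>u\<ge>0. (1 + u) powr a \<le> C * exp (u / 4 :: real)"
proof -
  obtain n :: nat where n: "a \<le> real n" using real_arch_simple by blast
  have "(1 + u) powr a \<le> (fact n * 4 ^ n * exp (1 / 4)) * exp (u / 4)" if u: "u \<ge> 0" for u
  proof -
    have "(1 + u) powr a \<le> (1 + u) powr real n" using u n by (intro powr_mono) auto
    also have "\<dots> = (1 + u) ^ n" using u by (simp add: powr_realpow)
    also have "\<dots> = 4 ^ n * ((1 + u) / 4) ^ n" by (simp add: power_divide)
    also have "((1 + u) / 4) ^ n \<le> fact n * exp ((1 + u) / 4)"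
    proof -
      have "((1 + u) / 4) ^ n /\<^sub>R fact n \<le> (\<Sum>k. ((1 + u) / 4) ^ k /\<^sub>R fact k)"
        using u summable_exp_generic[of "(1 + u) / 4"] by (intro sum_le_suminf[of _ "{n}", simplified]) auto
      then show ?thesis by (simp add: exp_def divide_inverse[symmetric] field_simps)
    qed
    finally show ?thesis
      by (simp add: add_divide_distrib exp_add mult_ac)
  qed
  then show ?thesis by blast
qed

lemma integrable_poly_gauss:
  fixes f :: "real^'p \<Rightarrow> 'b::{banach, second_countable_topology}"
  assumes f[measurable]: "f \<in> borel_measurable borel"
    and le: "\<And>x. norm (f x) \<le> B * (1 + (norm x)\<^sup>2) powr a"
  shows "integrable lborel (\<lambda>x. gauss (x - \<theta>) *\<^sub>R f x)"
proof (rule integrableI_bounded)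
  define a' where "a' = max a 0"
  obtain C where C: "\<And>u. u \<ge> 0 \<Longrightarrow> (1 + u) powr a' \<le> C * exp (u / 4)"
    using powr_le_exp_quarter by blast
  let ?b = "(2 * (1 + (norm \<theta>)\<^sup>2)) powr a'"
  have B: "B \<ge> 0" using order_trans[OF norm_ge_zero le[of 0]] by simp
  have C0: "C \<ge> 0" using order_trans[OF powr_ge_zero C[of 0]] by simp
  have "norm (gauss (x - \<theta>) *\<^sub>R f x) \<le> B * ?b * C * exp (- (1 / 2 * (norm (x - \<theta>))\<^sup>2 / 2))" for x
  proof -
    let ?u = "(norm (x - \<theta>))\<^sup>2"
    have "(1 + (norm x)\<^sup>2) powr a \<le> (1 + (norm x)\<^sup>2) powr a'"
      by (intro powr_mono) (auto simp: a'_def)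
    also have "\<dots> \<le> (2 * (1 + (norm \<theta>)\<^sup>2) * (1 + ?u)) powr a'"
      by (intro powr_mono2 one_plus_norm_shift) (auto simp: a'_def)
    also have "\<dots> = ?b * (1 + ?u) powr a'" by (rule powr_mult)
    also have "\<dots> \<le> ?b * (C * exp (?u / 4))" by (intro mult_left_mono C) auto
    finally have "norm (f x) \<le> B * (?b * (C * exp (?u / 4)))"
      using le[of x] B by (meson mult_left_mono order_trans)
    then have "gauss (x - \<theta>) * norm (f x) \<le> gauss (x - \<theta>) * (B * (?b * (C * exp (?u / 4))))"
      by (rule mult_left_mono) (rule gauss_nonneg)
    also have "\<dots> = B * ?b * C * (gauss (x - \<theta>) * exp (?u / 4))" by simp
    also have "gauss (x - \<theta>) * exp (?u / 4) = exp (- (1 / 2 * ?u / 2))"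
      by (simp add: gauss_def exp_add[symmetric])
    finally show ?thesis by (simp add: gauss_nonneg)
  qed
  then have "(\<integral>\<^sup>+x. ennreal (norm (gauss (x - \<theta>) *\<^sub>R f x)) \<partial>lborel)
      \<le> (\<integral>\<^sup>+x. ennreal (B * ?b * C * exp (- (1 / 2 * (norm (x - \<theta>))\<^sup>2 / 2))) \<partial>lborel)"
    by (intro nn_integral_mono ennreal_leI)
  also have "\<dots> = ennreal (B * ?b * C) * (\<integral>\<^sup>+x. ennreal (exp (- (1 / 2 * (norm (x - \<theta>))\<^sup>2 / 2))) \<partial>lborel)"
    using B C0 by (simp add: ennreal_mult nn_integral_cmult)
  also have "(\<integral>\<^sup>+x. ennreal (exp (- (1 / 2 * (norm (x - \<theta>))\<^sup>2 / 2))) \<partial>lborel)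
      = (\<integral>\<^sup>+x. ennreal (exp (- (1 / 2 * (norm (x :: real^'p))\<^sup>2 / 2))) \<partial>lborel)"
    using nn_integral_lborel_translate[of "\<lambda>x. ennreal (exp (- (1 / 2 * (norm (x :: real^'p))\<^sup>2 / 2)))" "- \<theta>"]
    by simp
  also have "ennreal (B * ?b * C) * \<dots> < \<infinity>"
    using nn_integral_gauss_scale[of "1/2", where 'n='p] by (simp add: ennreal_mult_less_top)
  finally show "(\<integral>\<^sup>+x. ennreal (norm (gauss (x - \<theta>) *\<^sub>R f x)) \<partial>lborel) < \<infinity>" .
qed simp

section \<open>Integration by parts and differentiation under the integral\<close>

text \<open>Boundary terms are avoided: the increment from x to x + e has integral zero by
  translation invariance, and by the fundamental theorem it is the average of the derivative over
  the segment. Fubini and translation turn this average into the integral of the derivative.\<close>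

lemma integral_directional_derivative_zero:
  fixes \<psi> \<psi>' :: "'a::euclidean_space \<Rightarrow> real"
  assumes der: "\<And>x. ((\<lambda>t. \<psi> (x + t *\<^sub>R e)) has_real_derivative \<psi>' x) (at 0)"
    and cont: "continuous_on UNIV \<psi>'"
    and int: "integrable lborel \<psi>" "integrable lborel \<psi>'"
  shows "(\<integral>x. \<psi>' x \<partial>lborel) = 0"
proof -
  have [measurable]: "\<psi> \<in> borel_measurable borel" "\<psi>' \<in> borel_measurable borel" using int by auto
  have der': "((\<lambda>t. \<psi> (x + t *\<^sub>R e)) has_real_derivative \<psi>' (x + s *\<^sub>R e)) (at s)" for x s
    using der[of "x + s *\<^sub>R e"] DERIV_shift[of "\<lambda>t. \<psi> (x + t *\<^sub>R e)" _ 0 s]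
    by (simp add: algebra_simps)
  have FTC: "(\<integral>t. indicator {0..1} t * \<psi>' (x + t *\<^sub>R e) \<partial>lborel) = \<psi> (x + e) - \<psi> x" for x
  proof -
    have "continuous_on UNIV (\<lambda>t. \<psi>' (x + t *\<^sub>R e))"
      by (intro continuous_on_compose2[OF cont] continuous_intros) auto
    then have "(\<integral>t. \<psi>' (x + t *\<^sub>R e) * indicator {0..1} t \<partial>lborel) = \<psi> (x + 1 *\<^sub>R e) - \<psi> (x + 0 *\<^sub>R e)"
      by (intro integral_FTC_Icc_real[of 0 1 "\<lambda>t. \<psi> (x + t *\<^sub>R e)"] der' conjI)
        (auto simp: continuous_on_eq_continuous_at)
    then show ?thesis by (simp add: mult.commute)
  qed
  have transl: "integrable lborel (\<lambda>x. f (x + v))" "(\<integral>x. f (x + v) \<partial>lborel) = (\<integral>x. f x \<partial>lborel)"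
    if "integrable lborel f" for f :: "'a \<Rightarrow> real" and v
  proof -
    have [measurable]: "f \<in> borel_measurable borel" using that by auto
    show "(\<integral>x. f (x + v) \<partial>lborel) = (\<integral>x. f x \<partial>lborel)"
      by (subst (2) lborel_distr_plus[symmetric, of v]) (simp add: integral_distr add.commute)
    have "integrable (distr lborel borel ((+) v)) f" using that by (simp add: lborel_distr_plus)
    then show "integrable lborel (\<lambda>x. f (x + v))"
      by (subst (asm) integrable_distr_eq) (simp_all add: add.commute)
  qed
  let ?g = "\<lambda>(x, t). indicat_real {0..1} t * \<psi>' (x + t *\<^sub>R e)"
  have G: "integrable (lborel \<Otimes>\<^sub>M lborel) ?g"
  proof (rule integrableI_bounded)
    have "(\<integral>\<^sup>+z. ennreal (norm (?g z)) \<partial>(lborel \<Otimes>\<^sub>M lborel))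
        = (\<integral>\<^sup>+t. \<integral>\<^sup>+x. ennreal (norm (indicat_real {0..1} t * \<psi>' (x + t *\<^sub>R e))) \<partial>lborel \<partial>lborel)"
      by (subst lborel_pair.nn_integral_snd[symmetric]) simp_all
    also have "\<dots> = (\<integral>\<^sup>+t. indicator {0..1 :: real} t * (\<integral>\<^sup>+x. ennreal \<bar>\<psi>' x\<bar> \<partial>lborel) \<partial>lborel)"
    proof (rule nn_integral_cong)
      fix t :: real
      have "(\<integral>\<^sup>+x. ennreal (norm (indicat_real {0..1} t * \<psi>' (x + t *\<^sub>R e))) \<partial>lborel)
          = indicator {0..1} t * (\<integral>\<^sup>+x. ennreal \<bar>\<psi>' (x + t *\<^sub>R e)\<bar> \<partial>lborel)"
        by (simp add: abs_mult indicator_def)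
      also have "(\<integral>\<^sup>+x. ennreal \<bar>\<psi>' (x + t *\<^sub>R e)\<bar> \<partial>lborel) = (\<integral>\<^sup>+x. ennreal \<bar>\<psi>' x\<bar> \<partial>lborel)"
        using nn_integral_lborel_translate[of "\<lambda>x. ennreal \<bar>\<psi>' x\<bar>" "t *\<^sub>R e"] by (simp add: add.commute)
      finally show "(\<integral>\<^sup>+x. ennreal (norm (indicat_real {0..1} t * \<psi>' (x + t *\<^sub>R e))) \<partial>lborel)
          = indicator {0..1} t * (\<integral>\<^sup>+x. ennreal \<bar>\<psi>' x\<bar> \<partial>lborel)" .
    qed
    also have "\<dots> = (\<integral>\<^sup>+x. ennreal \<bar>\<psi>' x\<bar> \<partial>lborel)"
      by (simp add: nn_integral_multc)
    also have "\<dots> < \<infinity>" using int(2) by (simp add: integrable_iff_bounded)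
    finally show "(\<integral>\<^sup>+z. ennreal (norm (?g z)) \<partial>(lborel \<Otimes>\<^sub>M lborel)) < \<infinity>" .
  qed simp
  have "(\<integral>x. \<psi> (x + e) - \<psi> x \<partial>lborel) = 0"
    using transl[OF int(1), of e] int(1) by simp
  then have "0 = (\<integral>x. \<integral>t. indicator {0..1} t * \<psi>' (x + t *\<^sub>R e) \<partial>lborel \<partial>lborel)"
    by (simp add: FTC)
  also have "\<dots> = (\<integral>t. \<integral>x. indicator {0..1} t * \<psi>' (x + t *\<^sub>R e) \<partial>lborel \<partial>lborel)"
    by (rule lborel_pair.Fubini_integral[symmetric]) (rule G)
  also have "\<dots> = (\<integral>t. indicator {0..1 :: real} t * (\<integral>x. \<psi>' x \<partial>lborel) \<partial>lborel)"
    using transl(2)[OF int(2)] by simp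
  also have "\<dots> = (\<integral>x. \<psi>' x \<partial>lborel)" by simp
  finally show ?thesis by simp
qed

text \<open>Dominated convergence along sequences; by the mean value theorem the bound w on the
  derivative also bounds the difference quotients.\<close>

lemma has_real_derivative_integral:
  fixes f f' :: "real \<Rightarrow> 'a \<Rightarrow> real"
  assumes der: "\<And>t x. ((\<lambda>t. f t x) has_real_derivative f' t x) (at t)"
    and int: "\<And>t. integrable M (f t)" and w: "integrable M w"
    and meas: "f' 0 \<in> borel_measurable M"
    and le: "\<And>t x. \<bar>t\<bar> \<le> 1 \<Longrightarrow> \<bar>f' t x\<bar> \<le> w x"
  shows "((\<lambda>t. \<integral>x. f t x \<partial>M) has_real_derivative (\<integral>x. f' 0 x \<partial>M)) (at 0)"
  unfolding has_field_derivative_iff tendsto_at_iff_sequentially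
proof (intro allI impI)
  fix X :: "nat \<Rightarrow> real"
  assume X: "\<forall>i. X i \<in> UNIV - {0}" "X \<longlonglongrightarrow> 0"
  have "eventually (\<lambda>n. \<bar>X n\<bar> < 1) sequentially"
    using order_tendstoD(2)[OF tendsto_rabs_zero[OF X(2)], of 1] by simp
  \<comment> \<open>From N on the increments stay in [-1, 1], where \<open>le\<close> gives the
    bound.\<close>
  then obtain N where N: "\<And>n. n \<ge> N \<Longrightarrow> \<bar>X n\<bar> < 1" by (auto simp: eventually_sequentially)
  define Y where "Y n = X (n + N)" for n
  have Y: "Y n \<noteq> 0" "\<bar>Y n\<bar> \<le> 1" for n using X(1) N[of "n + N"] by (auto simp: Y_def)
  have Yl: "Y \<longlonglongrightarrow> 0" unfolding Y_def using X(2) by (rule LIMSEQ_ignore_initial_segment)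
  have fm: "f t \<in> borel_measurable M" for t using int[of t] by auto
  have "(\<lambda>n. \<integral>x. (f (Y n) x - f 0 x) / Y n \<partial>M) \<longlonglongrightarrow> (\<integral>x. f' 0 x \<partial>M)"
  proof (rule integral_dominated_convergence[OF meas _ w])
    show "(\<lambda>x. (f (Y n) x - f 0 x) / Y n) \<in> borel_measurable M" for n using fm by measurable
    show "AE x in M. (\<lambda>n. (f (Y n) x - f 0 x) / Y n) \<longlonglongrightarrow> f' 0 x"
    proof (rule AE_I2)
      fix x
      have "((\<lambda>h. (f h x - f 0 x) / h) \<longlongrightarrow> f' 0 x) (at 0)"
        using der[of x 0] by (simp add: has_field_derivative_iff)
      then show "(\<lambda>n. (f (Y n) x - f 0 x) / Y n) \<longlonglongrightarrow> f' 0 x"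
        using Y(1) Yl by (auto simp: tendsto_at_iff_sequentially o_def)
    qed
    show "AE x in M. norm ((f (Y n) x - f 0 x) / Y n) \<le> w x" for n
    proof (rule AE_I2)
      fix x
      have "norm (f (Y n) x - f 0 x) \<le> w x * norm (Y n - 0)"
        by (rule field_differentiable_bound[of "{-1..1}" "\<lambda>t. f t x" "\<lambda>t. f' t x"])
          (use der le Y in \<open>auto intro: has_field_derivative_at_within simp: abs_le_iff\<close>)
      then show "norm ((f (Y n) x - f 0 x) / Y n) \<le> w x"
        using Y(1)[of n] by (simp add: divide_le_eq)
    qed
  qed
  then have "(\<lambda>n. ((\<integral>x. f (Y n) x \<partial>M) - (\<integral>x. f 0 x \<partial>M)) / (Y n - 0)) \<longlonglongrightarrow> (\<integral>x. f' 0 x \<partial>M)"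
    using int by simp
  then show "((\<lambda>y. ((\<integral>x. f y x \<partial>M) - (\<integral>x. f 0 x \<partial>M)) / (y - 0)) \<circ> X) \<longlonglongrightarrow> (\<integral>x. f' 0 x \<partial>M)"
    unfolding Y_def o_def by (rule LIMSEQ_offset)
qed

text \<open>\<open>G\<close> is the possibly improper prior of \<open>\<theta>\<close>. The wider kernel in \<open>upper\<close> leaves room for polynomial
  factors; \<open>lower\<close> bounds the tails of the marginal density from below.\<close>

locale gauss_prior =
  fixes G :: "(real^'p) measure" and K c \<kappa> :: real
  assumes sets_G [measurable_cong]: "sets G = sets borel"
    and sigma_finite_G: "sigma_finite_measure G"
    and upper: "\<And>x. (\<integral>\<^sup>+\<theta>. ennreal (exp (- ((norm (x - \<theta>))\<^sup>2 / 8))) \<partial>G) \<le> ennreal K"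
    and c_pos: "c > 0" and kappa: "\<kappa> \<ge> 0"
    and lower: "\<And>x. ennreal (c * (1 + (norm x)\<^sup>2) powr - \<kappa>) \<le> (\<integral>\<^sup>+\<theta>. ennreal (gauss (x - \<theta>)) \<partial>G)"
begin

sublocale G: sigma_finite_measure G by (rule sigma_finite_G)

definition marg :: "real^'p \<Rightarrow> real" where
  "marg x = (\<integral>\<theta>. gauss (x - \<theta>) \<partial>G)"

text \<open>The gradient of \<open>marg\<close> itself, not of its logarithm.\<close>

definition score :: "real^'p \<Rightarrow> real^'p" where
  "score x = (\<integral>\<theta>. gauss (x - \<theta>) *\<^sub>R (\<theta> - x) \<partial>G)"

definition bayes :: "real^'p \<Rightarrow> real^'p" where
  "bayes x = (1 / marg x) *\<^sub>R (\<integral>\<theta>. gauss (x - \<theta>) *\<^sub>R \<theta> \<partial>G)"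

lemma space_G [simp]: "space G = UNIV"
  using sets_eq_imp_space_eq[OF sets_G] by simp

lemma measurable_G_iff: "measurable G = measurable borel"
  by (intro ext measurable_cong_sets sets_G refl)

lemma integrable_exp8: "integrable G (\<lambda>\<theta>. exp (- ((norm (x - \<theta>))\<^sup>2 / 8)))"
proof (rule integrableI_bounded)
  have "(\<integral>\<^sup>+\<theta>. ennreal (norm (exp (- ((norm (x - \<theta>))\<^sup>2 / 8)))) \<partial>G) \<le> ennreal K" using upper[of x] by simp
  then show "(\<integral>\<^sup>+\<theta>. ennreal (norm (exp (- ((norm (x - \<theta>))\<^sup>2 / 8)))) \<partial>G) < \<infinity>"
    by (rule le_less_trans) simp
qed simp

text \<open>Fourth powers suffice: the highest moment used later is |\<theta> - \<theta>'|^2 times a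
  weight that grows like its square. They are absorbed by passing to the wider kernel of
  \<open>upper\<close>.\<close>

lemma integrable_gauss:
  fixes f :: "real^'p \<Rightarrow> 'b::{banach, second_countable_topology}"
  assumes [measurable]: "f \<in> borel_measurable borel" and le: "\<And>\<theta>. norm (f \<theta>) \<le> B * (1 + norm (x - \<theta>) ^ 4)"
  shows "integrable G (\<lambda>\<theta>. gauss (x - \<theta>) *\<^sub>R f \<theta>)"
    and "norm (gauss (x - \<theta>) *\<^sub>R f \<theta>) \<le> B * 33 * exp (- ((norm (x - \<theta>))\<^sup>2 / 4))"
proof -
  have B: "B \<ge> 0" using order_trans[OF norm_ge_zero le[of x]] by simp
  have le4: "norm (gauss (x - \<theta>) *\<^sub>R f \<theta>) \<le> B * 33 * exp (- ((norm (x - \<theta>))\<^sup>2 / 4))" for \<theta>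
  proof -
    have "norm (gauss (x - \<theta>) *\<^sub>R f \<theta>) \<le> gauss (x - \<theta>) * (B * (1 + norm (x - \<theta>) ^ 4))"
      using mult_left_mono[OF le gauss_nonneg, of "x - \<theta>" \<theta>] by (simp add: gauss_nonneg)
    also have "\<dots> = B * (gauss (x - \<theta>) * (1 + norm (x - \<theta>) ^ 4))" by simp
    also have "\<dots> \<le> B * (33 * exp (- ((norm (x - \<theta>))\<^sup>2 / 4)))"
      by (rule mult_left_mono[OF gauss_poly_le B])
    finally show ?thesis by (simp only: mult.assoc)
  qed
  then show "norm (gauss (x - \<theta>) *\<^sub>R f \<theta>) \<le> B * 33 * exp (- ((norm (x - \<theta>))\<^sup>2 / 4))" .
  show "integrable G (\<lambda>\<theta>. gauss (x - \<theta>) *\<^sub>R f \<theta>)"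
  proof (rule Bochner_Integration.integrable_bound[OF integrable_mult_right[OF integrable_exp8, of "B * 33" x]])
    have "norm (gauss (x - \<theta>) *\<^sub>R f \<theta>) \<le> norm (B * 33 * exp (- ((norm (x - \<theta>))\<^sup>2 / 8)))" for \<theta>
    proof -
      have "B * 33 * exp (- ((norm (x - \<theta>))\<^sup>2 / 4)) \<le> B * 33 * exp (- ((norm (x - \<theta>))\<^sup>2 / 8))"
        using B by (intro mult_left_mono) auto
      then show ?thesis using le4[of \<theta>] B by simp
    qed
    then show "AE \<theta> in G. norm (gauss (x - \<theta>) *\<^sub>R f \<theta>) \<le> norm (B * 33 * exp (- ((norm (x - \<theta>))\<^sup>2 / 8)))" by simp
  qed simp
qed

lemma le_one_plus_pow4: "t \<le> 1 + t ^ 4" if "t \<ge> 0" for t :: real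
proof (cases "t \<le> 1")
  case False
  then have "t ^ 1 \<le> t ^ 4" by (intro power_increasing) auto
  then show ?thesis by simp
qed (use that in \<open>simp add: add_increasing2\<close>)

lemma integrable_gauss_1: "integrable G (\<lambda>\<theta>. gauss (x - \<theta>))"
  using integrable_gauss(1)[of "\<lambda>_. 1 :: real" 1 x] by simp

lemma integrable_gauss_diff: "integrable G (\<lambda>\<theta>. gauss (x - \<theta>) *\<^sub>R (\<theta> - x))"
  using le_one_plus_pow4[of "norm (x - \<theta>)" for \<theta>]
  by (intro integrable_gauss[where B=1]) (auto simp: norm_minus_commute)

lemma integrable_gauss_id: "integrable G (\<lambda>\<theta>. gauss (x - \<theta>) *\<^sub>R \<theta>)"
  using Bochner_Integration.integrable_add[OF integrable_gauss_diff[of x] integrable_scaleR_left[OF integrable_gauss_1, of x x]]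
  by (simp add: scaleR_diff_right)

lemma nn_marg: "(\<integral>\<^sup>+\<theta>. ennreal (gauss (x - \<theta>)) \<partial>G) = ennreal (marg x)"
  unfolding marg_def by (rule nn_integral_eq_integral[OF integrable_gauss_1]) (simp add: gauss_nonneg)

lemma marg_nonneg: "0 \<le> marg x"
  unfolding marg_def by (simp add: gauss_nonneg)

lemma marg_ge: "c * (1 + (norm x)\<^sup>2) powr - \<kappa> \<le> marg x"
  using lower[of x] by (simp add: nn_marg marg_nonneg)

lemma marg_pos: "marg x > 0"
proof -
  have "1 + (norm x)\<^sup>2 > 0" by (simp add: add_pos_nonneg)
  then have "0 < c * (1 + (norm x)\<^sup>2) powr - \<kappa>" using c_pos by simp
  then show ?thesis using marg_ge[of x] by linarith
qed

lemma inverse_marg_le: "1 / marg x \<le> (1 / c) * (1 + (norm x)\<^sup>2) powr \<kappa>"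
proof -
  have p: "1 + (norm x)\<^sup>2 > 0" by (simp add: add_pos_nonneg)
  have "1 / marg x \<le> 1 / (c * (1 + (norm x)\<^sup>2) powr - \<kappa>)"
    using marg_ge[of x] marg_pos[of x] c_pos p by (intro divide_left_mono) auto
  also have "\<dots> = (1 / c) * (1 + (norm x)\<^sup>2) powr \<kappa>"
    using p by (simp add: powr_minus divide_simps)
  finally show ?thesis .
qed

lemma bayes_score: "bayes x = x + (1 / marg x) *\<^sub>R score x"
proof -
  have "score x = (\<integral>\<theta>. gauss (x - \<theta>) *\<^sub>R \<theta> - gauss (x - \<theta>) *\<^sub>R x \<partial>G)"
    by (simp add: score_def scaleR_diff_right)
  also have "\<dots> = (\<integral>\<theta>. gauss (x - \<theta>) *\<^sub>R \<theta> \<partial>G) - marg x *\<^sub>R x"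
    unfolding marg_def
    by (subst Bochner_Integration.integral_diff[OF integrable_gauss_id integrable_scaleR_left[OF integrable_gauss_1]])
      (simp add: integrable_gauss_1)
  finally show ?thesis
    using marg_pos[of x] by (simp add: bayes_def scaleR_diff_right)
qed

text \<open>\<open>ennreal\<close> sends a negative K to 0, which would force the marginal density
  to vanish.\<close>

lemma K_nonneg: "0 \<le> K"
proof (rule ccontr)
  assume "\<not> 0 \<le> K"
  then have "(\<integral>\<^sup>+\<theta>. ennreal (exp (- ((norm (0 - \<theta>))\<^sup>2 / 8))) \<partial>G) \<le> 0" using upper[of 0] by (simp add: ennreal_neg)
  moreover have "(\<integral>\<^sup>+\<theta>. ennreal (gauss (0 - \<theta>)) \<partial>G) \<le> (\<integral>\<^sup>+\<theta>. ennreal (exp (- ((norm (0 - \<theta>))\<^sup>2 / 8))) \<partial>G)"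
    by (intro nn_integral_mono ennreal_leI) (simp add: gauss_def)
  ultimately show False using marg_pos[of 0] nn_marg[of 0] by simp
qed

lemma integral_exp8_le: "(\<integral>\<theta>. exp (- ((norm (x - \<theta>))\<^sup>2 / 8)) \<partial>G) \<le> K"
proof -
  have "ennreal (\<integral>\<theta>. exp (- ((norm (x - \<theta>))\<^sup>2 / 8)) \<partial>G) \<le> ennreal K"
    using upper[of x] nn_integral_eq_integral[OF integrable_exp8[of x]] by simp
  then show ?thesis using K_nonneg by (simp add: ennreal_le_iff)
qed

lemma norm_score_le: "norm (score x) \<le> 33 * K"
proof -
  have "norm (score x) \<le> (\<integral>\<theta>. norm (gauss (x - \<theta>) *\<^sub>R (\<theta> - x)) \<partial>G)"
    unfolding score_def by (rule integral_norm_bound)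
  also have "\<dots> \<le> (\<integral>\<theta>. 33 * exp (- ((norm (x - \<theta>))\<^sup>2 / 8)) \<partial>G)"
  proof (rule integral_mono)
    show "norm (gauss (x - \<theta>) *\<^sub>R (\<theta> - x)) \<le> 33 * exp (- ((norm (x - \<theta>))\<^sup>2 / 8))" for \<theta>
    proof -
      have "norm (gauss (x - \<theta>) *\<^sub>R (\<theta> - x)) \<le> 1 * 33 * exp (- ((norm (x - \<theta>))\<^sup>2 / 4))"
        using le_one_plus_pow4[of "norm (x - \<theta>)" for \<theta>]
        by (intro integrable_gauss(2)[of "\<lambda>\<theta>. \<theta> - x"]) (auto simp: norm_minus_commute)
      also have "\<dots> \<le> 33 * exp (- ((norm (x - \<theta>))\<^sup>2 / 8))" by simp
      finally show ?thesis .
    qed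
  qed (rule integrable_norm[OF integrable_gauss_diff], rule integrable_mult_right[OF integrable_exp8])
  also have "\<dots> \<le> 33 * K" using integral_exp8_le[of x] by simp
  finally show ?thesis .
qed

text \<open>Gaussian kernels at nearby centres are dominated by one wider kernel, which justifies limits under the integral.\<close>

lemma exp_quarter_shift:
  fixes x y \<theta> :: "real^'p"
  assumes "norm (y - x) \<le> 1"
  shows "exp (- ((norm (y - \<theta>))\<^sup>2 / 4)) \<le> exp (1/4) * exp (- ((norm (x - \<theta>))\<^sup>2 / 8))"
proof -
  let ?a = "norm (x - y)" and ?b = "norm (y - \<theta>)"
  have "norm (x - \<theta>) \<le> ?a + ?b" using norm_triangle_ineq[of "x - y" "y - \<theta>"] by simp
  then have "(norm (x - \<theta>))\<^sup>2 \<le> (?a + ?b)\<^sup>2" by (intro power_mono) auto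
  also have "\<dots> \<le> 2 * ?a\<^sup>2 + 2 * ?b\<^sup>2"
    using sum_squares_bound[of ?a ?b] by (simp add: power2_sum)
  also have "?a\<^sup>2 \<le> 1" using assms by (simp add: power_le_one norm_minus_commute)
  finally show ?thesis by (simp add: exp_add[symmetric])
qed

lemma continuous_integral_gauss:
  fixes f :: "real^'p \<Rightarrow> real^'p \<Rightarrow> 'b::{banach, second_countable_topology}"
  assumes cont: "\<And>\<theta>. continuous_on UNIV (\<lambda>x. f x \<theta>)" and meas: "\<And>x. f x \<in> borel_measurable borel"
    and le: "\<And>x \<theta>. norm (f x \<theta>) \<le> B * (1 + norm (x - \<theta>) ^ 4)"
  shows "continuous_on UNIV (\<lambda>x. \<integral>\<theta>. gauss (x - \<theta>) *\<^sub>R f x \<theta> \<partial>G)"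
proof (rule continuous_on_sequentiallyI)
  fix u :: "nat \<Rightarrow> real^'p" and x
  assume u: "u \<longlonglongrightarrow> x"
  have B: "B \<ge> 0" using order_trans[OF norm_ge_zero le[of 0 0]] by simp
  have "eventually (\<lambda>n. norm (u n - x) < 1) sequentially"
    using tendstoD[OF u, of 1] by (simp add: dist_norm)
  then obtain N where N: "\<And>n. n \<ge> N \<Longrightarrow> norm (u n - x) < 1" by (auto simp: eventually_sequentially)
  have "(\<lambda>n. \<integral>\<theta>. gauss (u (n + N) - \<theta>) *\<^sub>R f (u (n + N)) \<theta> \<partial>G) \<longlonglongrightarrow> (\<integral>\<theta>. gauss (x - \<theta>) *\<^sub>R f x \<theta> \<partial>G)"
  proof (rule integral_dominated_convergence[where w="\<lambda>\<theta>. B * 33 * exp (1/4) * exp (- ((norm (x - \<theta>))\<^sup>2 / 8))"])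
    show "AE \<theta> in G. (\<lambda>n. gauss (u (n + N) - \<theta>) *\<^sub>R f (u (n + N)) \<theta>) \<longlonglongrightarrow> gauss (x - \<theta>) *\<^sub>R f x \<theta>"
    proof (rule AE_I2)
      fix \<theta>
      have "continuous_on UNIV (\<lambda>x. gauss (x - \<theta>) *\<^sub>R f x \<theta>)" by (intro continuous_intros cont)
      moreover have "(\<lambda>n. u (n + N)) \<longlonglongrightarrow> x" by (rule LIMSEQ_ignore_initial_segment[OF u])
      ultimately show "(\<lambda>n. gauss (u (n + N) - \<theta>) *\<^sub>R f (u (n + N)) \<theta>) \<longlonglongrightarrow> gauss (x - \<theta>) *\<^sub>R f x \<theta>"
        by (rule continuous_on_tendsto_compose) auto
    qed
    show "AE \<theta> in G. norm (gauss (u (n + N) - \<theta>) *\<^sub>R f (u (n + N)) \<theta>) \<le> B * 33 * exp (1/4) * exp (- ((norm (x - \<theta>))\<^sup>2 / 8))" for n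
    proof (rule AE_I2)
      fix \<theta>
      have "norm (gauss (u (n + N) - \<theta>) *\<^sub>R f (u (n + N)) \<theta>) \<le> B * 33 * exp (- ((norm (u (n + N) - \<theta>))\<^sup>2 / 4))"
        by (rule integrable_gauss(2)[OF meas le])
      also have "\<dots> \<le> B * 33 * (exp (1/4) * exp (- ((norm (x - \<theta>))\<^sup>2 / 8)))"
        using B N[of "n + N"] by (intro mult_left_mono exp_quarter_shift) auto
      finally show "norm (gauss (u (n + N) - \<theta>) *\<^sub>R f (u (n + N)) \<theta>) \<le> B * 33 * exp (1/4) * exp (- ((norm (x - \<theta>))\<^sup>2 / 8))"
        by (simp only: mult.assoc)
    qed
  qed (use meas in \<open>auto intro!: integrable_mult_right integrable_exp8 borel_measurable_scaleR simp: measurable_G_iff\<close>)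
  then show "(\<lambda>n. \<integral>\<theta>. gauss (u n - \<theta>) *\<^sub>R f (u n) \<theta> \<partial>G) \<longlonglongrightarrow> (\<integral>\<theta>. gauss (x - \<theta>) *\<^sub>R f x \<theta> \<partial>G)"
    by (rule LIMSEQ_offset)
qed

lemma continuous_marg: "continuous_on UNIV marg"
  using continuous_integral_gauss[of "\<lambda>_ _. 1 :: real" 1] by (simp add: marg_def[abs_def])

lemma continuous_score: "continuous_on UNIV score"
  unfolding score_def[abs_def]
  by (rule continuous_integral_gauss[where B=1])
    (use le_one_plus_pow4[OF norm_ge_zero] in \<open>auto simp: norm_minus_commute intro!: continuous_intros\<close>)

lemma continuous_bayes: "continuous_on UNIV bayes"
  unfolding bayes_score[abs_def]
  using marg_pos by (intro continuous_intros continuous_marg continuous_score) (auto simp: less_imp_neq[THEN not_sym])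

lemma bayes_measurable [measurable]: "bayes \<in> borel_measurable borel"
  by (rule borel_measurable_continuous_onI[OF continuous_bayes])

lemma marg_measurable [measurable]: "marg \<in> borel_measurable borel"
  by (rule borel_measurable_continuous_onI[OF continuous_marg])

lemma gauss_line_derivative:
  "((\<lambda>t. gauss (x + t *\<^sub>R axis i 1)) has_real_derivative - (x + t *\<^sub>R axis i 1) $ i * gauss (x + t *\<^sub>R axis i 1)) (at t)"
  for x :: "real^'q"
proof -
  have n: "(norm (x + t *\<^sub>R axis i 1))\<^sup>2 = (norm x)\<^sup>2 + 2 * t * x $ i + t\<^sup>2" for t
    unfolding power2_norm_eq_inner
    by (simp add: inner_simps inner_axis inner_axis' power2_eq_square algebra_simps)
  have "((\<lambda>t. exp (- (((norm x)\<^sup>2 + 2 * t * x $ i + t\<^sup>2) / 2))) has_real_derivative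
     - (x $ i + t) * exp (- (((norm x)\<^sup>2 + 2 * t * x $ i + t\<^sup>2) / 2))) (at t)"
    by (auto intro!: derivative_eq_intros simp: algebra_simps)
  then show ?thesis unfolding gauss_def n by (simp add: axis_def)
qed

text \<open>Differentiation under the integral; increments with |t| <= 1 are dominated by the wider
  kernel centred at x.\<close>

lemma marg_line_derivative:
  "((\<lambda>t. marg (x + t *\<^sub>R axis i 1)) has_real_derivative score x $ i) (at 0)"
proof -
  let ?y = "\<lambda>t. x + t *\<^sub>R axis i 1"
  have "((\<lambda>t. \<integral>\<theta>. gauss (?y t - \<theta>) \<partial>G) has_real_derivative (\<integral>\<theta>. - (?y 0 - \<theta>) $ i * gauss (?y 0 - \<theta>) \<partial>G)) (at 0)"
  proof (rule has_real_derivative_integral[where w="\<lambda>\<theta>. 33 * exp (1/4) * exp (- ((norm (x - \<theta>))\<^sup>2 / 8))"])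
    show "((\<lambda>t. gauss (?y t - \<theta>)) has_real_derivative - (?y t - \<theta>) $ i * gauss (?y t - \<theta>)) (at t)" for t \<theta>
      using gauss_line_derivative[of "x - \<theta>" i t] by (simp add: algebra_simps)
    show "integrable G (\<lambda>\<theta>. gauss (?y t - \<theta>))" for t by (rule integrable_gauss_1)
    show "integrable G (\<lambda>\<theta>. 33 * exp (1/4) * exp (- ((norm (x - \<theta>))\<^sup>2 / 8)))"
      by (intro integrable_mult_right integrable_exp8)
    show "(\<lambda>\<theta>. - (?y 0 - \<theta>) $ i * gauss (?y 0 - \<theta>)) \<in> borel_measurable G" by measurable
    show "\<bar>- (?y t - \<theta>) $ i * gauss (?y t - \<theta>)\<bar> \<le> 33 * exp (1/4) * exp (- ((norm (x - \<theta>))\<^sup>2 / 8))"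
      if "\<bar>t\<bar> \<le> 1" for t \<theta>
    proof -
      have "\<bar>- (?y t - \<theta>) $ i * gauss (?y t - \<theta>)\<bar> \<le> norm (gauss (?y t - \<theta>) *\<^sub>R (?y t - \<theta>))"
        using mult_right_mono[OF component_le_norm_cart[of "?y t - \<theta>" i] gauss_nonneg[of "?y t - \<theta>"]]
        by (simp only: abs_mult abs_minus_cancel norm_scaleR abs_of_nonneg[OF gauss_nonneg] mult.commute)
      also have "\<dots> \<le> 1 * 33 * exp (- ((norm (?y t - \<theta>))\<^sup>2 / 4))"
        using le_one_plus_pow4[OF norm_ge_zero]
        by (intro integrable_gauss(2)[where f="\<lambda>\<theta>. ?y t - \<theta>"]) auto
      also have "\<dots> \<le> 1 * 33 * (exp (1/4) * exp (- ((norm (x - \<theta>))\<^sup>2 / 8)))"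
        using that by (intro mult_left_mono exp_quarter_shift) auto
      finally show ?thesis by simp
    qed
  qed
  moreover have "(\<integral>\<theta>. - (?y 0 - \<theta>) $ i * gauss (?y 0 - \<theta>) \<partial>G) = score x $ i"
  proof -
    have "score x $ i = (\<integral>\<theta>. (gauss (x - \<theta>) *\<^sub>R (\<theta> - x)) $ i \<partial>G)"
      unfolding score_def
      by (rule integral_bounded_linear[OF bounded_linear_vec_nth integrable_gauss_diff, symmetric])
    then show ?thesis by (simp add: algebra_simps)
  qed
  ultimately show ?thesis by (simp add: marg_def)
qed

end

section \<open>Inadmissibility by Stein's identity\<close>

text \<open>A class closed under the operations used below and integrable against every Gaussian, so
  that integrability becomes a question of growth. The base 1 + |x|^2 is at least 1, hence its
  powers increase with the exponent.\<close>

definition poly_bounded :: "(real^'p \<Rightarrow> 'b::real_normed_vector) \<Rightarrow> bool" where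
  "poly_bounded f \<longleftrightarrow> (\<exists>B\<ge>0. \<exists>a\<ge>0. \<forall>x. norm (f x) \<le> B * (1 + (norm x)\<^sup>2) powr a)"

lemma poly_boundedI:
  assumes "\<And>x. norm (f x) \<le> B * (1 + (norm x)\<^sup>2) powr a"
  shows "poly_bounded f"
  unfolding poly_bounded_def
proof (intro exI conjI allI)
  fix x
  have "norm (f x) \<le> B * (1 + (norm x)\<^sup>2) powr a" by (rule assms)
  also have "\<dots> \<le> \<bar>B\<bar> * (1 + (norm x)\<^sup>2) powr max a 0"
    by (intro mult_mono powr_mono) auto
  finally show "norm (f x) \<le> \<bar>B\<bar> * (1 + (norm x)\<^sup>2) powr max a 0" .
qed auto

lemma poly_bounded_const: "poly_bounded (\<lambda>_. c)"
  by (rule poly_boundedI[of _ "norm c" 0]) (simp add: add_pos_nonneg less_imp_neq[THEN not_sym])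

lemma poly_bounded_id: "poly_bounded (\<lambda>x. x)"
proof (rule poly_boundedI[of _ 1 1])
  fix x :: "real^'p"
  have "2 * norm x \<le> 1 + (norm x)\<^sup>2" using sum_squares_bound[of 1 "norm x"] by simp
  then have "norm x \<le> 1 + (norm x)\<^sup>2" using norm_ge_zero[of x] by linarith
  then show "norm x \<le> 1 * (1 + (norm x)\<^sup>2) powr 1" by (simp add: add_nonneg_nonneg)
qed

lemma poly_bounded_mono:
  assumes "poly_bounded f" "\<And>x. norm (g x) \<le> C * norm (f x)" "C \<ge> 0"
  shows "poly_bounded g"
proof -
  obtain B a where "B \<ge> 0" and f: "\<And>x. norm (f x) \<le> B * (1 + (norm x)\<^sup>2) powr a"
    using assms(1) by (auto simp: poly_bounded_def)
  have "norm (g x) \<le> (C * B) * (1 + (norm x)\<^sup>2) powr a" for x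
    using order_trans[OF assms(2) mult_left_mono[OF f assms(3)]] by (simp add: mult.assoc)
  then show ?thesis by (rule poly_boundedI)
qed

lemma poly_bounded_add:
  assumes "poly_bounded f" "poly_bounded g"
  shows "poly_bounded (\<lambda>x. f x + g x)"
proof -
  obtain B a where B: "B \<ge> 0" "\<And>x. norm (f x) \<le> B * (1 + (norm x)\<^sup>2) powr a"
    using assms(1) by (auto simp: poly_bounded_def)
  obtain C b where C: "C \<ge> 0" "\<And>x. norm (g x) \<le> C * (1 + (norm x)\<^sup>2) powr b"
    using assms(2) by (auto simp: poly_bounded_def)
  have "norm (f x + g x) \<le> (B + C) * (1 + (norm x)\<^sup>2) powr max a b" for x
  proof -
    have "norm (f x) \<le> B * (1 + (norm x)\<^sup>2) powr max a b"
      using B(2)[of x] by (rule order_trans) (intro mult_left_mono powr_mono B, auto)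
    moreover have "norm (g x) \<le> C * (1 + (norm x)\<^sup>2) powr max a b"
      using C(2)[of x] by (rule order_trans) (intro mult_left_mono powr_mono C, auto)
    ultimately show ?thesis
      using norm_triangle_ineq[of "f x" "g x"] by (simp add: distrib_right)
  qed
  then show ?thesis by (rule poly_boundedI)
qed

lemma poly_bounded_sum: "(\<And>i. i \<in> A \<Longrightarrow> poly_bounded (f i)) \<Longrightarrow> poly_bounded (\<lambda>x. \<Sum>i\<in>A. f i x)"
  by (induction A rule: infinite_finite_induct) (simp_all add: poly_bounded_const poly_bounded_add)

lemma poly_bounded_product:
  assumes "poly_bounded f" "poly_bounded g" "\<And>x. norm (h x) \<le> norm (f x) * norm (g x)"
  shows "poly_bounded h"
proof -
  obtain B a where B: "B \<ge> 0" "\<And>x. norm (f x) \<le> B * (1 + (norm x)\<^sup>2) powr a"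
    using assms(1) by (auto simp: poly_bounded_def)
  obtain C b where C: "C \<ge> 0" "\<And>x. norm (g x) \<le> C * (1 + (norm x)\<^sup>2) powr b"
    using assms(2) by (auto simp: poly_bounded_def)
  have "norm (h x) \<le> (B * C) * (1 + (norm x)\<^sup>2) powr (a + b)" for x
  proof -
    have "norm (h x) \<le> (B * (1 + (norm x)\<^sup>2) powr a) * (C * (1 + (norm x)\<^sup>2) powr b)"
      using assms(3)[of x] by (rule order_trans) (intro mult_mono B C, auto simp: B(1))
    then show ?thesis by (simp add: powr_add mult_ac)
  qed
  then show ?thesis by (rule poly_boundedI)
qed

lemma poly_bounded_mult:
  fixes f g :: "real^'p \<Rightarrow> real"
  shows "poly_bounded f \<Longrightarrow> poly_bounded g \<Longrightarrow> poly_bounded (\<lambda>x. f x * g x)"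
  using poly_bounded_product[of f g "\<lambda>x. f x * g x"] by (simp add: abs_mult)

lemma poly_bounded_scaleR:
  "poly_bounded f \<Longrightarrow> poly_bounded g \<Longrightarrow> poly_bounded (\<lambda>x. f x *\<^sub>R g x)"
  using poly_bounded_product[of f g "\<lambda>x. f x *\<^sub>R g x"] by simp

lemma poly_bounded_inner:
  "poly_bounded f \<Longrightarrow> poly_bounded g \<Longrightarrow> poly_bounded (\<lambda>x. f x \<bullet> g x)"
  using poly_bounded_product[of f g "\<lambda>x. f x \<bullet> g x"] by (simp add: Cauchy_Schwarz_ineq2)

lemma poly_bounded_minus: "poly_bounded f \<Longrightarrow> poly_bounded (\<lambda>x. - f x)"
  by (erule poly_bounded_mono[of _ _ 1]) auto

lemma poly_bounded_diff:
  "poly_bounded f \<Longrightarrow> poly_bounded g \<Longrightarrow> poly_bounded (\<lambda>x. f x - g x)"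
  using poly_bounded_add[of f "\<lambda>x. - g x"] by (auto simp: poly_bounded_minus)

lemma poly_bounded_component: "poly_bounded f \<Longrightarrow> poly_bounded (\<lambda>x. f x $ i :: real)"
  by (erule poly_bounded_mono[of _ _ 1]) (auto simp: component_le_norm_cart)

lemma poly_bounded_matrix: "poly_bounded f \<Longrightarrow> poly_bounded (\<lambda>x. (A :: real^'n^'m) *v f x)"
  by (erule poly_bounded_mono[of _ _ "norm A"]) (auto simp: norm_matrix_vector_mult_le)

lemmas poly_bounded_intros = poly_bounded_const poly_bounded_id poly_bounded_add poly_bounded_sum
  poly_bounded_mult poly_bounded_scaleR poly_bounded_inner poly_bounded_minus poly_bounded_diff
  poly_bounded_component poly_bounded_matrix

lemma integrable_gauss_poly_bounded:
  fixes f :: "real^'p \<Rightarrow> 'b::{banach, second_countable_topology}"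
  assumes "f \<in> borel_measurable borel" "poly_bounded f"
  shows "integrable lborel (\<lambda>x. gauss (x - \<theta>) *\<^sub>R f x)"
  using assms by (auto simp: poly_bounded_def intro: integrable_poly_gauss)

lemma matrix_vector_mult_measurable [measurable]:
  "f \<in> borel_measurable M \<Longrightarrow> (\<lambda>x. (A :: real^'n^'m) *v f x) \<in> borel_measurable M"
  by (rule measurable_compose[where g="(*v) A"])
    (auto intro!: borel_measurable_continuous_onI linear_continuous_on)

section \<open>Risk as a Gaussian integral\<close>

lemma risk_eq:
  fixes \<delta> :: "real^'p \<Rightarrow> real^'p"
  assumes [measurable]: "\<delta> \<in> borel_measurable borel"
  shows "risk Q \<theta> \<delta> = (\<integral>\<^sup>+x. ennreal (gauss (x - \<theta>) / sqrt ((2 * pi) ^ CARD('p))) * ennreal (quadratic_loss Q \<theta> (\<delta> x)) \<partial>lborel)"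
proof -
  have *: "mvn_density \<theta> (mat 1) x = gauss (x - \<theta>) / sqrt ((2 * pi) ^ CARD('p))" for x
    by (simp add: mvn_density_def matrix_inv_mat_1 gauss_def power2_norm_eq_inner)
  have [measurable]: "(\<lambda>x. quadratic_loss Q \<theta> (\<delta> x)) \<in> borel_measurable borel"
    unfolding quadratic_loss_def by measurable
  show ?thesis unfolding risk_def mvn_def * by (subst nn_integral_density) auto
qed

lemma positive_definite_loss_nonneg: "positive_definite Q \<Longrightarrow> 0 \<le> quadratic_loss Q \<theta> d"
  unfolding quadratic_loss_def positive_definite_def by (cases "\<theta> - d = 0") (auto intro: less_imp_le)

lemma risk_poly_bounded:
  fixes \<delta> :: "real^'p \<Rightarrow> real^'p"
  assumes [measurable]: "\<delta> \<in> borel_measurable borel" and pb: "poly_bounded \<delta>" and Q: "positive_definite Q"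
  shows "integrable lborel (\<lambda>x. gauss (x - \<theta>) * quadratic_loss Q \<theta> (\<delta> x))"
    and "risk Q \<theta> \<delta> = ennreal ((\<integral>x. gauss (x - \<theta>) * quadratic_loss Q \<theta> (\<delta> x) \<partial>lborel) / sqrt ((2 * pi) ^ CARD('p)))"
proof -
  have [measurable]: "(\<lambda>x. quadratic_loss Q \<theta> (\<delta> x)) \<in> borel_measurable borel"
    unfolding quadratic_loss_def by measurable
  have "poly_bounded (\<lambda>x. quadratic_loss Q \<theta> (\<delta> x))"
    unfolding quadratic_loss_def by (intro poly_bounded_intros pb)
  then show int: "integrable lborel (\<lambda>x. gauss (x - \<theta>) * quadratic_loss Q \<theta> (\<delta> x))"
    using integrable_gauss_poly_bounded[of "\<lambda>x. quadratic_loss Q \<theta> (\<delta> x)" \<theta>] by simp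
  let ?s = "sqrt ((2 * pi) ^ CARD('p))"
  have "risk Q \<theta> \<delta> = (\<integral>\<^sup>+x. ennreal (gauss (x - \<theta>) * quadratic_loss Q \<theta> (\<delta> x) / ?s) \<partial>lborel)"
    unfolding risk_eq[OF assms(1)] using positive_definite_loss_nonneg[OF Q]
    by (simp add: ennreal_mult'[symmetric] gauss_nonneg)
  also have "\<dots> = ennreal (\<integral>x. gauss (x - \<theta>) * quadratic_loss Q \<theta> (\<delta> x) / ?s \<partial>lborel)"
    using int positive_definite_loss_nonneg[OF Q]
    by (intro nn_integral_eq_integral) (auto simp: gauss_nonneg)
  finally show "risk Q \<theta> \<delta> = ennreal ((\<integral>x. gauss (x - \<theta>) * quadratic_loss Q \<theta> (\<delta> x) \<partial>lborel) / ?s)"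
    by simp
qed

lemma positive_definite_inverse:
  assumes "positive_definite (Q :: real^'p^'p)"
  obtains B where "Q ** B = mat 1"
proof -
  have "x = 0" if "Q *v x = 0" for x
    using assms that by (metis inner_zero_right less_irrefl positive_definite_def)
  then show ?thesis
    using that matrix_left_invertible_ker matrix_left_right_inverse by metis
qed

text \<open>A negative integrand with integral zero would vanish almost everywhere, and Lebesgue
  measure is not the null measure.\<close>

lemma lborel_integral_neg:
  fixes f :: "'a::euclidean_space \<Rightarrow> real"
  assumes f: "integrable lborel f" and neg: "\<And>x. f x < 0"
  shows "(\<integral>x. f x \<partial>lborel) < 0"
proof -
  have "(\<integral>x. - f x \<partial>lborel) \<noteq> 0"
  proof
    assume "(\<integral>x. - f x \<partial>lborel) = 0"
    then have "AE x in lborel. - f x = 0"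
      using f neg by (subst (asm) integral_nonneg_eq_0_iff_AE) (auto simp: less_imp_le)
    then have "AE x :: 'a in lborel. False"
      by (rule AE_mp) (use neg in \<open>auto simp: less_imp_neq intro!: AE_I2\<close>)
    then show False by (simp add: AE_iff_measurable[OF _ refl])
  qed
  moreover have "(\<integral>x. - f x \<partial>lborel) \<ge> 0" using neg by (intro integral_nonneg_AE) (simp add: less_imp_le)
  ultimately show ?thesis by simp
qed

section \<open>Stein's identity and the dominating estimator\<close>

context gauss_prior
begin

lemma poly_bounded_inverse_marg: "poly_bounded (\<lambda>x. 1 / marg x)"
  by (rule poly_boundedI[of _ "1 / c" \<kappa>]) (use inverse_marg_le marg_pos in \<open>simp add: less_imp_le\<close>)

lemma poly_bounded_score: "poly_bounded score"
  by (rule poly_boundedI[of _ "33 * K" 0])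
    (use norm_score_le in \<open>simp add: add_pos_nonneg less_imp_neq[THEN not_sym]\<close>)

lemma poly_bounded_bayes: "poly_bounded bayes"
  unfolding bayes_score[abs_def]
  by (intro poly_bounded_add poly_bounded_id poly_bounded_scaleR poly_bounded_inverse_marg poly_bounded_score)

lemma score_measurable [measurable]: "score \<in> borel_measurable borel"
  by (rule borel_measurable_continuous_onI[OF continuous_score])

text \<open>The i-th derivative of the Gaussian times F_i / m integrates to zero. The product rule
  yields - (x - \<theta>)_i from the Gaussian and - \<open>score\<close>_i / m from 1/m; together
  they are the i-th component of \<theta> - \<open>bayes x\<close>, so no derivative of m is
  left.\<close>

lemma stein_identity:
  fixes F :: "real^'p \<Rightarrow> real^'p"
  assumes F: "continuous_on UNIV F" "poly_bounded F"
    and dF: "\<And>i. continuous_on UNIV (dF i)" "\<And>i. poly_bounded (dF i)"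
    and der: "\<And>x i. ((\<lambda>t. F (x + t *\<^sub>R axis i 1) $ i) has_real_derivative dF i x) (at 0)"
  shows "(\<integral>x. gauss (x - \<theta>) * ((F x \<bullet> (bayes x - \<theta>)) / marg x) \<partial>lborel)
    = (\<integral>x. gauss (x - \<theta>) * ((\<Sum>i\<in>UNIV. dF i x) / marg x) \<partial>lborel)"
proof -
  have [measurable]: "F \<in> borel_measurable borel" "dF i \<in> borel_measurable borel" for i
    using F dF by (auto intro: borel_measurable_continuous_onI)
  define u where "u i x = dF i x * (1 / marg x)" for i x
  define v where "v i x = (F x $ i * (1 / marg x)) * (score x $ i * (1 / marg x) + (x - \<theta>) $ i)" for i x
  have pb: "poly_bounded (u i)" "poly_bounded (v i)" "poly_bounded (\<lambda>x. F x $ i * (1 / marg x))" for i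
    unfolding u_def v_def
    by (intro poly_bounded_intros F(2) dF(2) poly_bounded_score poly_bounded_inverse_marg)+
  have [measurable]: "u i \<in> borel_measurable borel" "v i \<in> borel_measurable borel" for i
    unfolding u_def v_def by measurable
  have int: "integrable lborel (\<lambda>x. gauss (x - \<theta>) * u i x)" "integrable lborel (\<lambda>x. gauss (x - \<theta>) * v i x)"
    "integrable lborel (\<lambda>x. gauss (x - \<theta>) * (F x $ i * (1 / marg x)))" for i
    using integrable_gauss_poly_bounded[OF _ pb(1)] integrable_gauss_poly_bounded[OF _ pb(2)]
      integrable_gauss_poly_bounded[OF _ pb(3)] by simp_all
  have "(\<integral>x. gauss (x - \<theta>) * u i x - gauss (x - \<theta>) * v i x \<partial>lborel) = 0" for i
  proof (rule integral_directional_derivative_zero[where \<psi>="\<lambda>x. gauss (x - \<theta>) * (F x $ i * (1 / marg x))" and e="axis i 1"])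
    show "continuous_on UNIV (\<lambda>x. gauss (x - \<theta>) * u i x - gauss (x - \<theta>) * v i x)"
      unfolding u_def v_def using marg_pos
      by (intro continuous_intros F dF continuous_marg continuous_score) (auto simp: less_imp_neq[THEN not_sym])
    show "((\<lambda>t. gauss (x + t *\<^sub>R axis i 1 - \<theta>) * (F (x + t *\<^sub>R axis i 1) $ i * (1 / marg (x + t *\<^sub>R axis i 1))))
        has_real_derivative gauss (x - \<theta>) * u i x - gauss (x - \<theta>) * v i x) (at 0)" for x
    proof -
      have g: "((\<lambda>t. gauss (x + t *\<^sub>R axis i 1 - \<theta>)) has_real_derivative - (x - \<theta>) $ i * gauss (x - \<theta>)) (at 0)"
        using gauss_line_derivative[of "x - \<theta>" i 0] by (simp add: algebra_simps)
      have "((\<lambda>t. gauss (x + t *\<^sub>R axis i 1 - \<theta>) * (F (x + t *\<^sub>R axis i 1) $ i * (1 / marg (x + t *\<^sub>R axis i 1))))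
        has_real_derivative
          (- (x - \<theta>) $ i * gauss (x - \<theta>)) * (F x $ i * (1 / marg x)) +
          (dF i x * (1 / marg x) + (- score x $ i / (marg x * marg x)) * F x $ i) * gauss (x - \<theta>)) (at 0)"
        using DERIV_mult[OF g DERIV_mult[OF der[of x i] DERIV_divide[OF DERIV_const marg_line_derivative[of x i], of 1]]] marg_pos[of x]
        by simp
      moreover have "(- (x - \<theta>) $ i * gauss (x - \<theta>)) * (F x $ i * (1 / marg x)) +
          (dF i x * (1 / marg x) + (- score x $ i / (marg x * marg x)) * F x $ i) * gauss (x - \<theta>)
          = gauss (x - \<theta>) * u i x - gauss (x - \<theta>) * v i x"
        using marg_pos[of x] by (simp add: u_def v_def field_simps)
      ultimately show ?thesis by simp
    qed
  qed (use int in auto)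
  then have eq: "(\<integral>x. gauss (x - \<theta>) * u i x \<partial>lborel) = (\<integral>x. gauss (x - \<theta>) * v i x \<partial>lborel)" for i
    using int by simp
  have "(\<Sum>i\<in>UNIV. v i x) = (F x \<bullet> (bayes x - \<theta>)) / marg x" for x
  proof -
    have "(\<Sum>i\<in>UNIV. v i x) = (1 / marg x) * (F x \<bullet> ((1 / marg x) *\<^sub>R score x + (x - \<theta>)))"
      by (simp add: v_def inner_vec_def sum_distrib_left mult_ac)
    moreover have "(1 / marg x) *\<^sub>R score x + (x - \<theta>) = bayes x - \<theta>" by (simp add: bayes_score)
    ultimately show ?thesis by simp
  qed
  then have "(\<integral>x. gauss (x - \<theta>) * ((F x \<bullet> (bayes x - \<theta>)) / marg x) \<partial>lborel)
      = (\<integral>x. (\<Sum>i\<in>UNIV. gauss (x - \<theta>) * v i x) \<partial>lborel)"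
    by (simp add: sum_distrib_left[symmetric])
  also have "\<dots> = (\<Sum>i\<in>UNIV. \<integral>x. gauss (x - \<theta>) * v i x \<partial>lborel)" using int by simp
  also have "\<dots> = (\<Sum>i\<in>UNIV. \<integral>x. gauss (x - \<theta>) * u i x \<partial>lborel)" by (simp add: eq)
  also have "\<dots> = (\<integral>x. (\<Sum>i\<in>UNIV. gauss (x - \<theta>) * u i x) \<partial>lborel)" using int by simp
  also have "\<dots> = (\<integral>x. gauss (x - \<theta>) * ((\<Sum>i\<in>UNIV. dF i x) / marg x) \<partial>lborel)"
    by (simp add: u_def sum_distrib_left sum_divide_distrib)
  finally show ?thesis .
qed

lemma inadmissible_bayes:
  fixes Q :: "real^'p^'p"
  assumes Q: "positive_definite Q" and dim: "2 * \<kappa> + 2 < real CARD('p)"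
  shows "inadmissible Q bayes"
proof -
  obtain B where QB: "Q ** B = mat 1" using positive_definite_inverse[OF Q] .
  \<comment> \<open>In the quadratic term 1/m contributes at most order w^\<kappa> and |F|^2 order
    w^(1 - 2q); with q = \<kappa> + 1 the product has order w^(-q), the order of the
    divergence.\<close>
  define q where "q = \<kappa> + 1"
  define n where "n = real CARD('p)"
  have q: "2 * q < n" "q > 0" using dim kappa by (simp_all add: q_def n_def)
  \<comment> \<open>Small enough that the quadratic term stays below \<epsilon> (n - 2q) w^(-q),
    half of what the divergence term takes away.\<close>
  define \<epsilon> where "\<epsilon> = (n - 2 * q) * c / (norm B + 1)"
  have eps: "\<epsilon> > 0" using q c_pos by (simp add: \<epsilon>_def add_nonneg_pos)
  define w where "w x = 1 + (norm x)\<^sup>2" for x :: "real^'p"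
  have w: "w x \<ge> 1" "w x > 0" "w x \<noteq> 0" for x by (simp_all add: w_def add_pos_nonneg less_imp_neq[THEN not_sym])
  define F where "F x = (- \<epsilon> * w x powr - q) *\<^sub>R x" for x :: "real^'p"
  define dF where "dF i x = - \<epsilon> * (w x powr - q - 2 * q * (x $ i)\<^sup>2 * w x powr (- q - 1))" for i and x :: "real^'p"
  have cw: "continuous_on UNIV w" unfolding w_def by (intro continuous_intros)
  have pw: "poly_bounded (\<lambda>x. w x powr a)" for a
    by (rule poly_boundedI[of _ 1 a]) (simp add: w_def)
  have F: "continuous_on UNIV F" "poly_bounded F"
    unfolding F_def using w by (intro continuous_intros cw poly_bounded_intros pw; simp)+
  have dFc: "continuous_on UNIV (dF i)" for i
    unfolding dF_def using w by (auto intro!: continuous_intros cw)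
  have dFp: "poly_bounded (dF i)" for i
    unfolding dF_def power2_eq_square
    by (intro poly_bounded_mult poly_bounded_diff poly_bounded_const poly_bounded_component poly_bounded_id pw)
  have der: "((\<lambda>t. F (x + t *\<^sub>R axis i 1) $ i) has_real_derivative dF i x) (at 0)" for x i
  proof -
    have nm: "w (x + t *\<^sub>R axis i 1) = w x + 2 * t * x $ i + t\<^sup>2" for t
      unfolding w_def power2_norm_eq_inner
      by (simp add: inner_simps inner_axis inner_axis' power2_eq_square algebra_simps)
    have d1: "((\<lambda>t. w x + 2 * t * x $ i + t\<^sup>2) has_real_derivative 2 * x $ i) (at 0)"
      by (auto intro!: derivative_eq_intros)
    have "((\<lambda>t. (w x + 2 * t * x $ i + t\<^sup>2) powr - q) has_real_derivative - q * (w x powr (- q - 1)) * (2 * x $ i)) (at 0)"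
      using DERIV_fun_powr[OF d1, of "- q"] w by simp
    then have "((\<lambda>t. - \<epsilon> * (w x + 2 * t * x $ i + t\<^sup>2) powr - q * (x $ i + t)) has_real_derivative
        (- \<epsilon> * (- q * (w x powr (- q - 1)) * (2 * x $ i))) * (x $ i + 0) + - \<epsilon> * w x powr - q) (at 0)"
      using w(2)[of x] by (auto intro!: derivative_eq_intros)
    moreover have "F (x + t *\<^sub>R axis i 1) $ i = - \<epsilon> * (w x + 2 * t * x $ i + t\<^sup>2) powr - q * (x $ i + t)" for t
      by (simp add: F_def nm)
    moreover have "(- \<epsilon> * (- q * (w x powr (- q - 1)) * (2 * x $ i))) * (x $ i + 0) + - \<epsilon> * w x powr - q = dF i x"
      by (simp add: dF_def algebra_simps power2_eq_square)
    ultimately show ?thesis by (simp only:)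
  qed
  define divF where "divF x = (\<Sum>i\<in>UNIV. dF i x)" for x
  \<comment> \<open>The divergence of x w^(-q) is n w^(-q) - 2q |x|^2 w^(-q-1), and |x|^2 <= w; this
    is where n > 2q becomes a sign.\<close>
  have divF: "divF x \<le> - \<epsilon> * (n - 2 * q) * w x powr - q" for x
  proof -
    have "divF x = - \<epsilon> * (n * w x powr - q - 2 * q * (norm x)\<^sup>2 * w x powr (- q - 1))"
      by (simp add: divF_def dF_def sum_subtractf power2_norm_vec n_def sum_distrib_left[symmetric] sum_distrib_right[symmetric]
          sum_negf right_diff_distrib)
    moreover have "(norm x)\<^sup>2 * w x powr (- q - 1) \<le> w x powr - q"
    proof -
      have "(norm x)\<^sup>2 * w x powr (- q - 1) \<le> w x * w x powr (- q - 1)"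
        by (intro mult_right_mono) (auto simp: w_def)
      also have "\<dots> = w x powr - q" using w(2)[of x] by (simp add: powr_mult_base)
      finally show ?thesis .
    qed
    then have "2 * q * ((norm x)\<^sup>2 * w x powr (- q - 1)) \<le> 2 * q * w x powr - q"
      using q by (intro mult_left_mono) auto
    then have "\<epsilon> * ((n - 2 * q) * w x powr - q) \<le> \<epsilon> * (n * w x powr - q - 2 * q * (norm x)\<^sup>2 * w x powr (- q - 1))"
      using eps by (intro mult_left_mono) (auto simp: algebra_simps)
    ultimately show ?thesis by (simp add: algebra_simps)
  qed
  define g where "g x = (1 / marg x) *\<^sub>R F x" for x
  have gp: "poly_bounded g" unfolding g_def by (intro poly_bounded_intros F(2) poly_bounded_inverse_marg)
  have [measurable]: "F \<in> borel_measurable borel" "dF i \<in> borel_measurable borel" for i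
    using F dFc by (auto intro: borel_measurable_continuous_onI)
  have [measurable]: "g \<in> borel_measurable borel" "divF \<in> borel_measurable borel"
    unfolding g_def divF_def by measurable
  have neg: "2 * divF x / marg x + (B *v g x) \<bullet> g x < 0" for x
  proof -
    have m: "marg x > 0" by (rule marg_pos)
    have "(B *v g x) \<bullet> g x \<le> norm (B *v g x) * norm (g x)" by (rule norm_cauchy_schwarz)
    also have "\<dots> \<le> (norm B * norm (g x)) * norm (g x)" by (intro mult_right_mono norm_matrix_vector_mult_le) simp
    also have "\<dots> = (1 / marg x) * (norm B * ((1 / marg x) * (norm (F x))\<^sup>2))"
      using m by (simp add: g_def power2_eq_square)
    finally have 1: "(B *v g x) \<bullet> g x \<le> (1 / marg x) * (norm B * ((1 / marg x) * (norm (F x))\<^sup>2))" .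
    have "(norm (F x))\<^sup>2 = \<epsilon>\<^sup>2 * (w x powr - q)\<^sup>2 * (norm x)\<^sup>2"
      by (simp add: F_def power_mult_distrib)
    also have "\<dots> \<le> \<epsilon>\<^sup>2 * (w x powr - q)\<^sup>2 * w x"
      by (intro mult_left_mono) (auto simp: w_def)
    finally have "(1 / marg x) * (norm (F x))\<^sup>2 \<le> ((1 / c) * w x powr \<kappa>) * (\<epsilon>\<^sup>2 * (w x powr - q)\<^sup>2 * w x)"
      using inverse_marg_le[of x] c_pos w(2)[of x]
      by (intro mult_mono) (auto simp: w_def)
    also have "\<dots> = (\<epsilon>\<^sup>2 / c) * ((w x powr \<kappa> * w x powr 1) * w x powr - q * w x powr - q)"
      using w(2)[of x] by (simp add: power2_eq_square)
    also have "w x powr \<kappa> * w x powr 1 = w x powr q" by (simp add: q_def powr_add)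
    also have "w x powr q * w x powr - q = 1" using w(3)[of x] by (simp add: powr_minus)
    finally have "norm B * ((1 / marg x) * (norm (F x))\<^sup>2) \<le> norm B * ((\<epsilon>\<^sup>2 / c) * w x powr - q)"
      by (intro mult_left_mono) auto
    also have "\<dots> = (norm B * \<epsilon> / c) * (\<epsilon> * w x powr - q)" by (simp add: power2_eq_square)
    also have "norm B * \<epsilon> / c = (n - 2 * q) * (norm B / (norm B + 1))"
      using c_pos by (simp add: \<epsilon>_def)
    also have "\<dots> * (\<epsilon> * w x powr - q) \<le> ((n - 2 * q) * 1) * (\<epsilon> * w x powr - q)"
    proof -
      have "norm B + 1 > 0" by (simp add: add_nonneg_pos)
      then have "norm B / (norm B + 1) \<le> 1" by simp
      then show ?thesis using q eps by (intro mult_right_mono mult_left_mono) auto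
    qed
    also have "\<dots> < 2 * (\<epsilon> * (n - 2 * q) * w x powr - q)"
      using q eps w(2)[of x] by simp
    finally have "2 * divF x + norm B * ((1 / marg x) * (norm (F x))\<^sup>2) < 0"
      using divF[of x] by simp
    then have "(1 / marg x) * (2 * divF x + norm B * ((1 / marg x) * (norm (F x))\<^sup>2)) < 0"
      using m by (intro mult_pos_neg) auto
    then show ?thesis using 1 by (simp add: algebra_simps)
  qed
  define \<delta> where "\<delta> x = bayes x + B *v g x" for x
  have dm [measurable]: "\<delta> \<in> borel_measurable borel" unfolding \<delta>_def by measurable
  have dp: "poly_bounded \<delta>" unfolding \<delta>_def by (intro poly_bounded_intros poly_bounded_bayes gp)
  have less: "risk Q \<theta> \<delta> < risk Q \<theta> bayes" for \<theta>
  proof -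
    have QT: "transpose Q = Q" using Q by (simp add: positive_definite_def)
    have QBv: "Q *v (B *v v) = v" for v by (simp add: matrix_vector_mul_assoc QB)
    \<comment> \<open>Q cancels against its inverse B in the cross term, which leaves exactly the
      expression of Stein's identity for every Q.\<close>
    have loss: "quadratic_loss Q \<theta> (\<delta> x) = quadratic_loss Q \<theta> (bayes x)
        + (2 * (g x \<bullet> (bayes x - \<theta>)) + (B *v g x) \<bullet> g x)" for x
    proof -
      let ?u = "\<theta> - bayes x" and ?b = "B *v g x"
      have "?b \<bullet> (Q *v ?u) = ?u \<bullet> (Q *v ?b)" by (rule symmetric_inner[OF QT])
      then have "(?u - ?b) \<bullet> (Q *v (?u - ?b)) = ?u \<bullet> (Q *v ?u) - 2 * (?u \<bullet> g x) + ?b \<bullet> g x"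
        by (simp add: matrix_vector_mult_diff_distrib inner_diff_left inner_diff_right QBv)
      moreover have u: "\<theta> - \<delta> x = ?u - ?b" by (simp add: \<delta>_def)
      moreover have "- 2 * (?u \<bullet> g x) = 2 * (g x \<bullet> (bayes x - \<theta>))"
        by (simp add: inner_diff_left inner_diff_right inner_commute)
      ultimately show ?thesis unfolding quadratic_loss_def u by linarith
    qed
    have pb: "poly_bounded (\<lambda>x. g x \<bullet> (bayes x - \<theta>))" "poly_bounded (\<lambda>x. (B *v g x) \<bullet> g x)"
        "poly_bounded (\<lambda>x. divF x * (1 / marg x))"
      unfolding divF_def by (intro poly_bounded_intros gp poly_bounded_bayes dFp poly_bounded_inverse_marg)+
    have int: "integrable lborel (\<lambda>x. gauss (x - \<theta>) * (g x \<bullet> (bayes x - \<theta>)))"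
        "integrable lborel (\<lambda>x. gauss (x - \<theta>) * ((B *v g x) \<bullet> g x))"
        "integrable lborel (\<lambda>x. gauss (x - \<theta>) * (divF x / marg x))"
      using integrable_gauss_poly_bounded[OF _ pb(1), of \<theta>] integrable_gauss_poly_bounded[OF _ pb(2), of \<theta>]
        integrable_gauss_poly_bounded[OF _ pb(3), of \<theta>] by simp_all
    let ?L = "\<lambda>\<delta>. \<integral>x. gauss (x - \<theta>) * quadratic_loss Q \<theta> (\<delta> x) \<partial>lborel"
    note intL = risk_poly_bounded(1)[OF bayes_measurable poly_bounded_bayes Q, of \<theta>]
    have st: "(\<integral>x. gauss (x - \<theta>) * (g x \<bullet> (bayes x - \<theta>)) \<partial>lborel) = (\<integral>x. gauss (x - \<theta>) * (divF x / marg x) \<partial>lborel)"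
      using stein_identity[OF F dFc dFp der, of \<theta>] by (simp add: g_def divF_def)
    have "?L \<delta> = (\<integral>x. gauss (x - \<theta>) * quadratic_loss Q \<theta> (bayes x)
        + (2 * (gauss (x - \<theta>) * (g x \<bullet> (bayes x - \<theta>))) + gauss (x - \<theta>) * ((B *v g x) \<bullet> g x)) \<partial>lborel)"
      unfolding loss by (simp add: algebra_simps)
    also have "\<dots> = ?L bayes + (2 * (\<integral>x. gauss (x - \<theta>) * (g x \<bullet> (bayes x - \<theta>)) \<partial>lborel) + (\<integral>x. gauss (x - \<theta>) * ((B *v g x) \<bullet> g x) \<partial>lborel))"
      using int intL by simp
    also have "\<dots> = ?L bayes + (\<integral>x. gauss (x - \<theta>) * (2 * divF x / marg x + (B *v g x) \<bullet> g x) \<partial>lborel)"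
    proof -
      have "(\<integral>x. gauss (x - \<theta>) * (2 * divF x / marg x + (B *v g x) \<bullet> g x) \<partial>lborel)
          = (\<integral>x. 2 * (gauss (x - \<theta>) * (divF x / marg x)) + gauss (x - \<theta>) * ((B *v g x) \<bullet> g x) \<partial>lborel)"
        by (simp add: algebra_simps)
      also have "\<dots> = 2 * (\<integral>x. gauss (x - \<theta>) * (divF x / marg x) \<partial>lborel) + (\<integral>x. gauss (x - \<theta>) * ((B *v g x) \<bullet> g x) \<partial>lborel)"
        by (subst Bochner_Integration.integral_add[OF integrable_mult_right[OF int(3)] int(2)])
          (simp only: integral_mult_right_zero)
      finally show ?thesis unfolding st by simp
    qed
    also have "(\<integral>x. gauss (x - \<theta>) * (2 * divF x / marg x + (B *v g x) \<bullet> g x) \<partial>lborel) < 0"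
    proof (rule lborel_integral_neg)
      show "integrable lborel (\<lambda>x. gauss (x - \<theta>) * (2 * divF x / marg x + (B *v g x) \<bullet> g x))"
        using Bochner_Integration.integrable_add[OF integrable_mult_right[OF int(3), of 2] int(2)]
        by (simp add: algebra_simps)
      show "gauss (x - \<theta>) * (2 * divF x / marg x + (B *v g x) \<bullet> g x) < 0" for x
        by (rule mult_pos_neg[OF gauss_pos neg])
    qed
    finally have "?L \<delta> < ?L bayes" by simp
    moreover have "0 \<le> ?L \<delta>" using positive_definite_loss_nonneg[OF Q] by (simp add: gauss_nonneg)
    ultimately show ?thesis
      unfolding risk_poly_bounded(2)[OF dm dp Q] risk_poly_bounded(2)[OF bayes_measurable poly_bounded_bayes Q]
      by (intro ennreal_lessI divide_strict_right_mono divide_pos_pos) (auto intro: le_less_trans)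
  qed
  have "dominates Q \<delta> bayes"
    unfolding dominates_def using less by (auto intro: less_imp_le)
  then show ?thesis
    unfolding inadmissible_def estimator_def using dm bayes_measurable by blast
qed

end

section \<open>Admissibility by Blyth's method in the plane\<close>

definition tent :: "real^'q \<Rightarrow> real" where
  "tent b = max 0 (1 - norm b)"

text \<open>A discrete form of the logarithmic cutoff: the mean of tents of radii 2, 4, ..., 2^n.
  Each scale carries an energy of the same order in the plane, and the division by n spreads it
  thinly.\<close>

definition cutoff :: "nat \<Rightarrow> real^'q \<Rightarrow> real" where
  "cutoff n b = (\<Sum>j=1..n. tent (b /\<^sub>R 2 ^ j)) / n"

lemma tent_bounds: "0 \<le> tent b" "tent b \<le> 1"
  by (simp_all add: tent_def)

lemma tent_lipschitz: "\<bar>tent a - tent b\<bar> \<le> norm (a - b)"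
  using norm_triangle_ineq2[of a b] norm_triangle_ineq2[of b a]
  by (auto simp: tent_def norm_minus_commute max_def)

lemma tent_eq_0: "norm b \<ge> 1 \<Longrightarrow> tent b = 0"
  by (simp add: tent_def)

lemma tent_measurable [measurable]: "tent \<in> borel_measurable borel"
  unfolding tent_def[abs_def] by measurable

lemma cutoff_measurable [measurable]: "cutoff n \<in> borel_measurable borel"
  unfolding cutoff_def[abs_def] by measurable

lemma cutoff_bounds: "0 \<le> cutoff n b" "cutoff n b \<le> 1"
proof -
  show "0 \<le> cutoff n b" by (simp add: cutoff_def sum_nonneg tent_bounds)
  have "(\<Sum>j=1..n. tent (b /\<^sub>R 2 ^ j)) \<le> (\<Sum>j=1..n. 1)" by (intro sum_mono tent_bounds)
  then show "cutoff n b \<le> 1" by (simp add: cutoff_def divide_le_eq)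
qed

text \<open>Every radius is at least 2, so the unit disc lies in the inner half of each
  tent.\<close>

lemma cutoff_ge_half:
  assumes "norm b \<le> 1" "n \<ge> 1"
  shows "1 / 2 \<le> cutoff n b"
proof -
  have "1 / 2 \<le> tent (b /\<^sub>R 2 ^ j)" if "j \<in> {1..n}" for j
  proof -
    have "2 ^ 1 \<le> (2 :: real) ^ j" using that by (intro power_increasing) auto
    then have "norm b \<le> 2 ^ j / 2" using assms(1) by simp
    then have "norm (b /\<^sub>R 2 ^ j) \<le> 1 / 2" by (simp add: field_simps)
    then show ?thesis by (simp add: tent_def)
  qed
  then have "(\<Sum>j=1..n. 1 / 2) \<le> (\<Sum>j=1..n. tent (b /\<^sub>R 2 ^ j))" by (intro sum_mono)
  then show ?thesis using assms(2) by (simp add: cutoff_def field_simps)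
qed

lemma cutoff_support: "norm b \<ge> 2 ^ n \<Longrightarrow> cutoff n b = 0"
proof -
  assume b: "norm b \<ge> 2 ^ n"
  have "tent (b /\<^sub>R 2 ^ j) = 0" if "j \<in> {1..n}" for j
  proof (rule tent_eq_0)
    have "2 ^ j \<le> (2 :: real) ^ n" using that by (intro power_increasing) auto
    then have "2 ^ j \<le> norm b" using b by linarith
    then show "1 \<le> norm (b /\<^sub>R 2 ^ j)" by (simp add: field_simps)
  qed
  then show ?thesis by (simp add: cutoff_def)
qed

text \<open>Equal to pi when the dimension is two; the type argument only selects the space, and the
  proofs rely on scaling and positivity.\<close>

definition disc_area :: "(real^'q) itself \<Rightarrow> real" where
  "disc_area _ = measure lborel (ball (0 :: real^'q) 1)"

lemma emeasure_ball_2d: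
  assumes "CARD('q) = 2" "r > 0"
  shows "emeasure lborel (ball (a :: real^'q) r) = ennreal (disc_area TYPE(real^'q) * r\<^sup>2)"
proof -
  have "measure lborel (ball a r) = r ^ 2 * measure lborel (ball (0 :: real^'q) 1)"
    using content_ball_conv_unit_ball[of r a] assms by simp
  moreover have "emeasure lborel (ball a r) = ennreal (measure lborel (ball a r))"
    by (rule emeasure_eq_ennreal_measure) (metis emeasure_lborel_ball_finite less_irrefl infinity_ennreal_def)
  ultimately show ?thesis by (simp add: disc_area_def mult.commute)
qed

lemma disc_area_pos: "disc_area TYPE(real^'q) > 0"
  by (simp add: disc_area_def content_ball_pos)

text \<open>The energy of the cutoffs tends to zero because area scales like the square of the radius: on the scales
  \<open>i \<le> j\<close> the product of the increments is at most \<open>2\<^sup>-\<^sup>i\<^sup>-\<^sup>j |u|\<^sup>2\<close> on a set of area \<open>O(4\<^sup>i)\<close>.\<close>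

lemma cutoff_energy:
  fixes u :: "real^'q"
  assumes dim: "CARD('q) = 2" and n: "n \<ge> 1"
  shows "(\<integral>\<^sup>+b. ennreal ((cutoff n (b + u) - cutoff n b)\<^sup>2) \<partial>lborel) \<le> ennreal (6 * disc_area TYPE(real^'q) * (norm u)\<^sup>2 / n)"
proof -
  let ?v = "disc_area TYPE(real^'q)"
  have v: "?v \<ge> 0" using disc_area_pos by (rule less_imp_le)
  define D where "D j b = \<bar>tent ((b + u) /\<^sub>R 2 ^ j) - tent (b /\<^sub>R 2 ^ j)\<bar>" for j and b :: "real^'q"
  define A where "A n b = (\<Sum>j=1..n. D j b)" for n b
  have Dm [measurable]: "D j \<in> borel_measurable borel" for j unfolding D_def[abs_def] by measurable
  have Am [measurable]: "A n \<in> borel_measurable borel" for n unfolding A_def[abs_def] by measurable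
  have D0: "0 \<le> D j b" for j b by (simp add: D_def)
  have A0: "0 \<le> A n b" for n b by (simp add: A_def sum_nonneg D0)
  have D1: "D j b \<le> norm u / 2 ^ j" for j b
    using tent_lipschitz[of "(b + u) /\<^sub>R 2 ^ j" "b /\<^sub>R 2 ^ j"]
    by (simp add: D_def scaleR_diff_right[symmetric] divide_inverse mult.commute)
  have D2: "ennreal (D j b) \<le> ennreal (norm u / 2 ^ j) * (indicator (ball 0 (2 ^ j)) b + indicator (ball (- u) (2 ^ j)) b)" for j b
  proof (cases "b \<in> ball 0 (2 ^ j) \<or> b \<in> ball (- u) (2 ^ j)")
    case True
    have "ennreal (D j b) \<le> ennreal (norm u / 2 ^ j) * 1" using D1[of j b] by (simp add: ennreal_leI)
    also have "\<dots> \<le> ennreal (norm u / 2 ^ j) * (indicator (ball 0 (2 ^ j)) b + indicator (ball (- u) (2 ^ j)) b)"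
      using True by (intro mult_left_mono) (auto simp: indicator_def)
    finally show ?thesis .
  next
    case False
    then have "2 ^ j \<le> norm b" "2 ^ j \<le> norm (b + u)"
      by (auto simp: dist_norm norm_minus_commute add.commute)
    moreover have "tent (y /\<^sub>R 2 ^ j) = 0" if "2 ^ j \<le> norm y" for y :: "real^'q"
      using that by (intro tent_eq_0) (simp add: field_simps)
    ultimately have "tent (b /\<^sub>R 2 ^ j) = 0" "tent ((b + u) /\<^sub>R 2 ^ j) = 0" by blast+
    then show ?thesis by (simp add: D_def)
  qed
  have D3: "(\<integral>\<^sup>+b. ennreal (D j b) \<partial>lborel) \<le> ennreal (2 * ?v * norm u * 2 ^ j)" for j
  proof -
    have "(\<integral>\<^sup>+b. ennreal (D j b) \<partial>lborel)
        \<le> (\<integral>\<^sup>+b. ennreal (norm u / 2 ^ j) * (indicator (ball 0 (2 ^ j)) b + indicator (ball (- u) (2 ^ j)) b) \<partial>lborel)"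
      by (intro nn_integral_mono D2)
    also have "\<dots> = ennreal (norm u / 2 ^ j) * (ennreal (?v * (2 ^ j)\<^sup>2) + ennreal (?v * (2 ^ j)\<^sup>2))"
    proof -
      have "(\<integral>\<^sup>+b. indicator (ball 0 (2 ^ j)) b + indicator (ball (- u) (2 ^ j)) b \<partial>lborel)
          = (\<integral>\<^sup>+b. indicator (ball (0 :: real^'q) (2 ^ j)) b \<partial>lborel) + (\<integral>\<^sup>+b. indicator (ball (- u) (2 ^ j)) b \<partial>lborel)"
        by (rule nn_integral_add) (auto intro!: borel_measurable_indicator)
      also have "\<dots> = ennreal (?v * (2 ^ j)\<^sup>2) + ennreal (?v * (2 ^ j)\<^sup>2)"
        using emeasure_ball_2d[OF dim, of "2 ^ j"] by simp
      finally show ?thesis by (subst nn_integral_cmult) (auto intro!: borel_measurable_indicator borel_measurable_add)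
    qed
    also have "\<dots> = ennreal (norm u / 2 ^ j * (?v * (2 ^ j)\<^sup>2 + ?v * (2 ^ j)\<^sup>2))"
      using v by (simp add: ennreal_plus[symmetric] ennreal_mult'[symmetric] del: ennreal_plus)
    also have "norm u / 2 ^ j * (?v * (2 ^ j)\<^sup>2 + ?v * (2 ^ j)\<^sup>2) = 2 * ?v * norm u * 2 ^ j"
      by (simp add: power2_eq_square)
    finally show ?thesis .
  qed
  \<comment> \<open>Geometric series: the scales up to n together cost no more than 2^(n+1).\<close>
  have A1: "(\<integral>\<^sup>+b. ennreal (A n b) \<partial>lborel) \<le> ennreal (2 * ?v * norm u * 2 ^ Suc n)" for n
  proof (induction n)
    case (Suc n)
    have "(\<integral>\<^sup>+b. ennreal (A (Suc n) b) \<partial>lborel) = (\<integral>\<^sup>+b. ennreal (A n b) \<partial>lborel) + (\<integral>\<^sup>+b. ennreal (D (Suc n) b) \<partial>lborel)"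
      by (subst nn_integral_add[symmetric]) (auto simp: A_def sum_nonneg D0)
    also have "\<dots> \<le> ennreal (2 * ?v * norm u * 2 ^ Suc n) + ennreal (2 * ?v * norm u * 2 ^ Suc n)"
      by (intro add_mono Suc D3)
    also have "\<dots> = ennreal (2 * ?v * norm u * 2 ^ Suc (Suc n))"
      using v by (simp add: ennreal_plus[symmetric] del: ennreal_plus)
    finally show ?case .
  qed (simp add: A_def)
  \<comment> \<open>With s = |u|/2^(n+1), passing from n to n + 1 adds 2 s A_n and s D; by A1 and D3
    these integrate to at most 4 and 2 times v |u|^2, whence the constant 6.\<close>
  have A2: "(\<integral>\<^sup>+b. ennreal ((A n b)\<^sup>2) \<partial>lborel) \<le> ennreal (6 * ?v * (norm u)\<^sup>2 * n)" for n
  proof (induction n)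
    case (Suc n)
    let ?s = "norm u / 2 ^ Suc n"
    have "(A (Suc n) b)\<^sup>2 \<le> (A n b)\<^sup>2 + (2 * ?s * A n b + ?s * D (Suc n) b)" for b
    proof -
      have "2 * (A n b * D (Suc n) b) \<le> 2 * (?s * A n b)"
        using mult_left_mono[OF D1[of "Suc n" b] A0[of n b]] by (metis mult.commute mult_left_mono zero_le_numeral)
      moreover have "D (Suc n) b * D (Suc n) b \<le> ?s * D (Suc n) b"
        by (rule mult_right_mono[OF D1 D0])
      moreover have "(A (Suc n) b)\<^sup>2 = (A n b)\<^sup>2 + 2 * (A n b * D (Suc n) b) + D (Suc n) b * D (Suc n) b"
        by (simp add: A_def power2_eq_square algebra_simps)
      ultimately show ?thesis by linarith
    qed
    then have "(\<integral>\<^sup>+b. ennreal ((A (Suc n) b)\<^sup>2) \<partial>lborel)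
        \<le> (\<integral>\<^sup>+b. ennreal ((A n b)\<^sup>2) + (ennreal (2 * ?s) * ennreal (A n b) + ennreal ?s * ennreal (D (Suc n) b)) \<partial>lborel)"
      using A0 D0 by (intro nn_integral_mono)
        (simp add: ennreal_plus[symmetric] ennreal_mult[symmetric] ennreal_leI del: ennreal_plus)
    also have "\<dots> = (\<integral>\<^sup>+b. ennreal ((A n b)\<^sup>2) \<partial>lborel) + (ennreal (2 * ?s) * (\<integral>\<^sup>+b. ennreal (A n b) \<partial>lborel)
        + ennreal ?s * (\<integral>\<^sup>+b. ennreal (D (Suc n) b) \<partial>lborel))"
      by (simp add: nn_integral_add nn_integral_cmult)
    also have "\<dots> \<le> ennreal (6 * ?v * (norm u)\<^sup>2 * n) + (ennreal (2 * ?s) * ennreal (2 * ?v * norm u * 2 ^ Suc n)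
        + ennreal ?s * ennreal (2 * ?v * norm u * 2 ^ Suc n))"
      by (intro add_mono mult_left_mono Suc A1 D3) auto
    also have "\<dots> = ennreal (6 * ?v * (norm u)\<^sup>2 * n + (2 * ?s * (2 * ?v * norm u * 2 ^ Suc n) + ?s * (2 * ?v * norm u * 2 ^ Suc n)))"
      using v by (simp add: ennreal_plus[symmetric] ennreal_mult[symmetric] del: ennreal_plus)
    also have "6 * ?v * (norm u)\<^sup>2 * n + (2 * ?s * (2 * ?v * norm u * 2 ^ Suc n) + ?s * (2 * ?v * norm u * 2 ^ Suc n))
        = 6 * ?v * (norm u)\<^sup>2 * Suc n"
      by (simp add: field_simps power2_eq_square)
    finally show ?case .
  qed (simp add: A_def)
  \<comment> \<open>The factor 1/n is squared while A2 grows only like n, which leaves 1/n.\<close>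
  have "(cutoff n (b + u) - cutoff n b)\<^sup>2 \<le> (A n b)\<^sup>2 / (real n)\<^sup>2" for b
  proof -
    have "cutoff n (b + u) - cutoff n b = (\<Sum>j=1..n. tent ((b + u) /\<^sub>R 2 ^ j) - tent (b /\<^sub>R 2 ^ j)) / n"
      by (simp add: cutoff_def sum_subtractf diff_divide_distrib)
    then have "\<bar>cutoff n (b + u) - cutoff n b\<bar> \<le> A n b / n"
      using sum_abs[of "\<lambda>j. tent ((b + u) /\<^sub>R 2 ^ j) - tent (b /\<^sub>R 2 ^ j)" "{1..n}"] n
      by (simp add: A_def D_def divide_right_mono)
    then have "\<bar>cutoff n (b + u) - cutoff n b\<bar>\<^sup>2 \<le> (A n b / n)\<^sup>2" by (intro power_mono) auto
    then show ?thesis by (simp add: power_divide)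
  qed
  then have "(\<integral>\<^sup>+b. ennreal ((cutoff n (b + u) - cutoff n b)\<^sup>2) \<partial>lborel)
      \<le> (\<integral>\<^sup>+b. ennreal (1 / (real n)\<^sup>2) * ennreal ((A n b)\<^sup>2) \<partial>lborel)"
    by (intro nn_integral_mono) (simp add: ennreal_mult[symmetric] ennreal_leI)
  also have "\<dots> \<le> ennreal (1 / (real n)\<^sup>2) * ennreal (6 * ?v * (norm u)\<^sup>2 * n)"
    by (simp add: nn_integral_cmult) (intro mult_left_mono A2, simp)
  also have "\<dots> = ennreal (6 * ?v * (norm u)\<^sup>2 / n)"
    using v n by (simp add: ennreal_mult[symmetric] power2_eq_square field_simps)
  finally show ?thesis .
qed

section \<open>Priors invariant under translations by a plane\<close>

lemma indicator_ball_measurable [measurable]: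
  "f \<in> borel_measurable M \<Longrightarrow> (\<lambda>x. indicator (ball a r) (f x) :: ennreal) \<in> borel_measurable M"
  by (rule measurable_compose[where g="indicator (ball a r)"]) (auto intro!: borel_measurable_indicator)

lemma power2_le_one_plus_power4: "t\<^sup>2 \<le> 1 + t ^ 4" for t :: real
proof -
  have "2 * 1 * t\<^sup>2 \<le> 1\<^sup>2 + (t\<^sup>2)\<^sup>2" by (rule sum_squares_bound)
  then have "2 * t\<^sup>2 \<le> 1 + t ^ 4" by simp
  then show ?thesis using zero_le_power2[of t] by linarith
qed

lemma power4_add_le: "(a + b) ^ 4 \<le> 8 * (a ^ 4 + b ^ 4)" for a b :: real
proof -
  have "(a + b)\<^sup>2 \<le> 2 * (a\<^sup>2 + b\<^sup>2)" using sum_squares_bound[of a b] by (simp add: power2_sum)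
  then have "((a + b)\<^sup>2)\<^sup>2 \<le> (2 * (a\<^sup>2 + b\<^sup>2))\<^sup>2" by (intro power_mono) auto
  also have "\<dots> = 4 * (a\<^sup>2 + b\<^sup>2)\<^sup>2" by (simp only: power_mult_distrib) simp
  also have "(a\<^sup>2 + b\<^sup>2)\<^sup>2 \<le> 2 * ((a\<^sup>2)\<^sup>2 + (b\<^sup>2)\<^sup>2)" using sum_squares_bound[of "a\<^sup>2" "b\<^sup>2"] by (simp add: power2_sum)
  finally show ?thesis by simp
qed

text \<open>The prior is invariant under the plane \<open>range emb\<close> and finite on slabs transversal to it, so that up to a
  finite factor it behaves like Lebesgue measure in the plane.\<close>

locale shift_prior = gauss_prior G K c \<kappa>
  for G :: "(real^'p) measure" and K c \<kappa> :: real +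
  fixes av :: "real^'p \<Rightarrow> real^'q" and emb :: "real^'q \<Rightarrow> real^'p"
  assumes linear_av: "linear av" and linear_emb: "linear emb"
    and av_emb: "\<And>b. av (emb b) = b" and norm_av: "\<And>x. norm (av x) \<le> norm x"
    and shift: "\<And>f b. f \<in> borel_measurable borel \<Longrightarrow> (\<integral>\<^sup>+\<theta>. f (\<theta> + emb b) \<partial>G) = (\<integral>\<^sup>+\<theta>. f \<theta> \<partial>G)"
    and slab: "(\<integral>\<^sup>+\<theta>. indicator (ball 0 1) (av \<theta>) \<partial>G) < \<infinity>"
    and dim2: "CARD('q) = 2"
begin

lemma av_measurable [measurable]: "av \<in> borel_measurable borel" and emb_measurable [measurable]: "emb \<in> borel_measurable borel"
  by (intro borel_measurable_continuous_onI linear_continuous_on; simp add: linear_av linear_emb linear_linear)+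

lemma marg_shift: "marg (x + emb b) = marg x"
proof -
  have "ennreal (marg (x + emb b)) = (\<integral>\<^sup>+\<theta>. ennreal (gauss (x + emb b - (\<theta> + emb b))) \<partial>G)"
    unfolding nn_marg[symmetric] using shift[of "\<lambda>\<theta>. ennreal (gauss (x + emb b - \<theta>))" b] by simp
  also have "\<dots> = ennreal (marg x)" by (simp add: nn_marg)
  finally show ?thesis using marg_nonneg by simp
qed

lemma av_shift: "av (x + emb b) = av x + b"
  by (simp add: linear_add[OF linear_av] av_emb)

text \<open>Averaging over translates: \<open>\<integral> \<psi>(x) dx\<close> equals the integral over a fundamental slab \<open>|av x| < 1\<close> of
  \<open>\<integral> \<psi>(x - emb b) db\<close>, divided by the area of the disc.\<close>

lemma slab_average:
  assumes [measurable]: "\<psi> \<in> borel_measurable borel"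
  shows "(\<integral>\<^sup>+x. \<psi> x \<partial>lborel) * ennreal (disc_area TYPE(real^'q))
    = (\<integral>\<^sup>+x. indicator (ball 0 1) (av x) * (\<integral>\<^sup>+b. \<psi> (x + emb b) \<partial>lborel) \<partial>lborel)"
proof -
  have m [measurable]: "(\<lambda>z. \<psi> (fst z + emb (snd z))) \<in> borel_measurable (lborel \<Otimes>\<^sub>M lborel)" by measurable
  have disc: "(\<integral>\<^sup>+b. indicator (ball 0 1) (av x - b) \<partial>lborel) = ennreal (disc_area TYPE(real^'q))" for x
  proof -
    have "(\<integral>\<^sup>+b. indicator (ball 0 1) (av x - b) \<partial>lborel) = (\<integral>\<^sup>+b. indicator (ball 0 1) (b :: real^'q) \<partial>lborel)"
      by (rule nn_integral_lborel_reflect) (rule borel_measurable_indicator, simp)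
    also have "\<dots> = ennreal (disc_area TYPE(real^'q))"
      using emeasure_ball_2d[OF dim2, of 1 0] by simp
    finally show ?thesis .
  qed
  have "(\<integral>\<^sup>+x. \<psi> x \<partial>lborel) * ennreal (disc_area TYPE(real^'q)) = (\<integral>\<^sup>+x. \<integral>\<^sup>+b. indicator (ball 0 1) (av x - b) * \<psi> x \<partial>lborel \<partial>lborel)"
    by (simp add: nn_integral_multc disc nn_integral_cmult mult.commute[of "integral\<^sup>N lborel \<psi>"])
  also have "\<dots> = (\<integral>\<^sup>+b. \<integral>\<^sup>+x. indicator (ball 0 1) (av x - b) * \<psi> x \<partial>lborel \<partial>lborel)"
    by (rule lborel_pair.Fubini') measurable
  also have "\<dots> = (\<integral>\<^sup>+b. \<integral>\<^sup>+x. indicator (ball 0 1) (av x) * \<psi> (x + emb b) \<partial>lborel \<partial>lborel)"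
  proof (rule nn_integral_cong)
    fix b :: "real^'q"
    have "(\<integral>\<^sup>+x. indicator (ball 0 1) (av (emb b + x) - b) * \<psi> (emb b + x) \<partial>lborel)
        = (\<integral>\<^sup>+x. indicator (ball 0 1) (av x - b) * \<psi> x \<partial>lborel)"
      by (rule nn_integral_lborel_translate) measurable
    then show "(\<integral>\<^sup>+x. indicator (ball 0 1) (av x - b) * \<psi> x \<partial>lborel)
        = (\<integral>\<^sup>+x. indicator (ball 0 1) (av x) * \<psi> (x + emb b) \<partial>lborel)"
      using av_shift[of _ b] by (simp add: add.commute)
  qed
  also have "\<dots> = (\<integral>\<^sup>+x. \<integral>\<^sup>+b. indicator (ball 0 1) (av x) * \<psi> (x + emb b) \<partial>lborel \<partial>lborel)"
    by (rule lborel_pair.Fubini') measurable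
  also have "\<dots> = (\<integral>\<^sup>+x. indicator (ball 0 1) (av x) * (\<integral>\<^sup>+b. \<psi> (x + emb b) \<partial>lborel) \<partial>lborel)"
    by (simp add: nn_integral_cmult)
  finally show ?thesis .
qed

text \<open>Substituting x = \<theta> + z turns the slab condition on x into one on \<theta>
  displaced by av z. Invariance of G undoes the displacement, so the \<theta>-integral is the finite
  slab mass for every z and only a Gaussian moment in z remains.\<close>

lemma slab_moment:
  "(\<integral>\<^sup>+x. indicator (ball 0 1) (av x) * (\<integral>\<^sup>+\<theta>. ennreal (gauss (x - \<theta>) * (1 + norm (x - \<theta>) ^ 4)) \<partial>G) \<partial>lborel) < \<infinity>"
proof -
  interpret LG: pair_sigma_finite lborel G ..
  let ?k = "\<lambda>z :: real^'p. ennreal (gauss z * (1 + norm z ^ 4))"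
  let ?A = "\<integral>\<^sup>+\<theta>. indicator (ball 0 1) (av \<theta>) \<partial>G"
  have "(\<integral>\<^sup>+x. indicator (ball 0 1) (av x) * (\<integral>\<^sup>+\<theta>. ?k (x - \<theta>) \<partial>G) \<partial>lborel)
      = (\<integral>\<^sup>+x. \<integral>\<^sup>+\<theta>. indicator (ball 0 1) (av x) * ?k (x - \<theta>) \<partial>G \<partial>lborel)"
    by (simp add: nn_integral_cmult)
  also have "\<dots> = (\<integral>\<^sup>+\<theta>. \<integral>\<^sup>+x. indicator (ball 0 1) (av x) * ?k (x - \<theta>) \<partial>lborel \<partial>G)"
    by (rule LG.Fubini'[symmetric]) measurable
  also have "\<dots> = (\<integral>\<^sup>+\<theta>. \<integral>\<^sup>+z. indicator (ball 0 1) (av (\<theta> + z)) * ?k z \<partial>lborel \<partial>G)"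
  proof (rule nn_integral_cong)
    fix \<theta> :: "real^'p"
    have "(\<integral>\<^sup>+z. indicator (ball 0 1) (av (\<theta> + z)) * ?k (\<theta> + z - \<theta>) \<partial>lborel)
        = (\<integral>\<^sup>+x. indicator (ball 0 1) (av x) * ?k (x - \<theta>) \<partial>lborel)"
      by (rule nn_integral_lborel_translate) measurable
    then show "(\<integral>\<^sup>+x. indicator (ball 0 1) (av x) * ?k (x - \<theta>) \<partial>lborel)
        = (\<integral>\<^sup>+z. indicator (ball 0 1) (av (\<theta> + z)) * ?k z \<partial>lborel)" by simp
  qed
  also have "\<dots> = (\<integral>\<^sup>+z. \<integral>\<^sup>+\<theta>. indicator (ball 0 1) (av (\<theta> + z)) * ?k z \<partial>G \<partial>lborel)"
    by (rule LG.Fubini') measurable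
  also have "\<dots> = (\<integral>\<^sup>+z. ?A * ?k z \<partial>lborel)"
  proof (rule nn_integral_cong)
    fix z :: "real^'p"
    have "(\<integral>\<^sup>+\<theta>. indicator (ball 0 1) (av (\<theta> + z)) \<partial>G) = (\<integral>\<^sup>+\<theta>. indicator (ball 0 1) (av (\<theta> + emb (av z))) \<partial>G)"
      by (simp add: linear_add[OF linear_av] av_emb)
    also have "\<dots> = ?A" by (rule shift) measurable
    finally show "(\<integral>\<^sup>+\<theta>. indicator (ball 0 1) (av (\<theta> + z)) * ?k z \<partial>G) = ?A * ?k z"
      by (simp add: nn_integral_multc)
  qed
  also have "\<dots> = ?A * (\<integral>\<^sup>+z. ?k z \<partial>lborel)" by (simp add: nn_integral_cmult)
  also have "(\<integral>\<^sup>+z. ?k z \<partial>lborel) < \<infinity>"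
  proof -
    have "(\<integral>\<^sup>+z. ?k z \<partial>lborel) \<le> (\<integral>\<^sup>+z. 33 * ennreal (exp (- (1 / 2 * (norm (z :: real^'p))\<^sup>2 / 2))) \<partial>lborel)"
      using gauss_poly_le by (intro nn_integral_mono) (simp add: ennreal_mult'[symmetric] ennreal_leI flip: ennreal_numeral)
    also have "\<dots> < \<infinity>"
      using nn_integral_gauss_scale[of "1/2", where 'n='p] by (simp add: nn_integral_cmult ennreal_mult_less_top)
    finally show ?thesis .
  qed
  then have "?A * (\<integral>\<^sup>+z. ?k z \<partial>lborel) < \<infinity>" using slab by (simp add: ennreal_mult_less_top)
  finally show ?thesis .
qed

interpretation GG: pair_sigma_finite G G ..

text \<open>For w = 1 this is twice the posterior variance times \<open>marg x\<close>. Two weights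
  matter: the squared increment of the cutoff gives the Blyth remainder, the squared cutoff in one
  argument gives a bound on the weighted Bayes risk.\<close>

definition spread :: "((real^'q) \<times> (real^'q) \<Rightarrow> ennreal) \<Rightarrow> real^'p \<Rightarrow> ennreal" where
  "spread w x = ennreal (1 / marg x) * (\<integral>\<^sup>+\<theta>. \<integral>\<^sup>+\<theta>'. ennreal (gauss (x - \<theta>) * gauss (x - \<theta>') * (norm (\<theta> - \<theta>'))\<^sup>2) * w (av \<theta>, av \<theta>') \<partial>G \<partial>G)"

definition moment4 :: "real^'p \<Rightarrow> ennreal" where
  "moment4 x = (\<integral>\<^sup>+\<theta>. ennreal (gauss (x - \<theta>) * (1 + norm (x - \<theta>) ^ 4)) \<partial>G)"

text \<open>A moment on one fundamental slab, divided by the disc area as in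
  \<open>slab_average\<close>.\<close>

definition spread_const :: ennreal where
  "spread_const = (\<integral>\<^sup>+x. indicator (ball 0 1) (av x) * (32 * moment4 x) \<partial>lborel) / ennreal (disc_area TYPE(real^'q))"

lemma moment4_measurable [measurable]: "moment4 \<in> borel_measurable borel"
  unfolding moment4_def[abs_def] by measurable

lemma spread_const_finite: "spread_const < \<infinity>"
proof -
  have "(\<integral>\<^sup>+x. indicator (ball 0 1) (av x) * (32 * moment4 x) \<partial>lborel)
      = 32 * (\<integral>\<^sup>+x. indicator (ball 0 1) (av x) * moment4 x \<partial>lborel)"
    by (subst nn_integral_cmult[symmetric]) (auto simp: mult_ac)
  also have "\<dots> < \<infinity>" using slab_moment by (simp add: ennreal_mult_less_top moment4_def)
  finally show ?thesis
    using disc_area_pos[where 'q='q] by (simp add: spread_const_def ennreal_divide_eq_top_iff less_top[symmetric])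
qed

lemma spread_measurable [measurable]:
  assumes [measurable]: "w \<in> borel_measurable (borel \<Otimes>\<^sub>M borel)"
  shows "spread w \<in> borel_measurable borel"
  unfolding spread_def[abs_def] by measurable

text \<open>Averaging over translates moves the shift from x into the arguments of w, because the
  kernels, the distance and \<open>marg\<close> are unchanged under \<open>emb b\<close>. The
  integral over b is then controlled by \<open>L\<close>, and a fourth moment on one slab is
  left.\<close>

lemma spread_integral_le:
  assumes w [measurable]: "w \<in> borel_measurable (borel \<Otimes>\<^sub>M borel)"
    and L: "\<And>\<theta> \<theta>'. (\<integral>\<^sup>+b. w (av \<theta> + b, av \<theta>' + b) \<partial>lborel) \<le> L * ennreal (1 + (norm (\<theta> - \<theta>'))\<^sup>2)"
  shows "(\<integral>\<^sup>+x. spread w x \<partial>lborel) \<le> L * spread_const"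
proof -
  let ?k = "\<lambda>x \<theta> \<theta>'. ennreal (gauss (x - \<theta>) * gauss (x - \<theta>') * (norm (\<theta> - \<theta>'))\<^sup>2)"
  let ?g = "\<lambda>x \<theta>. ennreal (gauss (x - \<theta>))"
  let ?m = "\<lambda>x \<theta>. ennreal (gauss (x - \<theta>) * (1 + norm (x - \<theta>) ^ 4))"
  have inner: "(\<integral>\<^sup>+b. spread w (x + emb b) \<partial>lborel) \<le> L * (32 * moment4 x)" for x
  proof -
    have sh: "spread w (x + emb b) = ennreal (1 / marg x) * (\<integral>\<^sup>+\<theta>. \<integral>\<^sup>+\<theta>'. ?k x \<theta> \<theta>' * w (av \<theta> + b, av \<theta>' + b) \<partial>G \<partial>G)" for b
    proof -
      have "(\<integral>\<^sup>+\<theta>. \<integral>\<^sup>+\<theta>'. ?k (x + emb b) \<theta> \<theta>' * w (av \<theta>, av \<theta>') \<partial>G \<partial>G)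
          = (\<integral>\<^sup>+\<theta>. \<integral>\<^sup>+\<theta>'. ?k (x + emb b) (\<theta> + emb b) \<theta>' * w (av (\<theta> + emb b), av \<theta>') \<partial>G \<partial>G)"
        by (rule shift[symmetric]) measurable
      also have "\<dots> = (\<integral>\<^sup>+\<theta>. \<integral>\<^sup>+\<theta>'. ?k (x + emb b) (\<theta> + emb b) (\<theta>' + emb b) * w (av (\<theta> + emb b), av (\<theta>' + emb b)) \<partial>G \<partial>G)"
        by (intro nn_integral_cong shift[symmetric]) measurable
      also have "\<dots> = (\<integral>\<^sup>+\<theta>. \<integral>\<^sup>+\<theta>'. ?k x \<theta> \<theta>' * w (av \<theta> + b, av \<theta>' + b) \<partial>G \<partial>G)"
        by (simp add: av_shift)
      finally show ?thesis by (simp add: spread_def marg_shift)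
    qed
    interpret LG: pair_sigma_finite "lborel :: (real^'q) measure" G ..
    have eq: "(\<integral>\<^sup>+b. spread w (x + emb b) \<partial>lborel)
        = ennreal (1 / marg x) * (\<integral>\<^sup>+b. \<integral>\<^sup>+\<theta>. \<integral>\<^sup>+\<theta>'. ?k x \<theta> \<theta>' * w (av \<theta> + b, av \<theta>' + b) \<partial>G \<partial>G \<partial>lborel)"
      unfolding sh by (rule nn_integral_cmult) measurable
    have le: "(\<integral>\<^sup>+b. \<integral>\<^sup>+\<theta>. \<integral>\<^sup>+\<theta>'. ?k x \<theta> \<theta>' * w (av \<theta> + b, av \<theta>' + b) \<partial>G \<partial>G \<partial>lborel) \<le> ennreal (marg x) * (L * (32 * moment4 x))"
    proof -
    have "(\<integral>\<^sup>+b. \<integral>\<^sup>+\<theta>. \<integral>\<^sup>+\<theta>'. ?k x \<theta> \<theta>' * w (av \<theta> + b, av \<theta>' + b) \<partial>G \<partial>G \<partial>lborel)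
        = (\<integral>\<^sup>+\<theta>. \<integral>\<^sup>+b. \<integral>\<^sup>+\<theta>'. ?k x \<theta> \<theta>' * w (av \<theta> + b, av \<theta>' + b) \<partial>G \<partial>lborel \<partial>G)"
      by (rule LG.Fubini'[symmetric]) measurable
    also have "\<dots> = (\<integral>\<^sup>+\<theta>. \<integral>\<^sup>+\<theta>'. \<integral>\<^sup>+b. ?k x \<theta> \<theta>' * w (av \<theta> + b, av \<theta>' + b) \<partial>lborel \<partial>G \<partial>G)"
      by (intro nn_integral_cong LG.Fubini'[symmetric]) measurable
    also have "\<dots> \<le> (\<integral>\<^sup>+\<theta>. \<integral>\<^sup>+\<theta>'. L * (16 * (?m x \<theta> * ?g x \<theta>') + 16 * (?g x \<theta> * ?m x \<theta>')) \<partial>G \<partial>G)"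
    proof (intro nn_integral_mono)
      fix \<theta> \<theta>' :: "real^'p"
      let ?s = "norm (\<theta> - \<theta>')" and ?a = "norm (x - \<theta>)" and ?b = "norm (x - \<theta>')"
      have "(\<integral>\<^sup>+b. ?k x \<theta> \<theta>' * w (av \<theta> + b, av \<theta>' + b) \<partial>lborel) \<le> ?k x \<theta> \<theta>' * (L * ennreal (1 + ?s\<^sup>2))"
        using L[of \<theta> \<theta>'] by (simp add: nn_integral_cmult mult_left_mono)
      also have "\<dots> = L * ennreal (gauss (x - \<theta>) * gauss (x - \<theta>') * (?s\<^sup>2 * (1 + ?s\<^sup>2)))"
        by (simp add: ennreal_mult gauss_nonneg mult_ac)
      also have "\<dots> \<le> L * ennreal (gauss (x - \<theta>) * gauss (x - \<theta>') * (16 * (1 + ?a ^ 4) + 16 * (1 + ?b ^ 4)))"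
      proof (intro mult_left_mono ennreal_leI)
        \<comment> \<open>Altogether s^2 + s^4 <= 1 + 2 s^4 <= 1 + 16 (a^4 + b^4), shared
          symmetrically by the two points.\<close>
        have "?s \<le> ?a + ?b" using norm_triangle_ineq4[of "x - \<theta>'" "x - \<theta>"] by (simp add: add.commute)
        then have "?s ^ 4 \<le> (?a + ?b) ^ 4" by (intro power_mono) auto
        also have "\<dots> \<le> 8 * (?a ^ 4 + ?b ^ 4)" by (rule power4_add_le)
        finally have "?s ^ 4 \<le> 8 * (?a ^ 4 + ?b ^ 4)" .
        moreover have "?s\<^sup>2 \<le> 1 + ?s ^ 4" by (rule power2_le_one_plus_power4)
        moreover have "p + q \<le> 16 * (1 + A) + 16 * (1 + B)" if "q \<le> 8 * (A + B)" "p \<le> 1 + q" for p q A B :: real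
          using that by simp
        ultimately have "?s\<^sup>2 + ?s ^ 4 \<le> 16 * (1 + ?a ^ 4) + 16 * (1 + ?b ^ 4)" by blast
        moreover have "?s\<^sup>2 * (1 + ?s\<^sup>2) = ?s\<^sup>2 + ?s ^ 4" by (simp add: algebra_simps flip: power_add)
        ultimately show "?s\<^sup>2 * (1 + ?s\<^sup>2) \<le> 16 * (1 + ?a ^ 4) + 16 * (1 + ?b ^ 4)" by (simp only:)
      qed (auto simp: gauss_nonneg)
      also have "ennreal (gauss (x - \<theta>) * gauss (x - \<theta>') * (16 * (1 + ?a ^ 4) + 16 * (1 + ?b ^ 4)))
          = ennreal (16 * ((gauss (x - \<theta>) * (1 + ?a ^ 4)) * gauss (x - \<theta>')) + 16 * (gauss (x - \<theta>) * (gauss (x - \<theta>') * (1 + ?b ^ 4))))"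
        by (rule arg_cong[where f=ennreal]) (simp add: algebra_simps)
      also have "\<dots> = 16 * (?m x \<theta> * ?g x \<theta>') + 16 * (?g x \<theta> * ?m x \<theta>')"
      proof -
        have *: "ennreal (16 * (r * s) + 16 * (t * u)) = 16 * (ennreal r * ennreal s) + 16 * (ennreal t * ennreal u)"
          if "r \<ge> 0" "s \<ge> 0" "t \<ge> 0" "u \<ge> 0" for r s t u
          using that by (simp add: ennreal_mult)
        show ?thesis by (rule *) (simp_all add: gauss_nonneg)
      qed
      finally show "(\<integral>\<^sup>+b. ?k x \<theta> \<theta>' * w (av \<theta> + b, av \<theta>' + b) \<partial>lborel) \<le> L * (16 * (?m x \<theta> * ?g x \<theta>') + 16 * (?g x \<theta> * ?m x \<theta>'))" .
    qed
    also have "(\<integral>\<^sup>+\<theta>. \<integral>\<^sup>+\<theta>'. L * (16 * (?m x \<theta> * ?g x \<theta>') + 16 * (?g x \<theta> * ?m x \<theta>')) \<partial>G \<partial>G)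
        = L * (16 * (moment4 x * ennreal (marg x)) + 16 * (ennreal (marg x) * moment4 x))"
      by (simp add: nn_integral_cmult nn_integral_multc nn_integral_add nn_marg moment4_def)
    also have "\<dots> = ennreal (marg x) * (L * (32 * moment4 x))"
    proof -
      have "16 * (moment4 x * ennreal (marg x)) + 16 * (ennreal (marg x) * moment4 x) = (16 + 16) * (ennreal (marg x) * moment4 x)"
        by (simp only: distrib_right mult.commute[of "moment4 x"])
      then show ?thesis by (simp add: mult_ac)
    qed
    finally show ?thesis .
    qed
    have cancel: "ennreal (1 / marg x) * (ennreal (marg x) * (L * (32 * moment4 x))) = L * (32 * moment4 x)"
      using marg_pos[of x] by (simp add: mult.assoc[symmetric] ennreal_mult[symmetric])
    show ?thesis
      unfolding eq by (rule mult_left_mono[OF le zero_le, of "ennreal (1 / marg x)", unfolded cancel])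
  qed
  let ?A = "ennreal (disc_area TYPE(real^'q))"
  have A: "?A \<noteq> 0" "?A \<noteq> \<infinity>" using disc_area_pos[where 'q='q] by auto
  have "(\<integral>\<^sup>+x. spread w x \<partial>lborel) * ?A
      = (\<integral>\<^sup>+x. indicator (ball 0 1) (av x) * (\<integral>\<^sup>+b. spread w (x + emb b) \<partial>lborel) \<partial>lborel)"
    by (rule slab_average) measurable
  also have "\<dots> \<le> (\<integral>\<^sup>+x. L * (indicator (ball 0 1) (av x) * (32 * moment4 x)) \<partial>lborel)"
    using inner by (intro nn_integral_mono) (simp add: indicator_def split: split_indicator)
  also have "\<dots> = L * (\<integral>\<^sup>+x. indicator (ball 0 1) (av x) * (32 * moment4 x) \<partial>lborel)"
    by (rule nn_integral_cmult) measurable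
  also have "\<dots> = L * spread_const * ?A"
    unfolding spread_const_def using A
    by (simp add: ennreal_times_divide mult.assoc ennreal_divide_times)
  finally show ?thesis using A by (simp add: ennreal_mult_le_mult_iff mult.commute)
qed

section \<open>Blyth's inequality with cutoff weights\<close>

text \<open>Its square is the density of the n-th approximating prior with respect to G.\<close>

definition weight :: "nat \<Rightarrow> real^'p \<Rightarrow> real" where
  "weight n \<theta> = cutoff n (av \<theta>)"

lemma weight_measurable [measurable]: "weight n \<in> borel_measurable borel"
  unfolding weight_def[abs_def] by measurable

lemma weight_bounds: "0 \<le> weight n \<theta>" "weight n \<theta> \<le> 1"
  by (simp_all add: weight_def cutoff_bounds)

lemma weight_sq_le: "(weight n \<theta>)\<^sup>2 \<le> 1"
  using weight_bounds[of n \<theta>] by (simp add: power_le_one)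

definition wmass :: "nat \<Rightarrow> real^'p \<Rightarrow> real" where
  "wmass n x = (\<integral>\<theta>. gauss (x - \<theta>) * (weight n \<theta>)\<^sup>2 \<partial>G)"

definition wmean :: "nat \<Rightarrow> real^'p \<Rightarrow> real^'p" where
  "wmean n x = (\<integral>\<theta>. gauss (x - \<theta>) *\<^sub>R ((weight n \<theta>)\<^sup>2 *\<^sub>R \<theta>) \<partial>G)"

text \<open>A nonlocal Dirichlet form of the weight: squared differences over pairs of parameters in
  place of a squared gradient.\<close>

definition wvar :: "nat \<Rightarrow> real^'p \<Rightarrow> real" where
  "wvar n x = (\<integral>z. gauss (x - fst z) * gauss (x - snd z) * ((norm (fst z - snd z))\<^sup>2 * (weight n (fst z) - weight n (snd z))\<^sup>2) \<partial>(G \<Otimes>\<^sub>M G))"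

lemma integrable_moment: "integrable G (\<lambda>\<theta>. gauss (x - \<theta>) * (1 + norm (x - \<theta>) ^ 4))"
  using integrable_gauss(1)[of "\<lambda>\<theta>. 1 + norm (x - \<theta>) ^ 4" 1 x] by simp

lemma GG_product:
  fixes f g :: "real^'p \<Rightarrow> real"
  assumes f: "integrable G f" and g: "integrable G g"
  shows "integrable (G \<Otimes>\<^sub>M G) (\<lambda>z. f (fst z) * g (snd z))"
    and "(\<integral>z. f (fst z) * g (snd z) \<partial>(G \<Otimes>\<^sub>M G)) = (\<integral>\<theta>. f \<theta> \<partial>G) * (\<integral>\<theta>. g \<theta> \<partial>G)"
proof -
  have [measurable]: "f \<in> borel_measurable borel" "g \<in> borel_measurable borel"
    using f g by (auto simp: measurable_G_iff dest: borel_measurable_integrable)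
  show int: "integrable (G \<Otimes>\<^sub>M G) (\<lambda>z. f (fst z) * g (snd z))"
  proof (rule integrableI_bounded)
    have "(\<integral>\<^sup>+z. ennreal (norm (f (fst z) * g (snd z))) \<partial>(G \<Otimes>\<^sub>M G))
        = (\<integral>\<^sup>+\<theta>. \<integral>\<^sup>+\<theta>'. ennreal (norm (f \<theta>)) * ennreal (norm (g \<theta>')) \<partial>G \<partial>G)"
      by (subst G.nn_integral_fst[symmetric]) (simp_all add: abs_mult ennreal_mult)
    also have "\<dots> = (\<integral>\<^sup>+\<theta>. ennreal (norm (f \<theta>)) \<partial>G) * (\<integral>\<^sup>+\<theta>. ennreal (norm (g \<theta>)) \<partial>G)"
      by (simp add: nn_integral_cmult nn_integral_multc)
    also have "\<dots> < \<infinity>" using f g by (simp add: integrable_iff_bounded ennreal_mult_less_top)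
    finally show "(\<integral>\<^sup>+z. ennreal (norm (f (fst z) * g (snd z))) \<partial>(G \<Otimes>\<^sub>M G)) < \<infinity>" .
  qed measurable
  show "(\<integral>z. f (fst z) * g (snd z) \<partial>(G \<Otimes>\<^sub>M G)) = (\<integral>\<theta>. f \<theta> \<partial>G) * (\<integral>\<theta>. g \<theta> \<partial>G)"
    using GG.integral_fst'[OF int] by simp
qed

lemma integrable_GG:
  assumes [measurable]: "f \<in> borel_measurable (borel \<Otimes>\<^sub>M borel)"
    and le: "\<And>\<theta> \<theta>'. \<bar>f (\<theta>, \<theta>')\<bar> \<le> B * ((1 + norm (x - \<theta>) ^ 4) * (1 + norm (x - \<theta>') ^ 4))"
  shows "integrable (G \<Otimes>\<^sub>M G) (\<lambda>z. gauss (x - fst z) * gauss (x - snd z) * f z)"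
proof (rule Bochner_Integration.integrable_bound[OF integrable_mult_right[OF GG_product(1)[OF integrable_moment[of x] integrable_moment[of x]], of B]])
  show "(\<lambda>z. gauss (x - fst z) * gauss (x - snd z) * f z) \<in> borel_measurable (G \<Otimes>\<^sub>M G)" by measurable
  have "\<bar>gauss (x - \<theta>) * gauss (x - \<theta>') * f (\<theta>, \<theta>')\<bar>
      \<le> B * ((gauss (x - \<theta>) * (1 + norm (x - \<theta>) ^ 4)) * (gauss (x - \<theta>') * (1 + norm (x - \<theta>') ^ 4)))" for \<theta> \<theta>'
  proof -
    have "(gauss (x - \<theta>) * gauss (x - \<theta>')) * \<bar>f (\<theta>, \<theta>')\<bar>
        \<le> (gauss (x - \<theta>) * gauss (x - \<theta>')) * (B * ((1 + norm (x - \<theta>) ^ 4) * (1 + norm (x - \<theta>') ^ 4)))"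
      by (intro mult_left_mono le) (simp add: gauss_nonneg)
    then show ?thesis by (simp add: abs_mult gauss_nonneg mult_ac)
  qed
  then show "AE z in G \<Otimes>\<^sub>M G. norm (gauss (x - fst z) * gauss (x - snd z) * f z)
      \<le> norm (B * ((gauss (x - fst z) * (1 + norm (x - fst z) ^ 4)) * (gauss (x - snd z) * (1 + norm (x - snd z) ^ 4))))"
    by (intro AE_I2) (auto intro!: order_trans[OF _ abs_ge_self])
qed

lemma le_product_pow4:
  fixes a b :: real
  assumes "a \<ge> 0" "b \<ge> 0"
  shows "1 \<le> (1 + a ^ 4) * (1 + b ^ 4)" "a + b \<le> 2 * ((1 + a ^ 4) * (1 + b ^ 4))"
    "(a + b)\<^sup>2 \<le> 4 * ((1 + a ^ 4) * (1 + b ^ 4))"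
proof -
  let ?A = "1 + a ^ 4" and ?B = "1 + b ^ 4"
  have AB: "?A \<ge> 1" "?B \<ge> 1" by simp_all
  have 1: "?A \<le> ?A * ?B" "?B \<le> ?A * ?B"
    using mult_left_mono[OF AB(2), of ?A] mult_right_mono[OF AB(1), of ?B] by (simp_all add: distrib_left distrib_right)
  show "1 \<le> ?A * ?B" using AB(1) 1(1) by linarith
  show "a + b \<le> 2 * (?A * ?B)"
    using le_one_plus_pow4[OF assms(1)] le_one_plus_pow4[OF assms(2)] 1 by linarith
  have "(a + b)\<^sup>2 \<le> 2 * a\<^sup>2 + 2 * b\<^sup>2" using sum_squares_bound[of a b] by (simp add: power2_sum)
  also have "\<dots> \<le> 2 * ?A + 2 * ?B"
    by (intro add_mono mult_left_mono power2_le_one_plus_power4) auto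
  also have "\<dots> \<le> 2 * (?A * ?B) + 2 * (?A * ?B)"
    by (intro add_mono mult_left_mono 1) auto
  finally show "(a + b)\<^sup>2 \<le> 4 * (?A * ?B)" by simp
qed

lemma norm_diff_via: "norm (\<theta> - \<theta>') \<le> norm (x - \<theta>) + norm (x - (\<theta>' :: real^'p))"
  using norm_triangle_ineq4[of "x - \<theta>'" "x - \<theta>"] by (simp add: add.commute)

lemma integrable_weight:
  "integrable G (\<lambda>\<theta>. gauss (x - \<theta>) * (weight n \<theta>)\<^sup>2)"
  "integrable G (\<lambda>\<theta>. gauss (x - \<theta>) *\<^sub>R ((weight n \<theta>)\<^sup>2 *\<^sub>R \<theta>))"
proof -
  have "norm ((weight n \<theta>)\<^sup>2) \<le> 1 * (1 + norm (x - \<theta>) ^ 4)" for \<theta>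
    using weight_sq_le[of n \<theta>] by (simp add: add_increasing2)
  then show 1: "integrable G (\<lambda>\<theta>. gauss (x - \<theta>) * (weight n \<theta>)\<^sup>2)"
    using integrable_gauss(1)[of "\<lambda>\<theta>. (weight n \<theta>)\<^sup>2" 1 x] by simp
  have le: "norm ((weight n \<theta>)\<^sup>2 *\<^sub>R (\<theta> - x)) \<le> 1 * (1 + norm (x - \<theta>) ^ 4)" for \<theta>
  proof -
    have "(weight n \<theta>)\<^sup>2 * norm (\<theta> - x) \<le> 1 * norm (\<theta> - x)" by (intro mult_right_mono weight_sq_le) simp
    then show ?thesis using le_one_plus_pow4[OF norm_ge_zero, of "x - \<theta>"] by (simp add: norm_minus_commute)
  qed
  have "integrable G (\<lambda>\<theta>. gauss (x - \<theta>) *\<^sub>R ((weight n \<theta>)\<^sup>2 *\<^sub>R (\<theta> - x)))"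
    by (rule integrable_gauss(1)[OF _ le]) measurable
  from Bochner_Integration.integrable_add[OF this integrable_scaleR_left[OF 1, of x]]
  show "integrable G (\<lambda>\<theta>. gauss (x - \<theta>) *\<^sub>R ((weight n \<theta>)\<^sup>2 *\<^sub>R \<theta>))"
    by (simp add: scaleR_diff_right)
qed

lemma wmass_nonneg: "0 \<le> wmass n x"
  unfolding wmass_def by (simp add: gauss_nonneg)

text \<open>Symmetrising the double integral in \<open>\<theta>\<close> and \<open>\<theta>'\<close> turns the difference of the two posterior means into a covariance
  with \<open>h\<^sup>2\<close>; then \<open>h\<^sup>2 - h'\<^sup>2 = (h - h') (h + h')\<close> is split by AM-GM.\<close>

lemma blyth_pointwise:
  "marg x * ((norm e)\<^sup>2 * wmass n x) / 2 - 2 * wvar n x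
    \<le> marg x * ((norm e)\<^sup>2 * wmass n x + 2 * (e \<bullet> (wmass n x *\<^sub>R bayes x - wmean n x)))"
proof -
  let ?g = "\<lambda>z. gauss (x - fst z) * gauss (x - snd z)"
  let ?h = "\<lambda>z. weight n (fst z)" and ?h' = "\<lambda>z. weight n (snd z)"
  let ?GG = "G \<Otimes>\<^sub>M G"
  have [measurable]: "(\<lambda>z. gauss (x - fst z)) \<in> borel_measurable (borel \<Otimes>\<^sub>M borel)" by measurable
  let ?f1 = "\<lambda>z. (e \<bullet> (snd z - fst z)) * (?h z)\<^sup>2" and ?f2 = "\<lambda>z. (e \<bullet> (fst z - snd z)) * (?h' z)\<^sup>2"
  let ?f3 = "\<lambda>z. (norm (fst z - snd z))\<^sup>2 * (?h z - ?h' z)\<^sup>2"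
  have e1: "\<bar>(e \<bullet> (\<theta>' - \<theta>)) * (weight n \<tau>)\<^sup>2\<bar> \<le> (2 * norm e) * ((1 + norm (x - \<theta>) ^ 4) * (1 + norm (x - \<theta>') ^ 4))" for \<theta> \<theta>' \<tau>
  proof -
    have "\<bar>(e \<bullet> (\<theta>' - \<theta>)) * (weight n \<tau>)\<^sup>2\<bar> \<le> \<bar>e \<bullet> (\<theta>' - \<theta>)\<bar> * 1"
      unfolding abs_mult by (intro mult_left_mono) (auto simp: weight_sq_le)
    also have "\<dots> \<le> norm e * norm (\<theta>' - \<theta>)" using Cauchy_Schwarz_ineq2[of e "\<theta>' - \<theta>"] by simp
    also have "\<dots> \<le> norm e * (2 * ((1 + norm (x - \<theta>) ^ 4) * (1 + norm (x - \<theta>') ^ 4)))"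
      using norm_diff_via[of \<theta>' \<theta> x] le_product_pow4(2)[of "norm (x - \<theta>)" "norm (x - \<theta>')"]
      by (intro mult_left_mono) auto
    finally show ?thesis by (simp only: mult_ac)
  qed
  have i1: "integrable ?GG (\<lambda>z. ?g z * ?f1 z)"
  proof (rule integrable_GG)
    show "\<bar>?f1 (\<theta>, \<theta>')\<bar> \<le> 2 * norm e * ((1 + norm (x - \<theta>) ^ 4) * (1 + norm (x - \<theta>') ^ 4))" for \<theta> \<theta>'
      using e1[of \<theta>' \<theta> \<theta>] by (simp only: fst_conv snd_conv)
  qed measurable
  have i2: "integrable ?GG (\<lambda>z. ?g z * ?f2 z)"
  proof (rule integrable_GG)
    show "\<bar>?f2 (\<theta>, \<theta>')\<bar> \<le> 2 * norm e * ((1 + norm (x - \<theta>) ^ 4) * (1 + norm (x - \<theta>') ^ 4))" for \<theta> \<theta>'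
      using e1[of \<theta> \<theta>' \<theta>'] by (simp only: fst_conv snd_conv mult.commute[of "1 + norm (x - \<theta>) ^ 4"])
  qed measurable
  have i3: "integrable ?GG (\<lambda>z. ?g z * ?f3 z)"
  proof (rule integrable_GG[where B=4])
    fix \<theta> \<theta>' :: "real^'p"
    have "\<bar>weight n \<theta> - weight n \<theta>'\<bar> \<le> 1" using weight_bounds[of n \<theta>] weight_bounds[of n \<theta>'] by linarith
    then have "\<bar>weight n \<theta> - weight n \<theta>'\<bar>\<^sup>2 \<le> 1" by (intro power_le_one) auto
    then have "(norm (\<theta> - \<theta>'))\<^sup>2 * (weight n \<theta> - weight n \<theta>')\<^sup>2 \<le> (norm (\<theta> - \<theta>'))\<^sup>2 * 1" by (intro mult_left_mono) auto
    also have "\<dots> \<le> (norm (x - \<theta>) + norm (x - \<theta>'))\<^sup>2" using norm_diff_via by (simp add: power_mono)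
    also have "\<dots> \<le> 4 * ((1 + norm (x - \<theta>) ^ 4) * (1 + norm (x - \<theta>') ^ 4))" by (rule le_product_pow4) auto
    finally show "\<bar>?f3 (\<theta>, \<theta>')\<bar> \<le> 4 * ((1 + norm (x - \<theta>) ^ 4) * (1 + norm (x - \<theta>') ^ 4))" by simp
  qed measurable
  have hi: "integrable ?GG (\<lambda>z. (gauss (x - fst z) * (?h z)\<^sup>2) * gauss (x - snd z))"
    "(\<integral>z. (gauss (x - fst z) * (?h z)\<^sup>2) * gauss (x - snd z) \<partial>?GG) = wmass n x * marg x"
    "integrable ?GG (\<lambda>z. gauss (x - fst z) * (gauss (x - snd z) * (?h' z)\<^sup>2))"
    "(\<integral>z. gauss (x - fst z) * (gauss (x - snd z) * (?h' z)\<^sup>2) \<partial>?GG) = marg x * wmass n x"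
    using GG_product[OF integrable_weight(1)[of x n] integrable_gauss_1[of x]]
      GG_product[OF integrable_gauss_1[of x] integrable_weight(1)[of x n]]
    by (simp_all add: wmass_def marg_def)
  \<comment> \<open>With two copies of the parameter, the gap between the means becomes the integral
    of e \<bullet> (\<theta>' - \<theta>) against the squared weight at \<theta>.\<close>
  have T1: "(\<integral>z. ?g z * ?f1 z \<partial>?GG) = marg x * (e \<bullet> (wmass n x *\<^sub>R bayes x - wmean n x))"
  proof -
    have j1: "integrable G (\<lambda>\<theta>. e \<bullet> (gauss (x - \<theta>) *\<^sub>R \<theta>))" "integrable G (\<lambda>\<theta>. e \<bullet> (gauss (x - \<theta>) *\<^sub>R ((weight n \<theta>)\<^sup>2 *\<^sub>R \<theta>)))"
      by (rule integrable_inner_right, rule integrable_gauss_id, rule integrable_inner_right, rule integrable_weight(2))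
    have "(\<integral>z. ?g z * ?f1 z \<partial>?GG)
       = (\<integral>z. (gauss (x - fst z) * (?h z)\<^sup>2) * (e \<bullet> (gauss (x - snd z) *\<^sub>R snd z))
            - (e \<bullet> (gauss (x - fst z) *\<^sub>R ((?h z)\<^sup>2 *\<^sub>R fst z))) * gauss (x - snd z) \<partial>?GG)"
      by (rule Bochner_Integration.integral_cong) (auto simp: inner_diff_right algebra_simps)
    also have "\<dots> = wmass n x * (\<integral>\<theta>. e \<bullet> (gauss (x - \<theta>) *\<^sub>R \<theta>) \<partial>G)
        - (\<integral>\<theta>. e \<bullet> (gauss (x - \<theta>) *\<^sub>R ((weight n \<theta>)\<^sup>2 *\<^sub>R \<theta>)) \<partial>G) * marg x"
      using GG_product[OF integrable_weight(1)[of x n] j1(1)] GG_product[OF j1(2) integrable_gauss_1[of x]]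
      by (subst Bochner_Integration.integral_diff) (simp_all only: wmass_def marg_def)
    also have "(\<integral>\<theta>. e \<bullet> (gauss (x - \<theta>) *\<^sub>R \<theta>) \<partial>G) = e \<bullet> (marg x *\<^sub>R bayes x)"
      using marg_pos[of x] by (subst integral_inner_right) (auto simp: bayes_def intro: integrable_gauss_id)
    also have "(\<integral>\<theta>. e \<bullet> (gauss (x - \<theta>) *\<^sub>R ((weight n \<theta>)\<^sup>2 *\<^sub>R \<theta>)) \<partial>G) = e \<bullet> wmean n x"
      unfolding wmean_def by (rule integral_inner_right) (rule integrable_weight(2))
    finally show ?thesis by (simp add: inner_diff_right algebra_simps)
  qed
  \<comment> \<open>Exchanging the copies; the sum of both forms contains the difference of the
    squared weights.\<close>
  have T2: "(\<integral>z. ?g z * ?f2 z \<partial>?GG) = (\<integral>z. ?g z * ?f1 z \<partial>?GG)"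
    using GG.integral_product_swap[of "\<lambda>z. ?g z * ?f1 z"] i1
    by (simp add: case_prod_unfold mult_ac borel_measurable_integrable)
  let ?q = "\<lambda>z. (norm e)\<^sup>2 / 4 * ((gauss (x - fst z) * (?h z)\<^sup>2) * gauss (x - snd z) + gauss (x - fst z) * (gauss (x - snd z) * (?h' z)\<^sup>2))
      + 2 * (?g z * ?f3 z)"
  have "- (\<integral>z. ?q z \<partial>?GG) \<le> (\<integral>z. ?g z * ?f1 z + ?g z * ?f2 z \<partial>?GG)"
    unfolding Bochner_Integration.integral_minus[symmetric]
  proof (rule integral_mono)
    show "integrable ?GG (\<lambda>z. - ?q z)"
      by (intro Bochner_Integration.integrable_minus Bochner_Integration.integrable_add integrable_mult_right hi i3)
    show "integrable ?GG (\<lambda>z. ?g z * ?f1 z + ?g z * ?f2 z)" by (intro Bochner_Integration.integrable_add i1 i2)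
    fix z
    let ?a = "norm e * (?h z + ?h' z)" and ?b = "norm (fst z - snd z) * \<bar>?h z - ?h' z\<bar>"
    have "?f1 z + ?f2 z = (e \<bullet> (snd z - fst z)) * ((?h z - ?h' z) * (?h z + ?h' z))"
      by (simp add: inner_diff_right power2_eq_square algebra_simps)
    moreover have "\<bar>(e \<bullet> (snd z - fst z)) * ((?h z - ?h' z) * (?h z + ?h' z))\<bar> \<le> ?a * ?b"
    proof -
      have "\<bar>e \<bullet> (snd z - fst z)\<bar> * (\<bar>?h z - ?h' z\<bar> * \<bar>?h z + ?h' z\<bar>)
          \<le> (norm e * norm (snd z - fst z)) * (\<bar>?h z - ?h' z\<bar> * \<bar>?h z + ?h' z\<bar>)"
        by (intro mult_right_mono Cauchy_Schwarz_ineq2) auto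
      moreover have "\<bar>?h z + ?h' z\<bar> = ?h z + ?h' z" using weight_bounds(1) by (simp add: add_nonneg_nonneg)
      ultimately show ?thesis by (simp add: abs_mult norm_minus_commute mult_ac)
    qed
    \<comment> \<open>The coefficients 1/8 and 2 are fixed by the target: after (h + h')^2 <= 2 (h^2
      + h'^2) the first part integrates to half of m |e|^2 \<open>wmass n x\<close>, the second to 2
      \<open>wvar n x\<close>.\<close>
    moreover have "?a * ?b \<le> ?a\<^sup>2 / 8 + 2 * ?b\<^sup>2"
      using sum_squares_bound[of "?a / 2" "2 * ?b"] by (simp add: power_divide power_mult_distrib)
    moreover have "?a\<^sup>2 / 8 \<le> (norm e)\<^sup>2 / 4 * ((?h z)\<^sup>2 + (?h' z)\<^sup>2)"
    proof -
      have "(?h z + ?h' z)\<^sup>2 \<le> 2 * ((?h z)\<^sup>2 + (?h' z)\<^sup>2)"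
        using sum_squares_bound[of "?h z" "?h' z"] by (simp add: power2_sum)
      then have "(norm e)\<^sup>2 / 8 * (?h z + ?h' z)\<^sup>2 \<le> (norm e)\<^sup>2 / 8 * (2 * ((?h z)\<^sup>2 + (?h' z)\<^sup>2))"
        by (intro mult_left_mono) auto
      moreover have "(norm e)\<^sup>2 / 8 * (2 * ((?h z)\<^sup>2 + (?h' z)\<^sup>2)) = (norm e)\<^sup>2 / 4 * ((?h z)\<^sup>2 + (?h' z)\<^sup>2)"
        by simp
      moreover have "?a\<^sup>2 / 8 = (norm e)\<^sup>2 / 8 * (?h z + ?h' z)\<^sup>2" by (simp add: power_mult_distrib)
      ultimately show ?thesis by (simp only:)
    qed
    moreover have "?b\<^sup>2 = ?f3 z" by (simp add: power_mult_distrib)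
    ultimately have "- ((norm e)\<^sup>2 / 4 * ((?h z)\<^sup>2 + (?h' z)\<^sup>2) + 2 * ?f3 z) \<le> ?f1 z + ?f2 z"
      by linarith
    then have "?g z * - ((norm e)\<^sup>2 / 4 * ((?h z)\<^sup>2 + (?h' z)\<^sup>2) + 2 * ?f3 z) \<le> ?g z * (?f1 z + ?f2 z)"
      by (intro mult_left_mono) (simp_all add: gauss_nonneg)
    moreover have "?g z * - ((norm e)\<^sup>2 / 4 * ((?h z)\<^sup>2 + (?h' z)\<^sup>2) + 2 * ?f3 z) = - ?q z"
      by (simp add: algebra_simps)
    moreover have "?g z * (?f1 z + ?f2 z) = ?g z * ?f1 z + ?g z * ?f2 z" by (rule distrib_left)
    ultimately show "- ?q z \<le> ?g z * ?f1 z + ?g z * ?f2 z" by (simp only:)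
  qed
  also have "(\<integral>z. ?g z * ?f1 z + ?g z * ?f2 z \<partial>?GG) = 2 * (marg x * (e \<bullet> (wmass n x *\<^sub>R bayes x - wmean n x)))"
    using Bochner_Integration.integral_add[OF i1 i2] T1 T2 by linarith
  also have "(\<integral>z. ?q z \<partial>?GG) = (norm e)\<^sup>2 / 4 * (wmass n x * marg x + marg x * wmass n x) + 2 * wvar n x"
    using Bochner_Integration.integrable_add[OF hi(1,3)]
    by (subst Bochner_Integration.integral_add[OF integrable_mult_right integrable_mult_right[OF i3]])
      (simp_all only: integral_mult_right_zero Bochner_Integration.integral_add[OF hi(1,3)] hi(2,4) wvar_def)
  finally show ?thesis by (simp add: algebra_simps)
qed

lemma wvar_spread:
  "ennreal (wvar n x / marg x) = spread (\<lambda>(a, b). ennreal ((cutoff n a - cutoff n b)\<^sup>2)) x"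
proof -
  let ?f = "\<lambda>z. gauss (x - fst z) * gauss (x - snd z) * ((norm (fst z - snd z))\<^sup>2 * (weight n (fst z) - weight n (snd z))\<^sup>2)"
  have "integrable (G \<Otimes>\<^sub>M G) ?f"
  proof (rule integrable_GG[where B=4])
    fix \<theta> \<theta>' :: "real^'p"
    have "\<bar>weight n \<theta> - weight n \<theta>'\<bar> \<le> 1" using weight_bounds[of n \<theta>] weight_bounds[of n \<theta>'] by linarith
    then have "\<bar>weight n \<theta> - weight n \<theta>'\<bar>\<^sup>2 \<le> 1" by (intro power_le_one) auto
    then have "(norm (\<theta> - \<theta>'))\<^sup>2 * (weight n \<theta> - weight n \<theta>')\<^sup>2 \<le> (norm (\<theta> - \<theta>'))\<^sup>2 * 1" by (intro mult_left_mono) auto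
    also have "\<dots> \<le> (norm (x - \<theta>) + norm (x - \<theta>'))\<^sup>2" using norm_diff_via by (simp add: power_mono)
    also have "\<dots> \<le> 4 * ((1 + norm (x - \<theta>) ^ 4) * (1 + norm (x - \<theta>') ^ 4))" by (rule le_product_pow4) auto
    finally show "\<bar>(norm (fst (\<theta>, \<theta>') - snd (\<theta>, \<theta>')))\<^sup>2 * (weight n (fst (\<theta>, \<theta>')) - weight n (snd (\<theta>, \<theta>')))\<^sup>2\<bar>
      \<le> 4 * ((1 + norm (x - \<theta>) ^ 4) * (1 + norm (x - \<theta>') ^ 4))" by simp
  qed measurable
  then have "ennreal (wvar n x) = (\<integral>\<^sup>+z. ennreal (?f z) \<partial>(G \<Otimes>\<^sub>M G))"
    unfolding wvar_def by (intro nn_integral_eq_integral[symmetric]) (auto simp: gauss_nonneg)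
  also have "\<dots> = (\<integral>\<^sup>+\<theta>. \<integral>\<^sup>+\<theta>'. ennreal (?f (\<theta>, \<theta>')) \<partial>G \<partial>G)"
    by (rule G.nn_integral_fst[symmetric]) measurable
  also have "\<dots> = (\<integral>\<^sup>+\<theta>. \<integral>\<^sup>+\<theta>'. ennreal (gauss (x - \<theta>) * gauss (x - \<theta>') * (norm (\<theta> - \<theta>'))\<^sup>2) * ennreal ((cutoff n (av \<theta>) - cutoff n (av \<theta>'))\<^sup>2) \<partial>G \<partial>G)"
    by (simp add: ennreal_mult[symmetric] gauss_nonneg weight_def mult_ac)
  finally show ?thesis
    using marg_pos[of x] by (simp add: spread_def divide_inverse ennreal_mult' mult.commute)
qed

text \<open>Translating both arguments by b and integrating gives the cutoff energy for the
  displacement av \<theta> - av \<theta>', and \<open>norm_av\<close> bounds this displacement by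
  |\<theta> - \<theta>'|.\<close>

lemma spread_energy:
  assumes n: "n \<ge> 1"
  shows "(\<integral>\<^sup>+x. spread (\<lambda>(a, b). ennreal ((cutoff n a - cutoff n b)\<^sup>2)) x \<partial>lborel)
    \<le> ennreal (6 * disc_area TYPE(real^'q) / n) * spread_const"
proof (rule spread_integral_le)
  show "(\<lambda>(a, b). ennreal ((cutoff n a - cutoff n b)\<^sup>2)) \<in> borel_measurable (borel \<Otimes>\<^sub>M (borel :: (real^'q) measure))"
    by measurable
  fix \<theta> \<theta>' :: "real^'p"
  let ?u = "av \<theta> - av \<theta>'" and ?v = "disc_area TYPE(real^'q)"
  have "(\<integral>\<^sup>+b. ennreal ((cutoff n (av \<theta> + b) - cutoff n (av \<theta>' + b))\<^sup>2) \<partial>lborel)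
      = (\<integral>\<^sup>+b. ennreal ((cutoff n (av \<theta>' + b + ?u) - cutoff n (av \<theta>' + b))\<^sup>2) \<partial>lborel)"
    by (simp add: algebra_simps)
  also have "\<dots> = (\<integral>\<^sup>+b. ennreal ((cutoff n (b + ?u) - cutoff n b)\<^sup>2) \<partial>lborel)"
    by (rule nn_integral_lborel_translate[of "\<lambda>b. ennreal ((cutoff n (b + ?u) - cutoff n b)\<^sup>2)"]) measurable
  also have "\<dots> \<le> ennreal (6 * ?v * (norm ?u)\<^sup>2 / n)" by (rule cutoff_energy[OF dim2 n])
  also have "\<dots> \<le> ennreal (6 * ?v / n * (1 + (norm (\<theta> - \<theta>'))\<^sup>2))"
  proof (rule ennreal_leI)
    have "norm ?u \<le> norm (\<theta> - \<theta>')" using norm_av[of "\<theta> - \<theta>'"] by (simp add: linear_diff[OF linear_av])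
    then have "(norm ?u)\<^sup>2 \<le> 1 + (norm (\<theta> - \<theta>'))\<^sup>2" by (simp add: power_mono add_increasing)
    then have "6 * ?v / n * (norm ?u)\<^sup>2 \<le> 6 * ?v / n * (1 + (norm (\<theta> - \<theta>'))\<^sup>2)"
      using disc_area_pos[where 'q='q] by (intro mult_left_mono) auto
    then show "6 * ?v * (norm ?u)\<^sup>2 / n \<le> 6 * ?v / n * (1 + (norm (\<theta> - \<theta>'))\<^sup>2)" by simp
  qed
  also have "\<dots> = ennreal (6 * ?v / n) * ennreal (1 + (norm (\<theta> - \<theta>'))\<^sup>2)"
    using disc_area_pos[where 'q='q] by (intro ennreal_mult) auto
  finally show "(\<integral>\<^sup>+b. (case (av \<theta> + b, av \<theta>' + b) of (a, b) \<Rightarrow> ennreal ((cutoff n a - cutoff n b)\<^sup>2)) \<partial>lborel)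
      \<le> ennreal (6 * ?v / n) * ennreal (1 + (norm (\<theta> - \<theta>'))\<^sup>2)" by simp
qed

text \<open>The cutoff is bounded by 1 and supported in a disc of radius 2^n, so its square has a
  finite integral.\<close>

lemma spread_cutoff_finite:
  "(\<integral>\<^sup>+x. spread (\<lambda>(a, b). ennreal ((cutoff n a)\<^sup>2)) x \<partial>lborel) < \<infinity>"
proof -
  let ?v = "ennreal (disc_area TYPE(real^'q) * (2 ^ n)\<^sup>2)"
  have "(\<integral>\<^sup>+x. spread (\<lambda>(a, b). ennreal ((cutoff n a)\<^sup>2)) x \<partial>lborel) \<le> ?v * spread_const"
  proof (rule spread_integral_le)
    show "(\<lambda>(a, b). ennreal ((cutoff n a)\<^sup>2)) \<in> borel_measurable (borel \<Otimes>\<^sub>M (borel :: (real^'q) measure))"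
      by measurable
    fix \<theta> \<theta>' :: "real^'p"
    have "(\<integral>\<^sup>+b. ennreal ((cutoff n (av \<theta> + b))\<^sup>2) \<partial>lborel) = (\<integral>\<^sup>+b. ennreal ((cutoff n (b :: real^'q))\<^sup>2) \<partial>lborel)"
      by (rule nn_integral_lborel_translate) measurable
    also have "\<dots> \<le> (\<integral>\<^sup>+b. indicator (ball 0 (2 ^ n)) (b :: real^'q) \<partial>lborel)"
    proof (rule nn_integral_mono)
      fix b :: "real^'q"
      show "ennreal ((cutoff n b)\<^sup>2) \<le> indicator (ball 0 (2 ^ n)) b"
        using cutoff_bounds[of n b] cutoff_support[of n b]
        by (cases "b \<in> ball 0 (2 ^ n)") (auto simp: power_le_one dist_norm)
    qed
    also have "\<dots> = ?v" using emeasure_ball_2d[OF dim2, of "2 ^ n" 0] by simp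
    also have "\<dots> \<le> ?v * ennreal (1 + (norm (\<theta> - \<theta>'))\<^sup>2)"
      using mult_left_mono[of 1 "ennreal (1 + (norm (\<theta> - \<theta>'))\<^sup>2)" ?v] by simp
    finally show "(\<integral>\<^sup>+b. (case (av \<theta> + b, av \<theta>' + b) of (a, b) \<Rightarrow> ennreal ((cutoff n a)\<^sup>2)) \<partial>lborel)
      \<le> ?v * ennreal (1 + (norm (\<theta> - \<theta>'))\<^sup>2)" by simp
  qed
  also have "\<dots> < \<infinity>" using spread_const_finite by (simp add: ennreal_mult_less_top)
  finally show ?thesis .
qed

text \<open>Parallel axis theorem: the second moment about \<theta> is the one about the mean d plus
  m |d - \<theta>|^2, the linear term integrating to zero.\<close>

lemma bayes_jensen:
  "ennreal ((norm (bayes x - \<theta>))\<^sup>2) \<le> ennreal (1 / marg x) * (\<integral>\<^sup>+\<theta>'. ennreal (gauss (x - \<theta>') * (norm (\<theta> - \<theta>'))\<^sup>2) \<partial>G)"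
proof -
  let ?d = "bayes x"
  have m: "marg x > 0" by (rule marg_pos)
  have sq: "integrable G (\<lambda>\<theta>'. gauss (x - \<theta>') * (norm (\<theta>' - a))\<^sup>2)" for a
  proof -
    have "norm ((norm (\<theta>' - a))\<^sup>2) \<le> (2 + 2 * (norm (x - a))\<^sup>2) * (1 + norm (x - \<theta>') ^ 4)" for \<theta>'
    proof -
      have "norm (\<theta>' - a) \<le> norm (x - \<theta>') + norm (x - a)" by (rule norm_diff_via)
      then have "(norm (\<theta>' - a))\<^sup>2 \<le> (norm (x - \<theta>') + norm (x - a))\<^sup>2" by (intro power_mono) auto
      also have "\<dots> \<le> 2 * (norm (x - \<theta>'))\<^sup>2 + 2 * (norm (x - a))\<^sup>2 * 1"
        using sum_squares_bound[of "norm (x - \<theta>')" "norm (x - a)"] by (simp add: power2_sum)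
      also have "\<dots> \<le> 2 * (1 + norm (x - \<theta>') ^ 4) + 2 * (norm (x - a))\<^sup>2 * (1 + norm (x - \<theta>') ^ 4)"
        by (intro add_mono mult_left_mono power2_le_one_plus_power4) auto
      finally show ?thesis by (simp only: distrib_right) simp
    qed
    then have "integrable G (\<lambda>\<theta>'. gauss (x - \<theta>') *\<^sub>R (norm (\<theta>' - a))\<^sup>2)"
      by (rule integrable_gauss(1)[rotated]) measurable
    then show ?thesis by simp
  qed
  have lin: "integrable G (\<lambda>\<theta>'. (?d - \<theta>) \<bullet> (gauss (x - \<theta>') *\<^sub>R \<theta>' - gauss (x - \<theta>') *\<^sub>R ?d))"
    by (intro integrable_inner_right Bochner_Integration.integrable_diff integrable_gauss_id integrable_scaleR_left integrable_gauss_1)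
  have lin0: "(\<integral>\<theta>'. (?d - \<theta>) \<bullet> (gauss (x - \<theta>') *\<^sub>R \<theta>' - gauss (x - \<theta>') *\<^sub>R ?d) \<partial>G) = 0"
  proof -
    have "(\<integral>\<theta>'. gauss (x - \<theta>') *\<^sub>R \<theta>' - gauss (x - \<theta>') *\<^sub>R ?d \<partial>G) = (\<integral>\<theta>'. gauss (x - \<theta>') *\<^sub>R \<theta>' \<partial>G) - marg x *\<^sub>R ?d"
      unfolding marg_def
      by (subst Bochner_Integration.integral_diff[OF integrable_gauss_id integrable_scaleR_left[OF integrable_gauss_1]])
        (simp add: integrable_gauss_1)
    also have "\<dots> = 0" using m by (simp add: bayes_def)
    finally show ?thesis
      by (subst integral_inner_right)
        (auto intro!: Bochner_Integration.integrable_diff integrable_gauss_id integrable_scaleR_left integrable_gauss_1)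
  qed
  have "gauss (x - \<theta>') * (norm (\<theta> - \<theta>'))\<^sup>2 = gauss (x - \<theta>') * (norm (\<theta>' - ?d))\<^sup>2
      + 2 * ((?d - \<theta>) \<bullet> (gauss (x - \<theta>') *\<^sub>R \<theta>' - gauss (x - \<theta>') *\<^sub>R ?d)) + gauss (x - \<theta>') * (norm (?d - \<theta>))\<^sup>2" for \<theta>'
    unfolding power2_norm_eq_inner
    by (simp add: inner_diff_left inner_diff_right inner_commute algebra_simps)
  then have "(\<integral>\<theta>'. gauss (x - \<theta>') * (norm (\<theta> - \<theta>'))\<^sup>2 \<partial>G) = (\<integral>\<theta>'. gauss (x - \<theta>') * (norm (\<theta>' - ?d))\<^sup>2 \<partial>G)
      + 2 * (\<integral>\<theta>'. (?d - \<theta>) \<bullet> (gauss (x - \<theta>') *\<^sub>R \<theta>' - gauss (x - \<theta>') *\<^sub>R ?d) \<partial>G) + marg x * (norm (?d - \<theta>))\<^sup>2"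
    using sq[of ?d] lin integrable_gauss_1[of x] by (simp add: marg_def del: inner_diff_right)
  moreover have "0 \<le> (\<integral>\<theta>'. gauss (x - \<theta>') * (norm (\<theta>' - ?d))\<^sup>2 \<partial>G)" by (simp add: gauss_nonneg)
  ultimately have "marg x * (norm (?d - \<theta>))\<^sup>2 \<le> (\<integral>\<theta>'. gauss (x - \<theta>') * (norm (\<theta> - \<theta>'))\<^sup>2 \<partial>G)"
    using lin0 by simp
  then have "(norm (?d - \<theta>))\<^sup>2 \<le> (1 / marg x) * (\<integral>\<theta>'. gauss (x - \<theta>') * (norm (\<theta> - \<theta>'))\<^sup>2 \<partial>G)"
    using m by (simp add: field_simps)
  then have "ennreal ((norm (?d - \<theta>))\<^sup>2) \<le> ennreal (1 / marg x) * ennreal (\<integral>\<theta>'. gauss (x - \<theta>') * (norm (\<theta> - \<theta>'))\<^sup>2 \<partial>G)"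
    using m by (simp add: ennreal_mult'[symmetric] ennreal_leI)
  also have "ennreal (\<integral>\<theta>'. gauss (x - \<theta>') * (norm (\<theta> - \<theta>'))\<^sup>2 \<partial>G) = (\<integral>\<^sup>+\<theta>'. ennreal (gauss (x - \<theta>') * (norm (\<theta> - \<theta>'))\<^sup>2) \<partial>G)"
    using sq[of \<theta>] by (intro nn_integral_eq_integral[symmetric]) (auto simp: gauss_nonneg norm_minus_commute)
  finally show ?thesis .
qed

text \<open>This finiteness permits exchanging the integrals over x and \<theta> when risks are
  averaged over the weighted prior.\<close>

lemma weighted_risk_finite:
  "(\<integral>\<^sup>+\<theta>. \<integral>\<^sup>+x. ennreal (gauss (x - \<theta>) * (weight n \<theta>)\<^sup>2 * (norm (bayes x - \<theta>))\<^sup>2) \<partial>lborel \<partial>G) < \<infinity>"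
proof -
  interpret LG: pair_sigma_finite "lborel :: (real^'p) measure" G ..
  have "(\<integral>\<^sup>+\<theta>. \<integral>\<^sup>+x. ennreal (gauss (x - \<theta>) * (weight n \<theta>)\<^sup>2 * (norm (bayes x - \<theta>))\<^sup>2) \<partial>lborel \<partial>G)
      = (\<integral>\<^sup>+x. \<integral>\<^sup>+\<theta>. ennreal (gauss (x - \<theta>) * (weight n \<theta>)\<^sup>2 * (norm (bayes x - \<theta>))\<^sup>2) \<partial>G \<partial>lborel)"
    by (rule LG.Fubini') measurable
  also have "\<dots> \<le> (\<integral>\<^sup>+x. spread (\<lambda>(a, b). ennreal ((cutoff n a)\<^sup>2)) x \<partial>lborel)"
  proof (rule nn_integral_mono)
    fix x :: "real^'p"
    have "(\<integral>\<^sup>+\<theta>. ennreal (gauss (x - \<theta>) * (weight n \<theta>)\<^sup>2 * (norm (bayes x - \<theta>))\<^sup>2) \<partial>G)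
        \<le> (\<integral>\<^sup>+\<theta>. ennreal (gauss (x - \<theta>) * (weight n \<theta>)\<^sup>2) *
            (ennreal (1 / marg x) * (\<integral>\<^sup>+\<theta>'. ennreal (gauss (x - \<theta>') * (norm (\<theta> - \<theta>'))\<^sup>2) \<partial>G)) \<partial>G)"
    proof (rule nn_integral_mono)
      fix \<theta>
      have "ennreal (gauss (x - \<theta>) * (weight n \<theta>)\<^sup>2 * (norm (bayes x - \<theta>))\<^sup>2)
          = ennreal (gauss (x - \<theta>) * (weight n \<theta>)\<^sup>2) * ennreal ((norm (bayes x - \<theta>))\<^sup>2)"
        by (intro ennreal_mult) (auto simp: gauss_nonneg)
      then show "ennreal (gauss (x - \<theta>) * (weight n \<theta>)\<^sup>2 * (norm (bayes x - \<theta>))\<^sup>2) \<le> ennreal (gauss (x - \<theta>) * (weight n \<theta>)\<^sup>2) *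
            (ennreal (1 / marg x) * (\<integral>\<^sup>+\<theta>'. ennreal (gauss (x - \<theta>') * (norm (\<theta> - \<theta>'))\<^sup>2) \<partial>G))"
        using mult_left_mono[OF bayes_jensen zero_le] by simp
    qed
    also have "\<dots> = ennreal (1 / marg x) * (\<integral>\<^sup>+\<theta>. \<integral>\<^sup>+\<theta>'. ennreal (gauss (x - \<theta>) * (weight n \<theta>)\<^sup>2) * ennreal (gauss (x - \<theta>') * (norm (\<theta> - \<theta>'))\<^sup>2) \<partial>G \<partial>G)"
      by (subst nn_integral_cmult[symmetric], measurable) (simp add: nn_integral_cmult mult_ac)
    also have "\<dots> = spread (\<lambda>(a, b). ennreal ((cutoff n a)\<^sup>2)) x"
      by (simp add: spread_def weight_def ennreal_mult gauss_nonneg mult_ac)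
    finally show "(\<integral>\<^sup>+\<theta>. ennreal (gauss (x - \<theta>) * (weight n \<theta>)\<^sup>2 * (norm (bayes x - \<theta>))\<^sup>2) \<partial>G)
        \<le> spread (\<lambda>(a, b). ennreal ((cutoff n a)\<^sup>2)) x" .
  qed
  also have "\<dots> < \<infinity>" by (rule spread_cutoff_finite)
  finally show ?thesis .
qed

end

section \<open>Auxiliary facts for the limit argument\<close>

text \<open>An infinite integral of g makes the claim trivial; a finite one makes f integrable,
  being dominated by Y + g, and the pointwise inequality can be integrated.\<close>

lemma nn_integral_le_of_integral_nonpos:
  fixes Y f g :: "'a \<Rightarrow> real"
  assumes Y: "integrable M Y" "(\<integral>x. Y x \<partial>M) \<le> 0"
    and [measurable]: "f \<in> borel_measurable M" "g \<in> borel_measurable M"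
    and nonneg: "\<And>x. 0 \<le> f x" "\<And>x. 0 \<le> g x" and le: "\<And>x. f x - g x \<le> Y x"
  shows "(\<integral>\<^sup>+x. ennreal (f x) \<partial>M) \<le> (\<integral>\<^sup>+x. ennreal (g x) \<partial>M)"
proof (cases "(\<integral>\<^sup>+x. ennreal (g x) \<partial>M) < \<infinity>")
  case True
  then have g: "integrable M g" using nonneg by (intro integrableI_nonneg) auto
  have le': "f x \<le> Y x + g x" for x using le[of x] by linarith
  have f: "integrable M f"
    by (rule Bochner_Integration.integrable_bound[OF Bochner_Integration.integrable_add[OF Y(1) g]])
      (use le' nonneg in \<open>auto intro!: AE_I2 order_trans[OF _ abs_ge_self]\<close>)
  have "(\<integral>x. f x \<partial>M) \<le> (\<integral>x. Y x + g x \<partial>M)"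
    by (rule integral_mono[OF f Bochner_Integration.integrable_add[OF Y(1) g]]) (rule le')
  also have "\<dots> \<le> (\<integral>x. g x \<partial>M)" using Y g by simp
  finally show ?thesis
    using f g nonneg by (simp add: nn_integral_eq_integral ennreal_leI)
next
  case False
  then show ?thesis by (simp add: not_less top_unique)
qed

lemma nn_integral_add_scaled:
  fixes f g :: "'a \<Rightarrow> real"
  assumes [measurable]: "f \<in> borel_measurable M" "g \<in> borel_measurable M"
    and nonneg: "\<And>x. 0 \<le> f x" "\<And>x. 0 \<le> g x" and t: "0 \<le> t"
  shows "(\<integral>\<^sup>+x. ennreal (f x) \<partial>M) + ennreal t * (\<integral>\<^sup>+x. ennreal (g x) \<partial>M) = (\<integral>\<^sup>+x. ennreal (f x + t * g x) \<partial>M)"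
proof -
  have "ennreal (f x + t * g x) = ennreal (f x) + ennreal t * ennreal (g x)" for x
    using nonneg t by (simp add: ennreal_mult)
  then show ?thesis by (simp add: nn_integral_add nn_integral_cmult)
qed

lemma ennreal_le_all_div_imp_zero:
  fixes I :: ennreal
  assumes "\<And>n. n \<ge> 1 \<Longrightarrow> I \<le> ennreal (k / real n)"
  shows "I = 0"
proof -
  have "I < \<infinity>" using assms[of 1] by (simp add: le_less_trans[OF _ ennreal_less_top])
  then obtain r where r: "r \<ge> 0" "I = ennreal r" by (cases I) auto
  have "r \<le> max (k / real n) 0" if "n \<ge> 1" for n
    using assms[OF that] r by (auto simp: ennreal_le_iff2 le_max_iff_disj)
  moreover have "(\<lambda>n. max (k / real n) 0) \<longlonglongrightarrow> max 0 0"
    by (intro tendsto_max lim_const_over_n tendsto_const)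
  ultimately have "r \<le> 0"
    by (intro LIMSEQ_le_const[of "\<lambda>n. max (k / real n) 0"]) auto
  then show ?thesis using r by simp
qed

text \<open>In matrix terms, t Q^2 <= Q. It follows from positivity of Q at d - t Qd, where t |Q| <=
  1 controls the last term, and it transfers domination from the loss Q to the identity
  loss.\<close>

lemma positive_definite_contract:
  assumes Q: "positive_definite (Q :: real^'p^'p)"
  defines "t \<equiv> 1 / (norm Q + 1)"
  shows "t * (norm (Q *v d))\<^sup>2 \<le> d \<bullet> (Q *v d)"
proof -
  have t: "t > 0" "t * norm Q \<le> 1"
    by (simp_all add: t_def add_nonneg_pos divide_le_eq)
  let ?q = "Q *v d"
  have QT: "transpose Q = Q" using Q by (simp add: positive_definite_def)
  have nn: "0 \<le> (d - t *\<^sub>R ?q) \<bullet> (Q *v (d - t *\<^sub>R ?q))"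
    using Q by (cases "d - t *\<^sub>R ?q = 0") (auto simp: positive_definite_def less_imp_le)
  have "d \<bullet> (Q *v ?q) = ?q \<bullet> ?q" by (rule symmetric_inner[OF QT])
  then have "(d - t *\<^sub>R ?q) \<bullet> (Q *v (d - t *\<^sub>R ?q)) = d \<bullet> ?q - 2 * t * (?q \<bullet> ?q) + t * (t * (?q \<bullet> (Q *v ?q)))"
    by (simp add: matrix_vector_mult_diff_distrib matrix_vector_mult_scaleR inner_diff_left inner_diff_right algebra_simps)
  moreover have "t * (t * (?q \<bullet> (Q *v ?q))) \<le> t * (?q \<bullet> ?q)"
  proof -
    have "?q \<bullet> (Q *v ?q) \<le> norm ?q * norm (Q *v ?q)" by (rule norm_cauchy_schwarz)
    also have "\<dots> \<le> norm ?q * (norm Q * norm ?q)" by (intro mult_left_mono norm_matrix_vector_mult_le) simp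
    also have "\<dots> = norm Q * (?q \<bullet> ?q)" by (simp add: power2_norm_eq_inner[symmetric] power2_eq_square)
    finally have "t * (?q \<bullet> (Q *v ?q)) \<le> (t * norm Q) * (?q \<bullet> ?q)"
      using t by (simp add: mult_left_mono mult.assoc)
    also have "\<dots> \<le> 1 * (?q \<bullet> ?q)" using t by (intro mult_right_mono) auto
    finally show ?thesis using t by (intro mult_left_mono) auto
  qed
  ultimately have "t * (?q \<bullet> ?q) \<le> d \<bullet> ?q" using nn by linarith
  then show ?thesis by (simp add: power2_norm_eq_inner)
qed

section \<open>Uniqueness of the estimator and admissibility\<close>

context shift_prior
begin

interpretation GG: pair_sigma_finite G G ..
interpretation LG: pair_sigma_finite "lborel :: (real^'p) measure" G ..

lemma wmass_measurable [measurable]: "wmass n \<in> borel_measurable borel"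
  unfolding wmass_def[abs_def] by measurable

lemma wvar_measurable [measurable]: "wvar n \<in> borel_measurable borel"
proof -
  interpret P: sigma_finite_measure "G \<Otimes>\<^sub>M G"
    by (rule sigma_finite_pair_measure) (rule sigma_finite_G)+
  show ?thesis unfolding wvar_def[abs_def] by measurable
qed

text \<open>A minorant of 4 \<open>wmass n x\<close> that is free of n and therefore survives the
  limit.\<close>

definition slab_mass :: "real^'p \<Rightarrow> real" where
  "slab_mass x = (\<integral>\<theta>. gauss (x - \<theta>) * indicat_real (ball 0 1) (av \<theta>) \<partial>G)"

lemma indicat_av_measurable [measurable]: "(\<lambda>\<theta>. indicat_real (ball 0 1) (av \<theta>)) \<in> borel_measurable borel"
  by (rule measurable_compose[OF av_measurable]) (auto intro: borel_measurable_indicator)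

lemma slab_mass_measurable [measurable]: "slab_mass \<in> borel_measurable borel"
  unfolding slab_mass_def[abs_def] by measurable

lemma integrable_slab: "integrable G (\<lambda>\<theta>. gauss (x - \<theta>) * indicat_real (ball 0 1) (av \<theta>))"
  by (rule Bochner_Integration.integrable_bound[OF integrable_gauss_1[of x]]) (auto simp: indicator_def)

lemma slab_mass_le: "n \<ge> 1 \<Longrightarrow> slab_mass x \<le> 4 * wmass n x"
proof -
  assume n: "n \<ge> 1"
  have "gauss (x - \<theta>) * indicat_real (ball 0 1) (av \<theta>) \<le> 4 * (gauss (x - \<theta>) * (weight n \<theta>)\<^sup>2)" for \<theta>
  proof (cases "av \<theta> \<in> ball 0 1")
    case True
    then have "1 / 2 \<le> weight n \<theta>" unfolding weight_def using n by (intro cutoff_ge_half) (auto simp: dist_norm)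
    then have "(1 / 2)\<^sup>2 \<le> (weight n \<theta>)\<^sup>2" by (intro power_mono) auto
    then have "1 \<le> 4 * (weight n \<theta>)\<^sup>2" by (simp add: power_divide)
    then have "gauss (x - \<theta>) * 1 \<le> gauss (x - \<theta>) * (4 * (weight n \<theta>)\<^sup>2)" by (intro mult_left_mono gauss_nonneg)
    then show ?thesis using True by simp
  qed (simp add: gauss_nonneg)
  then have "slab_mass x \<le> (\<integral>\<theta>. 4 * (gauss (x - \<theta>) * (weight n \<theta>)\<^sup>2) \<partial>G)"
    unfolding slab_mass_def by (intro integral_mono integrable_slab integrable_mult_right integrable_weight)
  then show ?thesis by (simp add: wmass_def)
qed

text \<open>If the unit slab were null, invariance would make all its translates null; countably
  many of them cover the space, so \<open>marg\<close> would vanish.\<close>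

lemma slab_mass_pos: "slab_mass x > 0"
proof (rule ccontr)
  assume "\<not> slab_mass x > 0"
  moreover have "slab_mass x \<ge> 0" unfolding slab_mass_def by (simp add: gauss_nonneg)
  ultimately have "(\<integral>\<theta>. gauss (x - \<theta>) * indicat_real (ball 0 1) (av \<theta>) \<partial>G) = 0" by (simp add: slab_mass_def)
  then have "AE \<theta> in G. gauss (x - \<theta>) * indicat_real (ball 0 1) (av \<theta>) = 0"
    by (subst (asm) integral_nonneg_eq_0_iff_AE[OF integrable_slab]) (auto simp: gauss_nonneg)
  then have "AE \<theta> in G. av \<theta> \<notin> ball 0 1"
    by (rule AE_mp) (auto intro!: AE_I2 simp: gauss_pos[THEN less_imp_neq, THEN not_sym] indicator_def)
  then have z: "(\<integral>\<^sup>+\<theta>. indicator (ball 0 1) (av \<theta>) \<partial>G) = 0"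
    by (subst nn_integral_0_iff_AE) (auto elim!: AE_mp intro!: AE_I2 simp: indicator_def)
  have shifted: "AE \<theta> in G. av \<theta> \<notin> ball b 1" for b
  proof -
    have "(\<integral>\<^sup>+\<theta>. indicator (ball 0 1) (av (\<theta> + emb (- b))) \<partial>G) = 0"
      using shift[of "\<lambda>\<theta>. indicator (ball 0 1) (av \<theta>)" "- b"] z by simp
    then have "AE \<theta> in G. indicator (ball 0 1) (av (\<theta> + emb (- b))) = (0 :: ennreal)"
      by (subst (asm) nn_integral_0_iff_AE) auto
    then show ?thesis
      by (rule AE_mp) (auto intro!: AE_I2 simp: av_shift indicator_def dist_norm norm_minus_commute split: if_splits)
  qed
  obtain D :: "(real^'q) set" where D: "countable D" "\<And>X. open X \<Longrightarrow> X \<noteq> {} \<Longrightarrow> \<exists>d\<in>D. d \<in> X"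
    using countable_dense_exists by blast
  have "AE \<theta> in G. \<forall>b\<in>D. av \<theta> \<notin> ball b 1"
    using shifted by (subst AE_ball_countable[OF D(1)]) blast
  then have "AE \<theta> in G. gauss (x - \<theta>) = 0"
  proof (rule AE_mp, intro AE_I2 impI)
    fix \<theta> assume "\<forall>b\<in>D. av \<theta> \<notin> ball b 1"
    moreover have "\<exists>b\<in>D. av \<theta> \<in> ball b 1"
      using D(2)[of "ball (av \<theta>) 1"] by (auto simp: dist_commute)
    ultimately show "gauss (x - \<theta>) = 0" by blast
  qed
  then have "marg x = 0" unfolding marg_def by (rule integral_eq_zero_AE)
  then show False using marg_pos[of x] by simp
qed

text \<open>Averaging the risk inequality over the weighted prior bounds the weighted distance
  between the estimators by the cutoff energy, which is O(1/n). That distance dominates the integral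
  of |e|^2 \<open>slab_mass\<close>, which does not involve n and so must be zero.\<close>

lemma blyth_unique:
  assumes [measurable]: "\<delta> \<in> borel_measurable borel"
    and le: "\<And>\<theta>. risk (mat 1) \<theta> \<delta> \<le> risk (mat 1) \<theta> bayes"
  shows "AE x in lborel. \<delta> x = bayes x"
proof -
  define e where "e x = \<delta> x - bayes x" for x
  have [measurable]: "e \<in> borel_measurable borel" unfolding e_def[abs_def] by measurable
  have pd1: "positive_definite (mat 1 :: real^'p^'p)"
    by (simp add: positive_definite_def transpose_mat)
  have loss: "quadratic_loss (mat 1) \<theta> d = (norm (d - \<theta>))\<^sup>2" for \<theta> d :: "real^'p"
    by (simp add: quadratic_loss_def power2_norm_eq_inner[symmetric] norm_minus_commute)
  \<comment> \<open>The loss of the competitor splits as D = A + B + C with C the loss of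
    \<open>bayes\<close>; the risk inequality says that A + B has integral at most 0.\<close>
  define A where "A \<theta> x = gauss (x - \<theta>) * (norm (e x))\<^sup>2" for \<theta> x
  define B where "B \<theta> x = gauss (x - \<theta>) * (2 * (e x \<bullet> (bayes x - \<theta>)))" for \<theta> x
  define C where "C \<theta> x = gauss (x - \<theta>) * (norm (bayes x - \<theta>))\<^sup>2" for \<theta> x
  define D where "D \<theta> x = gauss (x - \<theta>) * (norm (\<delta> x - \<theta>))\<^sup>2" for \<theta> x
  have nonneg: "0 \<le> A \<theta> x" "0 \<le> C \<theta> x" "0 \<le> D \<theta> x" for \<theta> x
    by (simp_all add: A_def C_def D_def gauss_nonneg)
  have [measurable]: "A \<theta> \<in> borel_measurable borel" "B \<theta> \<in> borel_measurable borel" "C \<theta> \<in> borel_measurable borel"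
    "D \<theta> \<in> borel_measurable borel" for \<theta>
    unfolding A_def[abs_def] B_def[abs_def] C_def[abs_def] D_def[abs_def] by measurable
  have DABC: "D \<theta> x = A \<theta> x + B \<theta> x + C \<theta> x" for \<theta> x
  proof -
    have "(norm (a + b))\<^sup>2 = (norm a)\<^sup>2 + 2 * (a \<bullet> b) + (norm b)\<^sup>2" for a b :: "real^'p"
      by (simp add: power2_norm_eq_inner inner_add_left inner_add_right inner_commute)
    from this[of "e x" "bayes x - \<theta>"]
    have "(norm (\<delta> x - \<theta>))\<^sup>2 = (norm (e x))\<^sup>2 + 2 * (e x \<bullet> (bayes x - \<theta>)) + (norm (bayes x - \<theta>))\<^sup>2"
      by (simp add: e_def)
    then show ?thesis by (simp only: A_def B_def C_def D_def distrib_left)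
  qed
  have A_le: "A \<theta> x \<le> 2 * D \<theta> x + 2 * C \<theta> x" for \<theta> x
  proof -
    have "norm (e x) \<le> norm (\<delta> x - \<theta>) + norm (bayes x - \<theta>)"
      using norm_triangle_ineq4[of "\<delta> x - \<theta>" "bayes x - \<theta>"] by (simp add: e_def)
    then have "(norm (e x))\<^sup>2 \<le> (norm (\<delta> x - \<theta>) + norm (bayes x - \<theta>))\<^sup>2" by (intro power_mono) auto
    also have "\<dots> \<le> 2 * (norm (\<delta> x - \<theta>))\<^sup>2 + 2 * (norm (bayes x - \<theta>))\<^sup>2"
      using sum_squares_bound[of "norm (\<delta> x - \<theta>)" "norm (bayes x - \<theta>)"] by (simp add: power2_sum)
    finally have "gauss (x - \<theta>) * (norm (e x))\<^sup>2 \<le> gauss (x - \<theta>) * (2 * (norm (\<delta> x - \<theta>))\<^sup>2 + 2 * (norm (bayes x - \<theta>))\<^sup>2)"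
      by (intro mult_left_mono gauss_nonneg)
    then show ?thesis by (simp add: A_def C_def D_def algebra_simps)
  qed
  have AB_le: "\<bar>A \<theta> x + B \<theta> x\<bar> \<le> 2 * A \<theta> x + C \<theta> x" for \<theta> x
  proof -
    have "\<bar>2 * (e x \<bullet> (bayes x - \<theta>))\<bar> \<le> (norm (e x))\<^sup>2 + (norm (bayes x - \<theta>))\<^sup>2"
      using Cauchy_Schwarz_ineq2[of "e x" "bayes x - \<theta>"] sum_squares_bound[of "norm (e x)" "norm (bayes x - \<theta>)"]
      by simp
    then have "gauss (x - \<theta>) * \<bar>2 * (e x \<bullet> (bayes x - \<theta>))\<bar> \<le> gauss (x - \<theta>) * ((norm (e x))\<^sup>2 + (norm (bayes x - \<theta>))\<^sup>2)"
      by (intro mult_left_mono gauss_nonneg)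
    then have "\<bar>B \<theta> x\<bar> \<le> A \<theta> x + C \<theta> x"
      by (simp only: A_def B_def C_def abs_mult abs_of_nonneg[OF gauss_nonneg] distrib_left)
    then show ?thesis using nonneg(1)[of \<theta> x] by linarith
  qed
  have Cint: "integrable lborel (C \<theta>)" for \<theta>
    using risk_poly_bounded(1)[OF bayes_measurable poly_bounded_bayes pd1, of \<theta>] by (simp add: loss C_def[abs_def])
  have nnle: "(\<integral>\<^sup>+x. ennreal (D \<theta> x) \<partial>lborel) \<le> (\<integral>\<^sup>+x. ennreal (C \<theta> x) \<partial>lborel)" for \<theta>
  proof -
    let ?s = "sqrt ((2 * pi) ^ CARD('p))"
    have s: "?s > 0" by simp
    have r: "risk (mat 1) \<theta> f = ennreal (1 / ?s) * (\<integral>\<^sup>+x. ennreal (gauss (x - \<theta>) * (norm (f x - \<theta>))\<^sup>2) \<partial>lborel)"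
      if [measurable]: "f \<in> borel_measurable borel" for f
      unfolding risk_eq[OF that] loss
      by (subst nn_integral_cmult[symmetric], measurable) (simp add: ennreal_mult[symmetric] gauss_nonneg)
    show ?thesis
      using le[of \<theta>] s unfolding r[OF bayes_measurable] r[OF assms(1)] C_def D_def
      by (subst (asm) ennreal_mult_le_mult_iff) auto
  qed
  have Dint: "integrable lborel (D \<theta>)" and Dle: "(\<integral>x. D \<theta> x \<partial>lborel) \<le> (\<integral>x. C \<theta> x \<partial>lborel)" for \<theta>
  proof -
    have "(\<integral>\<^sup>+x. ennreal (C \<theta> x) \<partial>lborel) < \<infinity>" using Cint[of \<theta>] nonneg by (simp add: nn_integral_eq_integral)
    then show D: "integrable lborel (D \<theta>)" using nnle[of \<theta>] nonneg by (intro integrableI_nonneg) auto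
    show "(\<integral>x. D \<theta> x \<partial>lborel) \<le> (\<integral>x. C \<theta> x \<partial>lborel)"
      using nnle[of \<theta>] D Cint[of \<theta>] nonneg by (simp add: nn_integral_eq_integral)
  qed
  have AB: "integrable lborel (\<lambda>x. A \<theta> x + B \<theta> x)" "(\<integral>x. A \<theta> x + B \<theta> x \<partial>lborel) \<le> 0" for \<theta>
  proof -
    have eq: "A \<theta> x + B \<theta> x = D \<theta> x - C \<theta> x" for x by (simp add: DABC)
    show "integrable lborel (\<lambda>x. A \<theta> x + B \<theta> x)" "(\<integral>x. A \<theta> x + B \<theta> x \<partial>lborel) \<le> 0"
      unfolding eq using Dint Cint Dle by simp_all
  qed
  have nnA: "(\<integral>\<^sup>+x. ennreal (A \<theta> x) \<partial>lborel) \<le> 4 * (\<integral>\<^sup>+x. ennreal (C \<theta> x) \<partial>lborel)" for \<theta>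
  proof -
    have "(\<integral>\<^sup>+x. ennreal (A \<theta> x) \<partial>lborel) \<le> (\<integral>\<^sup>+x. 2 * ennreal (D \<theta> x) + 2 * ennreal (C \<theta> x) \<partial>lborel)"
      using A_le nonneg by (intro nn_integral_mono)
        (simp add: ennreal_plus[symmetric] ennreal_mult'[symmetric] ennreal_leI flip: ennreal_numeral del: ennreal_plus)
    also have "\<dots> = 2 * (\<integral>\<^sup>+x. ennreal (D \<theta> x) \<partial>lborel) + 2 * (\<integral>\<^sup>+x. ennreal (C \<theta> x) \<partial>lborel)"
      by (simp add: nn_integral_add nn_integral_cmult)
    also have "\<dots> \<le> 2 * (\<integral>\<^sup>+x. ennreal (C \<theta> x) \<partial>lborel) + 2 * (\<integral>\<^sup>+x. ennreal (C \<theta> x) \<partial>lborel)"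
      by (intro add_mono mult_left_mono nnle) auto
    also have "\<dots> = (2 + 2) * (\<integral>\<^sup>+x. ennreal (C \<theta> x) \<partial>lborel)" by (simp only: distrib_right)
    finally show ?thesis by simp
  qed
  \<comment> \<open>What A + B becomes after integrating \<theta> against the weighted prior;
    \<open>blyth_pointwise\<close> bounds it from below.\<close>
  define Y where "Y n x = (norm (e x))\<^sup>2 * wmass n x + 2 * (e x \<bullet> (wmass n x *\<^sub>R bayes x - wmean n x))" for n x
  let ?X = "\<lambda>n (x, \<theta>). (weight n \<theta>)\<^sup>2 * (A \<theta> x + B \<theta> x)"
  have Xm [measurable]: "?X n \<in> borel_measurable (lborel \<Otimes>\<^sub>M G)" for n
    unfolding A_def B_def by measurable
  \<comment> \<open>From |A + B| <= 2A + C and the bound of the integral of A by 4 times that of C,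
    the total is at most 2 times 4 plus 1 = 9 weighted Bayes risks.\<close>
  have Xint: "integrable (lborel \<Otimes>\<^sub>M G) (?X n)" for n
  proof (rule integrableI_bounded[OF Xm])
    have "(\<integral>\<^sup>+z. ennreal (norm (?X n z)) \<partial>(lborel \<Otimes>\<^sub>M G))
        = (\<integral>\<^sup>+\<theta>. \<integral>\<^sup>+x. ennreal (norm (?X n (x, \<theta>))) \<partial>lborel \<partial>G)"
      by (rule LG.nn_integral_snd[symmetric]) measurable
    also have "\<dots> \<le> (\<integral>\<^sup>+\<theta>. 9 * (\<integral>\<^sup>+x. ennreal (gauss (x - \<theta>) * (weight n \<theta>)\<^sup>2 * (norm (bayes x - \<theta>))\<^sup>2) \<partial>lborel) \<partial>G)"
    proof (rule nn_integral_mono)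
      fix \<theta>
      have "(\<integral>\<^sup>+x. ennreal (norm (?X n (x, \<theta>))) \<partial>lborel) \<le> (\<integral>\<^sup>+x. ennreal ((weight n \<theta>)\<^sup>2) * (2 * ennreal (A \<theta> x) + ennreal (C \<theta> x)) \<partial>lborel)"
      proof (rule nn_integral_mono)
        fix x
        have "norm (?X n (x, \<theta>)) \<le> (weight n \<theta>)\<^sup>2 * (2 * A \<theta> x + C \<theta> x)"
          using AB_le[of \<theta> x] by (simp add: abs_mult mult_left_mono)
        then have "ennreal (norm (?X n (x, \<theta>))) \<le> ennreal ((weight n \<theta>)\<^sup>2 * (2 * A \<theta> x + C \<theta> x))" by (rule ennreal_leI)
        then show "ennreal (norm (?X n (x, \<theta>))) \<le> ennreal ((weight n \<theta>)\<^sup>2) * (2 * ennreal (A \<theta> x) + ennreal (C \<theta> x))"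
          using nonneg by (simp add: ennreal_mult)
      qed
      also have "\<dots> = ennreal ((weight n \<theta>)\<^sup>2) * (2 * (\<integral>\<^sup>+x. ennreal (A \<theta> x) \<partial>lborel) + (\<integral>\<^sup>+x. ennreal (C \<theta> x) \<partial>lborel))"
        by (simp add: nn_integral_cmult nn_integral_add)
      also have "\<dots> \<le> ennreal ((weight n \<theta>)\<^sup>2) * (2 * (4 * (\<integral>\<^sup>+x. ennreal (C \<theta> x) \<partial>lborel)) + 1 * (\<integral>\<^sup>+x. ennreal (C \<theta> x) \<partial>lborel))"
        by (intro mult_left_mono add_mono nnA) auto
      also have "2 * (4 * (\<integral>\<^sup>+x. ennreal (C \<theta> x) \<partial>lborel)) + 1 * (\<integral>\<^sup>+x. ennreal (C \<theta> x) \<partial>lborel)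
          = (2 * 4 + 1) * (\<integral>\<^sup>+x. ennreal (C \<theta> x) \<partial>lborel)" by (simp only: distrib_right mult.assoc)
      also have "ennreal ((weight n \<theta>)\<^sup>2) * ((2 * 4 + 1) * (\<integral>\<^sup>+x. ennreal (C \<theta> x) \<partial>lborel))
          = 9 * (\<integral>\<^sup>+x. ennreal ((weight n \<theta>)\<^sup>2) * ennreal (C \<theta> x) \<partial>lborel)"
        by (simp add: nn_integral_cmult mult.left_commute)
      also have "(\<lambda>x. ennreal ((weight n \<theta>)\<^sup>2) * ennreal (C \<theta> x)) = (\<lambda>x. ennreal (gauss (x - \<theta>) * (weight n \<theta>)\<^sup>2 * (norm (bayes x - \<theta>))\<^sup>2))"
        by (simp add: C_def ennreal_mult[symmetric] gauss_nonneg mult_ac)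
      finally show "(\<integral>\<^sup>+x. ennreal (norm (?X n (x, \<theta>))) \<partial>lborel)
          \<le> 9 * (\<integral>\<^sup>+x. ennreal (gauss (x - \<theta>) * (weight n \<theta>)\<^sup>2 * (norm (bayes x - \<theta>))\<^sup>2) \<partial>lborel)" .
    qed
    also have "\<dots> = 9 * (\<integral>\<^sup>+\<theta>. \<integral>\<^sup>+x. ennreal (gauss (x - \<theta>) * (weight n \<theta>)\<^sup>2 * (norm (bayes x - \<theta>))\<^sup>2) \<partial>lborel \<partial>G)"
      by (rule nn_integral_cmult) measurable
    also have "\<dots> < \<infinity>" using weighted_risk_finite[of n] by (simp add: ennreal_mult_less_top)
    finally show "(\<integral>\<^sup>+z. ennreal (norm (?X n z)) \<partial>(lborel \<Otimes>\<^sub>M G)) < \<infinity>" .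
  qed
  have XY: "(\<integral>\<theta>. ?X n (x, \<theta>) \<partial>G) = Y n x" for n x
  proof -
    note i1 = integrable_weight(1)[of x n] and i2 = integrable_weight(2)[of x n]
    have "(\<integral>\<theta>. ?X n (x, \<theta>) \<partial>G) = (\<integral>\<theta>. ((norm (e x))\<^sup>2 + 2 * (e x \<bullet> bayes x)) * (gauss (x - \<theta>) * (weight n \<theta>)\<^sup>2)
        - 2 * (e x \<bullet> (gauss (x - \<theta>) *\<^sub>R ((weight n \<theta>)\<^sup>2 *\<^sub>R \<theta>))) \<partial>G)"
      by (rule Bochner_Integration.integral_cong) (auto simp: A_def B_def inner_diff_right algebra_simps)
    also have "\<dots> = ((norm (e x))\<^sup>2 + 2 * (e x \<bullet> bayes x)) * wmass n x - 2 * (e x \<bullet> wmean n x)"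
      unfolding wmass_def wmean_def integral_inner_right[OF i2, symmetric]
      by (subst Bochner_Integration.integral_diff[OF integrable_mult_right[OF i1] integrable_mult_right[OF integrable_inner_right[OF i2]]])
        (simp only: integral_mult_right_zero)
    finally show ?thesis by (simp add: Y_def inner_diff_right algebra_simps)
  qed
  have Yint: "integrable lborel (Y n)" for n
    using LG.integrable_fst'[OF Xint[of n]] unfolding XY .
  have Yle: "(\<integral>x. Y n x \<partial>lborel) \<le> 0" for n
  proof -
    have "(\<integral>x. Y n x \<partial>lborel) = (\<integral>\<theta>. \<integral>x. ?X n (x, \<theta>) \<partial>lborel \<partial>G)"
      using LG.Fubini_integral[of "\<lambda>x \<theta>. ?X n (x, \<theta>)"] Xint[of n] by (simp add: XY[symmetric])
    also have "\<dots> = (\<integral>\<theta>. (weight n \<theta>)\<^sup>2 * (\<integral>x. A \<theta> x + B \<theta> x \<partial>lborel) \<partial>G)" by simp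
    also have "\<dots> \<le> 0"
    proof -
      have "0 \<le> (\<integral>\<theta>. - ((weight n \<theta>)\<^sup>2 * (\<integral>x. A \<theta> x + B \<theta> x \<partial>lborel)) \<partial>G)"
        using AB(2) by (intro integral_nonneg_AE AE_I2) (simp add: mult_nonneg_nonpos)
      then show ?thesis by simp
    qed
    finally show ?thesis .
  qed
  let ?v = "disc_area TYPE(real^'q)"
  obtain S where S: "S \<ge> 0" "spread_const = ennreal S"
    using spread_const_finite by (cases spread_const) auto
  \<comment> \<open>The factor 8 is 2 times 4, from the half in the pointwise inequality and the 4
    in \<open>slab_mass_le\<close>; the inner 2 belongs to \<open>wvar\<close> and the 6 to the
    cutoff energy.\<close>
  have "(\<integral>\<^sup>+x. ennreal ((norm (e x))\<^sup>2 * slab_mass x) \<partial>lborel) \<le> ennreal (8 * (2 * (6 * ?v * S)) / real n)" if n: "n \<ge> 1" for n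
  proof -
    have "(\<integral>\<^sup>+x. ennreal ((norm (e x))\<^sup>2 * wmass n x / 2) \<partial>lborel) \<le> (\<integral>\<^sup>+x. ennreal (2 * wvar n x / marg x) \<partial>lborel)"
    proof (rule nn_integral_le_of_integral_nonpos[OF Yint[of n] Yle[of n]])
      fix x
      have m: "marg x > 0" by (rule marg_pos)
      have "marg x * ((norm (e x))\<^sup>2 * wmass n x) / 2 - 2 * wvar n x \<le> marg x * Y n x"
        unfolding Y_def by (rule blyth_pointwise)
      then show "(norm (e x))\<^sup>2 * wmass n x / 2 - 2 * wvar n x / marg x \<le> Y n x"
        using m by (simp add: field_simps)
      show "0 \<le> (norm (e x))\<^sup>2 * wmass n x / 2" by (simp add: wmass_nonneg)
      have "0 \<le> wvar n x" unfolding wvar_def by (simp add: gauss_nonneg)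
      then show "0 \<le> 2 * wvar n x / marg x" using m by simp
    qed measurable
    also have "\<dots> = (\<integral>\<^sup>+x. 2 * spread (\<lambda>(a, b). ennreal ((cutoff n a - cutoff n b)\<^sup>2)) x \<partial>lborel)"
      unfolding wvar_spread[symmetric]
    proof (rule nn_integral_cong)
      fix x
      have "0 \<le> wvar n x / marg x" unfolding wvar_def using marg_pos[of x] by (simp add: gauss_nonneg)
      then show "ennreal (2 * wvar n x / marg x) = 2 * ennreal (wvar n x / marg x)"
        using ennreal_mult[of 2 "wvar n x / marg x"] by simp
    qed
    also have "\<dots> = 2 * (\<integral>\<^sup>+x. spread (\<lambda>(a, b). ennreal ((cutoff n a - cutoff n b)\<^sup>2)) x \<partial>lborel)"
      by (rule nn_integral_cmult) measurable
    also have "\<dots> \<le> 2 * (ennreal (6 * ?v / n) * spread_const)"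
      by (intro mult_left_mono spread_energy n) simp
    also have "\<dots> = ennreal (2 * (6 * ?v / n * S))"
    proof -
      have "ennreal (2 * (6 * ?v / n * S)) = ennreal 2 * (ennreal (6 * ?v / n) * ennreal S)"
        using S(1) disc_area_pos[where 'q='q] by (subst ennreal_mult, simp, simp, subst ennreal_mult) auto
      then show ?thesis by (simp only: S(2) ennreal_numeral)
    qed
    finally have *: "(\<integral>\<^sup>+x. ennreal ((norm (e x))\<^sup>2 * wmass n x / 2) \<partial>lborel) \<le> ennreal (2 * (6 * ?v / n * S))" .
    have "(\<integral>\<^sup>+x. ennreal ((norm (e x))\<^sup>2 * slab_mass x) \<partial>lborel) \<le> (\<integral>\<^sup>+x. 8 * ennreal ((norm (e x))\<^sup>2 * wmass n x / 2) \<partial>lborel)"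
    proof (rule nn_integral_mono)
      fix x
      have "(norm (e x))\<^sup>2 * slab_mass x \<le> (norm (e x))\<^sup>2 * (4 * wmass n x)"
        by (intro mult_left_mono slab_mass_le n) simp
      also have "\<dots> = 8 * ((norm (e x))\<^sup>2 * wmass n x / 2)" by simp
      finally have "ennreal ((norm (e x))\<^sup>2 * slab_mass x) \<le> ennreal (8 * ((norm (e x))\<^sup>2 * wmass n x / 2))" by (rule ennreal_leI)
      also have "\<dots> = 8 * ennreal ((norm (e x))\<^sup>2 * wmass n x / 2)"
        using ennreal_mult[of 8 "(norm (e x))\<^sup>2 * wmass n x / 2"] by (simp add: wmass_nonneg)
      finally show "ennreal ((norm (e x))\<^sup>2 * slab_mass x) \<le> 8 * ennreal ((norm (e x))\<^sup>2 * wmass n x / 2)" .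
    qed
    also have "\<dots> = 8 * (\<integral>\<^sup>+x. ennreal ((norm (e x))\<^sup>2 * wmass n x / 2) \<partial>lborel)"
      by (rule nn_integral_cmult) measurable
    also have "\<dots> \<le> 8 * ennreal (2 * (6 * ?v / n * S))" by (intro mult_left_mono *) simp
    also have "\<dots> = ennreal (8 * (2 * (6 * ?v * S)) / real n)"
      using ennreal_mult[of 8 "2 * (6 * ?v / n * S)"] S disc_area_pos[where 'q='q] by simp
    finally show ?thesis .
  qed
  then have "(\<integral>\<^sup>+x. ennreal ((norm (e x))\<^sup>2 * slab_mass x) \<partial>lborel) = 0"
    by (rule ennreal_le_all_div_imp_zero)
  then have "AE x in lborel. ennreal ((norm (e x))\<^sup>2 * slab_mass x) = 0"
    by (subst (asm) nn_integral_0_iff_AE) auto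
  then show ?thesis
  proof (rule AE_mp, intro AE_I2 impI)
    fix x
    assume "ennreal ((norm (e x))\<^sup>2 * slab_mass x) = 0"
    then have "(norm (e x))\<^sup>2 * slab_mass x \<le> 0" by (simp add: ennreal_eq_0_iff)
    then have "e x = 0" using slab_mass_pos[of x] by (simp add: mult_le_0_iff)
    then show "\<delta> x = bayes x" by (simp add: e_def)
  qed
qed

text \<open>A competitor \<delta> under Q is converted into \<eta> = bayes + t Q (\<delta> - bayes),
  which is at least as good as \<open>bayes\<close> under the identity loss; the uniqueness result
  for that single loss then settles every Q.\<close>

lemma admissible_bayes:
  fixes Q :: "real^'p^'p"
  assumes Q: "positive_definite Q"
  shows "admissible Q bayes"
  unfolding admissible_def estimator_def
proof (intro conjI notI)
  show "bayes \<in> borel_measurable borel" by measurable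
  assume "\<exists>\<delta>'. \<delta>' \<in> borel_measurable borel \<and> dominates Q \<delta>' bayes"
  then obtain \<delta> where dm [measurable]: "\<delta> \<in> borel_measurable borel" and dom: "dominates Q \<delta> bayes" by blast
  define t where "t = 1 / (norm Q + 1)"
  have t: "t > 0" by (simp add: t_def add_nonneg_pos)
  have QT: "transpose Q = Q" using Q by (simp add: positive_definite_def)
  define \<eta> where "\<eta> x = bayes x + t *\<^sub>R (Q *v (\<delta> x - bayes x))" for x
  have em [measurable]: "\<eta> \<in> borel_measurable borel" unfolding \<eta>_def by measurable
  let ?l = "quadratic_loss (mat 1)" and ?q = "quadratic_loss Q"
  have pd1: "positive_definite (mat 1 :: real^'p^'p)"
    by (simp add: positive_definite_def transpose_mat)
  note nn = positive_definite_loss_nonneg[OF pd1] positive_definite_loss_nonneg[OF Q]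
  \<comment> \<open>After expansion both sides carry the same cross term u \<bullet> Qd with
    coefficient -2t; what remains is t^2 |Qd|^2 <= t (d \<bullet> Qd).\<close>
  have loss: "?l \<theta> (\<eta> x) + t * ?q \<theta> (bayes x) \<le> ?l \<theta> (bayes x) + t * ?q \<theta> (\<delta> x)" for \<theta> x
  proof -
    let ?u = "\<theta> - bayes x" and ?d = "\<delta> x - bayes x"
    have q: "?q \<theta> (\<delta> x) = ?u \<bullet> (Q *v ?u) - 2 * (?u \<bullet> (Q *v ?d)) + ?d \<bullet> (Q *v ?d)"
    proof -
      have "(a - b) \<bullet> (Q *v (a - b)) = a \<bullet> (Q *v a) - 2 * (a \<bullet> (Q *v b)) + b \<bullet> (Q *v b)" for a b
        using symmetric_inner[OF QT, of b a]
        by (simp add: matrix_vector_mult_diff_distrib inner_diff_left inner_diff_right)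
      moreover have "\<theta> - \<delta> x = ?u - ?d" by simp
      ultimately show ?thesis by (simp only: quadratic_loss_def)
    qed
    have l: "?l \<theta> (\<eta> x) = ?u \<bullet> ?u - 2 * t * (?u \<bullet> (Q *v ?d)) + t * (t * (norm (Q *v ?d))\<^sup>2)"
    proof -
      have "\<theta> - \<eta> x = ?u - t *\<^sub>R (Q *v ?d)" by (simp add: \<eta>_def)
      moreover have "(a - t *\<^sub>R b) \<bullet> (a - t *\<^sub>R b) = a \<bullet> a - 2 * t * (a \<bullet> b) + t * (t * (norm b)\<^sup>2)" for a b :: "real^'p"
        unfolding power2_norm_eq_inner by (simp add: inner_diff_left inner_diff_right inner_commute algebra_simps)
      ultimately show ?thesis by (simp only: quadratic_loss_def matrix_vector_mul_lid)
    qed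
    have "t * (t * (norm (Q *v ?d))\<^sup>2) \<le> t * (?d \<bullet> (Q *v ?d))"
      using positive_definite_contract[OF Q, of ?d] t by (intro mult_left_mono) (auto simp: t_def)
    then show ?thesis
      unfolding q l by (simp add: quadratic_loss_def algebra_simps)
  qed
  have rm: "(\<lambda>x. ?l \<theta> (f x)) \<in> borel_measurable borel" "(\<lambda>x. ?q \<theta> (f x)) \<in> borel_measurable borel"
    if [measurable]: "f \<in> borel_measurable borel" for f \<theta>
    unfolding quadratic_loss_def by measurable
  have fin: "risk Q \<theta> bayes < \<infinity>" "risk (mat 1) \<theta> bayes < \<infinity>" for \<theta>
    unfolding risk_poly_bounded(2)[OF bayes_measurable poly_bounded_bayes Q]
      risk_poly_bounded(2)[OF bayes_measurable poly_bounded_bayes pd1] by simp_all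
  have "risk (mat 1) \<theta> \<eta> \<le> risk (mat 1) \<theta> bayes" for \<theta>
  proof -
    have "risk (mat 1) \<theta> \<eta> + ennreal t * risk Q \<theta> bayes = (\<integral>\<^sup>+x. ennreal (?l \<theta> (\<eta> x) + t * ?q \<theta> (bayes x)) \<partial>mvn \<theta> (mat 1))"
      unfolding risk_def using rm(1)[OF em, of \<theta>] rm(2)[OF bayes_measurable, of \<theta>] t nn
      by (intro nn_integral_add_scaled) (auto simp: mvn_def)
    also have "\<dots> \<le> (\<integral>\<^sup>+x. ennreal (?l \<theta> (bayes x) + t * ?q \<theta> (\<delta> x)) \<partial>mvn \<theta> (mat 1))"
      by (intro nn_integral_mono ennreal_leI loss)
    also have "\<dots> = risk (mat 1) \<theta> bayes + ennreal t * risk Q \<theta> \<delta>"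
      unfolding risk_def using rm(2)[OF dm, of \<theta>] rm(1)[OF bayes_measurable, of \<theta>] t nn
      by (intro nn_integral_add_scaled[symmetric]) (auto simp: mvn_def)
    also have "\<dots> \<le> risk (mat 1) \<theta> bayes + ennreal t * risk Q \<theta> bayes"
      using dom by (intro add_left_mono mult_left_mono) (auto simp: dominates_def)
    finally have "ennreal t * risk Q \<theta> bayes + risk (mat 1) \<theta> \<eta> \<le> ennreal t * risk Q \<theta> bayes + risk (mat 1) \<theta> bayes"
      by (simp only: add.commute)
    \<comment> \<open>Finite risk of \<open>bayes\<close> allows the common summand to be cancelled
      among extended reals.\<close>
    moreover have "ennreal t * risk Q \<theta> bayes \<noteq> \<infinity>"
      using fin(1)[of \<theta>] by (simp add: ennreal_mult_eq_top_iff)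
    ultimately show ?thesis by (simp add: ennreal_add_left_cancel_le)
  qed
  then have "AE x in lborel. \<eta> x = bayes x" by (rule blyth_unique[OF em])
  then have eq: "AE x in lborel. \<delta> x = bayes x"
  proof (rule AE_mp, intro AE_I2 impI)
    fix x assume "\<eta> x = bayes x"
    then have "Q *v (\<delta> x - bayes x) = 0" using t by (simp add: \<eta>_def)
    then show "\<delta> x = bayes x"
      using Q unfolding positive_definite_def by (metis eq_iff_diff_eq_0 inner_zero_right less_irrefl)
  qed
  \<comment> \<open>Agreement almost everywhere gives equal risks, against the strict inequality in
    \<open>dominates\<close>.\<close>
  have "risk Q \<theta> \<delta> = risk Q \<theta> bayes" for \<theta>
    unfolding risk_eq[OF dm] risk_eq[OF bayes_measurable]
    by (rule nn_integral_cong_AE, rule AE_mp[OF eq], intro AE_I2 impI) simp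
  then show False using dom by (simp add: dominates_def)
qed

end

section \<open>The hierarchical prior\<close>

lemma det_measurable [measurable]:
  assumes "\<And>i j. (\<lambda>x. A x $ i $ j) \<in> borel_measurable M"
  shows "(\<lambda>x. det (A x :: real^'n^'n)) \<in> borel_measurable M"
  unfolding det_def using assms by measurable

lemma matrix_entry_measurable [measurable]: "(\<lambda>A :: real^'n^'m. A $ i $ j) \<in> borel_measurable borel"
  by (intro borel_measurable_continuous_onI continuous_intros)

lemma positive_definite_lower_bound:
  fixes V :: "'k::{finite,linorder} matrix"
  assumes "positive_definite V"
  obtains a where "a > 0" "\<And>x. a * (norm x)\<^sup>2 \<le> x \<bullet> (V *v x)"
proof -
  obtain H d where H: "orthogonal_matrix H" and d: "\<And>i. d $ i > 0" and V: "V = transpose H ** diag d ** H"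
    using positive_definite_diagonalise[OF assms] by blast
  let ?a = "Min (range (($) d))"
  have "?a > 0" using d by (subst Min_gr_iff) auto
  moreover have "?a * (norm x)\<^sup>2 \<le> x \<bullet> (V *v x)" for x
  proof -
    have "norm (H *v x) = norm x"
      using H orthogonal_transformation_norm[of "(*v) H" x] by (simp add: orthogonal_transformation_matrix)
    then have "?a * (norm x)\<^sup>2 = (\<Sum>i\<in>UNIV. ?a * ((H *v x) $ i)\<^sup>2)"
      by (metis power2_norm_vec sum_distrib_left)
    also have "\<dots> \<le> (\<Sum>i\<in>UNIV. d $ i * ((H *v x) $ i)\<^sup>2)"
      by (intro sum_mono mult_right_mono Min_le) auto
    finally show ?thesis by (simp add: V conj_quadratic)
  qed
  ultimately show ?thesis using that by blast
qed

text \<open>Strict positivity at uncountably many vectors becomes a countable union of closed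
  conditions, since the smallest eigenvalue exceeds some 1/(n + 1).\<close>

lemma positive_definite_set:
  "{V :: 'k::{finite,linorder} matrix. positive_definite V} =
    {V. transpose V = V} \<inter> (\<Union>n. \<Inter>x. {V. (1 / real (Suc n)) * (norm x)\<^sup>2 \<le> x \<bullet> (V *v x)})" (is "_ = ?R")
proof (intro set_eqI iffI)
  fix V :: "'k matrix"
  assume "V \<in> {V. positive_definite V}"
  then have pd: "positive_definite V" by simp
  obtain a where a: "a > 0" "\<And>x. a * (norm x)\<^sup>2 \<le> x \<bullet> (V *v x)"
    using positive_definite_lower_bound[OF pd] by blast
  obtain n where n: "1 / real (Suc n) < a" using a(1) by (metis nat_approx_posE)
  have "(1 / real (Suc n)) * (norm x)\<^sup>2 \<le> x \<bullet> (V *v x)" for x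
    by (rule order_trans[OF mult_right_mono a(2)]) (use n in auto)
  then show "V \<in> ?R" using pd by (auto simp: positive_definite_def)
next
  fix V :: "'k matrix"
  assume "V \<in> ?R"
  then obtain n where V: "transpose V = V" "\<And>x. (1 / real (Suc n)) * (norm x)\<^sup>2 \<le> x \<bullet> (V *v x)" by auto
  have "x \<bullet> (V *v x) > 0" if "x \<noteq> 0" for x
    by (rule less_le_trans[OF _ V(2)]) (use that in simp)
  then show "V \<in> {V. positive_definite V}" using V(1) by (simp add: positive_definite_def)
qed

lemma positive_definite_measurable [measurable]:
  "{V :: 'k::{finite,linorder} matrix. positive_definite V} \<in> sets borel"
proof -
  have "closed (\<Inter>x. {V :: 'k matrix. (1 / real (Suc n)) * (norm x)\<^sup>2 \<le> x \<bullet> (V *v x)})" for n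
  proof (intro closed_INT ballI closed_Collect_le continuous_intros)
    fix x :: "'k vector"
    show "continuous_on UNIV (\<lambda>V :: 'k matrix. V *v x)"
      by (rule linear_continuous_on, unfold linear_conv_bounded_linear[symmetric], rule linearI)
        (simp_all add: matrix_vector_mult_add_rdistrib scaleR_matrix_vector_assoc)
  qed
  moreover have "closed {V :: 'k matrix. transpose V = V}"
    by (intro closed_Collect_eq continuous_intros)
  ultimately show ?thesis
    unfolding positive_definite_set by (intro sets.Int sets.countable_UN borel_closed) auto
qed

lemma pred_positive_definite [measurable]: "Measurable.pred borel (positive_definite :: 'k::{finite,linorder} matrix \<Rightarrow> bool)"
  using positive_definite_measurable by (simp add: pred_def)

definition mvn0 :: "'k::{finite,linorder} matrix \<Rightarrow> 'k vector \<Rightarrow> real" where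
  "mvn0 V d = mvn_density 0 V d"

lemma mvn_density_mvn0: "mvn_density \<beta> V y = mvn0 V (y - \<beta>)"
  by (simp add: mvn0_def mvn_density_def)

lemma det_pos_definite:
  assumes "positive_definite (V :: 'k::{finite,linorder} matrix)"
  shows "det V > 0"
proof -
  obtain H d where "orthogonal_matrix H" and "\<And>i. d $ i > 0" and "V = transpose H ** diag d ** H"
    using positive_definite_diagonalise[OF assms] by blast
  then show ?thesis by (simp add: det_conj det_diag prod_pos)
qed

lemma mvn0_nonneg: "positive_definite V \<Longrightarrow> 0 \<le> mvn0 V d"
  by (simp add: mvn0_def mvn_density_def det_pos_definite less_imp_le)

text \<open>Cramer's rule replaces the inverse by determinants, which are visibly measurable.\<close>

lemma mvn0_cramer:
  fixes V :: "'k::{finite,linorder} matrix"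
  assumes "positive_definite V"
  shows "mvn0 V d = exp (- (d \<bullet> (\<chi> k. det (\<chi> i j. if j = k then d $ i else V $ i $ j) / det V)) / 2) / sqrt ((2 * pi) ^ CARD('k) * det V)"
proof -
  have nz: "det V \<noteq> 0" using det_pos_definite[OF assms] by simp
  then obtain B where B: "V ** B = mat 1" by (metis invertible_def invertible_det_nz)
  then have "V *v (matrix_inv V *v d) = d" by (simp add: matrix_inv_eqI matrix_vector_mul_assoc)
  then have "matrix_inv V *v d = (\<chi> k. det (\<chi> i j. if j = k then d $ i else V $ i $ j) / det V)"
    by (simp only: cramer[OF nz])
  then show ?thesis by (simp add: mvn0_def mvn_density_def)
qed

text \<open>The value 0 off the positive definite matrices makes the density measurable jointly in V
  and d on the whole space.\<close>

definition mvn0_ext :: "'k::{finite,linorder} matrix \<times> 'k vector \<Rightarrow> real" where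
  "mvn0_ext = (\<lambda>(V, d). if positive_definite V then mvn0 V d else 0)"

lemma mvn0_ext_measurable [measurable]: "(mvn0_ext :: 'k::{finite,linorder} matrix \<times> 'k vector \<Rightarrow> real) \<in> borel_measurable (borel \<Otimes>\<^sub>M borel)"
proof -
  have "mvn0_ext = (\<lambda>(V :: 'k matrix, d). if positive_definite V then exp (- (\<Sum>k\<in>UNIV. d $ k * (det (\<chi> i j. if j = k then d $ i else V $ i $ j) / det V)) / 2) / sqrt ((2 * pi) ^ CARD('k) * det V) else 0)"
    by (auto simp: mvn0_ext_def mvn0_cramer inner_vec_def fun_eq_iff)
  also have "\<dots> \<in> borel_measurable (borel \<Otimes>\<^sub>M borel)"
  proof -
    have [measurable]: "(\<lambda>z :: 'k matrix \<times> 'k vector. det (\<chi> i j. if j = k then snd z $ i else fst z $ i $ j)) \<in> borel_measurable (borel \<Otimes>\<^sub>M borel)" for k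
      by (rule det_measurable) simp
    have [measurable]: "(\<lambda>z :: 'k matrix \<times> 'k vector. det (fst z)) \<in> borel_measurable (borel \<Otimes>\<^sub>M borel)"
      by (rule det_measurable) simp
    show ?thesis unfolding case_prod_unfold by measurable
  qed
  finally show ?thesis .
qed

section \<open>Normal integrals in the eigenbasis\<close>

lemma mvn0_diagonal:
  assumes H: "orthogonal_matrix (H :: 'k::{finite,linorder} matrix)" and d: "\<And>i. d $ i > 0"
  shows "mvn0 (transpose H ** diag d ** H) y = exp (- ((\<Sum>i\<in>UNIV. (1 / d $ i) * ((H *v y) $ i)\<^sup>2) / 2)) / sqrt ((2 * pi) ^ CARD('k) * (\<Prod>i\<in>UNIV. d $ i))"
proof -
  have "d $ i \<noteq> 0" for i using d[of i] by simp
  then have "y \<bullet> (matrix_inv (transpose H ** diag d ** H) *v y) = (\<Sum>i\<in>UNIV. (1 / d $ i) * ((H *v y) $ i)\<^sup>2)"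
    by (simp add: matrix_inv_conj[OF H] conj_quadratic)
  then show ?thesis by (simp add: mvn0_def mvn_density_def det_conj[OF H] det_diag)
qed

lemma nn_integral_rotate:
  fixes f :: "'k::{finite,linorder} vector \<Rightarrow> ennreal"
  assumes "orthogonal_matrix H" "f \<in> borel_measurable borel"
  shows "(\<integral>\<^sup>+y. f (H *v y) \<partial>lborel) = (\<integral>\<^sup>+y. f y \<partial>lborel)"
  using assms by (intro nn_integral_lborel_isometry) (simp_all add: orthogonal_transformation_matrix)

lemma ennreal_inverse_mult: "s > 0 \<Longrightarrow> ennreal (1 / s) * ennreal s = 1"
  by (simp add: ennreal_mult[symmetric])

lemma nn_integral_mvn0:
  assumes "positive_definite (V :: 'k::{finite,linorder} matrix)"
  shows "(\<integral>\<^sup>+y. ennreal (mvn0 V y) \<partial>lborel) = 1"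
proof -
  obtain H d where H: "orthogonal_matrix H" and d: "\<And>i. d $ i > 0" and V: "V = transpose H ** diag d ** H"
    using positive_definite_diagonalise[OF assms] by blast
  let ?P = "\<Prod>i\<in>UNIV. d $ i" and ?e = "\<lambda>y :: 'k vector. exp (- ((\<Sum>i\<in>UNIV. (\<chi> i. 1 / d $ i) $ i * (y $ i)\<^sup>2) / 2))"
  have P: "?P > 0" using d by (simp add: prod_pos)
  let ?s = "sqrt ((2 * pi) ^ CARD('k) * ?P)"
  have s: "?s > 0" using P by simp
  have "(\<integral>\<^sup>+y. ennreal (mvn0 V y) \<partial>lborel) = (\<integral>\<^sup>+y. ennreal (?e (H *v y) / ?s) \<partial>lborel)"
    unfolding V by (subst mvn0_diagonal[OF H d]) simp
  also have "\<dots> = (\<integral>\<^sup>+y. ennreal (?e y / ?s) \<partial>lborel)"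
    by (rule nn_integral_rotate[OF H]) measurable
  also have "\<dots> = ennreal (1 / ?s) * (\<integral>\<^sup>+y. ennreal (?e y) \<partial>lborel)"
    using s by (subst nn_integral_cmult[symmetric]) (simp_all add: ennreal_mult[symmetric])
  also have "(\<integral>\<^sup>+y. ennreal (?e y) \<partial>lborel) = ennreal (sqrt ((2 * pi) ^ CARD('k) / (\<Prod>i\<in>UNIV. (\<chi> i. 1 / d $ i) $ i)))"
    by (rule nn_integral_gauss_diag) (simp add: d)
  also have "(2 * pi) ^ CARD('k) / (\<Prod>i\<in>UNIV. (\<chi> i. 1 / d $ i) $ i) = (2 * pi) ^ CARD('k) * ?P"
    by (simp add: prod_dividef)
  also have "ennreal (1 / ?s) * ennreal ?s = 1"
    by (rule ennreal_inverse_mult[OF s])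
  finally show ?thesis .
qed

text \<open>The two bounds cross at d = 4, where the right side equals 1.\<close>

lemma min_le_five: "d > 0 \<Longrightarrow> min (4 / d) 1 \<le> 5 / (1 + d)" for d :: real
  by (cases "d \<le> 4") (auto simp: min_le_iff_disj field_simps)

text \<open>The convolution is not evaluated: replacing the first exponential by 1 gives the bound
  1, replacing the second gives sqrt(4/d), and the smaller of the two has the right order in 1 +
  d.\<close>

lemma nn_integral_gauss_pair_1d:
  fixes w d :: real
  assumes d: "d > 0"
  shows "(\<integral>\<^sup>+y. ennreal (exp (- ((w - y)\<^sup>2 / 8)) * exp (- ((1 / d) * y\<^sup>2 / 2)) / sqrt (2 * pi * d)) \<partial>lborel) \<le> ennreal (sqrt (5 / (1 + d)))"
proof -
  let ?a = "\<lambda>y. exp (- ((w - y)\<^sup>2 / 8))" and ?b = "\<lambda>y. exp (- ((1 / d) * y\<^sup>2 / 2))" and ?s = "sqrt (2 * pi * d)"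
  have s: "?s > 0" using d by simp
  have "(\<integral>\<^sup>+y. ennreal (?a y * ?b y / ?s) \<partial>lborel) \<le> (\<integral>\<^sup>+y. ennreal (1 / ?s) * ennreal (?b y) \<partial>lborel)"
    using s by (intro nn_integral_mono) (auto simp: ennreal_mult[symmetric] divide_simps intro!: ennreal_leI)
  also have "\<dots> = ennreal (1 / ?s) * ennreal (sqrt (2 * pi / (1 / d)))"
    using nn_integral_exp_square[of "1 / d"] d by (simp add: nn_integral_cmult)
  also have "\<dots> = ennreal 1"
    using ennreal_inverse_mult[OF s] by simp
  finally have 1: "(\<integral>\<^sup>+y. ennreal (?a y * ?b y / ?s) \<partial>lborel) \<le> ennreal 1" .
  have "(\<integral>\<^sup>+y. ennreal (?a y * ?b y / ?s) \<partial>lborel) \<le> (\<integral>\<^sup>+y. ennreal (1 / ?s) * ennreal (?a y) \<partial>lborel)"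
    using s d by (intro nn_integral_mono) (auto simp: ennreal_mult[symmetric] divide_simps intro!: ennreal_leI)
  also have "\<dots> = ennreal (1 / ?s) * (\<integral>\<^sup>+y. ennreal (exp (- (1 / 4 * y\<^sup>2 / 2))) \<partial>lborel)"
    using nn_integral_lborel_reflect[of "\<lambda>y. ennreal (exp (- (1 / 4 * y\<^sup>2 / 2)))" w] by (simp add: nn_integral_cmult)
  also have "\<dots> = ennreal (1 / ?s) * ennreal (sqrt (2 * pi / (1 / 4)))"
    by (subst nn_integral_exp_square) simp_all
  also have "\<dots> = ennreal (1 / ?s * sqrt (2 * pi / (1 / 4)))" by (rule ennreal_mult[symmetric]) (use s in auto)
  also have "1 / ?s * sqrt (2 * pi / (1 / 4)) = sqrt (4 / d)"
  proof -
    have "2 * pi / (1 / 4) = 8 * pi" by simp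
    then have "1 / ?s * sqrt (2 * pi / (1 / 4)) = sqrt (8 * pi) / ?s" by (simp only: times_divide_eq_left mult_1)
    also have "\<dots> = sqrt (8 * pi / (2 * pi * d))" by (rule real_sqrt_divide[symmetric])
    also have "8 * pi / (2 * pi * d) = 4 / d" by simp
    finally show ?thesis .
  qed
  finally have 2: "(\<integral>\<^sup>+y. ennreal (?a y * ?b y / ?s) \<partial>lborel) \<le> ennreal (sqrt (4 / d))" .
  have "(\<integral>\<^sup>+y. ennreal (?a y * ?b y / ?s) \<partial>lborel) \<le> ennreal (sqrt (min (4 / d) 1))"
    using 1 2 by (auto simp: min_def)
  also have "\<dots> \<le> ennreal (sqrt (5 / (1 + d)))"
    using min_le_five[OF d] by (intro ennreal_leI real_sqrt_le_mono)
  finally show ?thesis .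
qed

text \<open>In the eigenbasis of V the integral splits into one-dimensional ones, and the factors 1
  + d_i multiply to det (I + V).\<close>

lemma nn_integral_kernel_mvn0_le:
  fixes V :: "'k::{finite,linorder} matrix"
  assumes "positive_definite V"
  shows "(\<integral>\<^sup>+t. ennreal (exp (- ((norm (z - t))\<^sup>2 / 8)) * mvn0 V (t - \<beta>)) \<partial>lborel)
    \<le> ennreal (sqrt (5 ^ CARD('k) / det (mat 1 + V)))"
proof -
  obtain H d where H: "orthogonal_matrix H" and d: "\<And>i. d $ i > 0" and V: "V = transpose H ** diag d ** H"
    using positive_definite_diagonalise[OF assms] by blast
  let ?w = "H *v (z - \<beta>)"
  let ?f = "\<lambda>i s. exp (- ((?w $ i - s)\<^sup>2 / 8)) * exp (- ((1 / d $ i) * s\<^sup>2 / 2)) / sqrt (2 * pi * d $ i)"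
  have f0: "0 \<le> ?f i s" for i s using d[of i] by simp
  have eq: "exp (- ((norm (z - (\<beta> + y)))\<^sup>2 / 8)) * mvn0 V (\<beta> + y - \<beta>) = (\<Prod>i\<in>UNIV. ?f i ((H *v y) $ i))" for y
  proof -
    have "norm (H *v (z - \<beta> - y)) = norm (z - \<beta> - y)"
      using H orthogonal_transformation_norm[of "(*v) H"] by (simp add: orthogonal_transformation_matrix)
    then have "(norm (z - (\<beta> + y)))\<^sup>2 = (\<Sum>i\<in>UNIV. (?w $ i - (H *v y) $ i)\<^sup>2)"
      by (simp add: power2_norm_vec[symmetric] matrix_vector_mult_diff_distrib[symmetric] diff_diff_eq flip: vector_minus_component)
    then have 1: "exp (- ((norm (z - (\<beta> + y)))\<^sup>2 / 8)) = (\<Prod>i\<in>UNIV. exp (- ((?w $ i - (H *v y) $ i)\<^sup>2 / 8)))"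
      by (simp add: exp_sum[symmetric] sum_negf sum_divide_distrib)
    have 2: "exp (- ((\<Sum>i\<in>UNIV. (1 / d $ i) * ((H *v y) $ i)\<^sup>2) / 2)) = (\<Prod>i\<in>UNIV. exp (- ((1 / d $ i) * ((H *v y) $ i)\<^sup>2 / 2)))"
      by (simp add: exp_sum[symmetric] sum_negf sum_divide_distrib)
    have "(2 * pi) ^ CARD('k) * (\<Prod>i\<in>UNIV. d $ i) = (\<Prod>i\<in>UNIV. 2 * pi * d $ i)"
      by (simp add: prod.distrib)
    then have 3: "sqrt ((2 * pi) ^ CARD('k) * (\<Prod>i\<in>UNIV. d $ i)) = (\<Prod>i\<in>UNIV. sqrt (2 * pi * d $ i))"
      by (simp only: prod_sqrt)
    show ?thesis
      unfolding V add_diff_cancel_left' mvn0_diagonal[OF H d] 1 2 3 by (simp add: prod.distrib prod_dividef)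
  qed
  have "(\<integral>\<^sup>+t. ennreal (exp (- ((norm (z - t))\<^sup>2 / 8)) * mvn0 V (t - \<beta>)) \<partial>lborel)
      = (\<integral>\<^sup>+y. ennreal (exp (- ((norm (z - (\<beta> + y)))\<^sup>2 / 8)) * mvn0 V (\<beta> + y - \<beta>)) \<partial>lborel)"
  proof (rule nn_integral_lborel_translate[symmetric])
    have "(\<lambda>t. ennreal (exp (- ((norm (z - t))\<^sup>2 / 8)) * mvn0_ext (V, t - \<beta>))) \<in> borel_measurable borel" by measurable
    then show "(\<lambda>t. ennreal (exp (- ((norm (z - t))\<^sup>2 / 8)) * mvn0 V (t - \<beta>))) \<in> borel_measurable borel"
      using assms by (simp add: mvn0_ext_def)
  qed
  also have "\<dots> = (\<integral>\<^sup>+y. (\<Prod>i\<in>UNIV. ennreal (?f i ((H *v y) $ i))) \<partial>lborel)"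
    unfolding eq using f0 by (simp add: prod_ennreal)
  also have "\<dots> = (\<integral>\<^sup>+y. (\<Prod>i\<in>UNIV. ennreal (?f i (y $ i))) \<partial>lborel)"
    by (rule nn_integral_rotate[OF H, of "\<lambda>y. \<Prod>i\<in>UNIV. ennreal (?f i (y $ i))"]) measurable
  also have "\<dots> = (\<Prod>i\<in>UNIV. \<integral>\<^sup>+s. ennreal (?f i s) \<partial>lborel)"
    by (rule nn_integral_lborel_vec_prod) measurable
  also have "\<dots> \<le> (\<Prod>i\<in>UNIV. ennreal (sqrt (5 / (1 + d $ i))))"
    by (intro prod_mono_ennreal nn_integral_gauss_pair_1d d)
  also have "\<dots> = ennreal (\<Prod>i\<in>UNIV. sqrt (5 / (1 + d $ i)))"
    using d by (intro prod_ennreal) (simp add: add_nonneg_nonneg less_imp_le)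
  also have "(\<Prod>i\<in>UNIV. sqrt (5 / (1 + d $ i))) = sqrt (5 ^ CARD('k) / det (mat 1 + V))"
    unfolding prod_sqrt V mat_plus_conj[OF H] det_conj[OF H] mat_plus_diag det_diag by (simp add: prod_dividef)
  finally show ?thesis .
qed

text \<open>Each coordinate is an entry of the matrix, so balls of matrices pull back to bounded
  sets of coordinates.\<close>

lemma sigma_finite_sym_lborel: "sigma_finite_measure (sym_lborel :: 'k::{finite,linorder} matrix measure)"
proof (rule sigma_finite_measure.intro)
  let ?A = "range (\<lambda>n. cball (0 :: 'k matrix) (real n))"
  have "emeasure sym_lborel (cball (0 :: 'k matrix) r) \<noteq> \<infinity>" for r
  proof -
    have "sym_of -` cball 0 r \<subseteq> (cbox (vec (- r)) (vec r) :: 'k sym_coords set)"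
    proof
      fix X :: "'k sym_coords"
      assume "X \<in> sym_of -` cball 0 r"
      then have V: "norm (sym_of X) \<le> r" by simp
      have "\<bar>X $ n\<bar> \<le> r" for n
      proof -
        have "X $ n = sym_of X $ fst (tri_entry n) $ snd (tri_entry n)"
          using arg_cong[OF coords_sym_of[of X], of "\<lambda>Y. Y $ n"] by (simp add: coords_def)
        also have "\<bar>\<dots>\<bar> \<le> norm (sym_of X $ fst (tri_entry n))" by (rule component_le_norm_cart)
        also have "\<dots> \<le> norm (sym_of X)" by (rule Finite_Cartesian_Product.norm_nth_le)
        finally show ?thesis using V by simp
      qed
      then show "X \<in> cbox (vec (- r)) (vec r)" by (simp add: mem_box_cart abs_le_iff minus_le_iff)
    qed
    then have "emeasure lborel (sym_of -` cball 0 r :: 'k sym_coords set) \<le> emeasure lborel (cbox (vec (- r)) (vec r) :: 'k sym_coords set)"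
      by (rule emeasure_mono) simp
    also have "\<dots> < \<infinity>"
      by (rule emeasure_bounded_finite) (rule bounded_cbox)
    finally have "emeasure lborel (sym_of -` cball 0 r :: 'k sym_coords set) < \<infinity>" .
    then show ?thesis by (simp add: sym_lborel_eq emeasure_distr)
  qed
  moreover have "\<Union> ?A = space (sym_lborel :: 'k matrix measure)"
    by (auto simp: sym_lborel_eq real_arch_simple)
  moreover have "?A \<subseteq> sets (sym_lborel :: 'k matrix measure)"
    by (auto simp: sym_lborel_eq)
  ultimately show "\<exists>A. countable A \<and> A \<subseteq> sets (sym_lborel :: 'k matrix measure) \<and> \<Union> A = space sym_lborel \<and> (\<forall>a\<in>A. emeasure sym_lborel a \<noteq> \<infinity>)"
    by (intro exI[of _ ?A]) auto
qed

lemma sets_sym_lborel [measurable_cong, simp]: "sets sym_lborel = sets borel"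
  by (simp add: sym_lborel_def)

text \<open>The first condition controls 0 and the second infinity; for the eigenvalue densities
  they become a1 < 1 and a2 + s > 1. The factor 2^|b| compares 1 + t with 1 on (0, 1] and with t on
  [1, \<infinity>).\<close>

lemma nn_integral_gamma_density_finite:
  fixes a b :: real
  assumes a: "a < 1" and ab: "a + b > 1"
  shows "(\<integral>\<^sup>+t. ennreal (t powr - a * (1 + t) powr - b) * indicator {0<..} t \<partial>lborel) < \<infinity>"
proof -
  let ?f = "\<lambda>t :: real. t powr - a * (1 + t) powr - b"
  let ?M = "2 powr \<bar>b\<bar>"
  have le1: "?f t \<le> ?M * t powr - a" if "0 < t" "t \<le> 1" for t
  proof -
    have "(1 + t) powr - b \<le> (1 + t) powr \<bar>b\<bar>" using that by (intro powr_mono) auto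
    also have "\<dots> \<le> ?M" using that by (intro powr_mono2) auto
    finally show ?thesis using mult_left_mono[OF _ powr_ge_zero, of "(1 + t) powr - b" ?M t "- a"] by (simp add: mult.commute)
  qed
  have le2: "?f t \<le> ?M * t powr (- (a + b))" if "1 \<le> t" for t
  proof -
    have "(1 + t) powr - b = t powr - b * ((1 + t) / t) powr - b"
      using that by (simp add: powr_mult[symmetric])
    also have "((1 + t) / t) powr - b \<le> ((1 + t) / t) powr \<bar>b\<bar>" using that by (intro powr_mono) auto
    also have "\<dots> \<le> ?M" using that by (intro powr_mono2) (auto simp: field_simps)
    finally have "(1 + t) powr - b \<le> t powr - b * ?M" by (simp add: mult_left_mono)
    then have "?f t \<le> t powr - a * (t powr - b * ?M)" by (simp add: mult_left_mono)
    moreover have "t powr (- (a + b)) = t powr - a * t powr - b" by (simp add: powr_add[symmetric])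
    ultimately show ?thesis by (simp add: mult_ac)
  qed
  have fin: "(\<integral>\<^sup>+t. ennreal (t powr e) * indicator S t \<partial>lborel) < \<infinity>"
    if "(\<lambda>t. t powr e) integrable_on S" "S \<in> sets borel" for e :: real and S
  proof -
    have "(\<integral>\<^sup>+t. ennreal (t powr e) * indicator S t \<partial>lebesgue) < \<infinity>"
      by (rule nn_integral_lebesgue_restrict) (use that in auto)
    moreover have "(\<integral>\<^sup>+t. ennreal (t powr e) * indicator S t \<partial>lebesgue) = (\<integral>\<^sup>+t. ennreal (t powr e) * indicator S t \<partial>lborel)"
      by (rule nn_integral_completion)
    ultimately show ?thesis by simp
  qed
  have 1: "(\<integral>\<^sup>+t. ennreal (t powr - a) * indicator {0..1} t \<partial>lborel) < \<infinity>"
    using has_integral_powr_from_0[of "- a" 1] a by (intro fin) auto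
  have 2: "(\<integral>\<^sup>+t. ennreal (t powr (- (a + b))) * indicator {1..} t \<partial>lborel) < \<infinity>"
    using has_integral_powr_to_inf[of "- (a + b)" 1] ab by (intro fin) auto
  have "(\<integral>\<^sup>+t. ennreal (?f t) * indicator {0<..} t \<partial>lborel)
      \<le> (\<integral>\<^sup>+t. ennreal ?M * (ennreal (t powr - a) * indicator {0..1} t) + ennreal ?M * (ennreal (t powr (- (a + b))) * indicator {1..} t) \<partial>lborel)"
  proof (rule nn_integral_mono)
    fix t :: real
    consider "t \<le> 0" | "0 < t" "t \<le> 1" | "1 < t" by linarith
    then show "ennreal (?f t) * indicator {0<..} t
        \<le> ennreal ?M * (ennreal (t powr - a) * indicator {0..1} t) + ennreal ?M * (ennreal (t powr (- (a + b))) * indicator {1..} t)"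
    proof cases
      case 2
      then have "ennreal (?f t) \<le> ennreal ?M * ennreal (t powr - a)"
        using le1[of t] by (simp add: ennreal_mult[symmetric] ennreal_leI)
      then show ?thesis using 2 by (simp add: add_increasing2)
    next
      case 3
      then have "ennreal (?f t) \<le> ennreal ?M * ennreal (t powr (- (a + b)))"
        using le2[of t] by (simp add: ennreal_mult[symmetric] ennreal_leI)
      then show ?thesis using 3 by simp
    qed simp
  qed
  also have "\<dots> = ennreal ?M * (\<integral>\<^sup>+t. ennreal (t powr - a) * indicator {0..1} t \<partial>lborel)
      + ennreal ?M * (\<integral>\<^sup>+t. ennreal (t powr (- (a + b))) * indicator {1..} t \<partial>lborel)"
    by (simp add: nn_integral_add nn_integral_cmult)
  also have "\<dots> < \<infinity>" using 1 2 by (simp add: ennreal_mult_less_top)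
  finally show ?thesis .
qed

lemma mvn0_ext_nonneg: "0 \<le> mvn0_ext z"
  by (cases z) (simp add: mvn0_ext_def mvn0_nonneg)

lemma mvn0_ext_pd: "positive_definite V \<Longrightarrow> mvn0_ext (V, d) = mvn0 V d"
  by (simp add: mvn0_ext_def)

section \<open>Blocks, their average and the diagonal embedding\<close>

lemma power2_norm_block: "(norm (x :: real^('m::finite \<times> 'k::finite)))\<^sup>2 = (\<Sum>i\<in>UNIV. (norm (block x i))\<^sup>2)"
  by (simp add: power2_norm_vec block_def sum.cartesian_product flip: UNIV_Times_UNIV)

lemma
  fixes x y :: "real^('m::finite \<times> 'k::finite)"
  shows block_diff: "block (x - y) i = block x i - block y i" and block_add: "block (x + y) i = block x i + block y i"
  by (simp_all add: block_def vec_eq_iff)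

lemma norm_block_le: "norm (block x i) \<le> norm x"
proof -
  have "(norm (block x i))\<^sup>2 \<le> (norm x)\<^sup>2"
    unfolding power2_norm_block by (rule member_le_sum) auto
  then show ?thesis by (rule power2_le_imp_le) simp
qed

text \<open>The diagonal embedding, used as \<open>emb\<close> of \<open>shift_prior\<close>: moving
  \<beta> by b moves every block of \<theta> by b. \<open>block_avg\<close> is its left inverse
  \<open>av\<close>.\<close>

definition replicate_blocks :: "'k::finite vector \<Rightarrow> ('m::finite \<times> 'k) vector" where
  "replicate_blocks b = (\<chi> p. b $ snd p)"

definition block_avg :: "('m::finite \<times> 'k::finite) vector \<Rightarrow> 'k vector" where
  "block_avg x = (1 / real CARD('m)) *\<^sub>R (\<Sum>i\<in>UNIV. block x i)"

lemma block_replicate_blocks: "block (replicate_blocks b) i = b"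
  by (simp add: block_def replicate_blocks_def vec_eq_iff)

lemma linear_replicate_blocks: "linear replicate_blocks"
  by (rule linearI) (simp_all add: replicate_blocks_def vec_eq_iff)

lemma linear_block_avg: "linear block_avg"
proof (rule linearI)
  fix x y :: "('m::finite \<times> 'k::finite) vector" and c
  show "block_avg (x + y) = block_avg x + block_avg y"
    by (simp add: block_avg_def block_add sum.distrib scaleR_add_right)
  have "block (c *\<^sub>R x) i = c *\<^sub>R block x i" for i by (simp add: block_def vec_eq_iff)
  then show "block_avg (c *\<^sub>R x) = c *\<^sub>R block_avg x"
    by (simp add: block_avg_def scaleR_sum_right)
qed

lemma block_avg_replicate_blocks: "block_avg (replicate_blocks b :: ('m::finite \<times> 'k::finite) vector) = b"
  by (simp add: block_avg_def block_replicate_blocks sum_constant_scaleR del: sum_constant)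

lemma norm_block_avg_le: "norm (block_avg x) \<le> norm (x :: ('m::finite \<times> 'k::finite) vector)"
proof -
  have "norm (\<Sum>i\<in>UNIV. block x i) \<le> (\<Sum>i\<in>(UNIV :: 'm set). norm x)"
    by (rule order_trans[OF norm_sum]) (intro sum_mono norm_block_le)
  then show ?thesis by (simp add: block_avg_def divide_le_eq mult.commute)
qed

lemma block_avg_measurable [measurable]: "block_avg \<in> borel_measurable borel" and replicate_blocks_measurable [measurable]: "replicate_blocks \<in> borel_measurable borel"
  by (intro borel_measurable_continuous_onI linear_continuous_on; simp add: linear_block_avg linear_replicate_blocks linear_linear)+

lemma gauss_block: "gauss x = (\<Prod>i\<in>UNIV. gauss (block x i))"
  by (simp add: gauss_def power2_norm_block exp_sum[symmetric] sum_negf sum_divide_distrib)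

section \<open>Covariances close to a multiple of the identity\<close>

text \<open>The i-th row of H is a unit eigenvector with eigenvalue d_i, so the quadratic form can
  be read there.\<close>

lemma diag_bounds_of_quadratic:
  fixes H :: "real^'n^'n"
  assumes H: "orthogonal_matrix H" and V: "V = transpose H ** diag d ** H"
    and q: "\<And>u. lo * (norm u)\<^sup>2 \<le> u \<bullet> (V *v u) \<and> u \<bullet> (V *v u) \<le> hi * (norm u)\<^sup>2"
  shows "lo \<le> d $ i" "d $ i \<le> hi"
proof -
  let ?u = "transpose H *v axis i 1"
  have Hu: "H *v ?u = axis i 1"
    using H by (simp add: matrix_vector_mul_assoc orthogonal_matrix_def del: transpose_matrix_vector)
  have "norm ?u = norm (axis i (1::real) :: real^'n)"
    using H orthogonal_transformation_norm[of "(*v) (transpose H)"]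
    by (simp add: orthogonal_transformation_matrix del: transpose_matrix_vector)
  then have "norm ?u = 1" by simp
  moreover have "?u \<bullet> (V *v ?u) = d $ i"
    unfolding V conj_quadratic Hu by (simp add: axis_def if_distrib[of "\<lambda>x. x\<^sup>2"] if_distrib[of "\<lambda>x. _ * x"] cong: if_cong)
  ultimately show "lo \<le> d $ i" "d $ i \<le> hi" using q[of ?u] by simp_all
qed

text \<open>The error form is at most r/(2n) times the squared l1 norm of u, hence at most r |u|^2 /
  2 by Cauchy-Schwarz; around the centre 3r/2 this leaves the range from r to 2r.\<close>

lemma quadratic_near_scalar:
  fixes V :: "real^'n^'n"
  assumes near: "\<And>i j. \<bar>V $ i $ j - (if i = j then 3 / 2 * r else 0)\<bar> \<le> r / (2 * real CARD('n))"
  shows "r * (norm u)\<^sup>2 \<le> u \<bullet> (V *v u) \<and> u \<bullet> (V *v u) \<le> 2 * r * (norm u)\<^sup>2"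
proof -
  let ?n = "real CARD('n)"
  let ?E = "\<lambda>i j. V $ i $ j - (if i = j then 3 / 2 * r else 0)"
  have r: "r / (2 * ?n) \<ge> 0" using near order_trans[OF abs_ge_zero] by blast
  have "u \<bullet> (V *v u) = (\<Sum>i\<in>UNIV. \<Sum>j\<in>UNIV. u $ i * (V $ i $ j * u $ j))"
    by (simp add: inner_vec_def matrix_vector_mult_def sum_distrib_left)
  also have "\<dots> = (\<Sum>i\<in>UNIV. \<Sum>j\<in>UNIV. u $ i * (?E i j * u $ j) + (if i = j then 3 / 2 * r * (u $ i)\<^sup>2 else 0))"
    by (intro sum.cong) (auto simp: algebra_simps power2_eq_square)
  also have "\<dots> = (\<Sum>i\<in>UNIV. \<Sum>j\<in>UNIV. u $ i * (?E i j * u $ j)) + 3 / 2 * r * (norm u)\<^sup>2"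
    by (simp add: sum.distrib power2_norm_vec sum_distrib_left)
  finally have eq: "u \<bullet> (V *v u) = (\<Sum>i\<in>UNIV. \<Sum>j\<in>UNIV. u $ i * (?E i j * u $ j)) + 3 / 2 * r * (norm u)\<^sup>2" .
  have "\<bar>\<Sum>i\<in>UNIV. \<Sum>j\<in>UNIV. u $ i * (?E i j * u $ j)\<bar> \<le> (\<Sum>i\<in>UNIV. \<Sum>j\<in>UNIV. \<bar>u $ i * (?E i j * u $ j)\<bar>)"
    by (intro order_trans[OF sum_abs] sum_mono sum_abs)
  also have "\<dots> \<le> (\<Sum>i\<in>UNIV. \<Sum>j\<in>UNIV. r / (2 * ?n) * (\<bar>u $ i\<bar> * \<bar>u $ j\<bar>))"
  proof (intro sum_mono)
    fix i j
    have "\<bar>?E i j\<bar> * (\<bar>u $ i\<bar> * \<bar>u $ j\<bar>) \<le> r / (2 * ?n) * (\<bar>u $ i\<bar> * \<bar>u $ j\<bar>)"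
      by (intro mult_right_mono near) simp
    then show "\<bar>u $ i * (?E i j * u $ j)\<bar> \<le> r / (2 * ?n) * (\<bar>u $ i\<bar> * \<bar>u $ j\<bar>)" by (simp add: abs_mult mult_ac)
  qed
  also have "\<dots> = r / (2 * ?n) * (\<Sum>i\<in>UNIV. \<bar>u $ i\<bar>)\<^sup>2"
    unfolding power2_eq_square sum_product unfolding sum_distrib_left ..
  also have "\<dots> \<le> r / (2 * ?n) * (?n * (norm u)\<^sup>2)"
  proof (rule mult_left_mono[OF _ r])
    have "(\<Sum>i\<in>UNIV. \<bar>u $ i\<bar> * 1)\<^sup>2 \<le> (\<Sum>i\<in>UNIV. \<bar>u $ i\<bar>\<^sup>2) * (\<Sum>i\<in>(UNIV :: 'n set). 1\<^sup>2)"
      by (rule Cauchy_Schwarz_ineq_sum)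
    then show "(\<Sum>i\<in>UNIV. \<bar>u $ i\<bar>)\<^sup>2 \<le> ?n * (norm u)\<^sup>2" by (simp add: power2_norm_vec mult.commute)
  qed
  also have "\<dots> = r * (norm u)\<^sup>2 / 2" by simp
  finally have "\<bar>\<Sum>i\<in>UNIV. \<Sum>j\<in>UNIV. u $ i * (?E i j * u $ j)\<bar> \<le> r * (norm u)\<^sup>2 / 2" .
  moreover have "\<bar>S\<bar> \<le> q / 2 \<Longrightarrow> q \<le> S + 3 / 2 * q \<and> S + 3 / 2 * q \<le> 2 * q" for S q :: real by linarith
  ultimately show ?thesis unfolding eq mult.assoc by blast
qed

lemma det_one_plus_pos:
  assumes "positive_definite (V :: 'k::{finite,linorder} matrix)"
  shows "det (mat 1 + V) > 0"
proof -
  obtain H d where H: "orthogonal_matrix H" and d: "\<And>i. d $ i > 0" and V: "V = transpose H ** diag d ** H"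
    using positive_definite_diagonalise[OF assms] by blast
  have "0 < (\<Prod>i\<in>UNIV. 1 + d $ i)" using d by (intro prod_pos) (simp add: add_pos_pos)
  then show ?thesis unfolding V mat_plus_conj[OF H] det_conj[OF H] mat_plus_diag det_diag by simp
qed

text \<open>The lower eigenvalue bound controls the exponent, which is at least - 6r/(2r) = -3, and
  the upper one controls the determinant.\<close>

lemma mvn0_lower:
  fixes V :: "'k::{finite,linorder} matrix"
  assumes r: "r > 0" and V: "positive_definite V"
    and q: "\<And>u. r * (norm u)\<^sup>2 \<le> u \<bullet> (V *v u) \<and> u \<bullet> (V *v u) \<le> 2 * r * (norm u)\<^sup>2"
    and y: "(norm y)\<^sup>2 \<le> 6 * r"
  shows "exp (- 3) / sqrt ((4 * pi * r) ^ CARD('k)) \<le> mvn0 V y"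
proof -
  obtain H d where H: "orthogonal_matrix H" and d: "\<And>i. d $ i > 0" and VH: "V = transpose H ** diag d ** H"
    using positive_definite_diagonalise[OF V] by blast
  have lo: "r \<le> d $ i" and hi: "d $ i \<le> 2 * r" for i
    using diag_bounds_of_quadratic[OF H VH q] by auto
  have "norm (H *v y) = norm y"
    using H orthogonal_transformation_norm[of "(*v) H" y] by (simp add: orthogonal_transformation_matrix)
  then have "(\<Sum>i\<in>UNIV. (1 / r) * ((H *v y) $ i)\<^sup>2) = (1 / r) * (norm y)\<^sup>2"
    by (simp only: sum_distrib_left[symmetric] power2_norm_vec[symmetric])
  also have "\<dots> \<le> 6" using r y by (simp add: field_simps)
  finally have s6: "(\<Sum>i\<in>UNIV. (1 / r) * ((H *v y) $ i)\<^sup>2) \<le> 6" .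
  have "(\<Sum>i\<in>UNIV. (1 / d $ i) * ((H *v y) $ i)\<^sup>2) \<le> (\<Sum>i\<in>UNIV. (1 / r) * ((H *v y) $ i)\<^sup>2)"
    using r d lo by (intro sum_mono mult_right_mono divide_left_mono mult_pos_pos) auto
  then have e: "exp (- 3) \<le> exp (- ((\<Sum>i\<in>UNIV. (1 / d $ i) * ((H *v y) $ i)\<^sup>2) / 2))"
    using s6 by simp
  have "(\<Prod>i\<in>UNIV. d $ i) \<le> (\<Prod>i\<in>(UNIV :: 'k set). 2 * r)"
    using hi d by (intro prod_mono) (auto simp: less_imp_le)
  then have "(2 * pi) ^ CARD('k) * (\<Prod>i\<in>UNIV. d $ i) \<le> (2 * pi) ^ CARD('k) * (2 * r) ^ CARD('k)" by simp
  also have "\<dots> = (4 * pi * r) ^ CARD('k)" unfolding power_mult_distrib[symmetric] by (simp add: mult_ac)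
  finally have "sqrt ((2 * pi) ^ CARD('k) * (\<Prod>i\<in>UNIV. d $ i)) \<le> sqrt ((4 * pi * r) ^ CARD('k))"
    by (rule real_sqrt_le_mono)
  moreover have "0 < sqrt ((2 * pi) ^ CARD('k) * (\<Prod>i\<in>UNIV. d $ i))" using d by (simp add: prod_pos)
  ultimately show ?thesis unfolding VH mvn0_diagonal[OF H d] using e by (intro frac_le) auto
qed

text \<open>Covers exponents of either sign, as a1 and a2 - a1 may be negative.\<close>

lemma powr_comparable:
  fixes s t e a :: real
  assumes "1 \<le> a" "0 < t" "t \<le> s" "s \<le> a * t"
  shows "s powr e \<le> a powr \<bar>e\<bar> * t powr e"
proof (cases "e \<ge> 0")
  case True
  have "s powr e \<le> (a * t) powr e" using assms True by (intro powr_mono2) auto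
  then show ?thesis using True by (simp add: powr_mult)
next
  case False
  then have "s powr e \<le> t powr e" using assms by (intro powr_mono2') auto
  also have "\<dots> \<le> a powr \<bar>e\<bar> * t powr e" using assms by (simp add: ge_one_powr_ge_zero mult_le_cancel_right1)
  finally show ?thesis .
qed

text \<open>One factor is kept so that the integral over \<beta> converges; the others give way to
  their uniform bound.\<close>

lemma prod_ennreal_le_remove:
  fixes f :: "'m::finite \<Rightarrow> ennreal"
  assumes "\<And>i. f i \<le> q"
  shows "(\<Prod>i\<in>UNIV. f i) \<le> f j * q ^ (CARD('m) - 1)"
proof -
  have "(\<Prod>i\<in>A. f i) \<le> q ^ card A" if "finite A" for A
    using that by (induction A rule: finite_induct) (auto intro: mult_mono assms)
  then have "(\<Prod>i\<in>UNIV - {j}. f i) \<le> q ^ (CARD('m) - 1)" by (metis card_Diff_singleton finite finite_Diff UNIV_I)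
  then show ?thesis by (subst prod.remove[of UNIV j]) (auto intro: mult_left_mono)
qed

section \<open>The induced prior of \<theta> and its bounds\<close>

locale hier_prior =
  fixes prior_V :: "'k::{finite,linorder} matrix \<Rightarrow> real" and a1 a2 C1 C2 :: real
  assumes a1: "a1 < 1"
    and prior_meas: "prior_V \<in> borel_measurable (restrict_space borel {V. positive_definite V})"
    and prior_nonneg: "\<And>V. positive_definite V \<Longrightarrow> prior_V V \<ge> 0"
    and C: "C1 > 0" "C2 > 0"
    and prior_bounds: "\<And>H d. orthogonal_matrix H \<Longrightarrow> (\<forall>i j. i < j \<longrightarrow> d $ i > d $ j) \<Longrightarrow> (\<forall>i. d $ i > 0) \<Longrightarrow>
      C1 / (det (mat 1 + diag d) powr (a2 - a1) * det (diag d) powr a1) \<le> prior_HD prior_V H d \<and>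
      prior_HD prior_V H d \<le> C2 / (det (mat 1 + diag d) powr (a2 - a1) * det (diag d) powr a1)"
begin

definition prior_ext :: "'k matrix \<Rightarrow> real" where
  "prior_ext V = (if positive_definite V then prior_V V else 0)"

lemma prior_ext_nonneg: "0 \<le> prior_ext V"
  by (simp add: prior_ext_def prior_nonneg)

lemma prior_ext_measurable [measurable]: "prior_ext \<in> borel_measurable borel"
proof -
  have "(\<lambda>V. indicator {V. positive_definite V} V *\<^sub>R prior_V V) \<in> borel_measurable borel"
    using prior_meas by (subst (asm) borel_measurable_restrict_space_iff) auto
  also have "(\<lambda>V. indicator {V. positive_definite V} V *\<^sub>R prior_V V) = prior_ext"
    by (auto simp: prior_ext_def fun_eq_iff indicator_def)
  finally show ?thesis .
qed

lemma prior_density_eq: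
  "det (mat 1 + diag d) powr (a2 - a1) * det (diag d) powr a1 = (\<Prod>i\<in>UNIV. (1 + d $ i) powr (a2 - a1) * (d $ i) powr a1)"
proof -
  show ?thesis
    by (simp add: mat_plus_diag det_diag prod.distrib prod_powr_distrib)
qed

text \<open>In eigenvalue coordinates the integrand times the gap product is, up to a constant, at
  most the product of d^(-a1) (1 + d)^(-(a2 - a1 + s)), of order d^(-(a2 + s)) at infinity. The case
  s = 0 is the mass of the prior of V; s = (m - 1)/2 enters the bound on the marginal
  density.\<close>

lemma nn_integral_prior_finite:
  assumes s: "a2 + s > 1"
  shows "(\<integral>\<^sup>+V. ennreal (prior_ext V * det (mat 1 + V) powr - s) \<partial>sym_lborel) < \<infinity>"
proof -
  let ?g = "\<lambda>t :: real. t powr - a1 * (1 + t) powr - (a2 - a1 + s)"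
  let ?f = "\<lambda>V. (1 / C2) * (prior_ext V * det (mat 1 + V) powr - s)"
  have [measurable]: "(\<lambda>V :: 'k matrix. det (mat 1 + V)) \<in> borel_measurable borel"
    by (rule det_measurable) simp
  have "(\<integral>\<^sup>+V. ennreal (?f V) \<partial>sym_lborel) < \<infinity>"
  proof (rule nn_integral_sym_lborel_finite)
    show "?f \<in> borel_measurable borel" by measurable
    show "0 \<le> ?f V" for V using C prior_ext_nonneg by simp
    show "\<not> positive_definite V \<Longrightarrow> ?f V = 0" for V by (simp add: prior_ext_def)
    show "?g \<in> borel_measurable borel" by measurable
    show "0 \<le> ?g t" for t by simp
    show "(\<integral>\<^sup>+t. ennreal (?g t) * indicator {0<..} t \<partial>lborel) < \<infinity>"
      by (rule nn_integral_gamma_density_finite) (use a1 s in auto)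
    fix H :: "'k matrix" and d :: "'k vector"
    assume H: "orthogonal_matrix H" and srt: "\<forall>i j. i < j \<longrightarrow> d $ j < d $ i" and pos: "\<forall>i. d $ i > 0"
    let ?V = "transpose H ** diag d ** H"
    have pd: "positive_definite ?V" using positive_definite_conj_iff[OF H] pos by simp
    have det: "det (mat 1 + ?V) powr - s = (\<Prod>i\<in>UNIV. (1 + d $ i) powr - s)"
      unfolding mat_plus_conj[OF H] det_conj[OF H] mat_plus_diag det_diag
      using pos by (simp add: prod_powr_distrib add_nonneg_nonneg less_imp_le)
    have "prior_ext ?V * (\<Prod>(i, j) | i < j. d $ i - d $ j) \<le> C2 / (\<Prod>i\<in>UNIV. (1 + d $ i) powr (a2 - a1) * (d $ i) powr a1)"
      using prior_bounds[OF H srt pos] prior_density_eq[of d] pd by (simp add: prior_HD_def prior_ext_def)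
    then have "(1 / C2) * (prior_ext ?V * (\<Prod>(i, j) | i < j. d $ i - d $ j)) \<le> 1 / (\<Prod>i\<in>UNIV. (1 + d $ i) powr (a2 - a1) * (d $ i) powr a1)"
      using C(2) by (simp add: field_simps)
    also have "\<dots> = (\<Prod>i\<in>UNIV. (1 + d $ i) powr - (a2 - a1) * (d $ i) powr - a1)"
    proof -
      have "1 / (\<Prod>i\<in>UNIV. f i) = (\<Prod>i\<in>UNIV. 1 / f i)" for f :: "'k \<Rightarrow> real" by (simp add: prod_dividef)
      then show ?thesis by (simp only: powr_minus_divide times_divide_times_eq mult_1)
    qed
    finally have "(1 / C2) * (prior_ext ?V * (\<Prod>(i, j) | i < j. d $ i - d $ j)) * (\<Prod>i\<in>UNIV. (1 + d $ i) powr - s)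
        \<le> (\<Prod>i\<in>UNIV. (1 + d $ i) powr - (a2 - a1) * (d $ i) powr - a1) * (\<Prod>i\<in>UNIV. (1 + d $ i) powr - s)"
      by (intro mult_right_mono prod_nonneg) auto
    also have "\<dots> = (\<Prod>i\<in>UNIV. ?g (d $ i))"
      unfolding prod.distrib[symmetric] by (intro prod.cong) (auto simp: powr_add[symmetric] algebra_simps)
    finally show "?f ?V * (\<Prod>(i, j) | i < j. d $ i - d $ j) \<le> (\<Prod>i\<in>UNIV. ?g (d $ i))"
      unfolding det by (simp only: mult_ac)
  qed
  moreover have "(\<integral>\<^sup>+V. ennreal (prior_ext V * det (mat 1 + V) powr - s) \<partial>sym_lborel) = ennreal C2 * (\<integral>\<^sup>+V. ennreal (?f V) \<partial>sym_lborel)"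
    using C by (subst nn_integral_cmult[symmetric]) (auto simp: ennreal_mult'[symmetric])
  ultimately show ?thesis by (simp add: ennreal_mult_less_top)
qed

definition theta_density :: "('m::finite \<times> 'k) vector \<times> 'k vector \<times> 'k matrix \<Rightarrow> real" where
  "theta_density = (\<lambda>(\<theta>, \<beta>, V). prior_ext V * (\<Prod>i\<in>UNIV. mvn0_ext (V, block \<theta> i - \<beta>)))"

definition theta_prior :: "('m::finite \<times> 'k) vector measure" where
  "theta_prior = distr (density param_measure (\<lambda>z. ennreal (theta_density z))) borel fst"

lemma sets_param_measure [measurable_cong, simp]:
  "sets (param_measure :: (('m::finite \<times> 'k) vector \<times> 'k vector \<times> 'k matrix) measure) = sets (borel \<Otimes>\<^sub>M borel \<Otimes>\<^sub>M borel)"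
  unfolding param_measure_def
  by (intro sets_pair_measure_cong sets_lborel sets_sym_lborel)

lemma theta_density_measurable [measurable]: "theta_density \<in> borel_measurable (borel \<Otimes>\<^sub>M borel \<Otimes>\<^sub>M borel)"
  unfolding theta_density_def case_prod_unfold by measurable

lemma theta_density_nonneg: "0 \<le> theta_density z"
  by (cases z) (simp add: theta_density_def prior_ext_nonneg mvn0_ext_nonneg prod_nonneg)

lemma sets_theta_prior [simp, measurable_cong]: "sets theta_prior = sets borel"
  by (simp add: theta_prior_def)

lemma nn_integral_theta_prior:
  fixes f :: "('m::finite \<times> 'k) vector \<Rightarrow> ennreal"
  assumes [measurable]: "f \<in> borel_measurable borel"
  shows "(\<integral>\<^sup>+\<theta>. f \<theta> \<partial>theta_prior) = (\<integral>\<^sup>+V. ennreal (prior_ext V) * (\<integral>\<^sup>+\<beta>. \<integral>\<^sup>+\<theta>. (\<Prod>i\<in>UNIV. ennreal (mvn0_ext (V, block \<theta> i - \<beta>))) * f \<theta> \<partial>lborel \<partial>lborel) \<partial>sym_lborel)"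
proof -
  interpret S: sigma_finite_measure "sym_lborel :: 'k matrix measure" by (rule sigma_finite_sym_lborel)
  interpret P: pair_sigma_finite "lborel :: 'k vector measure" "sym_lborel :: 'k matrix measure" ..
  interpret PS: sigma_finite_measure "lborel \<Otimes>\<^sub>M sym_lborel :: ('k vector \<times> 'k matrix) measure"
    by (rule sigma_finite_pair_measure) (rule lborel.sigma_finite_measure_axioms, rule sigma_finite_sym_lborel)
  interpret T: pair_sigma_finite "lborel :: ('m \<times> 'k) vector measure" "lborel \<Otimes>\<^sub>M sym_lborel :: ('k vector \<times> 'k matrix) measure" ..
  have "(\<integral>\<^sup>+\<theta>. f \<theta> \<partial>theta_prior) = (\<integral>\<^sup>+z. ennreal (theta_density z) * f (fst z) \<partial>param_measure)"
    unfolding theta_prior_def by (subst nn_integral_distr, simp, simp, subst nn_integral_density) simp_all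
  also have "\<dots> = (\<integral>\<^sup>+w. \<integral>\<^sup>+\<theta>. ennreal (theta_density (\<theta>, w)) * f \<theta> \<partial>lborel \<partial>(lborel \<Otimes>\<^sub>M sym_lborel))"
    unfolding param_measure_def by (subst T.nn_integral_snd[symmetric]) simp_all
  also have "\<dots> = (\<integral>\<^sup>+V. \<integral>\<^sup>+\<beta>. \<integral>\<^sup>+\<theta>. ennreal (theta_density (\<theta>, \<beta>, V)) * f \<theta> \<partial>lborel \<partial>lborel \<partial>sym_lborel)"
    by (subst P.nn_integral_snd[symmetric]) simp_all
  also have "\<dots> = (\<integral>\<^sup>+V. ennreal (prior_ext V) * (\<integral>\<^sup>+\<beta>. \<integral>\<^sup>+\<theta>. (\<Prod>i\<in>UNIV. ennreal (mvn0_ext (V, block \<theta> i - \<beta>))) * f \<theta> \<partial>lborel \<partial>lborel) \<partial>sym_lborel)"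
  proof (rule nn_integral_cong)
    fix V :: "'k matrix"
    have "ennreal (theta_density (\<theta>, \<beta>, V)) = ennreal (prior_ext V) * (\<Prod>i\<in>UNIV. ennreal (mvn0_ext (V, block \<theta> i - \<beta>)))" for \<theta> :: "('m \<times> 'k) vector" and \<beta>
      by (simp add: theta_density_def ennreal_mult prior_ext_nonneg prod_nonneg mvn0_ext_nonneg prod_ennreal)
    then show "(\<integral>\<^sup>+\<beta>. \<integral>\<^sup>+\<theta>. ennreal (theta_density (\<theta>, \<beta>, V)) * f \<theta> \<partial>lborel \<partial>lborel)
      = ennreal (prior_ext V) * (\<integral>\<^sup>+\<beta>. \<integral>\<^sup>+\<theta>. (\<Prod>i\<in>UNIV. ennreal (mvn0_ext (V, block \<theta> i - \<beta>))) * f \<theta> \<partial>lborel \<partial>lborel)"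
      by (simp add: mult.assoc nn_integral_cmult)
  qed
  finally show ?thesis .
qed

text \<open>The prior of \<beta> is Lebesgue measure, and moving \<theta> and \<beta> together
  leaves the normal densities unchanged.\<close>

lemma theta_prior_shift:
  fixes f :: "('m::finite \<times> 'k) vector \<Rightarrow> ennreal"
  assumes [measurable]: "f \<in> borel_measurable borel"
  shows "(\<integral>\<^sup>+\<theta>. f (\<theta> + replicate_blocks b) \<partial>theta_prior) = (\<integral>\<^sup>+\<theta>. f \<theta> \<partial>theta_prior)"
proof -
  have "(\<integral>\<^sup>+\<beta>. \<integral>\<^sup>+\<theta>. (\<Prod>i\<in>UNIV. ennreal (mvn0_ext (V, block \<theta> i - \<beta>))) * f (\<theta> + replicate_blocks b) \<partial>lborel \<partial>lborel)
      = (\<integral>\<^sup>+\<beta>. \<integral>\<^sup>+\<theta>. (\<Prod>i\<in>UNIV. ennreal (mvn0_ext (V, block \<theta> i - \<beta>))) * f \<theta> \<partial>lborel \<partial>lborel)" (is "?L = ?R") for V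
  proof -
    have "?R = (\<integral>\<^sup>+\<beta>. \<integral>\<^sup>+\<theta>. (\<Prod>i\<in>UNIV. ennreal (mvn0_ext (V, block \<theta> i - (b + \<beta>)))) * f \<theta> \<partial>lborel \<partial>lborel)"
      by (rule nn_integral_lborel_translate[symmetric]) measurable
    also have "\<dots> = (\<integral>\<^sup>+\<beta>. \<integral>\<^sup>+\<theta>. (\<Prod>i\<in>UNIV. ennreal (mvn0_ext (V, block (replicate_blocks b + \<theta>) i - (b + \<beta>)))) * f (replicate_blocks b + \<theta>) \<partial>lborel \<partial>lborel)"
      by (intro nn_integral_cong nn_integral_lborel_translate[symmetric]) measurable
    also have "\<dots> = ?L" by (simp add: block_add block_replicate_blocks add.commute)
    finally show ?thesis by simp
  qed
  then show ?thesis by (simp add: nn_integral_theta_prior)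
qed

lemma nn_integral_blocks_mvn0:
  fixes g :: "'m::finite \<Rightarrow> 'k vector \<Rightarrow> ennreal"
  assumes [measurable]: "\<And>i. g i \<in> borel_measurable borel"
  shows "(\<integral>\<^sup>+\<theta>. (\<Prod>i\<in>UNIV. ennreal (mvn0_ext (V, block \<theta> i - \<beta>))) * (\<Prod>i\<in>UNIV. g i (block \<theta> i)) \<partial>lborel)
    = (\<Prod>i\<in>UNIV. \<integral>\<^sup>+t. ennreal (mvn0_ext (V, t - \<beta>)) * g i t \<partial>lborel)"
  unfolding prod.distrib[symmetric]
  by (rule nn_integral_lborel_block_prod[of "\<lambda>i t. ennreal (mvn0_ext (V, t - \<beta>)) * g i t"]) measurable

lemma nn_integral_mvn0_ext:
  assumes "positive_definite V"
  shows "(\<integral>\<^sup>+t. ennreal (mvn0_ext (V, t - \<beta>)) \<partial>lborel) = 1" "(\<integral>\<^sup>+\<beta>. ennreal (mvn0_ext (V, t - \<beta>)) \<partial>lborel) = 1"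
proof -
  have 1: "(\<integral>\<^sup>+t. ennreal (mvn0_ext (V, t)) \<partial>lborel) = 1" using nn_integral_mvn0[OF assms] by (simp add: mvn0_ext_pd[OF assms])
  show "(\<integral>\<^sup>+t. ennreal (mvn0_ext (V, t - \<beta>)) \<partial>lborel) = 1"
    using nn_integral_lborel_translate[of "\<lambda>t. ennreal (mvn0_ext (V, t))" "- \<beta>"] 1 by simp
  show "(\<integral>\<^sup>+\<beta>. ennreal (mvn0_ext (V, t - \<beta>)) \<partial>lborel) = 1"
    using nn_integral_lborel_reflect[of "\<lambda>t. ennreal (mvn0_ext (V, t))" t] 1 by simp
qed

text \<open>Once \<theta> is re-centred at \<beta>, the variable \<beta> occurs in the indicator
  alone and contributes the volume of the ball; the normal densities integrate to 1. The prior mass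
  of V is left, finite for a2 > 1.\<close>

lemma theta_prior_slab:
  assumes "a2 > 1"
  shows "(\<integral>\<^sup>+\<theta>. indicator (ball 0 1) (block_avg \<theta>) \<partial>(theta_prior :: ('m::finite \<times> 'k) vector measure)) < \<infinity>"
proof -
  let ?A = "emeasure lborel (ball (0 :: 'k vector) 1)"
  have A: "?A < \<infinity>" by (rule emeasure_bounded_finite) (rule bounded_ball)
  have inner: "(\<integral>\<^sup>+\<beta>. \<integral>\<^sup>+\<theta>. (\<Prod>i\<in>UNIV. ennreal (mvn0_ext (V, block \<theta> i - \<beta>))) * indicator (ball 0 1) (block_avg (\<theta> :: ('m \<times> 'k) vector)) \<partial>lborel \<partial>lborel) = ?A"
    if pd: "positive_definite V" for V
  proof -
    have "(\<integral>\<^sup>+\<beta>. \<integral>\<^sup>+\<theta>. (\<Prod>i\<in>UNIV. ennreal (mvn0_ext (V, block \<theta> i - \<beta>))) * indicator (ball 0 1) (block_avg (\<theta> :: ('m \<times> 'k) vector)) \<partial>lborel \<partial>lborel)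
      = (\<integral>\<^sup>+\<beta>. \<integral>\<^sup>+\<theta>. (\<Prod>i\<in>UNIV. ennreal (mvn0_ext (V, block (replicate_blocks \<beta> + \<theta>) i - \<beta>))) * indicator (ball 0 1) (block_avg (replicate_blocks \<beta> + \<theta> :: ('m \<times> 'k) vector)) \<partial>lborel \<partial>lborel)"
      by (intro nn_integral_cong nn_integral_lborel_translate[symmetric]) measurable
    also have "\<dots> = (\<integral>\<^sup>+\<beta>. \<integral>\<^sup>+\<theta>. (\<Prod>i\<in>UNIV. ennreal (mvn0_ext (V, block \<theta> i))) * indicator (ball 0 1) (block_avg (\<theta> :: ('m \<times> 'k) vector) + \<beta>) \<partial>lborel \<partial>lborel)"
      by (simp add: block_add block_replicate_blocks linear_add[OF linear_block_avg] block_avg_replicate_blocks add.commute)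
    also have "\<dots> = (\<integral>\<^sup>+\<theta>. \<integral>\<^sup>+\<beta>. (\<Prod>i\<in>UNIV. ennreal (mvn0_ext (V, block \<theta> i))) * indicator (ball 0 1) (block_avg (\<theta> :: ('m \<times> 'k) vector) + \<beta>) \<partial>lborel \<partial>lborel)"
      by (rule lborel_pair.Fubini') measurable
    also have "\<dots> = (\<integral>\<^sup>+\<theta>. (\<Prod>i\<in>UNIV. ennreal (mvn0_ext (V, block (\<theta> :: ('m \<times> 'k) vector) i))) * ?A \<partial>lborel)"
    proof (rule nn_integral_cong)
      fix \<theta> :: "('m \<times> 'k) vector"
      have "(\<integral>\<^sup>+\<beta>. indicator (ball 0 1) (block_avg \<theta> + \<beta>) \<partial>lborel) = (\<integral>\<^sup>+\<beta>. indicator (ball 0 1) (\<beta> :: 'k vector) \<partial>lborel)"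
        by (rule nn_integral_lborel_translate) measurable
      then have "(\<integral>\<^sup>+\<beta>. indicator (ball 0 1) (block_avg \<theta> + \<beta>) \<partial>lborel) = ?A" by simp
      then show "(\<integral>\<^sup>+\<beta>. (\<Prod>i\<in>UNIV. ennreal (mvn0_ext (V, block \<theta> i))) * indicator (ball 0 1) (block_avg \<theta> + \<beta>) \<partial>lborel)
        = (\<Prod>i\<in>UNIV. ennreal (mvn0_ext (V, block \<theta> i))) * ?A"
        by (simp add: nn_integral_cmult)
    qed
    also have "\<dots> = (\<integral>\<^sup>+\<theta>. (\<Prod>i\<in>UNIV. ennreal (mvn0_ext (V, block (\<theta> :: ('m \<times> 'k) vector) i))) \<partial>lborel) * ?A"
      by (rule nn_integral_multc) measurable
    also have "(\<integral>\<^sup>+\<theta>. (\<Prod>i\<in>UNIV. ennreal (mvn0_ext (V, block (\<theta> :: ('m \<times> 'k) vector) i))) \<partial>lborel) = 1"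
      using nn_integral_blocks_mvn0[of "\<lambda>_ _. 1" V 0] nn_integral_mvn0_ext(1)[OF pd, of 0] by simp
    finally show ?thesis by simp
  qed
  have "(\<integral>\<^sup>+\<theta>. indicator (ball 0 1) (block_avg \<theta>) \<partial>(theta_prior :: ('m \<times> 'k) vector measure))
      = (\<integral>\<^sup>+V. ennreal (prior_ext V) * (\<integral>\<^sup>+\<beta>. \<integral>\<^sup>+\<theta>. (\<Prod>i\<in>UNIV. ennreal (mvn0_ext (V, block \<theta> i - \<beta>))) * indicator (ball 0 1) (block_avg (\<theta> :: ('m \<times> 'k) vector)) \<partial>lborel \<partial>lborel) \<partial>sym_lborel)"
    by (rule nn_integral_theta_prior) measurable
  also have "\<dots> = (\<integral>\<^sup>+V. ennreal (prior_ext V) * ?A \<partial>sym_lborel)"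
    by (intro nn_integral_cong) (auto simp: prior_ext_def inner)
  also have "\<dots> = (\<integral>\<^sup>+V. ennreal (prior_ext V) \<partial>sym_lborel) * ?A"
    by (rule nn_integral_multc) measurable
  also have "(\<integral>\<^sup>+V. ennreal (prior_ext V) \<partial>sym_lborel) = (\<integral>\<^sup>+V. ennreal (prior_ext V * det (mat 1 + V) powr - 0) \<partial>sym_lborel)"
  proof (rule nn_integral_cong)
    fix V :: "'k matrix"
    \<comment> \<open>\<open>powr\<close> with exponent 0 is 1 only at a nonzero base, so the
      determinant must not vanish.\<close>
    have "det (mat 1 + V) \<noteq> 0" if "positive_definite V"
      using det_one_plus_pos[OF that] by simp
    then show "ennreal (prior_ext V) = ennreal (prior_ext V * det (mat 1 + V) powr - 0)" by (simp add: prior_ext_def)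
  qed
  also have "\<dots> * ?A < \<infinity>"
    using nn_integral_prior_finite[of 0] assms A by (simp add: ennreal_mult_less_top)
  finally show ?thesis .
qed

text \<open>The density of one block integrates \<beta> out; each of the other m - 1 blocks
  contributes a factor of order det (I + V)^(-1/2). With s = (m - 1)/2 the condition a2 + s > 1 is
  the hypothesis on a2.\<close>

lemma theta_prior_upper:
  assumes a2: "(3 - real CARD('m)) / 2 < a2"
  obtains K where "\<And>x :: ('m::finite \<times> 'k) vector. (\<integral>\<^sup>+\<theta>. ennreal (exp (- ((norm (x - \<theta>))\<^sup>2 / 8))) \<partial>theta_prior) \<le> ennreal K"
proof -
  obtain j :: 'm where True by simp
  define s where "s = (real CARD('m) - 1) / 2"
  have s: "a2 + s > 1" using a2 by (simp add: s_def field_simps)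
  let ?A = "ennreal (sqrt ((2 * pi / (1 / 4)) ^ CARD('k)))"
  let ?B = "sqrt (5 ^ CARD('k)) ^ (CARD('m) - 1)"
  let ?D = "\<lambda>V :: 'k matrix. det (mat 1 + V)"
  let ?e = "\<lambda>z t :: 'k vector. ennreal (exp (- ((norm (z - t))\<^sup>2 / 8)))"
  have [measurable]: "?D \<in> borel_measurable borel" by (rule det_measurable) simp
  have m1: "CARD('m) - 1 + 1 = CARD('m)" by simp
  have inner: "(\<integral>\<^sup>+\<beta>. \<integral>\<^sup>+\<theta>. (\<Prod>i\<in>UNIV. ennreal (mvn0_ext (V, block \<theta> i - \<beta>))) * ennreal (exp (- ((norm (x - \<theta>))\<^sup>2 / 8))) \<partial>lborel \<partial>lborel)
      \<le> ?A * ennreal (?B * ?D V powr - s)" if pd: "positive_definite V" for V and x :: "('m \<times> 'k) vector"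
  proof -
    let ?J = "\<lambda>\<beta> i. \<integral>\<^sup>+t. ennreal (mvn0_ext (V, t - \<beta>)) * ?e (block x i) t \<partial>lborel"
    let ?q = "sqrt (5 ^ CARD('k) / ?D V)"
    have D: "?D V > 0" by (rule det_one_plus_pos[OF pd])
    have J: "?J \<beta> i \<le> ennreal ?q" for \<beta> i
      using nn_integral_kernel_mvn0_le[OF pd, of "block x i" \<beta>]
      by (simp add: mvn0_ext_pd[OF pd] ennreal_mult'[symmetric] mvn0_nonneg[OF pd] mult.commute)
    have pw: "?q ^ (CARD('m) - 1) = ?B * ?D V powr - s"
    proof -
      have "sqrt (?D V) ^ (CARD('m) - 1) = ?D V powr s"
        using D m1 unfolding s_def
        by (simp add: powr_half_sqrt[symmetric] powr_realpow[symmetric] powr_powr of_nat_diff)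
      then show ?thesis by (simp add: real_sqrt_divide power_divide powr_minus_divide)
    qed
    have "ennreal (exp (- ((norm (x - \<theta>))\<^sup>2 / 8))) = (\<Prod>i\<in>UNIV. ?e (block x i) (block \<theta> i))" for \<theta>
      by (simp add: power2_norm_block[of "x - \<theta>"] block_diff exp_sum[symmetric] sum_negf sum_divide_distrib prod_ennreal)
    then have "(\<integral>\<^sup>+\<theta>. (\<Prod>i\<in>UNIV. ennreal (mvn0_ext (V, block \<theta> i - \<beta>))) * ennreal (exp (- ((norm (x - \<theta>))\<^sup>2 / 8))) \<partial>lborel) = (\<Prod>i\<in>UNIV. ?J \<beta> i)" for \<beta>
      using nn_integral_blocks_mvn0[of "\<lambda>i. ?e (block x i)" V \<beta>] by simp
    moreover have "(\<Prod>i\<in>UNIV. ?J \<beta> i) \<le> ?J \<beta> j * ennreal ?q ^ (CARD('m) - 1)" for \<beta>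
      by (rule prod_ennreal_le_remove) (rule J)
    ultimately have "(\<integral>\<^sup>+\<beta>. \<integral>\<^sup>+\<theta>. (\<Prod>i\<in>UNIV. ennreal (mvn0_ext (V, block \<theta> i - \<beta>))) * ennreal (exp (- ((norm (x - \<theta>))\<^sup>2 / 8))) \<partial>lborel \<partial>lborel)
      \<le> (\<integral>\<^sup>+\<beta>. ?J \<beta> j * ennreal ?q ^ (CARD('m) - 1) \<partial>lborel)"
      by (intro nn_integral_mono) simp
    also have "\<dots> = (\<integral>\<^sup>+\<beta>. ?J \<beta> j \<partial>lborel) * ennreal ?q ^ (CARD('m) - 1)"
      by (rule nn_integral_multc) measurable
    also have "(\<integral>\<^sup>+\<beta>. ?J \<beta> j \<partial>lborel) = (\<integral>\<^sup>+t. \<integral>\<^sup>+\<beta>. ennreal (mvn0_ext (V, t - \<beta>)) * ?e (block x j) t \<partial>lborel \<partial>lborel)"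
      by (rule lborel_pair.Fubini') measurable
    also have "\<dots> = (\<integral>\<^sup>+t. ?e (block x j) t \<partial>lborel)"
      by (simp add: nn_integral_multc nn_integral_mvn0_ext(2)[OF pd])
    also have "\<dots> = (\<integral>\<^sup>+t. ennreal (exp (- (1 / 4 * (norm (t :: 'k vector))\<^sup>2 / 2))) \<partial>lborel)"
      using nn_integral_lborel_reflect[of "\<lambda>t. ennreal (exp (- ((norm (t :: 'k vector))\<^sup>2 / 8)))" "block x j"] by simp
    also have "\<dots> = ?A" by (rule nn_integral_gauss_scale) simp
    also have "ennreal ?q ^ (CARD('m) - 1) = ennreal (?B * ?D V powr - s)"
      using D by (simp only: pw[symmetric] ennreal_power real_sqrt_ge_zero divide_nonneg_pos zero_le_power zero_le_numeral)
    finally show ?thesis .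
  qed
  let ?I = "\<integral>\<^sup>+V. ennreal (prior_ext V * ?D V powr - s) \<partial>sym_lborel"
  have le: "(\<integral>\<^sup>+\<theta>. ennreal (exp (- ((norm (x - \<theta>))\<^sup>2 / 8))) \<partial>theta_prior) \<le> ?A * ennreal ?B * ?I" for x :: "('m \<times> 'k) vector"
  proof -
    have "(\<integral>\<^sup>+\<theta>. ennreal (exp (- ((norm (x - \<theta>))\<^sup>2 / 8))) \<partial>theta_prior) = (\<integral>\<^sup>+V. ennreal (prior_ext V) * (\<integral>\<^sup>+\<beta>. \<integral>\<^sup>+\<theta>. (\<Prod>i\<in>UNIV. ennreal (mvn0_ext (V, block \<theta> i - \<beta>))) * ennreal (exp (- ((norm (x - \<theta>))\<^sup>2 / 8))) \<partial>lborel \<partial>lborel) \<partial>sym_lborel)"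
      by (rule nn_integral_theta_prior) measurable
    also have "\<dots> \<le> (\<integral>\<^sup>+V. ennreal (prior_ext V) * (?A * ennreal (?B * ?D V powr - s)) \<partial>sym_lborel)"
    proof (rule nn_integral_mono)
      fix V :: "'k matrix"
      show "ennreal (prior_ext V) * (\<integral>\<^sup>+\<beta>. \<integral>\<^sup>+\<theta>. (\<Prod>i\<in>UNIV. ennreal (mvn0_ext (V, block \<theta> i - \<beta>))) * ennreal (exp (- ((norm (x - \<theta>))\<^sup>2 / 8))) \<partial>lborel \<partial>lborel)
        \<le> ennreal (prior_ext V) * (?A * ennreal (?B * ?D V powr - s))"
      proof (cases "positive_definite V")
        case True
        then show ?thesis by (intro mult_left_mono inner) simp_all
      qed (simp add: prior_ext_def)
    qed
    also have "\<dots> = (\<integral>\<^sup>+V. ?A * ennreal ?B * ennreal (prior_ext V * ?D V powr - s) \<partial>sym_lborel)"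
      by (intro nn_integral_cong) (simp add: ennreal_mult prior_ext_nonneg mult_ac)
    also have "\<dots> = ?A * ennreal ?B * ?I" by (rule nn_integral_cmult) measurable
    finally show ?thesis .
  qed
  have "?A * ennreal ?B * ?I < top"
    using nn_integral_prior_finite[OF s] by (simp add: ennreal_mult_less_top)
  then obtain K where "?A * ennreal ?B * ?I = ennreal K" by (rule less_top_ennreal[THEN iffD1, THEN exE]) blast
  then show ?thesis using le by (intro that[of K]) (simp only:)
qed

text \<open>The Gaussian kernel is bounded below on a ball, so the upper bound on its integral
  limits the mass of the ball.\<close>

lemma sigma_finite_theta_prior:
  assumes a2: "(3 - real CARD('m)) / 2 < a2"
  shows "sigma_finite_measure (theta_prior :: ('m::finite \<times> 'k) vector measure)"
proof (rule sigma_finite_measure.intro)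
  obtain K where K: "\<And>x :: ('m \<times> 'k) vector. (\<integral>\<^sup>+\<theta>. ennreal (exp (- ((norm (x - \<theta>))\<^sup>2 / 8))) \<partial>theta_prior) \<le> ennreal K"
    using theta_prior_upper[OF a2] by blast
  let ?A = "range (\<lambda>n. cball (0 :: ('m \<times> 'k) vector) (real n))"
  have "emeasure theta_prior (cball (0 :: ('m \<times> 'k) vector) r) \<noteq> \<infinity>" for r
  proof -
    have "emeasure theta_prior (cball (0 :: ('m \<times> 'k) vector) r) = (\<integral>\<^sup>+\<theta>. indicator (cball 0 r) (\<theta> :: ('m \<times> 'k) vector) \<partial>theta_prior)" by simp
    also have "\<dots> \<le> (\<integral>\<^sup>+\<theta>. ennreal (exp (r\<^sup>2 / 8)) * ennreal (exp (- ((norm (0 - \<theta> :: ('m \<times> 'k) vector))\<^sup>2 / 8))) \<partial>theta_prior)"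
    proof (intro nn_integral_mono)
      fix \<theta> :: "('m \<times> 'k) vector"
      have "1 \<le> exp (r\<^sup>2 / 8) * exp (- ((norm (0 - \<theta>))\<^sup>2 / 8))" if "norm \<theta> \<le> r"
        using power_mono[OF that, of 2] by (simp flip: exp_add)
      then show "indicator (cball 0 r) \<theta> \<le> ennreal (exp (r\<^sup>2 / 8)) * ennreal (exp (- ((norm (0 - \<theta>))\<^sup>2 / 8)))"
        by (auto simp: indicator_def ennreal_mult[symmetric] simp flip: ennreal_1 intro!: ennreal_leI)
    qed
    also have "\<dots> = ennreal (exp (r\<^sup>2 / 8)) * (\<integral>\<^sup>+\<theta>. ennreal (exp (- ((norm (0 - \<theta> :: ('m \<times> 'k) vector))\<^sup>2 / 8))) \<partial>theta_prior)"
      by (rule nn_integral_cmult) measurable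
    also have "\<dots> \<le> ennreal (exp (r\<^sup>2 / 8)) * ennreal K" by (intro mult_left_mono K) simp
    also have "\<dots> < \<infinity>" by (simp add: ennreal_mult_less_top)
    finally show ?thesis by simp
  qed
  moreover have "\<Union>?A = UNIV" by (auto intro: real_arch_simple)
  ultimately show "\<exists>A. countable A \<and> A \<subseteq> sets theta_prior \<and> \<Union>A = space (theta_prior :: ('m \<times> 'k) vector measure) \<and> (\<forall>a\<in>A. emeasure theta_prior a \<noteq> \<infinity>)"
    by (intro exI[of _ ?A]) (auto simp: sets_eq_imp_space_eq[OF sets_theta_prior])
qed

text \<open>The bound on the density in (H, d) has order r^(-k a2), and each of the k(k - 1)/2 gaps
  is at most r, so dividing by their product leaves at least the stated power. The bases 3 and 2 in
  M come from 1 + d <= 3r and d <= 2r.\<close>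

lemma prior_ext_lower:
  assumes H: "orthogonal_matrix H" and srt: "\<forall>i j. i < j \<longrightarrow> d $ i > d $ j"
    and r: "r \<ge> 1" and lo: "\<And>i. r \<le> d $ i" and hi: "\<And>i. d $ i \<le> 2 * r"
  defines "M \<equiv> 3 powr \<bar>a2 - a1\<bar> * 2 powr \<bar>a1\<bar>"
  shows "C1 / (M ^ CARD('k) * r powr (real CARD('k) * a2) * r ^ card {(i :: 'k, j). i < j})
    \<le> prior_ext (transpose H ** diag d ** H)"
proof -
  let ?P = "\<Prod>i\<in>UNIV. (1 + d $ i) powr (a2 - a1) * (d $ i) powr a1" and ?J = "\<Prod>(i, j) | i < j. d $ i - d $ j"
  have pos: "d $ i > 0" for i using lo[of i] r by simp
  have pd: "positive_definite (transpose H ** diag d ** H)" using positive_definite_conj_iff[OF H] pos by simp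
  have P0: "?P > 0"
  proof (rule prod_pos)
    fix i show "0 < (1 + d $ i) powr (a2 - a1) * d $ i powr a1" using pos[of i] by simp
  qed
  have J0: "?J > 0" using srt by (intro prod_pos) auto
  have "?P \<le> (\<Prod>i\<in>(UNIV :: 'k set). M * r powr a2)"
  proof (rule prod_mono, intro conjI)
    fix i
    show "0 \<le> (1 + d $ i) powr (a2 - a1) * (d $ i) powr a1" by simp
    have "(1 + d $ i) powr (a2 - a1) * (d $ i) powr a1 \<le> (3 powr \<bar>a2 - a1\<bar> * r powr (a2 - a1)) * (2 powr \<bar>a1\<bar> * r powr a1)"
      using r lo[of i] hi[of i] by (intro mult_mono powr_comparable) auto
    also have "\<dots> = M * (r powr (a2 - a1) * r powr a1)" by (simp add: M_def mult_ac)
    also have "r powr (a2 - a1) * r powr a1 = r powr a2" by (simp add: powr_add[symmetric])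
    finally show "(1 + d $ i) powr (a2 - a1) * (d $ i) powr a1 \<le> M * r powr a2" .
  qed
  also have "\<dots> = M ^ CARD('k) * r powr (real CARD('k) * a2)"
    using r by (simp add: power_mult_distrib powr_power mult.commute)
  finally have P: "?P \<le> M ^ CARD('k) * r powr (real CARD('k) * a2)" .
  have "?J \<le> (\<Prod>(i :: 'k, j) | i < j. r)"
  proof (rule prod_mono)
    fix p :: "'k \<times> 'k" assume "p \<in> {(i, j). i < j}"
    then obtain i j where p: "p = (i, j)" "i < j" by auto
    have "0 \<le> d $ i - d $ j" using srt p(2) by (simp add: less_imp_le)
    then show "0 \<le> (case p of (i, j) \<Rightarrow> d $ i - d $ j) \<and> (case p of (i, j) \<Rightarrow> d $ i - d $ j) \<le> (case p of (i, j) \<Rightarrow> r)"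
      using lo[of j] hi[of i] by (simp add: p(1))
  qed
  also have "\<dots> = r ^ card {(i :: 'k, j). i < j}" by (simp add: case_prod_unfold)
  finally have J: "?J \<le> r ^ card {(i :: 'k, j). i < j}" .
  have "C1 / (M ^ CARD('k) * r powr (real CARD('k) * a2) * r ^ card {(i :: 'k, j). i < j}) \<le> C1 / (?P * ?J)"
    using C P J P0 J0 by (intro divide_left_mono mult_mono mult_pos_pos) (auto simp: M_def intro: less_imp_le)
  also have "\<dots> = C1 / ?P / ?J" by simp
  finally have le: "C1 / (M ^ CARD('k) * r powr (real CARD('k) * a2) * r ^ card {(i :: 'k, j). i < j}) \<le> C1 / ?P / ?J" .
  have "C1 / ?P \<le> prior_ext (transpose H ** diag d ** H) * ?J"
    using prior_bounds[OF H srt] prior_density_eq[of d] pos pd by (simp add: prior_HD_def prior_ext_def)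
  then have "C1 / ?P / ?J \<le> prior_ext (transpose H ** diag d ** H)" by (simp only: pos_divide_le_eq[OF J0])
  then show ?thesis by (rule order_trans[OF le])
qed

text \<open>Only \<theta> in the unit ball around x and \<beta> in the ball of radius sqrt r are
  kept. There |\<theta>_i - \<beta>|^2 <= 2 (2r) + 2r = 6r, a bounded number of standard deviations,
  so each of the m densities has order r^(-k/2).\<close>

lemma inner_lower:
  fixes x :: "('m::finite \<times> 'k) vector" and V :: "'k matrix"
  defines "r \<equiv> 1 + (norm x)\<^sup>2"
  defines "U \<equiv> unit_ball_vol (real CARD('k)) * unit_ball_vol (real CARD('m \<times> 'k))"
  assumes V: "positive_definite V"
    and q: "\<And>u. r * (norm u)\<^sup>2 \<le> u \<bullet> (V *v u) \<and> u \<bullet> (V *v u) \<le> 2 * r * (norm u)\<^sup>2"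
  shows "ennreal (U * exp (- (1 / 2)) * sqrt (r ^ CARD('k)) * (exp (- 3) / sqrt ((4 * pi * r) ^ CARD('k))) ^ CARD('m))
    \<le> (\<integral>\<^sup>+\<beta>. \<integral>\<^sup>+\<theta>. (\<Prod>i\<in>UNIV. ennreal (mvn0_ext (V, block \<theta> i - \<beta>))) * ennreal (gauss (x - \<theta>)) \<partial>lborel \<partial>lborel)"
proof -
  have r: "r \<ge> 1" by (simp add: r_def)
  let ?c = "(exp (- 3) / sqrt ((4 * pi * r) ^ CARD('k))) ^ CARD('m) * exp (- (1 / 2))"
  let ?u = "unit_ball_vol (real CARD('m \<times> 'k))" and ?w = "unit_ball_vol (real CARD('k)) * sqrt r ^ CARD('k)"
  have c0: "?c \<ge> 0" using r by simp
  have pt: "?c \<le> (\<Prod>i\<in>UNIV. mvn0_ext (V, block \<theta> i - \<beta>)) * gauss (x - \<theta>)"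
    if \<theta>: "\<theta> \<in> cball x 1" and \<beta>: "\<beta> \<in> cball 0 (sqrt r)" for \<theta> \<beta>
  proof -
    have "norm \<theta> \<le> norm x + norm (\<theta> - x)" using norm_triangle_ineq[of x "\<theta> - x"] by simp
    then have "norm \<theta> \<le> norm x + 1" using \<theta> by (simp add: dist_norm norm_minus_commute)
    then have "(norm \<theta>)\<^sup>2 \<le> (norm x + 1)\<^sup>2" by (rule power_mono) simp
    also have "\<dots> \<le> 2 * r" using sum_squares_bound[of "norm x" 1] by (simp add: r_def power2_sum)
    finally have t: "(norm \<theta>)\<^sup>2 \<le> 2 * r" .
    have b: "(norm \<beta>)\<^sup>2 \<le> r" using \<beta> r power_mono[of "norm \<beta>" "sqrt r" 2] by simp
    have "(norm (block \<theta> i - \<beta>))\<^sup>2 \<le> 6 * r" for i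
    proof -
      have "norm (block \<theta> i - \<beta>) \<le> norm (block \<theta> i) + norm \<beta>" by (rule norm_triangle_ineq4)
      then have "(norm (block \<theta> i - \<beta>))\<^sup>2 \<le> (norm (block \<theta> i) + norm \<beta>)\<^sup>2" by (rule power_mono) simp
      also have "\<dots> \<le> 2 * (norm (block \<theta> i))\<^sup>2 + 2 * (norm \<beta>)\<^sup>2"
        using sum_squares_bound[of "norm (block \<theta> i)" "norm \<beta>"] by (simp add: power2_sum)
      also have "\<dots> \<le> 2 * (2 * r) + 2 * r"
        using order_trans[OF power_mono[OF norm_block_le[of \<theta> i] norm_ge_zero] t] b by (intro add_mono mult_left_mono) simp_all
      finally show ?thesis by simp
    qed
    then have "exp (- 3) / sqrt ((4 * pi * r) ^ CARD('k)) \<le> mvn0_ext (V, block \<theta> i - \<beta>)" for i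
      unfolding mvn0_ext_pd[OF V] using r by (intro mvn0_lower[OF _ V q]) auto
    then have "(\<Prod>i\<in>(UNIV :: 'm set). exp (- 3) / sqrt ((4 * pi * r) ^ CARD('k))) \<le> (\<Prod>i\<in>UNIV. mvn0_ext (V, block \<theta> i - \<beta>))"
      using r by (intro prod_mono) auto
    moreover have "exp (- (1 / 2)) \<le> gauss (x - \<theta>)"
      using \<theta> power_mono[of "norm (x - \<theta>)" 1 2] by (simp add: gauss_def dist_norm)
    ultimately show ?thesis using r by (intro mult_mono prod_nonneg mvn0_ext_nonneg) auto
  qed
  have "(\<integral>\<^sup>+\<beta>. \<integral>\<^sup>+\<theta>. ennreal ?c * indicator (cball 0 (sqrt r)) (\<beta> :: 'k vector) * indicator (cball x 1) \<theta> \<partial>lborel \<partial>lborel)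
      \<le> (\<integral>\<^sup>+\<beta>. \<integral>\<^sup>+\<theta>. (\<Prod>i\<in>UNIV. ennreal (mvn0_ext (V, block \<theta> i - \<beta>))) * ennreal (gauss (x - \<theta>)) \<partial>lborel \<partial>lborel)"
  proof (intro nn_integral_mono)
    fix \<beta> \<theta>
    have "(\<Prod>i\<in>UNIV. ennreal (mvn0_ext (V, block \<theta> i - \<beta>))) * ennreal (gauss (x - \<theta>)) = ennreal ((\<Prod>i\<in>UNIV. mvn0_ext (V, block \<theta> i - \<beta>)) * gauss (x - \<theta>))"
      by (simp add: prod_ennreal mvn0_ext_nonneg ennreal_mult prod_nonneg gauss_nonneg)
    then show "ennreal ?c * indicator (cball 0 (sqrt r)) \<beta> * indicator (cball x 1) \<theta> \<le> (\<Prod>i\<in>UNIV. ennreal (mvn0_ext (V, block \<theta> i - \<beta>))) * ennreal (gauss (x - \<theta>))"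
      using ennreal_leI[OF pt, of \<theta> \<beta>] by (cases "\<theta> \<in> cball x 1"; cases "\<beta> \<in> cball 0 (sqrt r)") (simp_all del: mem_cball)
  qed
  also have "(\<integral>\<^sup>+\<beta>. \<integral>\<^sup>+\<theta>. ennreal ?c * indicator (cball 0 (sqrt r)) (\<beta> :: 'k vector) * indicator (cball x 1) \<theta> \<partial>lborel \<partial>lborel)
      = ennreal ?c * ennreal ?w * ennreal ?u"
  proof -
    have 1: "(\<integral>\<^sup>+\<theta>. ennreal ?c * indicator (cball 0 (sqrt r)) (\<beta> :: 'k vector) * indicator (cball x 1) \<theta> \<partial>lborel)
        = ennreal ?c * indicator (cball 0 (sqrt r)) \<beta> * emeasure lborel (cball x 1)" for \<beta>
      by (rule nn_integral_cmult_indicator) simp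
    have "(\<integral>\<^sup>+\<beta>. ennreal ?c * indicator (cball 0 (sqrt r)) (\<beta> :: 'k vector) * emeasure lborel (cball x 1) \<partial>lborel)
        = ennreal ?c * emeasure lborel (cball (0 :: 'k vector) (sqrt r)) * emeasure lborel (cball x 1)"
      (is "?l = _")
    proof -
      have "?l = (\<integral>\<^sup>+\<beta>. ennreal ?c * indicator (cball 0 (sqrt r)) (\<beta> :: 'k vector) \<partial>lborel) * emeasure lborel (cball x 1)"
        by (rule nn_integral_multc) (intro borel_measurable_times_ennreal borel_measurable_indicator borel_measurable_const, simp)
      also have "(\<integral>\<^sup>+\<beta>. ennreal ?c * indicator (cball 0 (sqrt r)) (\<beta> :: 'k vector) \<partial>lborel) = ennreal ?c * emeasure lborel (cball (0 :: 'k vector) (sqrt r))"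
        by (rule nn_integral_cmult_indicator) simp
      finally show ?thesis .
    qed
    then show ?thesis unfolding 1 using r by (simp add: emeasure_cball)
  qed
  also have "\<dots> = ennreal (?c * ?w * ?u)"
    using c0 r by (simp add: ennreal_mult)
  also have "?c * ?w * ?u = U * exp (- (1 / 2)) * sqrt (r ^ CARD('k)) * (exp (- 3) / sqrt ((4 * pi * r) ^ CARD('k))) ^ CARD('m)"
    by (simp only: U_def real_sqrt_power mult_ac)
  finally show ?thesis .
qed

text \<open>With N = k(k - 1)/2, count powers of r = 1 + |x|^2: the box of matrices has volume r^(k
  + N), the prior of V is at least of order r^(-k a2 - N), the ball of \<beta> gives r^(k/2) and the
  m densities r^(-mk/2). N cancels and the sum of the exponents is -\<kappa>.\<close>

lemma theta_prior_lower:
  defines "\<kappa> \<equiv> real CARD('k) * (real CARD('m) - 3 + 2 * a2) / 2"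
  obtains c where "c > 0"
    "\<And>x :: ('m::finite \<times> 'k) vector. ennreal (c * (1 + (norm x)\<^sup>2) powr - \<kappa>) \<le> (\<integral>\<^sup>+\<theta>. ennreal (gauss (x - \<theta>)) \<partial>theta_prior)"
proof -
  let ?k = "real CARD('k)" and ?N = "card {(i :: 'k, j). i < j}" and ?m = "real CARD('m)"
  let ?M = "3 powr \<bar>a2 - a1\<bar> * 2 powr \<bar>a1\<bar> :: real"
  let ?U = "unit_ball_vol (real CARD('k)) * unit_ball_vol (real CARD('m \<times> 'k))"
  let ?E = "exp (- 3) / sqrt ((4 * pi) ^ CARD('k))"
  define c where "c = C1 / ?M ^ CARD('k) * (?U * exp (- (1 / 2)) * ?E ^ CARD('m)) / ?k ^ (CARD('k) + ?N)"
  obtain Z :: "'k sym_coords set" where Z: "negligible Z"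
    and distinct: "\<And>Y. positive_definite (sym_of Y) \<Longrightarrow> Y \<notin> Z \<Longrightarrow>
        \<exists>H d. orthogonal_matrix H \<and> (\<forall>i j. i < j \<longrightarrow> d $ j < d $ i) \<and> (\<forall>i. d $ i > 0) \<and>
           sym_of Y = transpose H ** diag d ** H"
    using AE_sym_lborel_distinct by blast
  have c: "c > 0" using C by (simp add: c_def)
  moreover have "ennreal (c * (1 + (norm x)\<^sup>2) powr - \<kappa>) \<le> (\<integral>\<^sup>+\<theta>. ennreal (gauss (x - \<theta>)) \<partial>theta_prior)" for x :: "('m \<times> 'k) vector"
  proof -
    define r where "r = 1 + (norm x)\<^sup>2"
    have r: "r \<ge> 1" by (simp add: r_def)
    let ?p = "C1 / (?M ^ CARD('k) * r powr (?k * a2) * r ^ ?N)"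
    let ?e = "?U * exp (- (1 / 2)) * sqrt (r ^ CARD('k)) * (exp (- 3) / sqrt ((4 * pi * r) ^ CARD('k))) ^ CARD('m)"
    let ?I = "\<lambda>V. \<integral>\<^sup>+\<beta>. \<integral>\<^sup>+\<theta>. (\<Prod>i\<in>UNIV. ennreal (mvn0_ext (V, block \<theta> i - \<beta>))) * ennreal (gauss (x - \<theta>)) \<partial>lborel \<partial>lborel"
    \<comment> \<open>Coordinates of the matrix (3r/2) I.\<close>
    define Y :: "'k sym_coords" where "Y = (\<chi> n. if fst (tri_entry n) = snd (tri_entry n) then 3 / 2 * r else 0)"
    \<comment> \<open>The half-width is the tolerance of \<open>quadratic_near_scalar\<close>, so
      the whole box has eigenvalues between r and 2r.\<close>
    define h where "h = r / (2 * ?k)"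
    have h: "h > 0" using r by (simp add: h_def)
    let ?B = "cbox (\<chi> n. Y $ n - h) (\<chi> n. Y $ n + h)"
    have q: "r * (norm u)\<^sup>2 \<le> u \<bullet> (sym_of X *v u) \<and> u \<bullet> (sym_of X *v u) \<le> 2 * r * (norm u)\<^sup>2"
      if X: "X \<in> ?B" for X u
    proof (rule quadratic_near_scalar)
      fix i j :: 'k
      let ?n = "tri_index (min i j) (max i j)"
      have "Y $ ?n = (if i = j then 3 / 2 * r else 0)"
        by (simp add: Y_def tri_entry_tri_index min_def max_def)
      moreover have "Y $ ?n - h \<le> X $ ?n" "X $ ?n \<le> Y $ ?n + h" using X by (simp_all add: mem_box_cart)
      then have "\<bar>X $ ?n - Y $ ?n\<bar> \<le> h" unfolding abs_le_iff by linarith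
      ultimately show "\<bar>sym_of X $ i $ j - (if i = j then 3 / 2 * r else 0)\<bar> \<le> r / (2 * ?k)"
        by (simp add: sym_of_def h_def)
    qed
    have pd: "positive_definite (sym_of X)" if X: "X \<in> ?B" for X
    proof -
      have "0 < u \<bullet> (sym_of X *v u)" if "u \<noteq> 0" for u
        by (rule less_le_trans[OF _ conjunct1[OF q[OF X]]]) (use that r in simp)
      then show ?thesis by (simp add: positive_definite_def transpose_sym_of)
    qed
    \<comment> \<open>Off the null set Z the eigenvalues are distinct, as the hypothesis on the
      prior demands.\<close>
    have pX: "?p \<le> prior_ext (sym_of X)" if X: "X \<in> ?B" "X \<notin> Z" for X
    proof -
      obtain H d where H: "orthogonal_matrix H" and srt: "\<forall>i j. i < j \<longrightarrow> d $ j < d $ i"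
        and VH: "sym_of X = transpose H ** diag d ** H"
        using distinct[OF pd[OF X(1)] X(2)] by blast
      show ?thesis unfolding VH
        by (rule prior_ext_lower[OF H srt r]) (use diag_bounds_of_quadratic[OF H VH q[OF X(1)]] in auto)
    qed
    have vol: "emeasure lborel ?B = ennreal ((r / ?k) ^ (CARD('k) + ?N))"
    proof -
      have ne: "?B \<noteq> {}" using h by (auto simp: interval_ne_empty_cart)
      have "measure lborel ?B = (\<Prod>n\<in>(UNIV :: 'k tri_ix enum_ix set). r / ?k)"
        unfolding content_cbox_cart[OF ne] by (simp add: h_def)
      also have "\<dots> = (\<Prod>i\<in>(UNIV :: 'k set). r / ?k) * (\<Prod>(i :: 'k, j) | i < j. r / ?k)"
        using prod_sym_coords[of "\<lambda>_. r / ?k"] by simp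
      also have "\<dots> = (r / ?k) ^ (CARD('k) + ?N)" by (simp add: case_prod_unfold power_add)
      finally have "measure lborel ?B = (r / ?k) ^ (CARD('k) + ?N)" .
      then show ?thesis by (metis emeasure_eq_ennreal_measure emeasure_lborel_cbox_finite less_irrefl infinity_ennreal_def)
    qed
    have rp: "r > 0" using r by simp
    have pow: "(r / ?k) ^ (CARD('k) + ?N) * ?p * ?e = c * r powr - \<kappa>"
    proof -
      have 1: "sqrt (r ^ n) = r powr (real n / 2)" for n
        using rp by (simp add: powr_half_sqrt[symmetric] powr_realpow[symmetric] powr_powr)
      have "(exp (- 3) / sqrt ((4 * pi * r) ^ CARD('k))) ^ CARD('m) = ?E ^ CARD('m) / sqrt (r ^ CARD('k)) ^ CARD('m)"
        by (simp add: power_mult_distrib real_sqrt_mult power_divide)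
      also have "sqrt (r ^ CARD('k)) ^ CARD('m) = r powr (?m * ?k / 2)"
        using rp by (simp add: 1 powr_power mult.commute)
      finally have e: "?e = ?U * exp (- (1 / 2)) * ?E ^ CARD('m) * (r powr (?k / 2) / r powr (?m * ?k / 2))"
        by (simp add: 1)
      have p: "(r / ?k) ^ (CARD('k) + ?N) * ?p = C1 / ?M ^ CARD('k) / ?k ^ (CARD('k) + ?N) * (r ^ CARD('k) / r powr (?k * a2))"
        using rp by (simp add: power_divide power_add mult_ac)
      have r: "r ^ CARD('k) / r powr (?k * a2) * (r powr (?k / 2) / r powr (?m * ?k / 2)) = r powr - \<kappa>"
      proof -
        have "- \<kappa> = ?k - ?k * a2 + (?k / 2 - ?m * ?k / 2)" by (simp add: \<kappa>_def field_simps)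
        then show ?thesis by (simp only: powr_add powr_diff powr_realpow[OF rp, symmetric])
      qed
      have c: "c = C1 / ?M ^ CARD('k) / ?k ^ (CARD('k) + ?N) * (?U * exp (- (1 / 2)) * ?E ^ CARD('m))"
        by (simp add: c_def)
      have "(a * b) * (u * v) = (a * u) * (b * v)" for a b u v :: real by simp
      then show ?thesis unfolding e p c r[symmetric] by blast
    qed
    have p0: "?p \<ge> 0" and e0: "?e \<ge> 0" using C r by simp_all
    have [measurable]: "(\<lambda>V. ennreal (prior_ext V) * ?I V) \<in> borel_measurable borel" by measurable
    have "ennreal (c * r powr - \<kappa>) = emeasure lborel ?B * (ennreal ?p * ennreal ?e)"
    proof -
      have "ennreal (a * b * d) = ennreal a * (ennreal b * ennreal d)" if "0 \<le> a" "0 \<le> b" "0 \<le> d" for a b d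
        using that by (simp add: ennreal_mult mult.assoc)
      moreover have "0 \<le> (r / ?k) ^ (CARD('k) + ?N)" using r by simp
      ultimately show ?thesis unfolding pow[symmetric] vol using p0 e0 by blast
    qed
    also have "\<dots> = (\<integral>\<^sup>+X. indicator ?B X * (ennreal ?p * ennreal ?e) \<partial>lborel)"
      by (subst nn_integral_multc) simp_all
    also have "\<dots> \<le> (\<integral>\<^sup>+X. ennreal (prior_ext (sym_of X)) * ?I (sym_of X) \<partial>lborel)"
    proof (rule nn_integral_mono_AE)
      have "AE X in lebesgue. X \<notin> Z"
        using Z by (simp add: AE_iff_null_sets negligible_iff_null_sets AE_not_in)
      then have "AE X in lborel. X \<notin> Z" by (simp add: AE_completion_iff)
      then show "AE X in lborel. indicator ?B X * (ennreal ?p * ennreal ?e) \<le> ennreal (prior_ext (sym_of X)) * ?I (sym_of X)"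
      proof eventually_elim
        fix X assume "X \<notin> Z"
        then show "indicator ?B X * (ennreal ?p * ennreal ?e) \<le> ennreal (prior_ext (sym_of X)) * ?I (sym_of X)"
          using mult_mono[OF ennreal_leI[OF pX] inner_lower[OF pd, of X x]] q[of X] unfolding r_def
          by (cases "X \<in> ?B") (auto simp: r_def)
      qed
    qed
    also have "\<dots> = (\<integral>\<^sup>+V. ennreal (prior_ext V) * ?I V \<partial>sym_lborel)"
      by (rule nn_integral_sym_lborel[symmetric]) measurable
    also have "\<dots> = (\<integral>\<^sup>+\<theta>. ennreal (gauss (x - \<theta>)) \<partial>theta_prior)"
      by (rule nn_integral_theta_prior[symmetric]) measurable
    finally show ?thesis by (simp add: r_def)
  qed
  ultimately show ?thesis by (rule that)
qed

section \<open>Identification of the posterior mean\<close>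

text \<open>The constants of the sampling densities cancel between \<open>joint_density\<close> and
  \<open>marginal_density\<close>; the integrand depends on the parameters through \<theta> alone,
  so the integrals over the parameter space are integrals against
  \<open>theta_prior\<close>.\<close>

lemma posterior_mean_theta_prior:
  fixes x :: "('m::finite \<times> 'k) vector"
  assumes M: "(\<integral>\<^sup>+\<theta>. ennreal (gauss (x - \<theta>)) \<partial>theta_prior) = ennreal M" "M > 0"
  shows "posterior_mean (\<lambda>\<beta>. 1) prior_V x = (1 / M) *\<^sub>R (\<integral>\<theta>. gauss (x - \<theta>) *\<^sub>R \<theta> \<partial>theta_prior)"
proof -
  define c where "c = (1 / sqrt ((2 * pi) ^ CARD('k))) ^ CARD('m)"
  have c: "c > 0" by (simp add: c_def)
  have joint: "joint_density (\<lambda>\<beta>. 1) prior_V x z = c * (gauss (x - fst z) * theta_density z)" for z :: "('m \<times> 'k) vector \<times> 'k vector \<times> 'k matrix"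
  proof -
    obtain \<theta> \<beta> V where z: "z = (\<theta>, \<beta>, V)" by (cases z)
    have id: "mvn_density (block \<theta> i) (mat 1) (block x i) = (1 / sqrt ((2 * pi) ^ CARD('k))) * gauss (block x i - block \<theta> i)" for i
      by (simp add: mvn_density_def matrix_inv_mat_1 gauss_def power2_norm_eq_inner)
    have "gauss (x - \<theta>) = (\<Prod>i\<in>UNIV. gauss (block x i - block \<theta> i))"
      by (subst gauss_block) (simp add: block_diff)
    then have "(\<Prod>i\<in>UNIV. mvn_density (block \<theta> i) (mat 1) (block x i)) = c * gauss (x - \<theta>)"
      by (simp only: id prod.distrib) (simp add: c_def)
    then show ?thesis
      by (simp add: z joint_density_def theta_density_def prod.distrib mvn_density_mvn0 prior_ext_def mvn0_ext_def)
  qed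
  have [measurable]: "fst \<in> param_measure \<rightarrow>\<^sub>M (borel :: ('m \<times> 'k) vector measure)" by simp
  have "marginal_density (\<lambda>\<beta>. 1) prior_V x = (\<integral>\<^sup>+z. ennreal c * (ennreal (theta_density z) * ennreal (gauss (x - fst z))) \<partial>param_measure)"
    unfolding marginal_density_def joint using c
    by (intro nn_integral_cong) (simp add: ennreal_mult gauss_nonneg theta_density_nonneg mult.commute)
  also have "\<dots> = ennreal c * (\<integral>\<^sup>+z. ennreal (theta_density z) * ennreal (gauss (x - fst z)) \<partial>param_measure)"
    by (rule nn_integral_cmult) measurable
  also have "(\<integral>\<^sup>+z. ennreal (theta_density z) * ennreal (gauss (x - fst z)) \<partial>param_measure) = ennreal M"
    unfolding M(1)[symmetric] theta_prior_def by (subst nn_integral_distr, simp, simp, subst nn_integral_density) simp_all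
  finally have marg: "marginal_density (\<lambda>\<beta>. 1) prior_V x = ennreal (c * M)" using c M(2) by (simp add: ennreal_mult)
  have "posterior (\<lambda>\<beta>. 1) prior_V x = density param_measure (\<lambda>z. ennreal (gauss (x - fst z) * theta_density z / M))"
    unfolding posterior_def marg joint using c M(2)
    by (simp add: divide_ennreal gauss_nonneg theta_density_nonneg)
  then have "posterior_mean (\<lambda>\<beta>. 1) prior_V x = (\<integral>z. (gauss (x - fst z) * theta_density z / M) *\<^sub>R fst z \<partial>param_measure)"
    unfolding posterior_mean_def using M(2)
    by (simp add: integral_density gauss_nonneg theta_density_nonneg)
  also have "\<dots> = (\<integral>z. (1 / M) *\<^sub>R (theta_density z *\<^sub>R (gauss (x - fst z) *\<^sub>R fst z)) \<partial>param_measure)"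
    by (simp add: mult_ac)
  also have "\<dots> = (1 / M) *\<^sub>R (\<integral>z. theta_density z *\<^sub>R (gauss (x - fst z) *\<^sub>R fst z) \<partial>param_measure)"
    by (rule integral_scaleR_right)
  also have "(\<integral>z. theta_density z *\<^sub>R (gauss (x - fst z) *\<^sub>R fst z) \<partial>param_measure) = (\<integral>\<theta>. gauss (x - \<theta>) *\<^sub>R \<theta> \<partial>theta_prior)"
    unfolding theta_prior_def by (subst integral_distr, simp, simp, subst integral_density) (simp_all add: theta_density_nonneg)
  finally show ?thesis .
qed

lemma gauss_prior_theta_prior:
  assumes a2: "(3 - real CARD('m)) / 2 < a2"
  defines "\<kappa> \<equiv> real CARD('k) * (real CARD('m) - 3 + 2 * a2) / 2"
  obtains K c where "gauss_prior (theta_prior :: ('m::finite \<times> 'k) vector measure) K c \<kappa>"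
    "\<And>x. posterior_mean (\<lambda>\<beta>. 1) prior_V x = gauss_prior.bayes (theta_prior :: ('m \<times> 'k) vector measure) x"
proof -
  obtain K where K: "\<And>x :: ('m \<times> 'k) vector. (\<integral>\<^sup>+\<theta>. ennreal (exp (- ((norm (x - \<theta>))\<^sup>2 / 8))) \<partial>theta_prior) \<le> ennreal K"
    using theta_prior_upper[OF a2] by blast
  obtain c where c: "c > 0"
    "\<And>x :: ('m \<times> 'k) vector. ennreal (c * (1 + (norm x)\<^sup>2) powr - \<kappa>) \<le> (\<integral>\<^sup>+\<theta>. ennreal (gauss (x - \<theta>)) \<partial>theta_prior)"
    using theta_prior_lower[where 'm = 'm] unfolding \<kappa>_def by blast
  \<comment> \<open>The inequality that makes the marginal finite also makes \<kappa>
    nonnegative.\<close>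
  have "0 \<le> real CARD('m) - 3 + 2 * a2" using a2 by (simp add: field_simps)
  then have "\<kappa> \<ge> 0" by (simp add: \<kappa>_def)
  then interpret G: gauss_prior "theta_prior :: ('m \<times> 'k) vector measure" K c \<kappa>
    by (intro gauss_prior.intro sets_theta_prior sigma_finite_theta_prior a2 K c)
  have "posterior_mean (\<lambda>\<beta>. 1) prior_V x = G.bayes x" for x
    unfolding G.bayes_def by (rule posterior_mean_theta_prior[OF G.nn_marg G.marg_pos])
  then show ?thesis using that[OF G.gauss_prior_axioms] by blast
qed

end

theorem theorem3p12:
  fixes prior_V :: "'k::{finite,linorder} matrix \<Rightarrow> real"
    and Q :: "('m::finite \<times> 'k::{finite,linorder}) matrix"
    and a1 a2 C1 C2 :: real
  assumes k: "CARD('k) \<ge> 2" and m: "CARD('m) \<ge> 2"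
    and a1: "a1 < 1"
    and Q: "positive_definite Q"
    and prior_meas: "prior_V \<in> borel_measurable (restrict_space borel {V. positive_definite V})"
    and prior_nonneg: "\<And>V. positive_definite V \<Longrightarrow> prior_V V \<ge> 0"
    and C: "C1 > 0" "C2 > 0"
    and prior_bounds: "\<And>H d. orthogonal_matrix H \<Longrightarrow> (\<forall>i j. i < j \<longrightarrow> d $ i > d $ j) \<Longrightarrow> (\<forall>i. d $ i > 0) \<Longrightarrow>
      C1 / (det (mat 1 + diag d) powr (a2 - a1) * det (diag d) powr a1) \<le> prior_HD prior_V H d \<and>
      prior_HD prior_V H d \<le> C2 / (det (mat 1 + diag d) powr (a2 - a1) * det (diag d) powr a1)"
  shows "(CARD('k) = 2 \<and> a2 > 1 \<longrightarrow>
            admissible Q (posterior_mean (\<lambda>\<beta>. 1) prior_V)) \<and>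
         ((3 - real CARD('m)) / 2 < a2 \<and> a2 < 3 / 2 - 1 / real CARD('k) \<longrightarrow>
            inadmissible Q (posterior_mean (\<lambda>\<beta>. 1) prior_V))"
proof (intro conjI impI)
  interpret P: hier_prior prior_V a1 a2 C1 C2
    using a1 prior_meas prior_nonneg C prior_bounds by (rule hier_prior.intro)
  let ?G = "P.theta_prior :: ('m \<times> 'k) vector measure"
  let ?\<kappa> = "real CARD('k) * (real CARD('m) - 3 + 2 * a2) / 2"
  {
    assume A: "CARD('k) = 2 \<and> a2 > 1"
    \<comment> \<open>m >= 2 gives (3 - m)/2 <= 1/2, which is below a2.\<close>
    then have "(3 - real CARD('m)) / 2 < a2" using m by simp
    then obtain K c where G: "gauss_prior ?G K c ?\<kappa>"
      and eq: "\<And>x. posterior_mean (\<lambda>\<beta>. 1) prior_V x = gauss_prior.bayes ?G x"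
      using P.gauss_prior_theta_prior[where 'm = 'm] by blast
    interpret gauss_prior ?G K c ?\<kappa> by (rule G)
    interpret shift_prior ?G K c ?\<kappa> block_avg replicate_blocks
      by (intro shift_prior.intro shift_prior_axioms.intro G linear_block_avg linear_replicate_blocks block_avg_replicate_blocks norm_block_avg_le P.theta_prior_shift P.theta_prior_slab)
        (simp_all add: A)
    show "admissible Q (posterior_mean (\<lambda>\<beta>. 1) prior_V)"
      using admissible_bayes[OF Q] by (simp only: ext[OF eq])
  }
  {
    assume A: "(3 - real CARD('m)) / 2 < a2 \<and> a2 < 3 / 2 - 1 / real CARD('k)"
    then obtain K c where G: "gauss_prior ?G K c ?\<kappa>"
      and eq: "\<And>x. posterior_mean (\<lambda>\<beta>. 1) prior_V x = gauss_prior.bayes ?G x"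
      using P.gauss_prior_theta_prior[where 'm = 'm] by blast
    interpret gauss_prior ?G K c ?\<kappa> by (rule G)
    \<comment> \<open>The terms mk cancel, and the inequality is a2 < 3/2 - 1/k multiplied by
      2k.\<close>
    have "2 * ?\<kappa> + 2 < real CARD('m \<times> 'k)"
    proof -
      have "real CARD('k) * a2 < real CARD('k) * (3 / 2 - 1 / real CARD('k))"
        using A k by (intro mult_strict_left_mono) auto
      also have "\<dots> = real CARD('k) * 3 / 2 - 1" using k by (simp add: field_simps)
      finally have "real CARD('k) * a2 < real CARD('k) * 3 / 2 - 1" .
      then have "real CARD('m) * real CARD('k) - 3 * real CARD('k) + 2 * (real CARD('k) * a2) + 2 < real CARD('m \<times> 'k)"
        by simp
      moreover have "2 * ?\<kappa> = real CARD('m) * real CARD('k) - 3 * real CARD('k) + 2 * (real CARD('k) * a2)"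
        by (simp add: field_simps)
      ultimately show ?thesis by (simp only:)
    qed
    then show "inadmissible Q (posterior_mean (\<lambda>\<beta>. 1) prior_V)"
      using inadmissible_bayes[OF Q] by (simp only: ext[OF eq])
  }
qed

end
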